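(* Let $R$ be a commutative ring. Let $\mathrm{RfGLoc}(D(R))$ be the poset, ordered by inclusion, of those localizing subcategories of $D(R)$ which are generated by sets of localizations $R_f$ of $R$, i.e. of the form $\mathrm{Loc}(R_f\mid f\in J)$ for a subset $J\subset R$. There is a natural isomorphism of posets $$\mathrm{RfGLoc}(D(R))\simeq\mathrm{RadId}(R)$$ given by $\mathrm{Loc}(R_f\mid f\in J)\mapsto\sqrt{(f\mid f\in J)}$ for $J\subset R$ a subset, with inverse $I\mapsto\mathrm{Loc}(R_f\mid f\in I)$ for $I$ a radical ideal. Moreover, restricted to finite parts, this isomorphism induces an isomorphism of distributive lattices between the lattice $\mathrm{fgRfGLoc}(D(R))$ of localizing subcategories of $D(R)$ generated by finite sets of localizations $R_f$ and the lattice of radicals of finitely generated ideals of $R$.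
   Context: $D(R)$ is the unbounded derived category of $R$. A localizing subcategory is a full triangulated subcategory closed under arbitrary direct sums; $\mathrm{Loc}(S)$ is the smallest localizing subcategory containing the set of objects $S$. For $f\in R$, $R_f=R[f^{-1}]$, regarded as a complex of $R$-modules concentrated in degree $0$. $\mathrm{RadId}(R)$ is the poset of radical ideals of $R$ ordered by inclusion (a coherent frame, whose finite elements are the radicals of finitely generated ideals). An element $c$ of a complete lattice is finite if $c\le\bigvee S$ implies $c\le\bigvee K$ for some finite $K\subset S$; $\mathrm{fgRfGLoc}(D(R))$ is the sublattice of finite elements of $\mathrm{RfGLoc}(D(R))$. *)

theory Defs
  imports "HOL-Algebra.Module" "HOL-Algebra.Ideal" "HOL-Algebra.Complete_Lattice"
begin

unbundle cardinal_syntax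

section \<open>Categories, coproducts, localization at a class of morphisms\<close>

record ('o, 'm) category =
  Ob :: "'o set"
  Hom :: "'o \<Rightarrow> 'o \<Rightarrow> 'm set"
  Ident :: "'o \<Rightarrow> 'm"
  Comp :: "'o \<Rightarrow> 'o \<Rightarrow> 'o \<Rightarrow> 'm \<Rightarrow> 'm \<Rightarrow> 'm"
    \<comment> \<open>\<open>Comp C X Y Z g f\<close> is the composite of \<open>f : X \<rightarrow> Y\<close> followed by \<open>g : Y \<rightarrow> Z\<close>\<close>

definition cat_iso :: "('o, 'm) category \<Rightarrow> 'o \<Rightarrow> 'o \<Rightarrow> 'm set" where
  "cat_iso C X Y =
     {f \<in> Hom C X Y. \<exists>g \<in> Hom C Y X.
        Comp C X Y X g f = Ident C X \<and> Comp C Y X Y f g = Ident C Y}"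

definition is_coproduct ::
  "('o, 'm) category \<Rightarrow> 'i set \<Rightarrow> ('i \<Rightarrow> 'o) \<Rightarrow> 'o \<Rightarrow> ('i \<Rightarrow> 'm) \<Rightarrow> bool" where
  "is_coproduct C I F X \<iota> \<longleftrightarrow>
     X \<in> Ob C \<and> (\<forall>i\<in>I. F i \<in> Ob C \<and> \<iota> i \<in> Hom C (F i) X) \<and>
     (\<forall>Y\<in>Ob C. \<forall>g. (\<forall>i\<in>I. g i \<in> Hom C (F i) Y) \<longrightarrow>
        (\<exists>!h. h \<in> Hom C X Y \<and> (\<forall>i\<in>I. Comp C (F i) X Y h (\<iota> i) = g i)))"

text \<open>
  The localization \<open>C[W\<inverse>]\<close> (Gabriel--Zisman): the objects are those of \<open>C\<close>, the morphisms are
  zigzags of morphisms of \<open>C\<close> and formal inverses of elements of \<open>W\<close>, modulo the congruence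
  generated by the relations of \<open>C\<close> and \<open>s s\<inverse> = 1\<close>, \<open>s\<inverse> s = 1\<close> for \<open>s\<close> in \<open>W\<close>.  A letter
  \<open>Fwd X Y f\<close> stands for \<open>f : X \<rightarrow> Y\<close>, and \<open>Bwd X Y s\<close> for the formal inverse \<open>Y \<rightarrow> X\<close> of
  \<open>s : X \<rightarrow> Y\<close>.  Zigzags are read from left to right.
\<close>

datatype ('o, 'm) letter = Fwd 'o 'o 'm | Bwd 'o 'o 'm

fun zigzag :: "('o, 'm) category \<Rightarrow> ('o \<Rightarrow> 'o \<Rightarrow> 'm set) \<Rightarrow>
    'o \<Rightarrow> ('o, 'm) letter list \<Rightarrow> 'o \<Rightarrow> bool" where
  "zigzag C W X [] Z \<longleftrightarrow> X \<in> Ob C \<and> X = Z"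
| "zigzag C W X (Fwd A B f # w) Z \<longleftrightarrow>
     X \<in> Ob C \<and> A = X \<and> f \<in> Hom C A B \<and> zigzag C W B w Z"
| "zigzag C W X (Bwd A B s # w) Z \<longleftrightarrow>
     X \<in> Ob C \<and> B = X \<and> s \<in> W A B \<and> zigzag C W A w Z"

inductive zz_eq :: "('o, 'm) category \<Rightarrow> ('o \<Rightarrow> 'o \<Rightarrow> 'm set) \<Rightarrow>
    'o \<Rightarrow> 'o \<Rightarrow> ('o, 'm) letter list \<Rightarrow> ('o, 'm) letter list \<Rightarrow> bool"
  for C W where
  refl: "zigzag C W X w Y \<Longrightarrow> zz_eq C W X Y w w"
| sym: "zz_eq C W X Y u v \<Longrightarrow> zz_eq C W X Y v u"
| trans: "zz_eq C W X Y u v \<Longrightarrow> zz_eq C W X Y v w \<Longrightarrow> zz_eq C W X Y u w"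
| append: "zz_eq C W X Y u u' \<Longrightarrow> zz_eq C W Y Z v v' \<Longrightarrow> zz_eq C W X Z (u @ v) (u' @ v')"
| ident: "X \<in> Ob C \<Longrightarrow> zz_eq C W X X [Fwd X X (Ident C X)] []"
| comp: "X \<in> Ob C \<Longrightarrow> Y \<in> Ob C \<Longrightarrow> Z \<in> Ob C \<Longrightarrow> f \<in> Hom C X Y \<Longrightarrow> g \<in> Hom C Y Z \<Longrightarrow>
    zz_eq C W X Z [Fwd X Y f, Fwd Y Z g] [Fwd X Z (Comp C X Y Z g f)]"
| inv1: "X \<in> Ob C \<Longrightarrow> Y \<in> Ob C \<Longrightarrow> s \<in> W X Y \<Longrightarrow> zz_eq C W X X [Fwd X Y s, Bwd X Y s] []"
| inv2: "X \<in> Ob C \<Longrightarrow> Y \<in> Ob C \<Longrightarrow> s \<in> W X Y \<Longrightarrow> zz_eq C W Y Y [Bwd X Y s, Fwd X Y s] []"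

definition zz_class :: "('o, 'm) category \<Rightarrow> ('o \<Rightarrow> 'o \<Rightarrow> 'm set) \<Rightarrow>
    'o \<Rightarrow> 'o \<Rightarrow> ('o, 'm) letter list \<Rightarrow> ('o, 'm) letter list set" where
  "zz_class C W X Y w = {v. zz_eq C W X Y w v}"

definition cat_localization :: "('o, 'm) category \<Rightarrow> ('o \<Rightarrow> 'o \<Rightarrow> 'm set) \<Rightarrow>
    ('o, ('o, 'm) letter list set) category" where
  "cat_localization C W =
     \<lparr>Ob = Ob C,
      Hom = (\<lambda>X Y. {w. zigzag C W X w Y} // {(u, v). zz_eq C W X Y u v}),
      Ident = (\<lambda>X. zz_class C W X X []),
      Comp = (\<lambda>X Y Z \<beta> \<alpha>. \<Union>u\<in>\<alpha>. \<Union>v\<in>\<beta>. zz_class C W X Z (u @ v))\<rparr>"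


section \<open>Modules and cochain complexes\<close>

definition lin_maps :: "('r, 'k) ring_scheme \<Rightarrow> ('r, 'a) module \<Rightarrow> ('r, 'b) module \<Rightarrow>
    ('a \<Rightarrow> 'b) set" where
  "lin_maps R M N =
     {h \<in> carrier M \<rightarrow>\<^sub>E carrier N.
        (\<forall>x\<in>carrier M. \<forall>y\<in>carrier M. h (x \<oplus>\<^bsub>M\<^esub> y) = h x \<oplus>\<^bsub>N\<^esub> h y) \<and>
        (\<forall>r\<in>carrier R. \<forall>x\<in>carrier M. h (r \<odot>\<^bsub>M\<^esub> x) = r \<odot>\<^bsub>N\<^esub> h x)}"

text \<open>The multiplication and unit of the \<open>module\<close> record play no role for modules.\<close>

definition dir_sum :: "('r, 'a) module \<Rightarrow> ('r, 'b) module \<Rightarrow> ('r, 'a \<times> 'b) module" where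
  "dir_sum M N =
     \<lparr>carrier = carrier M \<times> carrier N,
      mult = undefined, one = undefined,
      zero = (\<zero>\<^bsub>M\<^esub>, \<zero>\<^bsub>N\<^esub>),
      add = (\<lambda>(x, y) (x', y'). (x \<oplus>\<^bsub>M\<^esub> x', y \<oplus>\<^bsub>N\<^esub> y')),
      smult = (\<lambda>r (x, y). (r \<odot>\<^bsub>M\<^esub> x, r \<odot>\<^bsub>N\<^esub> y))\<rparr>"

record ('r, 'a) cochain_complex =
  Deg :: "int \<Rightarrow> ('r, 'a) module"
  Diff :: "int \<Rightarrow> 'a \<Rightarrow> 'a"

definition is_complex :: "('r, 'k) ring_scheme \<Rightarrow> ('r, 'a) cochain_complex \<Rightarrow> bool" where
  "is_complex R X \<longleftrightarrow>
     (\<forall>n. module R (Deg X n) \<and> Diff X n \<in> lin_maps R (Deg X n) (Deg X (n + 1)) \<and>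
        (\<forall>x\<in>carrier (Deg X n). Diff X (n + 1) (Diff X n x) = \<zero>\<^bsub>Deg X (n + 1 + 1)\<^esub>))"

definition cochain_maps :: "('r, 'k) ring_scheme \<Rightarrow>
    ('r, 'a) cochain_complex \<Rightarrow> ('r, 'b) cochain_complex \<Rightarrow> (int \<Rightarrow> 'a \<Rightarrow> 'b) set" where
  "cochain_maps R X Y =
     {f. \<forall>n. f n \<in> lin_maps R (Deg X n) (Deg Y n) \<and>
        (\<forall>x\<in>carrier (Deg X n). Diff Y n (f n x) = f (n + 1) (Diff X n x))}"

definition cochain_isos :: "('r, 'k) ring_scheme \<Rightarrow>
    ('r, 'a) cochain_complex \<Rightarrow> ('r, 'b) cochain_complex \<Rightarrow> (int \<Rightarrow> 'a \<Rightarrow> 'b) set" where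
  "cochain_isos R X Y =
     {f \<in> cochain_maps R X Y. \<forall>n. bij_betw (f n) (carrier (Deg X n)) (carrier (Deg Y n))}"

definition cocycles :: "('r, 'a) cochain_complex \<Rightarrow> int \<Rightarrow> 'a set" where
  "cocycles X n = {x \<in> carrier (Deg X n). Diff X n x = \<zero>\<^bsub>Deg X (n + 1)\<^esub>}"

definition coboundaries :: "('r, 'a) cochain_complex \<Rightarrow> int \<Rightarrow> 'a set" where
  "coboundaries X n = Diff X (n - 1) ` carrier (Deg X (n - 1))"

definition cohomology :: "('r, 'a) cochain_complex \<Rightarrow> int \<Rightarrow> 'a set monoid" where
  "cohomology X n = (Deg X n)\<lparr>carrier := cocycles X n\<rparr> A_Mod (coboundaries X n)"

definition cohomology_map :: "('r, 'a) cochain_complex \<Rightarrow> ('r, 'b) cochain_complex \<Rightarrow>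
    (int \<Rightarrow> 'a \<Rightarrow> 'b) \<Rightarrow> int \<Rightarrow> 'a set \<Rightarrow> 'b set" where
  "cohomology_map X Y f n = (\<lambda>c. \<Union>x\<in>c. coboundaries Y n +>\<^bsub>Deg Y n\<^esub> f n x)"

definition quasi_isos :: "('r, 'k) ring_scheme \<Rightarrow>
    ('r, 'a) cochain_complex \<Rightarrow> ('r, 'b) cochain_complex \<Rightarrow> (int \<Rightarrow> 'a \<Rightarrow> 'b) set" where
  "quasi_isos R X Y =
     {f \<in> cochain_maps R X Y.
        \<forall>n. cohomology_map X Y f n \<in> iso (cohomology X n) (cohomology Y n)}"

text \<open>The shift \<open>X[1]\<close>, with the usual sign in the differential.\<close>

definition shift :: "('r, 'a) cochain_complex \<Rightarrow> ('r, 'a) cochain_complex" where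
  "shift X =
     \<lparr>Deg = (\<lambda>n. Deg X (n + 1)),
      Diff = (\<lambda>n. \<lambda>x\<in>carrier (Deg X (n + 1)). \<ominus>\<^bsub>Deg X (n + 1 + 1)\<^esub> Diff X (n + 1) x)\<rparr>"

definition shift_map :: "(int \<Rightarrow> 'a \<Rightarrow> 'b) \<Rightarrow> int \<Rightarrow> 'a \<Rightarrow> 'b" where
  "shift_map f = (\<lambda>n. f (n + 1))"

text \<open>The cone of \<open>f : X \<rightarrow> Y\<close> is \<open>X[1] \<oplus> Y\<close> with differential \<open>(x, y) \<mapsto> (- d x, f x + d y)\<close>.\<close>

definition cone :: "('r, 'a) cochain_complex \<Rightarrow> ('r, 'b) cochain_complex \<Rightarrow>
    (int \<Rightarrow> 'a \<Rightarrow> 'b) \<Rightarrow> ('r, 'a \<times> 'b) cochain_complex" where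
  "cone X Y f =
     \<lparr>Deg = (\<lambda>n. dir_sum (Deg X (n + 1)) (Deg Y n)),
      Diff = (\<lambda>n. \<lambda>(x, y)\<in>carrier (Deg X (n + 1)) \<times> carrier (Deg Y n).
         (\<ominus>\<^bsub>Deg X (n + 1 + 1)\<^esub> Diff X (n + 1) x, f (n + 1) x \<oplus>\<^bsub>Deg Y (n + 1)\<^esub> Diff Y n y))\<rparr>"


section \<open>The unbounded derived category\<close>

text \<open>
  There is no type of all \<open>R\<close>-modules, so the derived category is formed relative to a universe
  of small sets, given by a type \<open>'u\<close>: small means of cardinality less than that of \<open>'u\<close>, modules
  have small carriers contained in \<open>'u\<close>, and direct sums are indexed by small sets.  If the
  cardinality of \<open>'u\<close> is strongly inaccessible, small is the same as of size an element of a
  Grothendieck universe; only regularity and uncountability are required here, so that suitable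
  types exist for every \<open>R\<close>.
\<close>

definition small :: "'u set \<Rightarrow> bool" where
  "small A \<longleftrightarrow> |A| <o |UNIV :: 'u set|"

definition universe_for :: "('r, 'k) ring_scheme \<Rightarrow> 'u itself \<Rightarrow> bool" where
  "universe_for R U \<longleftrightarrow>
     natLeq <o |UNIV :: 'u set| \<and> regularCard |UNIV :: 'u set| \<and>
     |carrier R| <o |UNIV :: 'u set|"

lemma universe_for_exists:
  fixes R :: "('r, 'k) ring_scheme"
  shows "universe_for R TYPE(('r + nat) suc)"
proof -
  let ?r = "|UNIV :: ('r + nat) set|"
  have card: "card_order ?r" by (rule card_of_card_order_on)
  have inf: "Cinfinite ?r"
    by (simp add: cinfinite_def Field_card_of card_of_card_order_on finite_Plus_UNIV_iff)
  have eq: "card_suc ?r =o |UNIV :: ('r + nat) suc set|"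
    using Card_order_card_suc[OF card] card_of_unique card_of_Field_ordIso
    by (metis Field_card_suc ordIso_symmetric)
  have lt: "?r <o |UNIV :: ('r + nat) suc set|"
    using card_suc_greater[OF card] eq ordLess_ordIso_trans by blast
  have n: "natLeq \<le>o ?r"
    using inf by (simp add: natLeq_ordLeq_cinfinite)
  have c: "|carrier R| \<le>o ?r"
    by (rule card_of_ordLeqI[where f = Inl]) auto
  have "regularCard |UNIV :: ('r + nat) suc set|"
    using regularCard_card_suc[OF card inf] regularCard_ordIso[OF eq Cinfinite_card_suc[OF inf card]] by blast
  then show ?thesis
    unfolding universe_for_def
    using ordLeq_ordLess_trans[OF n lt] ordLeq_ordLess_trans[OF c lt] by auto
qed

definition Ch :: "('r, 'k) ring_scheme \<Rightarrow>
    (('r, 'u) cochain_complex, int \<Rightarrow> 'u \<Rightarrow> 'u) category" where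
  "Ch R =
     \<lparr>Ob = {X. is_complex R X \<and> (\<forall>n. small (carrier (Deg X n)))},
      Hom = cochain_maps R,
      Ident = (\<lambda>X n. \<lambda>x\<in>carrier (Deg X n). x),
      Comp = (\<lambda>X Y Z g f n. compose (carrier (Deg X n)) (g n) (f n))\<rparr>"

type_synonym ('r, 'u) der_mor =
  "(('r, 'u) cochain_complex, int \<Rightarrow> 'u \<Rightarrow> 'u) letter list set"

definition Der :: "('r, 'k) ring_scheme \<Rightarrow>
    (('r, 'u) cochain_complex, ('r, 'u) der_mor) category" where
  "Der R = cat_localization (Ch R) (quasi_isos R)"

definition der_map :: "('r, 'k) ring_scheme \<Rightarrow> ('r, 'u) cochain_complex \<Rightarrow>
    ('r, 'u) cochain_complex \<Rightarrow> (int \<Rightarrow> 'u \<Rightarrow> 'u) \<Rightarrow> ('r, 'u) der_mor" where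
  "der_map R X Y f = zz_class (Ch R) (quasi_isos R) X Y [Fwd X Y f]"

definition der_shift :: "('r, 'k) ring_scheme \<Rightarrow> ('r, 'u) cochain_complex \<Rightarrow>
    ('r, 'u) cochain_complex \<Rightarrow> ('r, 'u) der_mor \<Rightarrow> ('r, 'u) der_mor" where
  "der_shift R X Y \<alpha> =
     (\<Union>w\<in>\<alpha>. zz_class (Ch R) (quasi_isos R) (shift X) (shift Y)
              (map (map_letter shift shift_map) w))"

text \<open>
  Since the carrier of the cone lives in \<open>'u \<times> 'u\<close>, the standard triangle
  \<open>X \<rightarrow> Y \<rightarrow> cone f \<rightarrow> X[1]\<close> is transported along an isomorphism \<open>\<theta>\<close> from the cone to a
  complex \<open>Z\<close> over \<open>'u\<close>.
\<close>

definition standard_triangle :: "('r, 'k) ring_scheme \<Rightarrow>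
    ('r, 'u) cochain_complex \<Rightarrow> ('r, 'u) cochain_complex \<Rightarrow> ('r, 'u) cochain_complex \<Rightarrow>
    (int \<Rightarrow> 'u \<Rightarrow> 'u) \<Rightarrow> (int \<Rightarrow> 'u \<Rightarrow> 'u) \<Rightarrow> (int \<Rightarrow> 'u \<Rightarrow> 'u) \<Rightarrow> bool" where
  "standard_triangle R X Y Z f i p \<longleftrightarrow>
     X \<in> Ob (Ch R) \<and> Y \<in> Ob (Ch R) \<and> Z \<in> Ob (Ch R) \<and> f \<in> cochain_maps R X Y \<and>
     (\<exists>\<theta> \<in> cochain_isos R (cone X Y f) Z.
        i = (\<lambda>n. \<lambda>y\<in>carrier (Deg Y n). \<theta> n (\<zero>\<^bsub>Deg X (n + 1)\<^esub>, y)) \<and>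
        p = (\<lambda>n. \<lambda>z\<in>carrier (Deg Z n).
               fst (inv_into (carrier (Deg (cone X Y f) n)) (\<theta> n) z)))"

definition distinguished :: "('r, 'k) ring_scheme \<Rightarrow>
    ('r, 'u) cochain_complex \<Rightarrow> ('r, 'u) cochain_complex \<Rightarrow> ('r, 'u) cochain_complex \<Rightarrow>
    ('r, 'u) der_mor \<Rightarrow> ('r, 'u) der_mor \<Rightarrow> ('r, 'u) der_mor \<Rightarrow> bool" where
  "distinguished R X Y Z u v w \<longleftrightarrow>
     u \<in> Hom (Der R) X Y \<and> v \<in> Hom (Der R) Y Z \<and> w \<in> Hom (Der R) Z (shift X) \<and>
     (\<exists>X' Y' Z' f i p a b c.
        standard_triangle R X' Y' Z' f i p \<and>
        a \<in> cat_iso (Der R) X X' \<and> b \<in> cat_iso (Der R) Y Y' \<and> c \<in> cat_iso (Der R) Z Z' \<and>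
        Comp (Der R) X X' Y' (der_map R X' Y' f) a = Comp (Der R) X Y Y' b u \<and>
        Comp (Der R) Y Y' Z' (der_map R Y' Z' i) b = Comp (Der R) Y Z Z' c v \<and>
        Comp (Der R) Z Z' (shift X') (der_map R Z' (shift X') p) c =
          Comp (Der R) Z (shift X) (shift X') (der_shift R X X' a) w)"


section \<open>Localizing subcategories\<close>

text \<open>
  Full subcategories are given by their sets of objects; triangulated subcategories are closed
  under isomorphism in the ambient category.
\<close>

definition triangulated_subcat ::
  "('r, 'k) ring_scheme \<Rightarrow> ('r, 'u) cochain_complex set \<Rightarrow> bool" where
  "triangulated_subcat R L \<longleftrightarrow>
     L \<subseteq> Ob (Der R) \<and> L \<noteq> {} \<and>
     (\<forall>X\<in>L. \<forall>Y\<in>Ob (Der R). cat_iso (Der R) X Y \<noteq> {} \<longrightarrow> Y \<in> L) \<and>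
     (\<forall>X\<in>Ob (Der R). X \<in> L \<longleftrightarrow> shift X \<in> L) \<and>
     (\<forall>X\<in>L. \<forall>Y\<in>L. \<forall>Z\<in>Ob (Der R). \<forall>u v w. distinguished R X Y Z u v w \<longrightarrow> Z \<in> L)"

definition localizing_subcat ::
  "('r, 'k) ring_scheme \<Rightarrow> ('r, 'u) cochain_complex set \<Rightarrow> bool" where
  "localizing_subcat R L \<longleftrightarrow>
     triangulated_subcat R L \<and>
     (\<forall>(I :: 'u set) F X \<iota>. small I \<and> F ` I \<subseteq> L \<and> is_coproduct (Der R) I F X \<iota> \<longrightarrow> X \<in> L)"

definition Loc :: "('r, 'k) ring_scheme \<Rightarrow>
    ('r, 'u) cochain_complex set \<Rightarrow> ('r, 'u) cochain_complex set" where
  "Loc R S = \<Inter>{L. localizing_subcat R L \<and> S \<subseteq> L}"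


section \<open>The localizations \<open>R\<^sub>f\<close>\<close>

text \<open>The pair \<open>(a, m)\<close> represents the fraction \<open>a / f^m\<close>.\<close>

definition frac_rel :: "('r, 'k) ring_scheme \<Rightarrow> 'r \<Rightarrow> (('r \<times> nat) \<times> ('r \<times> nat)) set" where
  "frac_rel R f =
     {((a, m), (b, n)). a \<in> carrier R \<and> b \<in> carrier R \<and>
        (\<exists>k::nat. f [^]\<^bsub>R\<^esub> k \<otimes>\<^bsub>R\<^esub> (f [^]\<^bsub>R\<^esub> n \<otimes>\<^bsub>R\<^esub> a) =
                  f [^]\<^bsub>R\<^esub> k \<otimes>\<^bsub>R\<^esub> (f [^]\<^bsub>R\<^esub> m \<otimes>\<^bsub>R\<^esub> b))}"

definition frac :: "('r, 'k) ring_scheme \<Rightarrow> 'r \<Rightarrow> 'r \<Rightarrow> nat \<Rightarrow> ('r \<times> nat) set" where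
  "frac R f a m = frac_rel R f `` {(a, m)}"

definition loc_ring :: "('r, 'k) ring_scheme \<Rightarrow> 'r \<Rightarrow> ('r, ('r \<times> nat) set) module" where
  "loc_ring R f =
     \<lparr>carrier = (carrier R \<times> UNIV) // frac_rel R f,
      mult = (\<lambda>P Q. \<Union>(a, m)\<in>P. \<Union>(b, n)\<in>Q. frac R f (a \<otimes>\<^bsub>R\<^esub> b) (m + n)),
      one = frac R f \<one>\<^bsub>R\<^esub> 0,
      zero = frac R f \<zero>\<^bsub>R\<^esub> 0,
      add = (\<lambda>P Q. \<Union>(a, m)\<in>P. \<Union>(b, n)\<in>Q.
               frac R f (f [^]\<^bsub>R\<^esub> n \<otimes>\<^bsub>R\<^esub> a \<oplus>\<^bsub>R\<^esub> f [^]\<^bsub>R\<^esub> m \<otimes>\<^bsub>R\<^esub> b) (m + n)),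
      smult = (\<lambda>r P. \<Union>(a, m)\<in>P. frac R f (r \<otimes>\<^bsub>R\<^esub> a) m)\<rparr>"

text \<open>
  \<open>X\<close> is a copy of \<open>R\<^sub>f\<close> as a complex in degree 0.  The carrier of \<open>loc_ring R f\<close> is not a
  subset of \<open>'u\<close>, so the object \<open>R\<^sub>f\<close> of the derived category is only specified up to isomorphism.
\<close>

definition is_loc_complex :: "('r, 'k) ring_scheme \<Rightarrow> 'r \<Rightarrow> ('r, 'u) cochain_complex \<Rightarrow> bool" where
  "is_loc_complex R f X \<longleftrightarrow>
     X \<in> Ob (Ch R) \<and>
     (\<exists>\<phi> \<in> lin_maps R (loc_ring R f) (Deg X 0).
        bij_betw \<phi> (carrier (loc_ring R f)) (carrier (Deg X 0))) \<and>
     (\<forall>n. n \<noteq> 0 \<longrightarrow> carrier (Deg X n) = {\<zero>\<^bsub>Deg X n\<^esub>})"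

definition LocR :: "('r, 'k) ring_scheme \<Rightarrow> 'r set \<Rightarrow> ('r, 'u) cochain_complex set" where
  "LocR R J = Loc R {X. \<exists>f\<in>J. is_loc_complex R f X}"

definition RfGLoc :: "('r, 'k) ring_scheme \<Rightarrow> ('r, 'u) cochain_complex set gorder" where
  "RfGLoc R = \<lparr>carrier = {LocR R J | J. J \<subseteq> carrier R}, eq = (=), le = (\<subseteq>)\<rparr>"


section \<open>Radical ideals\<close>

definition radical :: "('r, 'k) ring_scheme \<Rightarrow> 'r set \<Rightarrow> 'r set" where
  "radical R I = {r \<in> carrier R. \<exists>n::nat. r [^]\<^bsub>R\<^esub> n \<in> I}"

definition RadId :: "('r, 'k) ring_scheme \<Rightarrow> 'r set gorder" where
  "RadId R = \<lparr>carrier = {I. ideal I R \<and> radical R I = I}, eq = (=), le = (\<subseteq>)\<rparr>"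

definition fgRadId :: "('r, 'k) ring_scheme \<Rightarrow> 'r set gorder" where
  "fgRadId R = \<lparr>carrier = {radical R (Idl\<^bsub>R\<^esub> K) | K. finite K \<and> K \<subseteq> carrier R},
                eq = (=), le = (\<subseteq>)\<rparr>"


section \<open>Finite elements, isomorphisms of posets and of distributive lattices\<close>

definition finite_elements :: "'a gorder \<Rightarrow> 'a set" where
  "finite_elements L =
     {c \<in> carrier L. \<forall>S \<subseteq> carrier L. c \<sqsubseteq>\<^bsub>L\<^esub> \<Squnion>\<^bsub>L\<^esub> S \<longrightarrow>
        (\<exists>K \<subseteq> S. finite K \<and> c \<sqsubseteq>\<^bsub>L\<^esub> \<Squnion>\<^bsub>L\<^esub> K)}"

definition finite_part :: "'a gorder \<Rightarrow> 'a gorder" where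
  "finite_part L = L\<lparr>carrier := finite_elements L\<rparr>"

definition fgRfGLoc :: "('r, 'k) ring_scheme \<Rightarrow> ('r, 'u) cochain_complex set gorder" where
  "fgRfGLoc R = finite_part (RfGLoc R)"

definition poset_iso :: "'a gorder \<Rightarrow> 'b gorder \<Rightarrow> ('a \<Rightarrow> 'b) \<Rightarrow> bool" where
  "poset_iso A B \<phi> \<longleftrightarrow>
     partial_order A \<and> partial_order B \<and>
     bij_betw \<phi> (carrier A) (carrier B) \<and> order_emb A B \<phi>"

definition sublattice :: "'a gorder \<Rightarrow> 'a set \<Rightarrow> bool" where
  "sublattice L S \<longleftrightarrow>
     S \<subseteq> carrier L \<and> \<bottom>\<^bsub>L\<^esub> \<in> S \<and> \<top>\<^bsub>L\<^esub> \<in> S \<and>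
     (\<forall>x\<in>S. \<forall>y\<in>S. x \<squnion>\<^bsub>L\<^esub> y \<in> S \<and> x \<sqinter>\<^bsub>L\<^esub> y \<in> S)"

definition distributive_lattice :: "'a gorder \<Rightarrow> bool" where
  "distributive_lattice L \<longleftrightarrow>
     bounded_lattice L \<and>
     (\<forall>x\<in>carrier L. \<forall>y\<in>carrier L. \<forall>z\<in>carrier L.
        x \<sqinter>\<^bsub>L\<^esub> (y \<squnion>\<^bsub>L\<^esub> z) = (x \<sqinter>\<^bsub>L\<^esub> y) \<squnion>\<^bsub>L\<^esub> (x \<sqinter>\<^bsub>L\<^esub> z))"

definition lattice_iso :: "'a gorder \<Rightarrow> 'b gorder \<Rightarrow> ('a \<Rightarrow> 'b) \<Rightarrow> bool" where
  "lattice_iso A B \<phi> \<longleftrightarrow>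
     bij_betw \<phi> (carrier A) (carrier B) \<and> join_pres A B \<phi> \<and> meet_pres A B \<phi> \<and>
     \<phi> \<bottom>\<^bsub>A\<^esub> = \<bottom>\<^bsub>B\<^esub> \<and> \<phi> \<top>\<^bsub>A\<^esub> = \<top>\<^bsub>B\<^esub>"

end

theory Submission
  imports Defs "HOL-Algebra.QuotRing"
begin

text \<open>
  If \<open>L\<close> is localizing, the set \<open>A\<close> of all \<open>a\<close> with \<open>R\<^sub>a \<in> L\<close> is a radical ideal.  It is closed under
  multiples because \<open>R\<^sub>a\<^sub>b\<close> is the cokernel of an injective endomorphism of a countable direct sum of
  copies of \<open>R\<^sub>a\<close> (the telescope of multiplication by \<open>b\<close>); under sums because of the Mayer--Vietoris
  sequence \<open>0 \<rightarrow> R\<^sub>c \<rightarrow> R\<^sub>c\<^sub>a \<oplus> R\<^sub>c\<^sub>b \<rightarrow> R\<^sub>c\<^sub>a\<^sub>c\<^sub>b \<rightarrow> 0\<close> with \<open>c = a + b\<close>; and under roots because \<open>R\<^sub>a\<close> is also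
  the localization at \<open>a\<^sup>n a\<close>.  Conversely, if \<open>f\<close> is not in the radical of the ideal \<open>I\<close> generated by
  \<open>J\<close>, the module \<open>M = (R/I)\<^sub>f\<close> is nonzero, and the objects without nonzero morphisms to any shift of
  \<open>M\<close> form a localizing subcategory containing every \<open>R\<^sub>g\<close> with \<open>g \<in> J\<close>, but not \<open>R\<^sub>f\<close>.  To see that
  \<open>R\<^sub>f \<rightarrow> M\<close> stays nonzero in the derived category and that direct sums of complexes are coproducts
  there, zigzags are compared with roofs.
\<close>


section \<open>Zigzags and localizations of categories\<close>

text \<open>The substitute for homotopy is \<open>feq\<close>: the difference factors through an
  acyclic complex. Quasi-isomorphisms can be cancelled for \<open>feq\<close> on either side using
  nothing but cones, so neither a homotopy category nor resolutions enter. An invariant of zigzags,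
  \<open>ladder\<close>, then shows that chain maps which become equal in the derived category are
  already \<open>feq\<close>. A second obstacle is that carriers must lie in \<open>'u\<close>,
  whereas cones and sums have product and function types. They are studied over arbitrary types and
  moved back along isomorphisms, which the regularity and uncountability of the universe allow.
  Since R_f exists only up to isomorphism, it is handled through a characterization; this also lets
  one complex be a copy of R_f and of the localization at a multiple of f at the same time. Finally,
  the isomorphism of posets sends L to the set of all f with R_f in L, a description that does not
  mention generators.\<close>

locale localizable_category =
  fixes C :: "('o, 'm) category" and W :: "'o \<Rightarrow> 'o \<Rightarrow> 'm set"
  assumes Ident_Hom: "X \<in> Ob C \<Longrightarrow> Ident C X \<in> Hom C X X"
    and Comp_Hom: "\<lbrakk>X \<in> Ob C; Y \<in> Ob C; Z \<in> Ob C; f \<in> Hom C X Y; g \<in> Hom C Y Z\<rbrakk>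
      \<Longrightarrow> Comp C X Y Z g f \<in> Hom C X Z"
    and W_Hom: "\<lbrakk>X \<in> Ob C; Y \<in> Ob C; s \<in> W X Y\<rbrakk> \<Longrightarrow> s \<in> Hom C X Y"
begin

abbreviation zz where "zz \<equiv> zigzag C W"
abbreviation zeq where "zeq \<equiv> zz_eq C W"
abbreviation zcl where "zcl \<equiv> zz_class C W"

lemma zz_Ob: "zz X w Y \<Longrightarrow> X \<in> Ob C \<and> Y \<in> Ob C"
proof (induction w arbitrary: X)
  case (Cons l w)
  then show ?case by (cases l) auto
qed auto

lemma zz_append: "zz X (u @ v) Z \<longleftrightarrow> (\<exists>Y. zz X u Y \<and> zz Y v Z)"
proof (induction u arbitrary: X)
  case Nil
  then show ?case using zz_Ob by auto
next
  case (Cons l u)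
  then show ?case by (cases l) auto
qed

lemma zz_appendI: "zz X u Y \<Longrightarrow> zz Y v Z \<Longrightarrow> zz X (u @ v) Z"
  using zz_append by blast

lemma zeq_zz: "zeq X Y u v \<Longrightarrow> zz X u Y \<and> zz X v Y"
proof (induction rule: zz_eq.induct)
  case (append X Y u u' Z v v')
  then show ?case using zz_appendI by blast
qed (auto simp: Ident_Hom Comp_Hom W_Hom)

lemma zeq_cong: "\<lbrakk>zeq X Y u u'; zz Y v Z\<rbrakk> \<Longrightarrow> zeq X Z (u @ v) (u' @ v)"
  by (blast intro: zz_eq.append zz_eq.refl)

lemma zeq_cong2: "\<lbrakk>zz X u Y; zeq Y Z v v'\<rbrakk> \<Longrightarrow> zeq X Z (u @ v) (u @ v')"
  by (blast intro: zz_eq.append zz_eq.refl)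

lemma zeq_comp:
  "\<lbrakk>X \<in> Ob C; Y \<in> Ob C; Z \<in> Ob C; f \<in> Hom C X Y; g \<in> Hom C Y Z; Comp C X Y Z g f = h\<rbrakk>
    \<Longrightarrow> zeq X Z ([Fwd X Y f] @ [Fwd Y Z g]) [Fwd X Z h]"
  using zz_eq.comp by fastforce

lemma zeq_cancel_left:
  assumes "X \<in> Ob C" "Y \<in> Ob C" "s \<in> W X Y" "zz Y u Z" "zz Y v Z"
    and "zeq X Z ([Fwd X Y s] @ u) ([Fwd X Y s] @ v)"
  shows "zeq Y Z u v"
proof -
  have B: "zz Y [Bwd X Y s] X" using assms by auto
  have "zeq Y Z (([Bwd X Y s] @ [Fwd X Y s]) @ w) w" if "zz Y w Z" for w
    using zeq_cong[OF zz_eq.inv2[where C = C and W = W, OF assms(1-3)] that] by simp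
  then show ?thesis
    using assms(4,5) zeq_cong2[OF B assms(6)] by (metis append.assoc zz_eq.sym zz_eq.trans)
qed

lemma zeq_cancel_right:
  assumes "X \<in> Ob C" "Y \<in> Ob C" "s \<in> W X Y" "zz Z u X" "zz Z v X"
    and "zeq Z Y (u @ [Fwd X Y s]) (v @ [Fwd X Y s])"
  shows "zeq Z X u v"
proof -
  have B: "zz Y [Bwd X Y s] X" using assms by auto
  have "zeq Z X (w @ ([Fwd X Y s] @ [Bwd X Y s])) w" if "zz Z w X" for w
    using zeq_cong2[OF that zz_eq.inv1[where C = C and W = W, OF assms(1-3)]] by simp
  then show ?thesis
    using assms(4,5) zeq_cong[OF assms(6) B] by (metis append.assoc zz_eq.sym zz_eq.trans)
qed

text \<open>Isomorphisms of the localization are kept as pairs of representing zigzags, so that most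
  later arguments never open an equivalence class.\<close>

definition ziso where
  "ziso X Y u v \<longleftrightarrow> zz X u Y \<and> zz Y v X \<and> zeq X X (u @ v) [] \<and> zeq Y Y (v @ u) []"

lemma ziso_sym: "ziso X Y u v \<Longrightarrow> ziso Y X v u"
  by (auto simp: ziso_def)

lemma ziso_W: "\<lbrakk>X \<in> Ob C; Y \<in> Ob C; s \<in> W X Y\<rbrakk> \<Longrightarrow> ziso X Y [Fwd X Y s] [Bwd X Y s]"
  using zz_eq.inv1[where C = C and W = W] zz_eq.inv2[where C = C and W = W]
  by (fastforce simp: ziso_def W_Hom)

lemma zcl_eq: "zz X u Y \<Longrightarrow> zcl X Y u = zcl X Y v \<longleftrightarrow> zeq X Y u v"
  unfolding zz_class_def by (auto intro: zz_eq.refl zz_eq.sym zz_eq.trans)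

lemma Hom_loc: "Hom (cat_localization C W) X Y = {zcl X Y w | w. zz X w Y}"
  by (auto simp: cat_localization_def quotient_def zz_class_def)

lemma Ob_loc [simp]: "Ob (cat_localization C W) = Ob C"
  by (simp add: cat_localization_def)

lemma Ident_loc: "Ident (cat_localization C W) X = zcl X X []"
  by (simp add: cat_localization_def)

lemma Comp_loc:
  assumes "zz X u Y" "zz Y v Z"
  shows "Comp (cat_localization C W) X Y Z (zcl Y Z v) (zcl X Y u) = zcl X Z (u @ v)"
proof -
  have "zcl X Z (u' @ v') = zcl X Z (u @ v)" if "zeq X Y u u'" "zeq Y Z v v'" for u' v'
    using zcl_eq zz_eq.append[OF that] zz_appendI[OF assms] by blast
  then have "(\<Union>u'\<in>zcl X Y u. \<Union>v'\<in>zcl Y Z v. zcl X Z (u' @ v')) = zcl X Z (u @ v)"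
    using zz_eq.refl[OF assms(1)] zz_eq.refl[OF assms(2)] unfolding zz_class_def by blast
  then show ?thesis by (simp add: cat_localization_def)
qed

lemma cat_iso_loc:
  "cat_iso (cat_localization C W) X Y = {zcl X Y u | u. \<exists>v. ziso X Y u v}"
proof (intro equalityI subsetI)
  fix f assume "f \<in> cat_iso (cat_localization C W) X Y"
  then obtain u v where uv: "f = zcl X Y u" "zz X u Y" "zz Y v X"
    "Comp (cat_localization C W) X Y X (zcl Y X v) (zcl X Y u) = zcl X X []"
    "Comp (cat_localization C W) Y X Y (zcl X Y u) (zcl Y X v) = zcl Y Y []"
    by (auto simp: cat_iso_def Hom_loc Ident_loc)
  have "zz X (u @ v) X" "zz Y (v @ u) Y" using uv zz_appendI by blast+
  then have "ziso X Y u v"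
    using uv(4,5) zcl_eq Comp_loc[OF uv(2,3)] Comp_loc[OF uv(3,2)] uv(2,3)
    by (simp add: ziso_def)
  then show "f \<in> {zcl X Y u | u. \<exists>v. ziso X Y u v}" using uv(1) by blast
next
  fix f assume "f \<in> {zcl X Y u | u. \<exists>v. ziso X Y u v}"
  then obtain u v where uv: "f = zcl X Y u" "ziso X Y u v" by blast
  have z: "zz X u Y" "zz Y v X" "zeq X X (u @ v) []" "zeq Y Y (v @ u) []"
    using uv(2) by (auto simp: ziso_def)
  have "Comp (cat_localization C W) X Y X (zcl Y X v) (zcl X Y u) = zcl X X []"
    "Comp (cat_localization C W) Y X Y (zcl X Y u) (zcl Y X v) = zcl Y Y []"
    using Comp_loc[OF z(1,2)] Comp_loc[OF z(2,1)] z(3,4) zz_appendI[OF z(1,2)]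
      zz_appendI[OF z(2,1)] zcl_eq by simp_all
  then show "f \<in> cat_iso (cat_localization C W) X Y"
    using z uv(1) by (auto simp: cat_iso_def Hom_loc Ident_loc)
qed

text \<open>Vanishing of Hom, phrased without an addition on morphisms. Between objects of the
  derived category the zero map always exists, so there it means Hom(X, M) = 0.\<close>

definition hom_trivial where
  "hom_trivial X M \<longleftrightarrow> (\<forall>u v. zz X u M \<longrightarrow> zz X v M \<longrightarrow> zeq X M u v)"

lemma hom_trivial_iso_left:
  assumes "hom_trivial X M" "ziso X Y a b"
  shows "hom_trivial Y M"
  unfolding hom_trivial_def
proof (intro allI impI)
  fix u v assume uv: "zz Y u M" "zz Y v M"
  have a: "zz X a Y" "zz Y b X" "zeq Y Y (b @ a) []" using assms(2) by (auto simp: ziso_def)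
  have "zeq X M (a @ u) (a @ v)"
    using assms(1) uv a zz_appendI by (auto simp: hom_trivial_def)
  then have "zeq Y M (b @ a @ u) (b @ a @ v)" using a zeq_cong2 by blast
  moreover have "zeq Y M (b @ a @ w) w" if "zz Y w M" for w
    using zeq_cong[OF a(3) that] by simp
  ultimately show "zeq Y M u v" using uv by (meson zz_eq.sym zz_eq.trans)
qed

lemma hom_trivial_iso_right:
  assumes "hom_trivial X M" "ziso M N a b"
  shows "hom_trivial X N"
  unfolding hom_trivial_def
proof (intro allI impI)
  fix u v assume uv: "zz X u N" "zz X v N"
  have a: "zz M a N" "zz N b M" "zeq N N (b @ a) []" using assms(2) by (auto simp: ziso_def)
  have "zeq X M (u @ b) (v @ b)"
    using assms(1) uv a zz_appendI by (auto simp: hom_trivial_def)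
  then have "zeq X N ((u @ b) @ a) ((v @ b) @ a)" using a zeq_cong by blast
  moreover have "zeq X N ((w @ b) @ a) w" if "zz X w N" for w
    using zeq_cong2[OF that a(3)] by simp
  ultimately show "zeq X N u v" using uv by (meson zz_eq.sym zz_eq.trans)
qed

text \<open>Two morphisms out of a coproduct agree on every summand, so the uniqueness half of the
  universal property identifies them. No model of the coproduct is involved.\<close>

lemma hom_trivial_coproduct:
  assumes "is_coproduct (cat_localization C W) I F X \<iota>" "\<And>i. i \<in> I \<Longrightarrow> hom_trivial (F i) M"
  shows "hom_trivial X M"
  unfolding hom_trivial_def
proof (intro allI impI)
  let ?D = "cat_localization C W"
  fix u v assume uv: "zz X u M" "zz X v M"
  have M: "M \<in> Ob ?D" using zz_Ob uv by simp
  have \<iota>: "\<iota> i \<in> Hom ?D (F i) X" if "i \<in> I" for i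
    using assms(1) that by (simp add: is_coproduct_def)
  define g where "g = (\<lambda>i. Comp ?D (F i) X M (zcl X M u) (\<iota> i))"
  have g: "g i \<in> Hom ?D (F i) M \<and> Comp ?D (F i) X M (zcl X M v) (\<iota> i) = g i" if i: "i \<in> I" for i
  proof -
    obtain w where w: "\<iota> i = zcl (F i) X w" "zz (F i) w X" using \<iota>[OF i] by (auto simp: Hom_loc)
    have "zeq (F i) M (w @ u) (w @ v)"
      using assms(2)[OF i] w uv zz_appendI by (auto simp: hom_trivial_def)
    moreover have "zz (F i) (w @ u) M" using w uv zz_appendI by blast
    ultimately have "zcl (F i) M (w @ u) = zcl (F i) M (w @ v)" using zcl_eq by blast
    then show ?thesis
      using w uv \<open>zz (F i) (w @ u) M\<close> by (auto simp: g_def Comp_loc Hom_loc)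
  qed
  then have "\<exists>!h. h \<in> Hom ?D X M \<and> (\<forall>i\<in>I. Comp ?D (F i) X M h (\<iota> i) = g i)"
    using assms(1) M unfolding is_coproduct_def by blast
  moreover have "zcl X M u \<in> Hom ?D X M \<and> (\<forall>i\<in>I. Comp ?D (F i) X M (zcl X M u) (\<iota> i) = g i)"
    using uv g by (auto simp: Hom_loc g_def)
  moreover have "zcl X M v \<in> Hom ?D X M \<and> (\<forall>i\<in>I. Comp ?D (F i) X M (zcl X M v) (\<iota> i) = g i)"
    using uv g by (auto simp: Hom_loc)
  ultimately have "zcl X M u = zcl X M v" by blast
  then show "zeq X M u v" using uv zcl_eq by blast
qed

lemma zz_map:
  assumes "\<And>X. X \<in> Ob C \<Longrightarrow> \<sigma> X \<in> Ob C"
    and "\<And>X Y f. \<lbrakk>X \<in> Ob C; Y \<in> Ob C; f \<in> Hom C X Y\<rbrakk> \<Longrightarrow> \<mu> f \<in> Hom C (\<sigma> X) (\<sigma> Y)"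
    and "\<And>X Y f. \<lbrakk>X \<in> Ob C; Y \<in> Ob C; f \<in> W X Y\<rbrakk> \<Longrightarrow> \<mu> f \<in> W (\<sigma> X) (\<sigma> Y)"
  shows "zz X w Y \<Longrightarrow> zz (\<sigma> X) (map (map_letter \<sigma> \<mu>) w) (\<sigma> Y)"
proof (induction w arbitrary: X)
  case (Cons l w)
  then show ?case
    by (cases l) (use assms zz_Ob in auto)
qed (use assms in auto)

text \<open>A functor that preserves \<open>W\<close> descends to the localization. It is applied to
  the shift and to its inverse.\<close>

lemma zeq_map:
  assumes \<sigma>: "\<And>X. X \<in> Ob C \<Longrightarrow> \<sigma> X \<in> Ob C"
    and \<mu>: "\<And>X Y f. \<lbrakk>X \<in> Ob C; Y \<in> Ob C; f \<in> Hom C X Y\<rbrakk> \<Longrightarrow> \<mu> f \<in> Hom C (\<sigma> X) (\<sigma> Y)"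
    and W: "\<And>X Y f. \<lbrakk>X \<in> Ob C; Y \<in> Ob C; f \<in> W X Y\<rbrakk> \<Longrightarrow> \<mu> f \<in> W (\<sigma> X) (\<sigma> Y)"
    and id: "\<And>X. X \<in> Ob C \<Longrightarrow> \<mu> (Ident C X) = Ident C (\<sigma> X)"
    and comp: "\<And>X Y Z f g. \<lbrakk>X \<in> Ob C; Y \<in> Ob C; Z \<in> Ob C; f \<in> Hom C X Y; g \<in> Hom C Y Z\<rbrakk>
      \<Longrightarrow> \<mu> (Comp C X Y Z g f) = Comp C (\<sigma> X) (\<sigma> Y) (\<sigma> Z) (\<mu> g) (\<mu> f)"
  shows "zeq X Y u v \<Longrightarrow>
    zeq (\<sigma> X) (\<sigma> Y) (map (map_letter \<sigma> \<mu>) u) (map (map_letter \<sigma> \<mu>) v)"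
proof (induction rule: zz_eq.induct)
  case (refl X w Y)
  then show ?case using zz_map[of \<sigma> \<mu>, OF assms(1-3)] by (blast intro: zz_eq.refl)
next
  case (sym X Y u v)
  then show ?case by (blast intro: zz_eq.sym)
next
  case (trans X Y u v w)
  then show ?case by (blast intro: zz_eq.trans)
next
  case (append X Y u u' Z v v')
  then show ?case by (auto intro: zz_eq.append)
next
  case (ident X)
  then show ?case using zz_eq.ident[where C = C and W = W, OF \<sigma>] by (simp add: id)
next
  case (comp X Y Z f g)
  then show ?case using zz_eq.comp[where C = C and W = W, OF \<sigma> \<sigma> \<sigma> \<mu> \<mu>] by (simp add: assms(5))
next
  case (inv1 X Y s)
  then show ?case using zz_eq.inv1[where C = C and W = W, OF \<sigma> \<sigma> W] by simp
next
  case (inv2 X Y s)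
  then show ?case using zz_eq.inv2[where C = C and W = W, OF \<sigma> \<sigma> W] by simp
qed

end


section \<open>Modules and linear maps\<close>

context cring
begin

lemma module_abelian_group: "module R M \<Longrightarrow> abelian_group M"
  by (simp add: module_def)

lemma module_minus_zero:
  assumes "module R M"
  shows "\<ominus>\<^bsub>M\<^esub> \<zero>\<^bsub>M\<^esub> = \<zero>\<^bsub>M\<^esub>"
proof -
  interpret abelian_group M using assms by (rule module_abelian_group)
  show ?thesis using l_neg[OF zero_closed] r_zero[OF a_inv_closed[OF zero_closed]] by simp
qed

text \<open>The module laws are restated with the premise \<open>module R M\<close>, so that the
  simplifier can calculate in many modules at once without an interpretation for each of
  them.\<close>

lemmas mod_closed [simp] =
  abelian_groupE(1)[OF module_abelian_group] abelian_groupE(2)[OF module_abelian_group]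
  abelian_group.a_inv_closed[OF module_abelian_group]
  module.smult_closed[of R]

lemmas mod_simps [simp] =
  abelian_monoid.l_zero[OF abelian_group.axioms(1)[OF module_abelian_group]]
  abelian_monoid.r_zero[OF abelian_group.axioms(1)[OF module_abelian_group]]
  abelian_group.l_neg[OF module_abelian_group]
  abelian_group.r_neg[OF module_abelian_group]
  abelian_group.r_neg1[OF module_abelian_group]
  abelian_group.r_neg2[OF module_abelian_group]
  abelian_group.minus_minus[OF module_abelian_group]
  module_minus_zero
  module.smult_one[of R] module.smult_l_null[of R] module.smult_r_null[of R]

lemma mod_add_cancel [simp]:
  assumes "module R M" "x \<in> carrier M" "y \<in> carrier M" "z \<in> carrier M"
  shows "z \<oplus>\<^bsub>M\<^esub> x = z \<oplus>\<^bsub>M\<^esub> y \<longleftrightarrow> x = y" "x \<oplus>\<^bsub>M\<^esub> z = y \<oplus>\<^bsub>M\<^esub> z \<longleftrightarrow> x = y"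
proof -
  interpret abelian_group M using assms(1) by (rule module_abelian_group)
  show "z \<oplus>\<^bsub>M\<^esub> x = z \<oplus>\<^bsub>M\<^esub> y \<longleftrightarrow> x = y" "x \<oplus>\<^bsub>M\<^esub> z = y \<oplus>\<^bsub>M\<^esub> z \<longleftrightarrow> x = y"
    using assms by auto
qed

lemma mod_eq_iff:
  assumes "module R M" "x \<in> carrier M" "y \<in> carrier M"
  shows "x = y \<longleftrightarrow> x \<oplus>\<^bsub>M\<^esub> \<ominus>\<^bsub>M\<^esub> y = \<zero>\<^bsub>M\<^esub>"
proof -
  interpret abelian_group M using assms(1) by (rule module_abelian_group)
  show ?thesis
  proof
    assume "x \<oplus>\<^bsub>M\<^esub> \<ominus>\<^bsub>M\<^esub> y = \<zero>\<^bsub>M\<^esub>"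
    then have "\<ominus>\<^bsub>M\<^esub> (\<ominus>\<^bsub>M\<^esub> y) = x" using minus_equality assms by blast
    then show "x = y" using assms by (simp only: minus_minus)
  qed (use assms r_neg in blast)
qed

lemma mod_neg_unique:
  assumes "module R M" "x \<in> carrier M" "y \<in> carrier M" "x \<oplus>\<^bsub>M\<^esub> y = \<zero>\<^bsub>M\<^esub>"
  shows "x = \<ominus>\<^bsub>M\<^esub> y"
proof -
  interpret abelian_group M using assms(1) by (rule module_abelian_group)
  show ?thesis using minus_equality[OF assms(4,3,2)] by simp
qed

lemmas mod_ac =
  abelian_monoid.a_assoc[OF abelian_group.axioms(1)[OF module_abelian_group]]
  abelian_monoid.a_comm[OF abelian_group.axioms(1)[OF module_abelian_group]]
  abelian_monoid.a_lcomm[OF abelian_group.axioms(1)[OF module_abelian_group]]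

lemma mod_add_diff [simp]:
  assumes "module R M" "x \<in> carrier M" "y \<in> carrier M"
  shows "y \<oplus>\<^bsub>M\<^esub> (x \<oplus>\<^bsub>M\<^esub> \<ominus>\<^bsub>M\<^esub> y) = x" "(x \<oplus>\<^bsub>M\<^esub> \<ominus>\<^bsub>M\<^esub> y) \<oplus>\<^bsub>M\<^esub> y = x"
    "y \<oplus>\<^bsub>M\<^esub> (\<ominus>\<^bsub>M\<^esub> y \<oplus>\<^bsub>M\<^esub> x) = x" "(\<ominus>\<^bsub>M\<^esub> y \<oplus>\<^bsub>M\<^esub> x) \<oplus>\<^bsub>M\<^esub> y = x"
proof -
  have "(x \<oplus>\<^bsub>M\<^esub> \<ominus>\<^bsub>M\<^esub> y) \<oplus>\<^bsub>M\<^esub> y = x" using assms by (subst mod_ac(1)) simp_all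
  moreover have "y \<oplus>\<^bsub>M\<^esub> (x \<oplus>\<^bsub>M\<^esub> \<ominus>\<^bsub>M\<^esub> y) = (x \<oplus>\<^bsub>M\<^esub> \<ominus>\<^bsub>M\<^esub> y) \<oplus>\<^bsub>M\<^esub> y"
    using assms by (intro mod_ac(2)) simp_all
  moreover have "\<ominus>\<^bsub>M\<^esub> y \<oplus>\<^bsub>M\<^esub> x = x \<oplus>\<^bsub>M\<^esub> \<ominus>\<^bsub>M\<^esub> y"
    using assms by (intro mod_ac(2)) simp_all
  ultimately show "y \<oplus>\<^bsub>M\<^esub> (x \<oplus>\<^bsub>M\<^esub> \<ominus>\<^bsub>M\<^esub> y) = x" "(x \<oplus>\<^bsub>M\<^esub> \<ominus>\<^bsub>M\<^esub> y) \<oplus>\<^bsub>M\<^esub> y = x"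
    "y \<oplus>\<^bsub>M\<^esub> (\<ominus>\<^bsub>M\<^esub> y \<oplus>\<^bsub>M\<^esub> x) = x" "(\<ominus>\<^bsub>M\<^esub> y \<oplus>\<^bsub>M\<^esub> x) \<oplus>\<^bsub>M\<^esub> y = x"
    by simp_all
qed

lemma mod_add_add_neg:
  assumes "module R M" "x \<in> carrier M" "y \<in> carrier M"
  shows "(x \<oplus>\<^bsub>M\<^esub> y) \<oplus>\<^bsub>M\<^esub> \<ominus>\<^bsub>M\<^esub> y = x"
  using assms by (subst mod_ac(1)) simp_all

lemma mod_neg_zero_iff:
  assumes "module R M" "x \<in> carrier M"
  shows "\<ominus>\<^bsub>M\<^esub> x = \<zero>\<^bsub>M\<^esub> \<longleftrightarrow> x = \<zero>\<^bsub>M\<^esub>" "\<zero>\<^bsub>M\<^esub> = \<ominus>\<^bsub>M\<^esub> x \<longleftrightarrow> x = \<zero>\<^bsub>M\<^esub>"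
  using assms by (metis mod_simps(7) module_minus_zero)+

lemmas mod_minus_add = abelian_group.minus_add[OF module_abelian_group]

end

text \<open>Keeps degrees in the form \<open>n + 1 + 1\<close>, in which the differentials produce them.\<close>

declare [[simproc del: int_combine_numerals]]

abbreviation el :: "('r, 'x) cochain_complex \<Rightarrow> int \<Rightarrow> 'x set" where
  "el X n \<equiv> carrier (Deg X n)"

abbreviation zr :: "('r, 'x) cochain_complex \<Rightarrow> int \<Rightarrow> 'x" where
  "zr X n \<equiv> \<zero>\<^bsub>Deg X n\<^esub>"

context cring
begin

abbreviation lmaps where "lmaps \<equiv> lin_maps R"
abbreviation cpx where "cpx \<equiv> is_complex R"
abbreviation cmaps where "cmaps \<equiv> cochain_maps R"

lemma lin_restrictI:
  assumes "\<And>x. x \<in> carrier M \<Longrightarrow> \<phi> x \<in> carrier N"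
    and "\<And>x y. \<lbrakk>x \<in> carrier M; y \<in> carrier M\<rbrakk> \<Longrightarrow> \<phi> (x \<oplus>\<^bsub>M\<^esub> y) = \<phi> x \<oplus>\<^bsub>N\<^esub> \<phi> y"
    and "\<And>r x. \<lbrakk>r \<in> carrier R; x \<in> carrier M\<rbrakk> \<Longrightarrow> \<phi> (r \<odot>\<^bsub>M\<^esub> x) = r \<odot>\<^bsub>N\<^esub> \<phi> x"
    and "module R M"
  shows "(\<lambda>x\<in>carrier M. \<phi> x) \<in> lmaps M N"
  using assms by (auto simp: lin_maps_def)

lemma lin_simps:
  assumes "module R M" "module R N" "h \<in> lmaps M N"
  shows "x \<in> carrier M \<Longrightarrow> h x \<in> carrier N"
    and "\<lbrakk>x \<in> carrier M; y \<in> carrier M\<rbrakk> \<Longrightarrow> h (x \<oplus>\<^bsub>M\<^esub> y) = h x \<oplus>\<^bsub>N\<^esub> h y"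
    and "\<lbrakk>r \<in> carrier R; x \<in> carrier M\<rbrakk> \<Longrightarrow> h (r \<odot>\<^bsub>M\<^esub> x) = r \<odot>\<^bsub>N\<^esub> h x"
    and "h \<zero>\<^bsub>M\<^esub> = \<zero>\<^bsub>N\<^esub>"
    and "x \<in> carrier M \<Longrightarrow> h (\<ominus>\<^bsub>M\<^esub> x) = \<ominus>\<^bsub>N\<^esub> h x"
proof -
  show cl: "h x \<in> carrier N" if "x \<in> carrier M" for x
    using that assms(3) by (auto simp: lin_maps_def)
  show add: "h (x \<oplus>\<^bsub>M\<^esub> y) = h x \<oplus>\<^bsub>N\<^esub> h y" if "x \<in> carrier M" "y \<in> carrier M" for x y
    using that assms(3) by (auto simp: lin_maps_def)
  show "h (r \<odot>\<^bsub>M\<^esub> x) = r \<odot>\<^bsub>N\<^esub> h x" if "r \<in> carrier R" "x \<in> carrier M" for r x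
    using that assms(3) by (auto simp: lin_maps_def)
  have "h \<zero>\<^bsub>M\<^esub> \<oplus>\<^bsub>N\<^esub> h \<zero>\<^bsub>M\<^esub> = h \<zero>\<^bsub>M\<^esub> \<oplus>\<^bsub>N\<^esub> \<zero>\<^bsub>N\<^esub>"
    using add[of "\<zero>\<^bsub>M\<^esub>" "\<zero>\<^bsub>M\<^esub>"] assms(1,2) cl by simp
  then show z: "h \<zero>\<^bsub>M\<^esub> = \<zero>\<^bsub>N\<^esub>"
    using mod_add_cancel(1)[OF assms(2), of "h \<zero>\<^bsub>M\<^esub>" "\<zero>\<^bsub>N\<^esub>" "h \<zero>\<^bsub>M\<^esub>"] assms(1,2) cl by simp
  show "h (\<ominus>\<^bsub>M\<^esub> x) = \<ominus>\<^bsub>N\<^esub> h x" if "x \<in> carrier M" for x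
    using add[of "\<ominus>\<^bsub>M\<^esub> x" x] assms(1,2) cl that z by (auto intro: mod_neg_unique)
qed

lemma lin_maps_eqI:
  assumes "h \<in> lmaps M N" "k \<in> lmaps M N" "\<And>x. x \<in> carrier M \<Longrightarrow> h x = k x"
  shows "h = k"
  using assms by (auto simp: lin_maps_def intro: PiE_ext)

lemma lin_maps_restrict: "h \<in> lmaps M N \<Longrightarrow> (\<lambda>x\<in>carrier M. h x) = h"
  by (auto simp: lin_maps_def)


section \<open>Complexes and cochain maps\<close>

lemma complex_module [simp]: "cpx X \<Longrightarrow> module R (Deg X n)"
  by (simp add: is_complex_def)

lemma complex_Diff: "cpx X \<Longrightarrow> Diff X n \<in> lmaps (Deg X n) (Deg X (n + 1))"
  by (simp add: is_complex_def)

lemma Diff_simps [simp]: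
  assumes "cpx X"
  shows "x \<in> el X n \<Longrightarrow> Diff X n x \<in> el X (n + 1)"
    and "\<lbrakk>x \<in> el X n; y \<in> el X n\<rbrakk>
      \<Longrightarrow> Diff X n (x \<oplus>\<^bsub>Deg X n\<^esub> y) = Diff X n x \<oplus>\<^bsub>Deg X (n + 1)\<^esub> Diff X n y"
    and "\<lbrakk>r \<in> carrier R; x \<in> el X n\<rbrakk>
      \<Longrightarrow> Diff X n (r \<odot>\<^bsub>Deg X n\<^esub> x) = r \<odot>\<^bsub>Deg X (n + 1)\<^esub> Diff X n x"
    and "Diff X n (zr X n) = zr X (n + 1)"
    and "x \<in> el X n \<Longrightarrow> Diff X n (\<ominus>\<^bsub>Deg X n\<^esub> x) = \<ominus>\<^bsub>Deg X (n + 1)\<^esub> Diff X n x"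
  using lin_simps[OF complex_module[OF assms] complex_module[OF assms] complex_Diff[OF assms]]
  by simp_all

lemma Diff_Diff [simp]:
  "\<lbrakk>cpx X; x \<in> el X n\<rbrakk> \<Longrightarrow> Diff X (n + 1) (Diff X n x) = zr X (n + 1 + 1)"
  by (simp add: is_complex_def)

lemma is_complexI:
  assumes "\<And>n. module R (Deg X n)" "\<And>n. Diff X n \<in> lmaps (Deg X n) (Deg X (n + 1))"
    and "\<And>n x. x \<in> el X n \<Longrightarrow> Diff X (n + 1) (Diff X n x) = zr X (n + 1 + 1)"
  shows "cpx X"
  unfolding is_complex_def using assms by blast

lemma cochain_mapsI:
  assumes "\<And>n. f n \<in> lmaps (Deg X n) (Deg Y n)"
    and "\<And>n x. x \<in> el X n \<Longrightarrow> Diff Y n (f n x) = f (n + 1) (Diff X n x)"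
  shows "f \<in> cmaps X Y"
  using assms by (simp add: cochain_maps_def)

text \<open>Members of \<open>lin_maps\<close> are extensional. Cutting a degreewise formula off to
  the carriers makes it a candidate for a chain map, and equality of chain maps becomes equality on
  elements.\<close>

definition cres :: "('r, 'x) cochain_complex \<Rightarrow> (int \<Rightarrow> 'x \<Rightarrow> 'y) \<Rightarrow> int \<Rightarrow> 'x \<Rightarrow> 'y" where
  "cres X \<phi> = (\<lambda>n. \<lambda>x\<in>el X n. \<phi> n x)"

lemma cres_apply [simp]: "x \<in> el X n \<Longrightarrow> cres X \<phi> n x = \<phi> n x"
  by (simp add: cres_def)

lemma cres_mapsI:
  assumes "cpx X"
    and "\<And>n x. x \<in> el X n \<Longrightarrow> \<phi> n x \<in> el Y n"
    and "\<And>n x y. \<lbrakk>x \<in> el X n; y \<in> el X n\<rbrakk>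
      \<Longrightarrow> \<phi> n (x \<oplus>\<^bsub>Deg X n\<^esub> y) = \<phi> n x \<oplus>\<^bsub>Deg Y n\<^esub> \<phi> n y"
    and "\<And>n r x. \<lbrakk>r \<in> carrier R; x \<in> el X n\<rbrakk>
      \<Longrightarrow> \<phi> n (r \<odot>\<^bsub>Deg X n\<^esub> x) = r \<odot>\<^bsub>Deg Y n\<^esub> \<phi> n x"
    and "\<And>n x. x \<in> el X n \<Longrightarrow> Diff Y n (\<phi> n x) = \<phi> (n + 1) (Diff X n x)"
  shows "cres X \<phi> \<in> cmaps X Y"
  unfolding cres_def
  by (rule cochain_mapsI) (use assms in \<open>auto intro!: lin_restrictI\<close>)

lemma cochain_maps_lin: "f \<in> cmaps X Y \<Longrightarrow> f n \<in> lmaps (Deg X n) (Deg Y n)"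
  by (simp add: cochain_maps_def)

text \<open>As a rewrite rule, the last equation moves differentials outwards, where they cancel.\<close>

lemma cmap_simps:
  assumes "cpx X" "cpx Y" "f \<in> cmaps X Y"
  shows "x \<in> el X n \<Longrightarrow> f n x \<in> el Y n"
    and "\<lbrakk>x \<in> el X n; y \<in> el X n\<rbrakk>
      \<Longrightarrow> f n (x \<oplus>\<^bsub>Deg X n\<^esub> y) = f n x \<oplus>\<^bsub>Deg Y n\<^esub> f n y"
    and "\<lbrakk>r \<in> carrier R; x \<in> el X n\<rbrakk> \<Longrightarrow> f n (r \<odot>\<^bsub>Deg X n\<^esub> x) = r \<odot>\<^bsub>Deg Y n\<^esub> f n x"
    and "f n (zr X n) = zr Y n"
    and "x \<in> el X n \<Longrightarrow> f n (\<ominus>\<^bsub>Deg X n\<^esub> x) = \<ominus>\<^bsub>Deg Y n\<^esub> f n x"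
    and "x \<in> el X n \<Longrightarrow> f (n + 1) (Diff X n x) = Diff Y n (f n x)"
  using lin_simps[OF complex_module[OF assms(1)] complex_module[OF assms(2)]
      cochain_maps_lin[OF assms(3)]] assms(3)
  by (auto simp: cochain_maps_def)

lemma cmap_eqI:
  assumes "f \<in> cmaps X Y" "g \<in> cmaps X Y"
    "\<And>n x. x \<in> el X n \<Longrightarrow> f n x = g n x"
  shows "f = g"
proof
  fix n show "f n = g n"
    using lin_maps_eqI[OF cochain_maps_lin[OF assms(1)] cochain_maps_lin[OF assms(2)]] assms(3) by blast
qed

text \<open>The composition of \<open>Ch R\<close>, but polymorphic in the three carrier types,
  because cones and sums leave the type \<open>'u\<close>.\<close>

definition ccomp :: "('r, 'x) cochain_complex \<Rightarrow> (int \<Rightarrow> 'y \<Rightarrow> 'z) \<Rightarrow> (int \<Rightarrow> 'x \<Rightarrow> 'y) \<Rightarrow> int \<Rightarrow> 'x \<Rightarrow> 'z"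
  where "ccomp X g f = (\<lambda>n. compose (el X n) (g n) (f n))"

lemma ccomp_apply [simp]: "x \<in> el X n \<Longrightarrow> ccomp X g f n x = g n (f n x)"
  by (simp add: ccomp_def compose_def)

lemma ccomp_cres: "ccomp X g f = cres X (\<lambda>n x. g n (f n x))"
  by (simp add: ccomp_def cres_def compose_def)

lemma ccomp_closed:
  assumes "cpx X" "cpx Y" "cpx Z"
    "f \<in> cmaps X Y" "g \<in> cmaps Y Z"
  shows "ccomp X g f \<in> cmaps X Z"
  unfolding ccomp_cres
  by (rule cres_mapsI)
    (simp_all add: assms cmap_simps[OF assms(1,2,4)] cmap_simps[OF assms(2,3,5)])

definition cid :: "('r, 'x) cochain_complex \<Rightarrow> int \<Rightarrow> 'x \<Rightarrow> 'x" where
  "cid X = cres X (\<lambda>n x. x)"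

lemma cid_apply [simp]: "x \<in> el X n \<Longrightarrow> cid X n x = x"
  by (simp add: cid_def)

lemma cid_closed [simp]: "cpx X \<Longrightarrow> cid X \<in> cmaps X X"
  unfolding cid_def by (rule cres_mapsI) auto

definition czero :: "('r, 'x) cochain_complex \<Rightarrow> ('r, 'y) cochain_complex \<Rightarrow> int \<Rightarrow> 'x \<Rightarrow> 'y" where
  "czero X Y = cres X (\<lambda>n x. zr Y n)"

lemma czero_apply [simp]: "x \<in> el X n \<Longrightarrow> czero X Y n x = zr Y n"
  by (simp add: czero_def)

lemma czero_closed [simp]: "\<lbrakk>cpx X; cpx Y\<rbrakk> \<Longrightarrow> czero X Y \<in> cmaps X Y"
  unfolding czero_def by (rule cres_mapsI) auto

definition cneg :: "('r, 'x) cochain_complex \<Rightarrow> ('r, 'y) cochain_complex \<Rightarrow> (int \<Rightarrow> 'x \<Rightarrow> 'y) \<Rightarrow> int \<Rightarrow> 'x \<Rightarrow> 'y" where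
  "cneg X Y f = cres X (\<lambda>n x. \<ominus>\<^bsub>Deg Y n\<^esub> f n x)"

lemma cneg_apply [simp]: "x \<in> el X n \<Longrightarrow> cneg X Y f n x = \<ominus>\<^bsub>Deg Y n\<^esub> f n x"
  by (simp add: cneg_def)

lemma mod_smult_neg:
  "\<lbrakk>module R M; r \<in> carrier R; x \<in> carrier M\<rbrakk> \<Longrightarrow> r \<odot>\<^bsub>M\<^esub> \<ominus>\<^bsub>M\<^esub> x = \<ominus>\<^bsub>M\<^esub> (r \<odot>\<^bsub>M\<^esub> x)"
  using module.smult_r_minus by fastforce

lemma mod_smult_comm:
  assumes "module R M" "r \<in> carrier R" "s \<in> carrier R" "x \<in> carrier M"
  shows "r \<odot>\<^bsub>M\<^esub> (s \<odot>\<^bsub>M\<^esub> x) = s \<odot>\<^bsub>M\<^esub> (r \<odot>\<^bsub>M\<^esub> x)"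
  using assms by (metis module.smult_assoc1 m_comm)

lemmas mod_lin = module.smult_r_distr[of R] mod_smult_neg mod_minus_add

lemma cneg_closed:
  assumes "cpx X" "cpx Y" "f \<in> cmaps X Y"
  shows "cneg X Y f \<in> cmaps X Y"
  unfolding cneg_def
  by (rule cres_mapsI) (simp_all add: assms cmap_simps[OF assms] mod_lin)


section \<open>Quasi-isomorphisms\<close>

text \<open>Exactness is indexed by n + 1, so that the primitive lies in degree n and no
  differential starting in degree n - 1 occurs; every integer has this form.\<close>

definition acyclic_cpx :: "('r, 'x) cochain_complex \<Rightarrow> bool" where
  "acyclic_cpx X \<longleftrightarrow> (\<forall>n. \<forall>x\<in>el X (n + 1). Diff X (n + 1) x = zr X (n + 1 + 1) \<longrightarrow>
     (\<exists>z\<in>el X n. x = Diff X n z))"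

text \<open>The two clauses are injectivity and surjectivity on cohomology in degree n + 1, in terms
  of elements. Unlike \<open>quasi_isos\<close> this needs no cosets; \<open>quasi_isos_iff\<close>
  shows that it is the same notion.\<close>

definition qi where
  "qi X Y f \<longleftrightarrow> f \<in> cmaps X Y \<and>
     (\<forall>n. \<forall>x\<in>el X (n + 1). \<forall>y\<in>el Y n.
        Diff X (n + 1) x = zr X (n + 1 + 1) \<longrightarrow> f (n + 1) x = Diff Y n y \<longrightarrow>
        (\<exists>z\<in>el X n. x = Diff X n z)) \<and>
     (\<forall>n. \<forall>y\<in>el Y (n + 1). Diff Y (n + 1) y = zr Y (n + 1 + 1) \<longrightarrow>
        (\<exists>x\<in>el X (n + 1). \<exists>z\<in>el Y n.
           Diff X (n + 1) x = zr X (n + 1 + 1) \<and> y = f (n + 1) x \<oplus>\<^bsub>Deg Y (n + 1)\<^esub> Diff Y n z))"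

lemma qiI:
  assumes "f \<in> cmaps X Y"
    and "\<And>n x y. \<lbrakk>x \<in> el X (n + 1); y \<in> el Y n;
        Diff X (n + 1) x = zr X (n + 1 + 1); f (n + 1) x = Diff Y n y\<rbrakk>
        \<Longrightarrow> \<exists>z\<in>el X n. x = Diff X n z"
    and "\<And>n y. \<lbrakk>y \<in> el Y (n + 1); Diff Y (n + 1) y = zr Y (n + 1 + 1)\<rbrakk> \<Longrightarrow>
        \<exists>x\<in>el X (n + 1). \<exists>z\<in>el Y n.
           Diff X (n + 1) x = zr X (n + 1 + 1) \<and> y = f (n + 1) x \<oplus>\<^bsub>Deg Y (n + 1)\<^esub> Diff Y n z"
  shows "qi X Y f"
  using assms unfolding qi_def by blast

lemma qi_cmap: "qi X Y f \<Longrightarrow> f \<in> cmaps X Y"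
  by (simp add: qi_def)

lemma qi_inj:
  assumes "qi X Y f" "x \<in> el X (n + 1)" "y \<in> el Y n"
    "Diff X (n + 1) x = zr X (n + 1 + 1)" "f (n + 1) x = Diff Y n y"
  obtains z where "z \<in> el X n" "x = Diff X n z"
  using assms unfolding qi_def by blast

lemma qi_surj:
  assumes "qi X Y f" "y \<in> el Y (n + 1)" "Diff Y (n + 1) y = zr Y (n + 1 + 1)"
  obtains x z where "x \<in> el X (n + 1)" "z \<in> el Y n"
    "Diff X (n + 1) x = zr X (n + 1 + 1)" "y = f (n + 1) x \<oplus>\<^bsub>Deg Y (n + 1)\<^esub> Diff Y n z"
  using assms unfolding qi_def by blast

lemma acyclicE:
  assumes "acyclic_cpx X" "x \<in> el X (n + 1)" "Diff X (n + 1) x = zr X (n + 1 + 1)"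
  obtains z where "z \<in> el X n" "x = Diff X n z"
  using assms unfolding acyclic_cpx_def by blast

definition cohom_class :: "('r, 'x) cochain_complex \<Rightarrow> int \<Rightarrow> 'x \<Rightarrow> 'x set" where
  "cohom_class X n x = coboundaries X n +>\<^bsub>Deg X n\<^esub> x"

lemma cohom_class_def':
  "cohom_class X (n + 1) x = {Diff X n z \<oplus>\<^bsub>Deg X (n + 1)\<^esub> x | z. z \<in> el X n}"
  by (auto simp: cohom_class_def a_r_coset_def' coboundaries_def)

lemma cohom_class_eq:
  assumes X: "cpx X" and "x \<in> el X (n + 1)" "y \<in> el X (n + 1)"
  shows "cohom_class X (n + 1) x = cohom_class X (n + 1) y \<longleftrightarrow>
    (\<exists>z\<in>el X n. x = y \<oplus>\<^bsub>Deg X (n + 1)\<^esub> Diff X n z)" (is "?l \<longleftrightarrow> ?r")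
proof
  have "x = Diff X n (zr X n) \<oplus>\<^bsub>Deg X (n + 1)\<^esub> x" using assms by simp
  then have "x \<in> cohom_class X (n + 1) x"
    unfolding cohom_class_def' using X mod_closed(2) complex_module by blast
  moreover assume ?l
  ultimately obtain z where "z \<in> el X n" "x = Diff X n z \<oplus>\<^bsub>Deg X (n + 1)\<^esub> y"
    unfolding cohom_class_def' by blast
  then have "x = y \<oplus>\<^bsub>Deg X (n + 1)\<^esub> Diff X n z" using assms by (simp add: mod_ac)
  then show ?r using \<open>z \<in> el X n\<close> by blast
next
  assume ?r
  then obtain z where z: "z \<in> el X n" "x = y \<oplus>\<^bsub>Deg X (n + 1)\<^esub> Diff X n z" by blast
  have "Diff X n w \<oplus>\<^bsub>Deg X (n + 1)\<^esub> x = Diff X n (w \<oplus>\<^bsub>Deg X n\<^esub> z) \<oplus>\<^bsub>Deg X (n + 1)\<^esub> y"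
    "Diff X n w \<oplus>\<^bsub>Deg X (n + 1)\<^esub> y = Diff X n (w \<oplus>\<^bsub>Deg X n\<^esub> \<ominus>\<^bsub>Deg X n\<^esub> z) \<oplus>\<^bsub>Deg X (n + 1)\<^esub> x"
    if "w \<in> el X n" for w
    using that z assms by (simp_all add: mod_ac)
  moreover have "w \<oplus>\<^bsub>Deg X n\<^esub> z \<in> el X n" "w \<oplus>\<^bsub>Deg X n\<^esub> \<ominus>\<^bsub>Deg X n\<^esub> z \<in> el X n"
    if "w \<in> el X n" for w
    using that z X by simp_all
  ultimately show ?l unfolding cohom_class_def' by blast
qed

lemma cohomology_carrier:
  "carrier (cohomology X n) = cohom_class X n ` cocycles X n"
  by (auto simp: cohomology_def A_FactGroup_def FactGroup_def RCOSETS_def r_coset_def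
      cohom_class_def a_r_coset_def')

lemma cohomology_mult:
  assumes X: "cpx X" and "x \<in> el X (n + 1)" "y \<in> el X (n + 1)"
  shows "cohom_class X (n + 1) x \<otimes>\<^bsub>cohomology X (n + 1)\<^esub> cohom_class X (n + 1) y =
    cohom_class X (n + 1) (x \<oplus>\<^bsub>Deg X (n + 1)\<^esub> y)"
proof -
  let ?M = "Deg X (n + 1)"
  have "cohom_class X (n + 1) x \<otimes>\<^bsub>cohomology X (n + 1)\<^esub> cohom_class X (n + 1) y =
    {(Diff X n z \<oplus>\<^bsub>?M\<^esub> x) \<oplus>\<^bsub>?M\<^esub> (Diff X n w \<oplus>\<^bsub>?M\<^esub> y) | z w.
      z \<in> el X n \<and> w \<in> el X n}"
    by (auto simp: cohomology_def A_FactGroup_def FactGroup_def set_mult_def cohom_class_def')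
  also have "\<dots> = {Diff X n z \<oplus>\<^bsub>?M\<^esub> (x \<oplus>\<^bsub>?M\<^esub> y) | z. z \<in> el X n}" (is "?A = ?B")
  proof (intro equalityI subsetI)
    fix a assume "a \<in> ?A"
    then obtain z w where zw: "z \<in> el X n" "w \<in> el X n"
      "a = (Diff X n z \<oplus>\<^bsub>?M\<^esub> x) \<oplus>\<^bsub>?M\<^esub> (Diff X n w \<oplus>\<^bsub>?M\<^esub> y)" by blast
    have "a = Diff X n (z \<oplus>\<^bsub>Deg X n\<^esub> w) \<oplus>\<^bsub>?M\<^esub> (x \<oplus>\<^bsub>?M\<^esub> y)"
      using zw assms by (simp add: mod_ac)
    moreover have "z \<oplus>\<^bsub>Deg X n\<^esub> w \<in> el X n" using zw X by simp
    ultimately show "a \<in> ?B" by blast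
  next
    fix a assume "a \<in> ?B"
    then obtain z where z: "z \<in> el X n" "a = Diff X n z \<oplus>\<^bsub>?M\<^esub> (x \<oplus>\<^bsub>?M\<^esub> y)" by blast
    have "a = (Diff X n z \<oplus>\<^bsub>?M\<^esub> x) \<oplus>\<^bsub>?M\<^esub> (Diff X n (zr X n) \<oplus>\<^bsub>?M\<^esub> y)"
      using z assms by (simp add: mod_ac)
    moreover have "zr X n \<in> el X n" using X by simp
    ultimately show "a \<in> ?A" using z(1) by blast
  qed
  finally show ?thesis by (simp add: cohom_class_def')
qed

lemma cohomology_map_class:
  assumes X: "cpx X" and Y: "cpx Y" and f: "f \<in> cmaps X Y"
    and x: "x \<in> el X (n + 1)"
  shows "cohomology_map X Y f (n + 1) (cohom_class X (n + 1) x) = cohom_class Y (n + 1) (f (n + 1) x)"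
proof -
  note [simp] = cmap_simps[OF X Y f] X Y
  have "cohom_class Y (n + 1) (f (n + 1) (Diff X n z \<oplus>\<^bsub>Deg X (n + 1)\<^esub> x))
      = cohom_class Y (n + 1) (f (n + 1) x)" if "z \<in> el X n" for z
    using that x by (subst cohom_class_eq) (auto intro!: bexI[of _ "f n z"] simp: mod_ac)
  moreover have "zr X n \<in> el X n" by simp
  ultimately have "(\<Union>y\<in>cohom_class X (n + 1) x. cohom_class Y (n + 1) (f (n + 1) y))
      = cohom_class Y (n + 1) (f (n + 1) x)"
    unfolding cohom_class_def'[of X] by blast
  then show ?thesis by (simp add: cohomology_map_def cohom_class_def)
qed

lemma all_int_Suc: "(\<forall>n. P n) \<longleftrightarrow> (\<forall>n::int. P (n + 1))"
  by (metis diff_add_cancel)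

text \<open>The only place where cohomology groups are handled. Classes of cocycles add and map as
  their representatives do, so a bijective homomorphism of cosets unfolds to the two clauses of
  \<open>qi\<close>.\<close>

lemma quasi_isos_iff:
  assumes X: "cpx X" and Y: "cpx Y"
  shows "f \<in> quasi_isos R X Y \<longleftrightarrow> qi X Y f"
proof (cases "f \<in> cmaps X Y")
  case f: True
  note [simp] = cmap_simps[OF X Y f] X Y
  have cl: "x \<in> cocycles X (n + 1) \<longleftrightarrow>
      x \<in> el X (n + 1) \<and> Diff X (n + 1) x = zr X (n + 1 + 1)"
    for X :: "('a, 'z) cochain_complex" and x n
    by (simp add: cocycles_def)
  have fc: "f (n + 1) x \<in> cocycles Y (n + 1)" if "x \<in> cocycles X (n + 1)" for x n
  proof -
    have "x \<in> el X (n + 1)" "Diff X (n + 1) x = zr X (n + 1 + 1)"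
      using that by (auto simp: cl)
    then show ?thesis
      using cmap_simps(4)[OF X Y f, of "n + 1 + 1"] cmap_simps(6)[OF X Y f, of x "n + 1"]
      by (auto simp: cl simp del: cmap_simps)
  qed
  have "cohomology_map X Y f (n + 1) \<in> iso (cohomology X (n + 1)) (cohomology Y (n + 1)) \<longleftrightarrow>
    (\<forall>x\<in>el X (n + 1). \<forall>y\<in>el Y n.
        Diff X (n + 1) x = zr X (n + 1 + 1) \<longrightarrow> f (n + 1) x = Diff Y n y \<longrightarrow>
        (\<exists>z\<in>el X n. x = Diff X n z)) \<and>
     (\<forall>y\<in>el Y (n + 1). Diff Y (n + 1) y = zr Y (n + 1 + 1) \<longrightarrow>
        (\<exists>x\<in>el X (n + 1). \<exists>z\<in>el Y n.
           Diff X (n + 1) x = zr X (n + 1 + 1) \<and> y = f (n + 1) x \<oplus>\<^bsub>Deg Y (n + 1)\<^esub> Diff Y n z))"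
    (is "?iso \<longleftrightarrow> ?inj \<and> ?surj") for n
  proof -
    let ?H = "cohomology_map X Y f (n + 1)" and ?Z = "cocycles X (n + 1)" and ?W = "cocycles Y (n + 1)"
    let ?c = "cohom_class X (n + 1)" and ?d = "cohom_class Y (n + 1)"
    have car: "carrier (cohomology X (n + 1)) = ?c ` ?Z" "carrier (cohomology Y (n + 1)) = ?d ` ?W"
      by (rule cohomology_carrier)+
    have H: "?H (?c x) = ?d (f (n + 1) x)" if "x \<in> ?Z" for x
      using that cohomology_map_class[OF X Y f] by (simp add: cl)
    have hom: "?H \<in> hom (cohomology X (n + 1)) (cohomology Y (n + 1))"
    proof (rule homI)
      fix a assume "a \<in> carrier (cohomology X (n + 1))"
      then show "?H a \<in> carrier (cohomology Y (n + 1))" using H fc by (auto simp: car)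
    next
      fix a b assume "a \<in> carrier (cohomology X (n + 1))" "b \<in> carrier (cohomology X (n + 1))"
      then obtain x y where xy: "x \<in> ?Z" "y \<in> ?Z" "a = ?c x" "b = ?c y" by (auto simp: car)
      then have "x \<oplus>\<^bsub>Deg X (n + 1)\<^esub> y \<in> ?Z" by (auto simp: cl)
      then show "?H (a \<otimes>\<^bsub>cohomology X (n + 1)\<^esub> b) = ?H a \<otimes>\<^bsub>cohomology Y (n + 1)\<^esub> ?H b"
        using xy by (simp add: H cohomology_mult cl)
    qed
    have "inj_on ?H (?c ` ?Z) \<longleftrightarrow> ?inj"
    proof
      assume inj: "inj_on ?H (?c ` ?Z)"
      show ?inj
      proof (intro ballI impI)
        fix x y assume x: "x \<in> el X (n + 1)" "y \<in> el Y n"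
          "Diff X (n + 1) x = zr X (n + 1 + 1)" "f (n + 1) x = Diff Y n y"
        have z: "zr X (n + 1) \<in> ?Z" and xZ: "x \<in> ?Z" using x by (simp_all add: cl)
        have "?d (f (n + 1) x) = ?d (f (n + 1) (zr X (n + 1)))"
          using x by (subst cohom_class_eq) auto
        then have "?c x = ?c (zr X (n + 1))"
          using inj_onD[OF inj, of "?c x" "?c (zr X (n + 1))"] H[OF xZ] H[OF z] xZ z by simp
        then show "\<exists>z\<in>el X n. x = Diff X n z"
          using x by (subst (asm) cohom_class_eq) auto
      qed
    next
      assume inj: ?inj
      show "inj_on ?H (?c ` ?Z)"
      proof (rule inj_onI)
        fix a b assume "a \<in> ?c ` ?Z" "b \<in> ?c ` ?Z" and eq: "?H a = ?H b"
        then obtain x y where xy: "x \<in> ?Z" "y \<in> ?Z" "a = ?c x" "b = ?c y" by auto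
        then have xy': "x \<in> el X (n + 1)" "y \<in> el X (n + 1)" by (auto simp: cl)
        obtain w where w: "w \<in> el Y n"
          "f (n + 1) x = f (n + 1) y \<oplus>\<^bsub>Deg Y (n + 1)\<^esub> Diff Y n w"
          using eq xy xy' by (auto simp: H cohom_class_eq)
        \<comment> \<open>The difference of the two cocycles is mapped to a coboundary, which
          reduces injectivity on classes to the kernel condition.\<close>
        let ?u = "x \<oplus>\<^bsub>Deg X (n + 1)\<^esub> \<ominus>\<^bsub>Deg X (n + 1)\<^esub> y"
        have "f (n + 1) ?u = (f (n + 1) y \<oplus>\<^bsub>Deg Y (n + 1)\<^esub> Diff Y n w) \<oplus>\<^bsub>Deg Y (n + 1)\<^esub>
            \<ominus>\<^bsub>Deg Y (n + 1)\<^esub> f (n + 1) y"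
          using xy' w by simp
        also have "\<dots> = Diff Y n w" using xy' w(1) by (simp add: mod_ac)
        finally have fu: "f (n + 1) ?u = Diff Y n w" .
        have u: "?u \<in> el X (n + 1)" "Diff X (n + 1) ?u = zr X (n + 1 + 1)"
          using xy xy' by (auto simp: cl)
        obtain z where z: "z \<in> el X n" "?u = Diff X n z"
          using inj[rule_format, OF u(1) w(1) u(2) fu] by blast
        have "x = y \<oplus>\<^bsub>Deg X (n + 1)\<^esub> ?u" using xy' by simp
        then have "x = y \<oplus>\<^bsub>Deg X (n + 1)\<^esub> Diff X n z" using z by simp
        with z(1) have "\<exists>z\<in>el X n. x = y \<oplus>\<^bsub>Deg X (n + 1)\<^esub> Diff X n z" by blast
        then show "a = b" using xy xy' by (simp add: cohom_class_eq)
      qed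
    qed
    moreover have "?H ` (?c ` ?Z) = ?d ` ?W \<longleftrightarrow> ?surj"
    proof
      assume s: "?H ` (?c ` ?Z) = ?d ` ?W"
      show ?surj
      proof (intro ballI impI)
        fix y assume y: "y \<in> el Y (n + 1)" "Diff Y (n + 1) y = zr Y (n + 1 + 1)"
        then have "?d y \<in> ?H ` (?c ` ?Z)" using s by (auto simp: cl)
        then obtain x where "x \<in> ?Z" "?d y = ?d (f (n + 1) x)" by (auto simp: H)
        then show "\<exists>x\<in>el X (n + 1). \<exists>z\<in>el Y n.
           Diff X (n + 1) x = zr X (n + 1 + 1) \<and> y = f (n + 1) x \<oplus>\<^bsub>Deg Y (n + 1)\<^esub> Diff Y n z"
          using y by (subst (asm) cohom_class_eq) (auto simp: cl)
      qed
    next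
      assume s: ?surj
      have "?d y \<in> ?H ` (?c ` ?Z)" if yW: "y \<in> ?W" for y
      proof -
        obtain x z where "x \<in> ?Z" "z \<in> el Y n" "y = f (n + 1) x \<oplus>\<^bsub>Deg Y (n + 1)\<^esub> Diff Y n z"
          using s yW unfolding cl by blast
        then have "?d y = ?H (?c x)" using yW by (auto simp: H cohom_class_eq cl)
        then show ?thesis using \<open>x \<in> ?Z\<close> by blast
      qed
      moreover have "?H ` (?c ` ?Z) \<subseteq> ?d ` ?W" using fc by (auto simp: H)
      ultimately show "?H ` (?c ` ?Z) = ?d ` ?W" by blast
    qed
    ultimately show ?thesis using hom by (simp add: iso_def bij_betw_def car)
  qed
  then have "(\<forall>n. cohomology_map X Y f n \<in> iso (cohomology X n) (cohomology Y n)) \<longleftrightarrow> qi X Y f"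
    unfolding all_int_Suc[of "\<lambda>n. cohomology_map X Y f n \<in> _ n"] qi_def using f by blast
  then show ?thesis using f by (simp add: quasi_isos_def)
qed (auto simp: quasi_isos_def qi_def)

lemma dir_sum_simps [simp]:
  "carrier (dir_sum M N) = carrier M \<times> carrier N"
  "\<zero>\<^bsub>dir_sum M N\<^esub> = (\<zero>\<^bsub>M\<^esub>, \<zero>\<^bsub>N\<^esub>)"
  "(x, y) \<oplus>\<^bsub>dir_sum M N\<^esub> (x', y') = (x \<oplus>\<^bsub>M\<^esub> x', y \<oplus>\<^bsub>N\<^esub> y')"
  "r \<odot>\<^bsub>dir_sum M N\<^esub> (x, y) = (r \<odot>\<^bsub>M\<^esub> x, r \<odot>\<^bsub>N\<^esub> y)"
  by (simp_all add: dir_sum_def)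

lemma dir_sum_module [simp]:
  assumes "module R M" "module R N"
  shows "module R (dir_sum M N)"
proof (rule moduleI)
  show "abelian_group (dir_sum M N)"
  proof (rule abelian_groupI)
    fix x assume "x \<in> carrier (dir_sum M N)"
    then show "\<exists>y\<in>carrier (dir_sum M N). y \<oplus>\<^bsub>dir_sum M N\<^esub> x = \<zero>\<^bsub>dir_sum M N\<^esub>"
      using assms by (intro bexI[of _ "(\<ominus>\<^bsub>M\<^esub> fst x, \<ominus>\<^bsub>N\<^esub> snd x)"]) auto
  qed (use assms in \<open>auto simp: mod_ac\<close>)
qed (use assms in \<open>auto simp: mod_lin module.smult_l_distr[of R] module.smult_assoc1[of R] is_cring\<close>)

lemma dir_sum_neg [simp]:
  assumes "module R M" "module R N" "x \<in> carrier M" "y \<in> carrier N"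
  shows "\<ominus>\<^bsub>dir_sum M N\<^esub> (x, y) = (\<ominus>\<^bsub>M\<^esub> x, \<ominus>\<^bsub>N\<^esub> y)"
proof -
  have "(\<ominus>\<^bsub>M\<^esub> x, \<ominus>\<^bsub>N\<^esub> y) = \<ominus>\<^bsub>dir_sum M N\<^esub> (x, y)"
    by (rule mod_neg_unique) (use assms in auto)
  then show ?thesis by simp
qed


subsection \<open>Direct sums\<close>

definition dsum :: "('z, 'x) cochain_complex \<Rightarrow> ('z, 'y) cochain_complex \<Rightarrow> ('z, 'x \<times> 'y) cochain_complex" where
  "dsum X Y =
     \<lparr>Deg = (\<lambda>n. dir_sum (Deg X n) (Deg Y n)),
      Diff = (\<lambda>n. \<lambda>(x, y)\<in>el X n \<times> el Y n. (Diff X n x, Diff Y n y))\<rparr>"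

lemma dsum_simps [simp]:
  "Deg (dsum X Y) n = dir_sum (Deg X n) (Deg Y n)"
  "\<lbrakk>x \<in> el X n; y \<in> el Y n\<rbrakk> \<Longrightarrow> Diff (dsum X Y) n (x, y) = (Diff X n x, Diff Y n y)"
  by (simp_all add: dsum_def)

lemma dsum_complex [simp]:
  assumes "cpx X" "cpx Y"
  shows "cpx (dsum X Y)"
proof (rule is_complexI)
  fix n
  have "Diff (dsum X Y) n =
    (\<lambda>z\<in>el (dsum X Y) n. case z of (x, y) \<Rightarrow> (Diff X n x, Diff Y n y))"
    by (simp add: dsum_def)
  moreover have "\<dots> \<in> lmaps (Deg (dsum X Y) n) (Deg (dsum X Y) (n + 1))"
    by (rule lin_restrictI) (use assms in auto)
  ultimately show "Diff (dsum X Y) n \<in> lmaps (Deg (dsum X Y) n) (Deg (dsum X Y) (n + 1))"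
    by simp
qed (use assms in auto)

definition cinl where "cinl X Y = cres X (\<lambda>n x. (x, zr Y n))"
definition cfst where "cfst X Y = cres (dsum X Y) (\<lambda>n. fst)"
definition cpair where "cpair X f g = cres X (\<lambda>n x. (f n x, g n x))"
definition ccopair where "ccopair X Y Z f g = cres (dsum X Y) (\<lambda>n (x, y). f n x \<oplus>\<^bsub>Deg Z n\<^esub> g n y)"

lemma cinl_closed: "\<lbrakk>cpx X; cpx Y\<rbrakk> \<Longrightarrow> cinl X Y \<in> cmaps X (dsum X Y)"
  unfolding cinl_def by (rule cres_mapsI) auto

lemma cfst_closed: "\<lbrakk>cpx X; cpx Y\<rbrakk> \<Longrightarrow> cfst X Y \<in> cmaps (dsum X Y) X"
  unfolding cfst_def by (rule cres_mapsI) auto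

lemma cpair_closed:
  assumes "cpx X" "cpx Y" "cpx Z"
    "f \<in> cmaps X Y" "g \<in> cmaps X Z"
  shows "cpair X f g \<in> cmaps X (dsum Y Z)"
  unfolding cpair_def
  by (rule cres_mapsI)
    (simp_all add: assms cmap_simps[OF assms(1,2,4)] cmap_simps[OF assms(1,3,5)])

lemma ccopair_closed:
  assumes "cpx X" "cpx Y" "cpx Z"
    "f \<in> cmaps X Z" "g \<in> cmaps Y Z"
  shows "ccopair X Y Z f g \<in> cmaps (dsum X Y) Z"
  unfolding ccopair_def
  by (rule cres_mapsI)
    (auto simp: assms cmap_simps[OF assms(1,3,4)] cmap_simps[OF assms(2,3,5)] mod_ac mod_lin)


subsection \<open>Properties of quasi-isomorphisms\<close>

text \<open>One case of two-out-of-three. The triangle is assumed to commute only elementwise, so no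
  composite has to be formed in applications.\<close>

lemma qi_comp_left:
  assumes X: "cpx X" and Y: "cpx Y" and Z: "cpx Z"
    and g: "qi Y Z g" and f: "f \<in> cmaps X Y" and h: "qi X Z h"
    and gf: "\<And>n x. x \<in> el X n \<Longrightarrow> g n (f n x) = h n x"
  shows "qi X Y f"
proof -
  note [simp] = X Y Z cmap_simps[OF X Y f] cmap_simps[OF Y Z qi_cmap[OF g]] cmap_simps[OF X Z qi_cmap[OF h]]
  show ?thesis
  proof (rule qiI[OF f])
    fix n x y
    assume a: "x \<in> el X (n + 1)" "y \<in> el Y n"
      "Diff X (n + 1) x = zr X (n + 1 + 1)" "f (n + 1) x = Diff Y n y"
    have "h (n + 1) x = Diff Z n (g n y)" using a gf[OF a(1)] by simp
    then show "\<exists>z\<in>el X n. x = Diff X n z"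
      using qi_inj[OF h a(1) _ a(3)] a(2) by (metis cmap_simps(1)[OF Y Z qi_cmap[OF g]])
  next
    fix n y
    assume y: "y \<in> el Y (n + 1)" "Diff Y (n + 1) y = zr Y (n + 1 + 1)"
    have "Diff Z (n + 1) (g (n + 1) y) = zr Z (n + 1 + 1)"
      using y cmap_simps(6)[OF Y Z qi_cmap[OF g], of y "n + 1"] by (simp del: cmap_simps(6))
    then obtain x z where x: "x \<in> el X (n + 1)" "z \<in> el Z n"
      "Diff X (n + 1) x = zr X (n + 1 + 1)" "g (n + 1) y = h (n + 1) x \<oplus>\<^bsub>Deg Z (n + 1)\<^esub> Diff Z n z"
      using qi_surj[OF h, of "g (n + 1) y" n] y by auto
    let ?u = "y \<oplus>\<^bsub>Deg Y (n + 1)\<^esub> \<ominus>\<^bsub>Deg Y (n + 1)\<^esub> f (n + 1) x"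
    have u: "?u \<in> el Y (n + 1)" using x y by simp
    have "Diff Y (n + 1) (f (n + 1) x) = zr Y (n + 1 + 1)"
      using x cmap_simps(6)[OF X Y f, of x "n + 1"] by (simp del: cmap_simps(6))
    then have du: "Diff Y (n + 1) ?u = zr Y (n + 1 + 1)" using x y by simp
    have "g (n + 1) ?u = Diff Z n z" using x y gf[OF x(1)] by (simp add: mod_ac)
    then obtain w where "w \<in> el Y n" "?u = Diff Y n w"
      using qi_inj[OF g u x(2) du] by blast
    moreover have "y = f (n + 1) x \<oplus>\<^bsub>Deg Y (n + 1)\<^esub> ?u" using x y by simp
    ultimately show "\<exists>x\<in>el X (n + 1). \<exists>z\<in>el Y n.
        Diff X (n + 1) x = zr X (n + 1 + 1) \<and> y = f (n + 1) x \<oplus>\<^bsub>Deg Y (n + 1)\<^esub> Diff Y n z"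
      using x by metis
  qed
qed

text \<open>The other case of two-out-of-three, where the first map of the triangle is known to be a
  quasi-isomorphism.\<close>

lemma qi_comp_right:
  assumes X: "cpx X" and Y: "cpx Y" and Z: "cpx Z"
    and f: "qi X Y f" and g: "g \<in> cmaps Y Z" and h: "qi X Z h"
    and gf: "\<And>n x. x \<in> el X n \<Longrightarrow> g n (f n x) = h n x"
  shows "qi Y Z g"
proof -
  note [simp] = X Y Z cmap_simps[OF Y Z g] cmap_simps[OF X Y qi_cmap[OF f]] cmap_simps[OF X Z qi_cmap[OF h]]
  show ?thesis
  proof (rule qiI[OF g])
    fix n y z
    assume a: "y \<in> el Y (n + 1)" "z \<in> el Z n"
      "Diff Y (n + 1) y = zr Y (n + 1 + 1)" "g (n + 1) y = Diff Z n z"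
    obtain x w where x: "x \<in> el X (n + 1)" "w \<in> el Y n"
      "Diff X (n + 1) x = zr X (n + 1 + 1)" "y = f (n + 1) x \<oplus>\<^bsub>Deg Y (n + 1)\<^esub> Diff Y n w"
      using qi_surj[OF f a(1,3)] .
    \<comment> \<open>Since \<open>y\<close> differs from \<open>f x\<close> by the coboundary of
      \<open>w\<close>, subtracting \<open>g w\<close> from \<open>z\<close> gives a primitive of
      \<open>h x\<close>.\<close>
    let ?v = "z \<oplus>\<^bsub>Deg Z n\<^esub> \<ominus>\<^bsub>Deg Z n\<^esub> g n w"
    have v: "?v \<in> el Z n" using a x by simp
    have "h (n + 1) x \<oplus>\<^bsub>Deg Z (n + 1)\<^esub> Diff Z n (g n w) = Diff Z n z"
      using a(4) x gf[OF x(1)] by simp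
    moreover have "Diff Z n ?v = Diff Z n z \<oplus>\<^bsub>Deg Z (n + 1)\<^esub> \<ominus>\<^bsub>Deg Z (n + 1)\<^esub> Diff Z n (g n w)"
      using a(2) x(2) by simp
    ultimately have "Diff Z n ?v = (h (n + 1) x \<oplus>\<^bsub>Deg Z (n + 1)\<^esub> Diff Z n (g n w))
        \<oplus>\<^bsub>Deg Z (n + 1)\<^esub> \<ominus>\<^bsub>Deg Z (n + 1)\<^esub> Diff Z n (g n w)"
      by (simp only:)
    also have "\<dots> = h (n + 1) x" by (rule mod_add_add_neg) (use x in simp_all)
    finally have "h (n + 1) x = Diff Z n ?v" ..
    then obtain u where u: "u \<in> el X n" "x = Diff X n u"
      using qi_inj[OF h x(1) v x(3)] by blast
    have "y = f (n + 1) (Diff X n u) \<oplus>\<^bsub>Deg Y (n + 1)\<^esub> Diff Y n w" using x(4) u(2) by (simp only:)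
    also have "\<dots> = Diff Y n (f n u \<oplus>\<^bsub>Deg Y n\<^esub> w)" using u(1) x(2) by simp
    finally have "y = Diff Y n (f n u \<oplus>\<^bsub>Deg Y n\<^esub> w)" .
    moreover have "f n u \<oplus>\<^bsub>Deg Y n\<^esub> w \<in> el Y n" using u(1) x(2) by simp
    ultimately show "\<exists>z\<in>el Y n. y = Diff Y n z" by blast
  next
    fix n z
    assume z: "z \<in> el Z (n + 1)" "Diff Z (n + 1) z = zr Z (n + 1 + 1)"
    obtain x w where x: "x \<in> el X (n + 1)" "w \<in> el Z n"
      "Diff X (n + 1) x = zr X (n + 1 + 1)" "z = h (n + 1) x \<oplus>\<^bsub>Deg Z (n + 1)\<^esub> Diff Z n w"
      using qi_surj[OF h z] .
    have "Diff Y (n + 1) (f (n + 1) x) = zr Y (n + 1 + 1)"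
      using x cmap_simps(6)[OF X Y qi_cmap[OF f], of x "n + 1"] by (simp del: cmap_simps(6))
    moreover have "z = g (n + 1) (f (n + 1) x) \<oplus>\<^bsub>Deg Z (n + 1)\<^esub> Diff Z n w"
      using x gf[OF x(1)] by simp
    moreover have "f (n + 1) x \<in> el Y (n + 1)" using x by simp
    ultimately show "\<exists>x\<in>el Y (n + 1). \<exists>w\<in>el Z n.
        Diff Y (n + 1) x = zr Y (n + 1 + 1) \<and> z = g (n + 1) x \<oplus>\<^bsub>Deg Z (n + 1)\<^esub> Diff Z n w"
      using x(2) by blast
  qed
qed

lemma qi_trans:
  assumes X: "cpx X" and Y: "cpx Y" and Z: "cpx Z"
    and f: "qi X Y f" and g: "qi Y Z g"
  shows "qi X Z (ccomp X g f)"
proof -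
  note [simp] = X Y Z cmap_simps[OF Y Z qi_cmap[OF g]] cmap_simps[OF X Y qi_cmap[OF f]]
  show ?thesis
  proof (rule qiI)
    show "ccomp X g f \<in> cmaps X Z" using ccomp_closed[OF X Y Z qi_cmap[OF f] qi_cmap[OF g]] .
  next
    fix n x z
    assume a: "x \<in> el X (n + 1)" "z \<in> el Z n"
      "Diff X (n + 1) x = zr X (n + 1 + 1)" "ccomp X g f (n + 1) x = Diff Z n z"
    have "Diff Y (n + 1) (f (n + 1) x) = zr Y (n + 1 + 1)"
      using a cmap_simps(6)[OF X Y qi_cmap[OF f], of x "n + 1"] by (simp del: cmap_simps(6))
    then obtain y where "y \<in> el Y n" "f (n + 1) x = Diff Y n y"
      using qi_inj[OF g _ a(2), of "f (n + 1) x"] a by auto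
    then show "\<exists>z\<in>el X n. x = Diff X n z"
      using qi_inj[OF f a(1) _ a(3)] by blast
  next
    fix n z
    assume z: "z \<in> el Z (n + 1)" "Diff Z (n + 1) z = zr Z (n + 1 + 1)"
    obtain y w where y: "y \<in> el Y (n + 1)" "w \<in> el Z n"
      "Diff Y (n + 1) y = zr Y (n + 1 + 1)" "z = g (n + 1) y \<oplus>\<^bsub>Deg Z (n + 1)\<^esub> Diff Z n w"
      using qi_surj[OF g z] .
    obtain x v where x: "x \<in> el X (n + 1)" "v \<in> el Y n"
      "Diff X (n + 1) x = zr X (n + 1 + 1)" "y = f (n + 1) x \<oplus>\<^bsub>Deg Y (n + 1)\<^esub> Diff Y n v"
      using qi_surj[OF f y(1,3)] .
    have "z = ccomp X g f (n + 1) x \<oplus>\<^bsub>Deg Z (n + 1)\<^esub> Diff Z n (g n v \<oplus>\<^bsub>Deg Z n\<^esub> w)"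
      using x y by (simp add: mod_ac)
    moreover have "g n v \<oplus>\<^bsub>Deg Z n\<^esub> w \<in> el Z n" using x y by simp
    ultimately show "\<exists>x\<in>el X (n + 1). \<exists>w\<in>el Z n.
        Diff X (n + 1) x = zr X (n + 1 + 1) \<and> z = ccomp X g f (n + 1) x \<oplus>\<^bsub>Deg Z (n + 1)\<^esub> Diff Z n w"
      using x by blast
  qed
qed

lemma qi_bij:
  assumes X: "cpx X" and Y: "cpx Y" and f: "f \<in> cochain_isos R X Y"
  shows "qi X Y f"
proof -
  have f': "f \<in> cmaps X Y" and b: "bij_betw (f n) (el X n) (el Y n)" for n
    using f by (auto simp: cochain_isos_def)
  note [simp] = X Y cmap_simps[OF X Y f']
  show ?thesis
  proof (rule qiI[OF f'])
    fix n x y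
    assume a: "x \<in> el X (n + 1)" "y \<in> el Y n" "f (n + 1) x = Diff Y n y"
    then obtain z where z: "z \<in> el X n" "y = f n z"
      using b[of n] by (auto simp: bij_betw_def)
    then have "f (n + 1) (Diff X n z) = f (n + 1) x" using a by simp
    then have "x = Diff X n z"
      using inj_onD[OF bij_betw_imp_inj_on[OF b[of "n + 1"]], of x "Diff X n z"] a z by simp
    then show "\<exists>z\<in>el X n. x = Diff X n z" using z by blast
  next
    fix n y
    assume y: "y \<in> el Y (n + 1)" "Diff Y (n + 1) y = zr Y (n + 1 + 1)"
    then obtain x where x: "x \<in> el X (n + 1)" "y = f (n + 1) x"
      using b[of "n + 1"] by (auto simp: bij_betw_def)
    have "f (n + 1 + 1) (Diff X (n + 1) x) = f (n + 1 + 1) (zr X (n + 1 + 1))" using x y by simp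
    then have "Diff X (n + 1) x = zr X (n + 1 + 1)"
      using inj_onD[OF bij_betw_imp_inj_on[OF b[of "n + 1 + 1"]],
          of "Diff X (n + 1) x" "zr X (n + 1 + 1)"] x by simp
    moreover have "y = f (n + 1) x \<oplus>\<^bsub>Deg Y (n + 1)\<^esub> Diff Y n (zr Y n)" using x by simp
    moreover have "zr Y n \<in> el Y n" by simp
    ultimately show "\<exists>x\<in>el X (n + 1). \<exists>z\<in>el Y n.
        Diff X (n + 1) x = zr X (n + 1 + 1) \<and> y = f (n + 1) x \<oplus>\<^bsub>Deg Y (n + 1)\<^esub> Diff Y n z"
      using x(1) by blast
  qed
qed

lemma qi_cid [simp]: "cpx X \<Longrightarrow> qi X X (cid X)"
  by (rule qi_bij) (auto simp: cochain_isos_def intro!: bij_betwI[of _ _ _ "\<lambda>x. x"])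

lemma qi_cfst:
  assumes X: "cpx X" and E: "cpx E" and a: "acyclic_cpx E"
  shows "qi (dsum X E) X (cfst X E)"
proof (rule qiI[OF cfst_closed[OF X E]])
  note [simp] = X E
  fix n z y
  assume z: "z \<in> el (dsum X E) (n + 1)" "y \<in> el X n"
    "Diff (dsum X E) (n + 1) z = zr (dsum X E) (n + 1 + 1)" "cfst X E (n + 1) z = Diff X n y"
  obtain x e where xe: "z = (x, e)" "x \<in> el X (n + 1)" "e \<in> el E (n + 1)"
    using z(1) by auto
  then have "Diff E (n + 1) e = zr E (n + 1 + 1)" "x = Diff X n y"
    using z by (auto simp: cfst_def)
  then obtain e' where "e' \<in> el E n" "e = Diff E n e'" using acyclicE[OF a xe(3)] by blast
  then have "z = Diff (dsum X E) n (y, e')" "(y, e') \<in> el (dsum X E) n"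
    using xe z(2) \<open>x = Diff X n y\<close> by auto
  then show "\<exists>w\<in>el (dsum X E) n. z = Diff (dsum X E) n w" by blast
next
  note [simp] = X E
  fix n y
  assume y: "y \<in> el X (n + 1)" "Diff X (n + 1) y = zr X (n + 1 + 1)"
  show "\<exists>x\<in>el (dsum X E) (n + 1). \<exists>z\<in>el X n.
    Diff (dsum X E) (n + 1) x = zr (dsum X E) (n + 1 + 1) \<and>
    y = cfst X E (n + 1) x \<oplus>\<^bsub>Deg X (n + 1)\<^esub> Diff X n z"
    by (rule bexI[of _ "(y, zr E (n + 1))"], rule bexI[of _ "zr X n"])
      (use y in \<open>auto simp: cfst_def\<close>)
qed

text \<open>Followed by the projection to \<open>Y\<close>, a quasi-isomorphism because
  \<open>E\<close> is acyclic, the map is \<open>f\<close>; two-out-of-three applies whatever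
  \<open>g\<close> is.\<close>

lemma qi_cpair:
  assumes X: "cpx X" and Y: "cpx Y" and E: "cpx E" and a: "acyclic_cpx E"
    and f: "qi X Y f" and g: "g \<in> cmaps X E"
  shows "qi X (dsum Y E) (cpair X f g)"
proof (rule qi_comp_left[OF X _ Y qi_cfst[OF Y E a] _ f])
  fix n x assume "x \<in> el X n"
  then show "cfst Y E n (cpair X f g n x) = f n x"
    by (simp add: cfst_def cpair_def cmap_simps[OF X Y qi_cmap[OF f]] cmap_simps[OF X E g])
qed (use X Y E cpair_closed[OF X Y E qi_cmap[OF f] g] in auto)

lemma qi_cinl:
  assumes X: "cpx X" and E: "cpx E" and a: "acyclic_cpx E"
  shows "qi X (dsum X E) (cinl X E)"
  by (rule qi_comp_left[OF X _ X qi_cfst[OF X E a] cinl_closed[OF X E] qi_cid[OF X]])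
    (use X E in \<open>auto simp: cfst_def cinl_def\<close>)

text \<open>Dual argument: precomposed with the inclusion of \<open>X\<close>, the map is
  \<open>f\<close>.\<close>

lemma qi_ccopair:
  assumes X: "cpx X" and Y: "cpx Y" and E: "cpx E" and a: "acyclic_cpx E"
    and f: "qi X Y f" and g: "g \<in> cmaps E Y"
  shows "qi (dsum X E) Y (ccopair X E Y f g)"
  by (rule qi_comp_right[OF X _ Y qi_cinl[OF X E a] ccopair_closed[OF X E Y qi_cmap[OF f] g] f])
    (use X Y E in \<open>auto simp: ccopair_def cinl_def cmap_simps[OF X Y qi_cmap[OF f]] cmap_simps[OF E Y g]\<close>)

lemma acyclic_dsum:
  assumes "cpx X" "cpx Y" "acyclic_cpx X" "acyclic_cpx Y"
  shows "acyclic_cpx (dsum X Y)"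
  unfolding acyclic_cpx_def
proof (intro allI ballI impI)
  fix n z
  assume z: "z \<in> el (dsum X Y) (n + 1)"
    "Diff (dsum X Y) (n + 1) z = zr (dsum X Y) (n + 1 + 1)"
  obtain x y where xy: "z = (x, y)" "x \<in> el X (n + 1)" "y \<in> el Y (n + 1)"
    using z(1) by auto
  then have "Diff X (n + 1) x = zr X (n + 1 + 1)" "Diff Y (n + 1) y = zr Y (n + 1 + 1)"
    using z assms by auto
  then obtain u v where "u \<in> el X n" "x = Diff X n u" "v \<in> el Y n" "y = Diff Y n v"
    using acyclicE[OF assms(3) xy(2)] acyclicE[OF assms(4) xy(3)] by metis
  then show "\<exists>w\<in>el (dsum X Y) n. z = Diff (dsum X Y) n w"
    using assms xy(1) by (intro bexI[of _ "(u, v)"]) auto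
qed

subsection \<open>Cones\<close>

lemma cone_simps [simp]:
  "Deg (cone X Y f) n = dir_sum (Deg X (n + 1)) (Deg Y n)"
  "\<lbrakk>x \<in> el X (n + 1); y \<in> el Y n\<rbrakk> \<Longrightarrow> Diff (cone X Y f) n (x, y) =
    (\<ominus>\<^bsub>Deg X (n + 1 + 1)\<^esub> Diff X (n + 1) x, f (n + 1) x \<oplus>\<^bsub>Deg Y (n + 1)\<^esub> Diff Y n y)"
  by (simp_all add: cone_def)

lemma cone_complex:
  assumes X: "cpx X" and Y: "cpx Y" and f: "f \<in> cmaps X Y"
  shows "cpx (cone X Y f)"
proof (rule is_complexI)
  note [simp] = X Y cmap_simps[OF X Y f]
  show "module R (Deg (cone X Y f) n)" for n by simp
  show "Diff (cone X Y f) n \<in> lmaps (Deg (cone X Y f) n) (Deg (cone X Y f) (n + 1))" for n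
  proof -
    have "Diff (cone X Y f) n = (\<lambda>z\<in>el (cone X Y f) n. case z of (x, y) \<Rightarrow>
        (\<ominus>\<^bsub>Deg X (n + 1 + 1)\<^esub> Diff X (n + 1) x, f (n + 1) x \<oplus>\<^bsub>Deg Y (n + 1)\<^esub> Diff Y n y))"
      by (simp add: cone_def)
    moreover have "\<dots> \<in> lmaps (Deg (cone X Y f) n) (Deg (cone X Y f) (n + 1))"
      by (rule lin_restrictI) (auto simp: mod_lin mod_ac)
    ultimately show ?thesis by simp
  qed
  fix n z assume "z \<in> el (cone X Y f) n"
  then show "Diff (cone X Y f) (n + 1) (Diff (cone X Y f) n z) = zr (cone X Y f) (n + 1 + 1)"
    by (auto simp: mod_ac)
qed

definition cone_in where "cone_in X Y = cres Y (\<lambda>n y. (zr X (n + 1), y))"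
definition cone_pr where "cone_pr X Y f = cres (cone X Y f) (\<lambda>n. fst)"
text \<open>A map out of a cone amounts to a map \<open>g\<close> on \<open>Y\<close> together with
  a null-homotopy \<open>h\<close> of its composite with \<open>f\<close>; the last premise of
  \<open>cone_out_closed\<close> says exactly this.\<close>

definition cone_out where
  "cone_out X Y f W h g = cres (cone X Y f) (\<lambda>n (x, y). h n x \<oplus>\<^bsub>Deg W n\<^esub> g n y)"

lemma cone_in_closed:
  assumes "cpx X" "cpx Y" "f \<in> cmaps X Y"
  shows "cone_in X Y \<in> cmaps Y (cone X Y f)"
  unfolding cone_in_def
  by (rule cres_mapsI) (use assms cmap_simps[OF assms] in auto)

lemma shift_simps [simp]:
  "Deg (shift X) n = Deg X (n + 1)"
  "x \<in> el X (n + 1) \<Longrightarrow> Diff (shift X) n x = \<ominus>\<^bsub>Deg X (n + 1 + 1)\<^esub> Diff X (n + 1) x"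
  by (simp_all add: shift_def)

lemma shift_complex [simp]:
  assumes X: "cpx X"
  shows "cpx (shift X)"
proof (rule is_complexI)
  fix n
  have "(\<lambda>x\<in>el X (n + 1). \<ominus>\<^bsub>Deg X (n + 1 + 1)\<^esub> Diff X (n + 1) x) \<in>
    lmaps (Deg X (n + 1)) (Deg X (n + 1 + 1))"
    by (rule lin_restrictI) (use X in \<open>simp_all add: mod_lin\<close>)
  then show "Diff (shift X) n \<in> lmaps (Deg (shift X) n) (Deg (shift X) (n + 1))"
    by (simp add: shift_def)
qed (use X in simp_all)

lemma shift_map_closed:
  assumes "cpx X" "cpx Y" "f \<in> cmaps X Y"
  shows "shift_map f \<in> cmaps (shift X) (shift Y)"
proof (rule cochain_mapsI)
  show "shift_map f n \<in> lmaps (Deg (shift X) n) (Deg (shift Y) n)" for n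
    using cochain_maps_lin[OF assms(3)] by (simp add: shift_map_def)
  fix n x assume "x \<in> el (shift X) n"
  then show "Diff (shift Y) n (shift_map f n x) = shift_map f (n + 1) (Diff (shift X) n x)"
    using assms(1,2) cmap_simps[OF assms] by (simp add: shift_map_def)
qed

lemma cone_pr_closed:
  assumes "cpx X" "cpx Y" "f \<in> cmaps X Y"
  shows "cone_pr X Y f \<in> cmaps (cone X Y f) (shift X)"
  unfolding cone_pr_def
  by (rule cres_mapsI[OF cone_complex[OF assms]]) (use assms cmap_simps[OF assms] in auto)

lemma cone_out_closed:
  assumes X: "cpx X" and Y: "cpx Y" and W: "cpx W"
    and f: "f \<in> cmaps X Y" and g: "g \<in> cmaps Y W"
    and h: "\<And>n. h n \<in> lmaps (Deg X (n + 1)) (Deg W n)"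
    and eq: "\<And>n x. x \<in> el X (n + 1) \<Longrightarrow>
      g (n + 1) (f (n + 1) x) = Diff W n (h n x) \<oplus>\<^bsub>Deg W (n + 1)\<^esub> h (n + 1) (Diff X (n + 1) x)"
  shows "cone_out X Y f W h g \<in> cmaps (cone X Y f) W"
  unfolding cone_out_def
proof (rule cres_mapsI[OF cone_complex[OF X Y f]])
  note hs = lin_simps[OF complex_module[OF X] complex_module[OF W] h]
  note [simp] = X Y W cmap_simps[OF X Y f] cmap_simps[OF Y W g] hs
  fix n z assume "z \<in> el (cone X Y f) n"
  then obtain x y where z: "z = (x, y)" "x \<in> el X (n + 1)" "y \<in> el Y n" by auto
  show "Diff W n (case z of (x, y) \<Rightarrow> h n x \<oplus>\<^bsub>Deg W n\<^esub> g n y) =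
    (case Diff (cone X Y f) n z of (x, y) \<Rightarrow> h (n + 1) x \<oplus>\<^bsub>Deg W (n + 1)\<^esub> g (n + 1) y)"
    using z eq[OF z(2)] by (simp add: mod_ac)
qed (use X Y W cmap_simps[OF X Y f] cmap_simps[OF Y W g] lin_simps[OF complex_module[OF X] complex_module[OF W] h]
    in \<open>auto simp: mod_ac mod_lin\<close>)

text \<open>For a cocycle (x, y), \<open>f x\<close> is a coboundary, hence x = dz by injectivity.
  Then f z + y is a cocycle, so by surjectivity it is f x1 + d y1, and (x1 - z, y1) is a primitive
  of (x, y).\<close>

lemma acyclic_cone:
  assumes X: "cpx X" and Y: "cpx Y" and f: "qi X Y f"
  shows "acyclic_cpx (cone X Y f)"
  unfolding acyclic_cpx_def
proof (intro allI ballI impI)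
  note fs = cmap_simps[OF X Y qi_cmap[OF f]]
  note [simp] = X Y fs
  fix n w assume w: "w \<in> el (cone X Y f) (n + 1)"
    "Diff (cone X Y f) (n + 1) w = zr (cone X Y f) (n + 1 + 1)"
  obtain x y where xy: "w = (x, y)" "x \<in> el X (n + 1 + 1)" "y \<in> el Y (n + 1)"
    using w(1) by auto
  have dx: "Diff X (n + 1 + 1) x = zr X (n + 1 + 1 + 1)"
    and fx: "f (n + 1 + 1) x \<oplus>\<^bsub>Deg Y (n + 1 + 1)\<^esub> Diff Y (n + 1) y = zr Y (n + 1 + 1)"
    using w xy by (auto simp: mod_neg_zero_iff)
  have "f (n + 1 + 1) x = Diff Y (n + 1) (\<ominus>\<^bsub>Deg Y (n + 1)\<^esub> y)"
    using mod_neg_unique[OF _ _ _ fx] xy by simp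
  moreover have "\<ominus>\<^bsub>Deg Y (n + 1)\<^esub> y \<in> el Y (n + 1)" using xy by simp
  ultimately obtain z where z: "z \<in> el X (n + 1)" "x = Diff X (n + 1) z"
    using qi_inj[OF f xy(2) _ dx] by blast
  let ?c = "f (n + 1) z \<oplus>\<^bsub>Deg Y (n + 1)\<^esub> y"
  have c: "?c \<in> el Y (n + 1)" using z xy by simp
  have dc: "Diff Y (n + 1) ?c = zr Y (n + 1 + 1)"
    using fx xy(3) z(1) unfolding z(2) by simp
  obtain x1 y1 where x1: "x1 \<in> el X (n + 1)" "y1 \<in> el Y n"
    "Diff X (n + 1) x1 = zr X (n + 1 + 1)" "?c = f (n + 1) x1 \<oplus>\<^bsub>Deg Y (n + 1)\<^esub> Diff Y n y1"
    using qi_surj[OF f c dc] .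
  let ?a = "x1 \<oplus>\<^bsub>Deg X (n + 1)\<^esub> \<ominus>\<^bsub>Deg X (n + 1)\<^esub> z"
  have "f (n + 1) ?a \<oplus>\<^bsub>Deg Y (n + 1)\<^esub> Diff Y n y1
      = (f (n + 1) x1 \<oplus>\<^bsub>Deg Y (n + 1)\<^esub> Diff Y n y1) \<oplus>\<^bsub>Deg Y (n + 1)\<^esub> \<ominus>\<^bsub>Deg Y (n + 1)\<^esub> f (n + 1) z"
    using x1(1,2) z(1) by (simp add: mod_ac)
  also have "\<dots> = ?c \<oplus>\<^bsub>Deg Y (n + 1)\<^esub> \<ominus>\<^bsub>Deg Y (n + 1)\<^esub> f (n + 1) z" by (simp only: x1(4))
  also have "\<dots> = y" using z(1) xy(3) by (simp add: mod_ac)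
  finally have "(x, y) = Diff (cone X Y f) n (?a, y1)"
    using x1(1-3) z by simp
  moreover have "(?a, y1) \<in> el (cone X Y f) n" using x1 z by simp
  ultimately show "\<exists>v\<in>el (cone X Y f) n. w = Diff (cone X Y f) n v" using xy(1) by blast
qed

text \<open>The quotient of the cone by \<open>Y\<close> is the shift of the acyclic complex
  \<open>X\<close>, so the inclusion of \<open>Y\<close> loses no cohomology.\<close>

lemma qi_cone_in:
  assumes X: "cpx X" and Y: "cpx Y" and f: "f \<in> cmaps X Y" and a: "acyclic_cpx X"
  shows "qi Y (cone X Y f) (cone_in X Y)"
proof (rule qiI[OF cone_in_closed[OF X Y f]])
  note [simp] = X Y cmap_simps[OF X Y f]
  fix n y z
  assume y: "y \<in> el Y (n + 1)" "z \<in> el (cone X Y f) n"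
    "cone_in X Y (n + 1) y = Diff (cone X Y f) n z"
  obtain e w where ew: "z = (e, w)" "e \<in> el X (n + 1)" "w \<in> el Y n" using y by auto
  have e: "Diff X (n + 1) e = zr X (n + 1 + 1)" "y = f (n + 1) e \<oplus>\<^bsub>Deg Y (n + 1)\<^esub> Diff Y n w"
    using y ew by (auto simp: cone_in_def mod_neg_zero_iff)
  obtain e1 where e1: "e1 \<in> el X n" "e = Diff X n e1" using acyclicE[OF a ew(2) e(1)] .
  have "y = Diff Y n (f n e1 \<oplus>\<^bsub>Deg Y n\<^esub> w)" using e(2) e1(1) ew(3) unfolding e1(2) by simp
  moreover have "f n e1 \<oplus>\<^bsub>Deg Y n\<^esub> w \<in> el Y n" using e1 ew by simp
  ultimately show "\<exists>z\<in>el Y n. y = Diff Y n z" by blast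
next
  note [simp] = X Y cmap_simps[OF X Y f]
  fix n z assume z: "z \<in> el (cone X Y f) (n + 1)"
    "Diff (cone X Y f) (n + 1) z = zr (cone X Y f) (n + 1 + 1)"
  obtain e y where ey: "z = (e, y)" "e \<in> el X (n + 1 + 1)" "y \<in> el Y (n + 1)"
    using z by auto
  have e: "Diff X (n + 1 + 1) e = zr X (n + 1 + 1 + 1)"
    "f (n + 1 + 1) e \<oplus>\<^bsub>Deg Y (n + 1 + 1)\<^esub> Diff Y (n + 1) y = zr Y (n + 1 + 1)"
    using z ey by (auto simp: mod_neg_zero_iff)
  obtain e1 where e1: "e1 \<in> el X (n + 1)" "e = Diff X (n + 1) e1" using acyclicE[OF a ey(2) e(1)] .
  \<comment> \<open>Writing e = d e1, the coboundary of (- e1, 0) is (e, - f e1). Subtracting it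
    from (e, y) leaves a cocycle supported on \<open>Y\<close>.\<close>
  let ?y = "f (n + 1) e1 \<oplus>\<^bsub>Deg Y (n + 1)\<^esub> y"
  have "Diff Y (n + 1) ?y = zr Y (n + 1 + 1)" using e(2) e1(1) ey(3) unfolding e1(2) by simp
  moreover have "z = cone_in X Y (n + 1) ?y \<oplus>\<^bsub>Deg (cone X Y f) (n + 1)\<^esub>
    Diff (cone X Y f) n (\<ominus>\<^bsub>Deg X (n + 1)\<^esub> e1, zr Y n)"
    using e1 ey by (simp add: cone_in_def mod_ac)
  moreover have "?y \<in> el Y (n + 1)"
    "(\<ominus>\<^bsub>Deg X (n + 1)\<^esub> e1, zr Y n) \<in> el (cone X Y f) n"
    using e1(1) ey(3) by simp_all
  ultimately show "\<exists>y\<in>el Y (n + 1). \<exists>w\<in>el (cone X Y f) n.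
    Diff Y (n + 1) y = zr Y (n + 1 + 1) \<and>
    z = cone_in X Y (n + 1) y \<oplus>\<^bsub>Deg (cone X Y f) (n + 1)\<^esub> Diff (cone X Y f) n w" by blast
qed

text \<open>The kernel of the projection is the acyclic complex \<open>Y\<close>.\<close>

lemma qi_cone_pr:
  assumes X: "cpx X" and Y: "cpx Y" and f: "f \<in> cmaps X Y" and a: "acyclic_cpx Y"
  shows "qi (cone X Y f) (shift X) (cone_pr X Y f)"
proof (rule qiI[OF cone_pr_closed[OF X Y f]])
  note [simp] = X Y cmap_simps[OF X Y f]
  fix n z y
  assume z: "z \<in> el (cone X Y f) (n + 1)" "y \<in> el (shift X) n"
    "Diff (cone X Y f) (n + 1) z = zr (cone X Y f) (n + 1 + 1)"
    "cone_pr X Y f (n + 1) z = Diff (shift X) n y"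
  obtain x e where xe: "z = (x, e)" "x \<in> el X (n + 1 + 1)" "e \<in> el Y (n + 1)"
    using z by auto
  have y: "y \<in> el X (n + 1)" using z by simp
  have x: "x = \<ominus>\<^bsub>Deg X (n + 1 + 1)\<^esub> Diff X (n + 1) y"
    using z xe y by (simp add: cone_pr_def)
  have e: "f (n + 1 + 1) x \<oplus>\<^bsub>Deg Y (n + 1 + 1)\<^esub> Diff Y (n + 1) e = zr Y (n + 1 + 1)"
    using z xe by auto
  \<comment> \<open>Because x = - dy, the cocycle condition says that \<open>e\<close> and
    \<open>f y\<close> have the same differential, so their difference has a primitive.\<close>
  let ?e = "e \<oplus>\<^bsub>Deg Y (n + 1)\<^esub> \<ominus>\<^bsub>Deg Y (n + 1)\<^esub> f (n + 1) y"
  have "Diff Y (n + 1) ?e = zr Y (n + 1 + 1)" "?e \<in> el Y (n + 1)"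
    using e y xe(3) unfolding x by (simp_all add: mod_ac)
  then obtain e1 where e1: "e1 \<in> el Y n" "?e = Diff Y n e1" using acyclicE[OF a] by blast
  have "e = f (n + 1) y \<oplus>\<^bsub>Deg Y (n + 1)\<^esub> ?e" using y xe(3) by simp
  then have "z = Diff (cone X Y f) n (y, e1)" using xe(1) x y e1 by simp
  moreover have "(y, e1) \<in> el (cone X Y f) n" using y e1 by simp
  ultimately show "\<exists>w\<in>el (cone X Y f) n. z = Diff (cone X Y f) n w" by blast
next
  note [simp] = X Y cmap_simps[OF X Y f]
  fix n x assume "x \<in> el (shift X) (n + 1)"
    "Diff (shift X) (n + 1) x = zr (shift X) (n + 1 + 1)"
  then have x: "x \<in> el X (n + 1 + 1)" "Diff X (n + 1 + 1) x = zr X (n + 1 + 1 + 1)"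
    by (auto simp: mod_neg_zero_iff)
  have "Diff Y (n + 1 + 1) (f (n + 1 + 1) x) = zr Y (n + 1 + 1 + 1)"
    using x cmap_simps(6)[OF X Y f, of x "n + 1 + 1"] by (simp del: cmap_simps(6))
  then obtain e where e: "e \<in> el Y (n + 1)" "f (n + 1 + 1) x = Diff Y (n + 1) e"
    using acyclicE[OF a, of "f (n + 1 + 1) x" "n + 1"] x(1) by auto
  let ?z = "(x, \<ominus>\<^bsub>Deg Y (n + 1)\<^esub> e)"
  have "Diff (cone X Y f) (n + 1) ?z = zr (cone X Y f) (n + 1 + 1)"
    "x = cone_pr X Y f (n + 1) ?z \<oplus>\<^bsub>Deg (shift X) (n + 1)\<^esub> Diff (shift X) n (zr X (n + 1))"
    "?z \<in> el (cone X Y f) (n + 1)" "zr X (n + 1) \<in> el (shift X) n"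
    using x e by (simp_all add: cone_pr_def)
  then show "\<exists>z\<in>el (cone X Y f) (n + 1). \<exists>w\<in>el (shift X) n.
     Diff (cone X Y f) (n + 1) z = zr (cone X Y f) (n + 1 + 1) \<and>
     x = cone_pr X Y f (n + 1) z \<oplus>\<^bsub>Deg (shift X) (n + 1)\<^esub> Diff (shift X) n w" by blast
qed


subsection \<open>Shifts\<close>

definition unshift :: "('z, 'x) cochain_complex \<Rightarrow> ('z, 'x) cochain_complex" where
  "unshift X =
     \<lparr>Deg = (\<lambda>n. Deg X (n - 1)),
      Diff = (\<lambda>n. \<lambda>x\<in>el X (n - 1). \<ominus>\<^bsub>Deg X n\<^esub> Diff X (n - 1) x)\<rparr>"

definition unshift_map :: "(int \<Rightarrow> 'x \<Rightarrow> 'y) \<Rightarrow> int \<Rightarrow> 'x \<Rightarrow> 'y" where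
  "unshift_map f = (\<lambda>n. f (n - 1))"

lemma unshift_simps [simp]:
  "Deg (unshift X) n = Deg X (n - 1)"
  "x \<in> el X (n - 1) \<Longrightarrow> Diff (unshift X) n x = \<ominus>\<^bsub>Deg X n\<^esub> Diff X (n - 1) x"
  by (simp_all add: unshift_def)

text \<open>Instances of the rules for \<open>Diff\<close> at n - 1, with the target degree n - 1 +
  1 written as n, as \<open>unshift\<close> requires.\<close>

lemma Diff_pred [simp]:
  assumes "cpx X" "x \<in> el X (n - 1)"
  shows "Diff X (n - 1) x \<in> el X n"
    "Diff X n (Diff X (n - 1) x) = zr X (n + 1)"
    "Diff X (n - 1) (\<ominus>\<^bsub>Deg X (n - 1)\<^esub> x) = \<ominus>\<^bsub>Deg X n\<^esub> Diff X (n - 1) x"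
    "y \<in> el X (n - 1) \<Longrightarrow>
      Diff X (n - 1) (x \<oplus>\<^bsub>Deg X (n - 1)\<^esub> y) = Diff X (n - 1) x \<oplus>\<^bsub>Deg X n\<^esub> Diff X (n - 1) y"
    "r \<in> carrier R \<Longrightarrow> Diff X (n - 1) (r \<odot>\<^bsub>Deg X (n - 1)\<^esub> x) = r \<odot>\<^bsub>Deg X n\<^esub> Diff X (n - 1) x"
  using Diff_simps(1,5)[OF assms] Diff_Diff[OF assms] Diff_simps(2)[OF assms] Diff_simps(3)[OF assms(1) _ assms(2)]
  by simp_all

lemma unshift_complex [simp]:
  assumes X: "cpx X"
  shows "cpx (unshift X)"
proof (rule is_complexI)
  fix n
  have "(\<lambda>x\<in>el X (n - 1). \<ominus>\<^bsub>Deg X n\<^esub> Diff X (n - 1) x) \<in> lmaps (Deg X (n - 1)) (Deg X n)"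
    by (rule lin_restrictI) (use X in \<open>simp_all add: mod_lin\<close>)
  then show "Diff (unshift X) n \<in> lmaps (Deg (unshift X) n) (Deg (unshift X) (n + 1))"
    by (simp add: unshift_def)
qed (use X in simp_all)

text \<open>The two signs cancel and differentials are extensional, so this is an equality of
  records and not merely an isomorphism. Statements proved for shifted complexes can therefore be
  unshifted literally.\<close>

lemma shift_unshift:
  assumes "cpx X"
  shows "shift (unshift X) = X"
proof -
  have "Diff (shift (unshift X)) n = Diff X n" for n
  proof -
    have "Diff (shift (unshift X)) n = (\<lambda>x\<in>el X n. Diff X n x)"
      unfolding shift_def using assms by (auto simp: unshift_def intro!: restrict_ext)
    then show ?thesis using lin_maps_restrict[OF complex_Diff[OF assms]] by simp
  qed
  then show ?thesis by (intro cochain_complex.equality ext) simp_all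
qed

lemma unshift_shift:
  assumes "cpx X"
  shows "unshift (shift X) = X"
proof -
  have "Diff (unshift (shift X)) n = Diff X n" for n
  proof -
    have "Diff (unshift (shift X)) n = (\<lambda>x\<in>el X n. Diff X n x)"
      unfolding unshift_def using assms by (auto simp: shift_def intro!: restrict_ext)
    then show ?thesis using lin_maps_restrict[OF complex_Diff[OF assms]] by simp
  qed
  then show ?thesis by (intro cochain_complex.equality ext) simp_all
qed

lemma shift_map_unshift_map [simp]: "shift_map (unshift_map f) = f" "unshift_map (shift_map f) = f"
  by (simp_all add: shift_map_def unshift_map_def)

lemma unshift_map_closed:
  assumes "cpx X" "cpx Y" "f \<in> cmaps X Y"
  shows "unshift_map f \<in> cmaps (unshift X) (unshift Y)"
proof (rule cochain_mapsI)
  show "unshift_map f n \<in> lmaps (Deg (unshift X) n) (Deg (unshift Y) n)" for n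
    using cochain_maps_lin[OF assms(3)] by (simp add: unshift_map_def)
  fix n x assume "x \<in> el (unshift X) n"
  then show "Diff (unshift Y) n (unshift_map f n x) = unshift_map f (n + 1) (Diff (unshift X) n x)"
    using assms(1,2) cmap_simps[OF assms] cmap_simps(6)[OF assms, of x "n - 1"]
    by (simp add: unshift_map_def)
qed

lemma acyclic_unshift:
  assumes X: "cpx X" and a: "acyclic_cpx X"
  shows "acyclic_cpx (unshift X)"
  unfolding acyclic_cpx_def
proof (intro allI ballI impI)
  fix n x assume x: "x \<in> el (unshift X) (n + 1)"
    "Diff (unshift X) (n + 1) x = zr (unshift X) (n + 1 + 1)"
  have "Diff X n x = zr X (n + 1)" using x X by (auto simp: mod_neg_zero_iff)
  then obtain z where z: "z \<in> el X (n - 1)" "x = Diff X (n - 1) z"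
    using acyclicE[OF a, of x "n - 1"] x by auto
  then have "x = Diff (unshift X) n (\<ominus>\<^bsub>Deg X (n - 1)\<^esub> z)" using X by simp
  then show "\<exists>z\<in>el (unshift X) n. x = Diff (unshift X) n z" using z X
    by (intro bexI[of _ "\<ominus>\<^bsub>Deg X (n - 1)\<^esub> z"]) simp_all
qed

lemma qi_shift:
  assumes X: "cpx X" and Y: "cpx Y" and f: "qi X Y f"
  shows "qi (shift X) (shift Y) (shift_map f)"
proof (rule qiI[OF shift_map_closed[OF X Y qi_cmap[OF f]]])
  note [simp] = X Y cmap_simps[OF X Y qi_cmap[OF f]]
  fix n x y
  assume x: "x \<in> el (shift X) (n + 1)" "y \<in> el (shift Y) n"
    "Diff (shift X) (n + 1) x = zr (shift X) (n + 1 + 1)"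
    "shift_map f (n + 1) x = Diff (shift Y) n y"
  have *: "Diff X (n + 1 + 1) x = zr X (n + 1 + 1 + 1)"
    "f (n + 1 + 1) x = Diff Y (n + 1) (\<ominus>\<^bsub>Deg Y (n + 1)\<^esub> y)"
    "\<ominus>\<^bsub>Deg Y (n + 1)\<^esub> y \<in> el Y (n + 1)"
    using x by (auto simp: mod_neg_zero_iff shift_map_def)
  have "x \<in> el X (n + 1 + 1)" using x by simp
  then obtain z where z: "z \<in> el X (n + 1)" "x = Diff X (n + 1) z"
    using qi_inj[OF f _ *(3,1,2)] by blast
  then have "x = Diff (shift X) n (\<ominus>\<^bsub>Deg X (n + 1)\<^esub> z)" by simp
  then show "\<exists>z\<in>el (shift X) n. x = Diff (shift X) n z" using z
    by (intro bexI[of _ "\<ominus>\<^bsub>Deg X (n + 1)\<^esub> z"]) simp_all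
next
  note [simp] = X Y cmap_simps[OF X Y qi_cmap[OF f]]
  fix n y
  assume "y \<in> el (shift Y) (n + 1)"
    "Diff (shift Y) (n + 1) y = zr (shift Y) (n + 1 + 1)"
  then have y: "y \<in> el Y (n + 1 + 1)" "Diff Y (n + 1 + 1) y = zr Y (n + 1 + 1 + 1)"
    by (auto simp: mod_neg_zero_iff)
  obtain x z where x: "x \<in> el X (n + 1 + 1)" "z \<in> el Y (n + 1)"
    "Diff X (n + 1 + 1) x = zr X (n + 1 + 1 + 1)"
    "y = f (n + 1 + 1) x \<oplus>\<^bsub>Deg Y (n + 1 + 1)\<^esub> Diff Y (n + 1) z"
    using qi_surj[OF f y] .
  show "\<exists>x\<in>el (shift X) (n + 1). \<exists>z\<in>el (shift Y) n.
      Diff (shift X) (n + 1) x = zr (shift X) (n + 1 + 1) \<and>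
      y = shift_map f (n + 1) x \<oplus>\<^bsub>Deg (shift Y) (n + 1)\<^esub> Diff (shift Y) n z"
    by (rule bexI[of _ x], rule bexI[of _ "\<ominus>\<^bsub>Deg Y (n + 1)\<^esub> z"])
      (use x in \<open>simp_all add: shift_map_def\<close>)
qed

lemma qi_unshift:
  assumes X: "cpx X" and Y: "cpx Y" and f: "qi X Y f"
  shows "qi (unshift X) (unshift Y) (unshift_map f)"
proof (rule qiI[OF unshift_map_closed[OF X Y qi_cmap[OF f]]])
  note [simp] = X Y cmap_simps[OF X Y qi_cmap[OF f]]
  fix n x y
  assume x: "x \<in> el (unshift X) (n + 1)" "y \<in> el (unshift Y) n"
    "Diff (unshift X) (n + 1) x = zr (unshift X) (n + 1 + 1)"
    "unshift_map f (n + 1) x = Diff (unshift Y) n y"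
  have *: "Diff X n x = zr X (n + 1)"
    "f n x = Diff Y (n - 1) (\<ominus>\<^bsub>Deg Y (n - 1)\<^esub> y)"
    "\<ominus>\<^bsub>Deg Y (n - 1)\<^esub> y \<in> el Y (n - 1)"
    using x by (auto simp: mod_neg_zero_iff unshift_map_def)
  have "x \<in> el X n" using x by simp
  then obtain z where z: "z \<in> el X (n - 1)" "x = Diff X (n - 1) z"
    using qi_inj[OF f, of x "n - 1"] * by (simp only: diff_add_cancel) blast
  then have "x = Diff (unshift X) n (\<ominus>\<^bsub>Deg X (n - 1)\<^esub> z)" by simp
  then show "\<exists>z\<in>el (unshift X) n. x = Diff (unshift X) n z" using z
    by (intro bexI[of _ "\<ominus>\<^bsub>Deg X (n - 1)\<^esub> z"]) simp_all
next
  note [simp] = X Y cmap_simps[OF X Y qi_cmap[OF f]]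
  fix n y
  assume "y \<in> el (unshift Y) (n + 1)"
    "Diff (unshift Y) (n + 1) y = zr (unshift Y) (n + 1 + 1)"
  then have y: "y \<in> el Y n" "Diff Y n y = zr Y (n + 1)"
    by (auto simp: mod_neg_zero_iff)
  obtain x z where x: "x \<in> el X n" "z \<in> el Y (n - 1)"
    "Diff X n x = zr X (n + 1)" "y = f n x \<oplus>\<^bsub>Deg Y n\<^esub> Diff Y (n - 1) z"
    using qi_surj[OF f, of y "n - 1"] y by auto
  show "\<exists>x\<in>el (unshift X) (n + 1). \<exists>z\<in>el (unshift Y) n.
      Diff (unshift X) (n + 1) x = zr (unshift X) (n + 1 + 1) \<and>
      y = unshift_map f (n + 1) x \<oplus>\<^bsub>Deg (unshift Y) (n + 1)\<^esub> Diff (unshift Y) n z"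
    by (rule bexI[of _ x], rule bexI[of _ "\<ominus>\<^bsub>Deg Y (n - 1)\<^esub> z"])
      (use x in \<open>simp_all add: unshift_map_def\<close>)
qed

end

section \<open>Small complexes\<close>

text \<open>\<open>small\<close> is restricted to subsets of \<open>'u\<close>; the same bound is
  needed for carriers of other types, such as those of cones, sums and modules of fractions.\<close>

definition small_in :: "'u itself \<Rightarrow> 'x set \<Rightarrow> bool" where
  "small_in U A \<longleftrightarrow> |A| <o |UNIV :: 'u set|"

locale derived_category = cring R for R :: "('r, 'k) ring_scheme" (structure) +
  fixes U :: "'u itself"
  assumes universe: "universe_for R U"
begin

lemma small_in_image: "small_in U A \<Longrightarrow> small_in U (f ` A)"
  unfolding small_in_def using card_of_image ordLeq_ordLess_trans by blast

lemma small_in_subset: "small_in U A \<Longrightarrow> B \<subseteq> A \<Longrightarrow> small_in U B"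
  unfolding small_in_def using card_of_mono1 ordLeq_ordLess_trans by blast

lemma infinite_universe: "infinite (UNIV :: 'u set)"
proof -
  have "natLeq <o |UNIV :: 'u set|" using universe by (simp add: universe_for_def)
  then show ?thesis using infinite_iff_natLeq_ordLeq ordLess_imp_ordLeq by blast
qed

lemma Cinfinite_universe: "Cinfinite |UNIV :: 'u set|"
  using infinite_universe by (simp add: cinfinite_def Field_card_of card_of_card_order_on)

lemma small_in_nat: "small_in U (A :: nat set)"
proof -
  have "|A| \<le>o natLeq"
    using card_of_mono1[OF subset_UNIV, of A] card_of_nat ordLeq_ordIso_trans by blast
  then show ?thesis
    using universe ordLeq_ordLess_trans by (auto simp: small_in_def universe_for_def)
qed

text \<open>Regularity of the universe: a small union of small sets is small.\<close>

lemma small_in_UN: "small_in U I \<Longrightarrow> (\<And>i. i \<in> I \<Longrightarrow> small_in U (A i)) \<Longrightarrow> small_in U (\<Union>i\<in>I. A i)"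
  unfolding small_in_def
  by (rule card_of_UNION_ordLess_infinite_Field_regularCard[OF _ Cinfinite_universe])
    (use universe in \<open>auto simp: universe_for_def\<close>)

lemma small_in_Times:
  assumes "small_in U A" "small_in U B"
  shows "small_in U (A \<times> B)"
proof -
  have "A \<times> B = (\<Union>x\<in>A. Pair x ` B)" by auto
  then show ?thesis using small_in_UN[OF assms(1) small_in_image[OF assms(2)]] by simp
qed

lemma small_in_ring: "small_in U (carrier R)"
  using universe by (simp add: small_in_def universe_for_def)

text \<open>A countable union of finite powers. Countable index sets are small because the universe
  is uncountable.\<close>

lemma small_in_lists:
  assumes "small_in U A"
  shows "small_in U (lists A)"
proof -
  have "small_in U {xs \<in> lists A. length xs = n}" for n
  proof (induction n)
    case 0
    have "{xs \<in> lists A. length xs = 0} = (\<lambda>_. []) ` {0::nat}" by auto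
    then show ?case using small_in_image[OF small_in_nat] by (simp only:)
  next
    case (Suc n)
    have "{xs \<in> lists A. length xs = Suc n} = (\<lambda>(x, xs). x # xs) ` (A \<times> {xs \<in> lists A. length xs = n})"
      by (auto simp: length_Suc_conv image_iff)
    then show ?case using small_in_image[OF small_in_Times[OF assms Suc]] by simp
  qed
  then have "small_in U (\<Union>n. {xs \<in> lists A. length xs = n})"
    by (intro small_in_UN small_in_nat)
  then show ?thesis by (rule small_in_subset) auto
qed

abbreviation usmall where "usmall X \<equiv> \<forall>n. small_in U (el X n)"

abbreviation Obj :: "('r, 'u) cochain_complex set" where "Obj \<equiv> Ob (Ch R)"

lemma Obj_iff: "X \<in> Obj \<longleftrightarrow> cpx X \<and> usmall X"
  by (simp add: Ch_def small_def small_in_def)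

lemma Obj_complex [simp]: "X \<in> Obj \<Longrightarrow> cpx X"
  by (simp add: Obj_iff)

lemma Obj_small: "X \<in> Obj \<Longrightarrow> usmall X"
  by (simp add: Obj_iff)

lemma usmall_dsum: "usmall X \<Longrightarrow> usmall Y \<Longrightarrow> usmall (dsum X Y)"
  by (simp add: small_in_Times)

lemma usmall_cone: "usmall X \<Longrightarrow> usmall Y \<Longrightarrow> usmall (cone X Y f)"
  by (simp add: small_in_Times)

lemma Obj_shift [simp]: "X \<in> Obj \<Longrightarrow> shift X \<in> Obj"
  by (simp add: Obj_iff)

lemma Obj_unshift [simp]: "X \<in> Obj \<Longrightarrow> unshift X \<in> Obj"
  by (simp add: Obj_iff)

text \<open>Structure carried along \<open>e\<close>, which is meant to be injective on the carrier.
  It serves to move modules over arbitrary types into \<open>'u\<close>.\<close>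

definition transport_module :: "('r, 'x) module \<Rightarrow> ('x \<Rightarrow> 'y) \<Rightarrow> ('r, 'y) module" where
  "transport_module M e =
     \<lparr>carrier = e ` carrier M, mult = undefined, one = undefined, zero = e \<zero>\<^bsub>M\<^esub>,
      add = (\<lambda>x y. e (inv_into (carrier M) e x \<oplus>\<^bsub>M\<^esub> inv_into (carrier M) e y)),
      smult = (\<lambda>r x. e (r \<odot>\<^bsub>M\<^esub> inv_into (carrier M) e x))\<rparr>"

lemma transport_module:
  assumes M: "module R M" and e: "inj_on e (carrier M)"
  shows "module R (transport_module M e)" (is "module R ?N")
    and "(\<lambda>x\<in>carrier M. e x) \<in> lmaps M (transport_module M e)"
proof -
  have [simp]: "carrier ?N = e ` carrier M" "\<zero>\<^bsub>?N\<^esub> = e \<zero>\<^bsub>M\<^esub>"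
    "\<And>x y. \<lbrakk>x \<in> carrier M; y \<in> carrier M\<rbrakk> \<Longrightarrow> e x \<oplus>\<^bsub>?N\<^esub> e y = e (x \<oplus>\<^bsub>M\<^esub> y)"
    "\<And>r x. x \<in> carrier M \<Longrightarrow> r \<odot>\<^bsub>?N\<^esub> e x = e (r \<odot>\<^bsub>M\<^esub> x)"
    using e by (simp_all add: transport_module_def)
  note [simp] = M
  show "module R ?N"
  proof (rule moduleI)
    show "abelian_group ?N"
    proof (rule abelian_groupI)
      fix x assume "x \<in> carrier ?N"
      then obtain x' where "x' \<in> carrier M" "x = e x'" by auto
      then show "\<exists>y\<in>carrier ?N. y \<oplus>\<^bsub>?N\<^esub> x = \<zero>\<^bsub>?N\<^esub>"
        by (intro bexI[of _ "e (\<ominus>\<^bsub>M\<^esub> x')"]) auto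
    qed (auto simp: mod_ac)
  qed (auto simp: mod_lin module.smult_l_distr[of R] module.smult_assoc1[of R] is_cring)
  show "(\<lambda>x\<in>carrier M. e x) \<in> lmaps M ?N"
    by (rule lin_restrictI) auto
qed

lemma iso_inverse:
  assumes X: "cpx X" and Y: "cpx Y" and f: "f \<in> cochain_isos R X Y"
  obtains g where "g \<in> cochain_isos R Y X"
    "\<And>n x. x \<in> el X n \<Longrightarrow> g n (f n x) = x"
    "\<And>n y. y \<in> el Y n \<Longrightarrow> f n (g n y) = y"
proof -
  have f': "f \<in> cmaps X Y" and b: "bij_betw (f n) (el X n) (el Y n)" for n
    using f by (auto simp: cochain_isos_def)
  note [simp] = X Y cmap_simps[OF X Y f']
  define g where "g = (\<lambda>n. inv_into (el X n) (f n))"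
  have gf [simp]: "g n (f n x) = x" if "x \<in> el X n" for n x
    using that b[of n] by (simp add: g_def bij_betw_def)
  have fg: "\<exists>x\<in>el X n. y = f n x" if "y \<in> el Y n" for n y
    using that b[of n] by (auto simp: bij_betw_def)
  have cg: "cres Y g \<in> cmaps Y X"
  proof (rule cres_mapsI[OF Y])
    fix n y assume "y \<in> el Y n"
    then obtain x where x: "x \<in> el X n" "y = f n x" using fg by blast
    then show "g n y \<in> el X n" by simp
    have "f (n + 1) (Diff X n x) = Diff Y n y" using x by simp
    then show "Diff X n (g n y) = g (n + 1) (Diff Y n y)"
      using x gf[of "Diff X n x" "n + 1"] by (simp del: gf) (simp)
  next
    fix n y y' assume "y \<in> el Y n" "y' \<in> el Y n"
    then obtain x x' where x: "x \<in> el X n" "y = f n x" "x' \<in> el X n" "y' = f n x'"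
      using fg by blast
    then have "y \<oplus>\<^bsub>Deg Y n\<^esub> y' = f n (x \<oplus>\<^bsub>Deg X n\<^esub> x')" by simp
    then have "g n (y \<oplus>\<^bsub>Deg Y n\<^esub> y') = x \<oplus>\<^bsub>Deg X n\<^esub> x'" using x by (simp only: gf mod_closed X complex_module)
    then show "g n (y \<oplus>\<^bsub>Deg Y n\<^esub> y') = g n y \<oplus>\<^bsub>Deg X n\<^esub> g n y'" using x by simp
  next
    fix n r y assume "r \<in> carrier R" "y \<in> el Y n"
    then obtain x where x: "r \<in> carrier R" "x \<in> el X n" "y = f n x" using fg by blast
    then have "r \<odot>\<^bsub>Deg Y n\<^esub> y = f n (r \<odot>\<^bsub>Deg X n\<^esub> x)" by simp
    then have "g n (r \<odot>\<^bsub>Deg Y n\<^esub> y) = r \<odot>\<^bsub>Deg X n\<^esub> x" using x by (simp only: gf mod_closed X complex_module)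
    then show "g n (r \<odot>\<^bsub>Deg Y n\<^esub> y) = r \<odot>\<^bsub>Deg X n\<^esub> g n y" using x by simp
  qed
  have "cres Y g \<in> cochain_isos R Y X"
    unfolding cochain_isos_def
  proof (intro CollectI conjI cg allI)
    fix n
    show "bij_betw (cres Y g n) (el Y n) (el X n)"
      using bij_betw_inv_into[OF b[of n]] by (subst bij_betw_cong[of _ _ "g n"]) (auto simp: g_def)
  qed
  moreover have "f n (g n y) = y" if "y \<in> el Y n" for n y using fg[OF that] by auto
  ultimately show ?thesis using that by auto
qed

text \<open>Smallness supplies an injection of each carrier into \<open>'u\<close>. In this way
  cones and sums, built over other types, yield objects of the derived category.\<close>

lemma transport:
  fixes X :: "('r, 'x) cochain_complex"
  assumes X: "cpx X" and small: "usmall X"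
  obtains Z \<theta> where "Z \<in> Obj" "\<theta> \<in> cochain_isos R X Z"
proof -
  have "\<exists>e :: 'x \<Rightarrow> 'u. inj_on e (el X n)" for n
    using ordLess_imp_ordLeq[OF small[unfolded small_in_def, rule_format, of n]]
    by (simp add: card_of_ordLeq[symmetric])
  then obtain e :: "int \<Rightarrow> 'x \<Rightarrow> 'u" where e: "\<And>n. inj_on (e n) (el X n)" by metis
  note [simp] = X
  define Z where "Z = \<lparr>Deg = (\<lambda>n. transport_module (Deg X n) (e n)),
    Diff = (\<lambda>n. \<lambda>z\<in>e n ` el X n. e (n + 1) (Diff X n (inv_into (el X n) (e n) z)))\<rparr>"
  have Deg: "Deg Z n = transport_module (Deg X n) (e n)" for n by (simp add: Z_def)
  have car: "el Z n = e n ` el X n" for n by (simp add: Deg transport_module_def)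
  have ops1: "e n x \<oplus>\<^bsub>Deg Z n\<^esub> e n y = e n (x \<oplus>\<^bsub>Deg X n\<^esub> y)"
    if "x \<in> el X n" "y \<in> el X n" for n x y
    using that e[of n] by (simp add: Deg transport_module_def)
  have ops2: "r \<odot>\<^bsub>Deg Z n\<^esub> e n x = e n (r \<odot>\<^bsub>Deg X n\<^esub> x)"
    "Diff Z n (e n x) = e (n + 1) (Diff X n x)" if "x \<in> el X n" for n x r
    using that e[of n] by (simp_all add: Deg transport_module_def) (simp add: Z_def)
  note ops = ops1 ops2
  have Z: "cpx Z"
  proof (rule is_complexI)
    fix n
    show m: "module R (Deg Z n)" using transport_module(1)[OF complex_module[OF X] e] by (simp add: Deg)
    have "(\<lambda>z\<in>el Z n. Diff Z n z) \<in> lmaps (Deg Z n) (Deg Z (n + 1))"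
      by (rule lin_restrictI[OF _ _ _ m]) (auto simp: car ops)
    moreover have "(\<lambda>z\<in>el Z n. Diff Z n z) = Diff Z n"
      by (simp add: Z_def transport_module_def restrict_def fun_eq_iff)
    ultimately show "Diff Z n \<in> lmaps (Deg Z n) (Deg Z (n + 1))" by simp
    fix z assume "z \<in> el Z n"
    then show "Diff Z (n + 1) (Diff Z n z) = zr Z (n + 1 + 1)"
      by (auto simp: car ops) (simp add: Deg transport_module_def)
  qed
  moreover have "usmall Z" using small by (simp add: car small_in_image)
  ultimately have "Z \<in> Obj" by (simp add: Obj_iff)
  moreover have "cres X e \<in> cochain_isos R X Z"
    unfolding cochain_isos_def
  proof (intro CollectI conjI allI)
    show "cres X e \<in> cmaps X Z"
      by (rule cres_mapsI[OF X]) (auto simp: car ops)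
    show "bij_betw (cres X e n) (el X n) (el Z n)" for n
      using e[of n] by (auto simp: bij_betw_def car inj_on_def)
  qed
  ultimately show ?thesis using that by blast
qed

lemma transportE:
  fixes X :: "('r, 'x) cochain_complex"
  assumes X: "cpx X" and small: "usmall X"
  obtains Z \<theta> \<psi> where "Z \<in> Obj" "qi X Z \<theta>" "qi Z X \<psi>"
    "\<And>n x. x \<in> el X n \<Longrightarrow> \<psi> n (\<theta> n x) = x"
    "\<And>n z. z \<in> el Z n \<Longrightarrow> \<theta> n (\<psi> n z) = z"
proof -
  obtain Z \<theta> where Z: "Z \<in> Obj" "\<theta> \<in> cochain_isos R X Z" using transport[OF assms] by blast
  obtain \<psi> where "\<psi> \<in> cochain_isos R Z X"
    "\<And>n x. x \<in> el X n \<Longrightarrow> \<psi> n (\<theta> n x) = x"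
    "\<And>n z. z \<in> el Z n \<Longrightarrow> \<theta> n (\<psi> n z) = z"
    using iso_inverse[OF X Obj_complex[OF Z(1)] Z(2)] by blast
  then show ?thesis using that Z qi_bij X by (metis Obj_complex)
qed

lemma acyclic_transfer:
  assumes X: "cpx X" and Y: "cpx Y" and f: "qi X Y f" and a: "acyclic_cpx X"
  shows "acyclic_cpx Y"
  unfolding acyclic_cpx_def
proof (intro allI ballI impI)
  fix n y assume y: "y \<in> el Y (n + 1)" "Diff Y (n + 1) y = zr Y (n + 1 + 1)"
  obtain x z where x: "x \<in> el X (n + 1)" "z \<in> el Y n"
    "Diff X (n + 1) x = zr X (n + 1 + 1)" "y = f (n + 1) x \<oplus>\<^bsub>Deg Y (n + 1)\<^esub> Diff Y n z"
    using qi_surj[OF f y] .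
  obtain w where w: "w \<in> el X n" "x = Diff X n w" using acyclicE[OF a x(1,3)] .
  have "y = Diff Y n (f n w \<oplus>\<^bsub>Deg Y n\<^esub> z)"
    using X Y w(1) x(2) cmap_simps[OF X Y qi_cmap[OF f]] unfolding x(4) w(2) by simp
  moreover have "f n w \<oplus>\<^bsub>Deg Y n\<^esub> z \<in> el Y n"
    using X Y w(1) x(2) cmap_simps[OF X Y qi_cmap[OF f]] by simp
  ultimately show "\<exists>z\<in>el Y n. y = Diff Y n z" by blast
qed


section \<open>Maps that agree modulo acyclic complexes\<close>

text \<open>\<open>f\<close> and \<open>g\<close> differ by a map that factors through an acyclic complex. This relation is
  self-dual, is implied by homotopy, and turns out to be equality in the derived category.\<close>

definition feq where
  "feq X Y f g \<longleftrightarrow> f \<in> cmaps X Y \<and> g \<in> cmaps X Y \<and>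
     (\<exists>E\<in>Obj. \<exists>a b. acyclic_cpx E \<and> a \<in> cmaps X E \<and> b \<in> cmaps E Y \<and>
        (\<forall>n. \<forall>x\<in>el X n. f n x = g n x \<oplus>\<^bsub>Deg Y n\<^esub> b n (a n x)))"

text \<open>The definition asks for an acyclic object over \<open>'u\<close>. Here \<open>E\<close>
  may live over any type, which is what cones and sums provide; it is transported before
  use.\<close>

lemma feqI:
  fixes E :: "('r, 'x) cochain_complex"
  assumes X: "cpx X" and Y: "cpx Y"
    and f: "f \<in> cmaps X Y" and g: "g \<in> cmaps X Y"
    and E: "cpx E" "usmall E" "acyclic_cpx E"
    and a: "a \<in> cmaps X E" and b: "b \<in> cmaps E Y"
    and eq: "\<And>n x. x \<in> el X n \<Longrightarrow> f n x = g n x \<oplus>\<^bsub>Deg Y n\<^esub> b n (a n x)"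
  shows "feq X Y f g"
proof -
  obtain Z \<theta> \<psi> where Z: "Z \<in> Obj" "qi E Z \<theta>" "qi Z E \<psi>"
    "\<And>n x. x \<in> el E n \<Longrightarrow> \<psi> n (\<theta> n x) = x"
    using transportE[OF E(1,2)] by metis
  have "acyclic_cpx Z" using acyclic_transfer[OF E(1) Obj_complex[OF Z(1)] Z(2) E(3)] .
  moreover have "ccomp X \<theta> a \<in> cmaps X Z" "ccomp Z b \<psi> \<in> cmaps Z Y"
    using ccomp_closed[OF X E(1) _ a qi_cmap[OF Z(2)]] ccomp_closed[OF _ E(1) Y qi_cmap[OF Z(3)] b] Z(1) by auto
  moreover have "f n x = g n x \<oplus>\<^bsub>Deg Y n\<^esub> ccomp Z b \<psi> n (ccomp X \<theta> a n x)" if "x \<in> el X n" for n x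
    using that eq Z(4) cmap_simps(1)[OF X E(1) a] cmap_simps(1)[OF E(1) _ qi_cmap[OF Z(2)]] Z(1) by simp
  ultimately show ?thesis unfolding feq_def using f g Z(1) by blast
qed

lemma feqE:
  assumes "feq X Y f g"
  obtains E a b where "E \<in> Obj" "acyclic_cpx E" "a \<in> cmaps X E" "b \<in> cmaps E Y"
    "\<And>n x. x \<in> el X n \<Longrightarrow> f n x = g n x \<oplus>\<^bsub>Deg Y n\<^esub> b n (a n x)"
  using assms unfolding feq_def by blast

lemma feq_cmap: "feq X Y f g \<Longrightarrow> f \<in> cmaps X Y" "feq X Y f g \<Longrightarrow> g \<in> cmaps X Y"
  by (auto simp: feq_def)

lemma feq_sym:
  assumes X: "cpx X" and Y: "cpx Y" and fg: "feq X Y f g"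
  shows "feq X Y g f"
proof -
  obtain E a b where E: "E \<in> Obj" "acyclic_cpx E" "a \<in> cmaps X E" "b \<in> cmaps E Y"
    and eq: "\<And>n x. x \<in> el X n \<Longrightarrow> f n x = g n x \<oplus>\<^bsub>Deg Y n\<^esub> b n (a n x)"
    using feqE[OF fg] by metis
  note [simp] = X Y cmap_simps[OF X _ E(3)] cmap_simps[OF _ Y E(4)] cmap_simps[OF X Y feq_cmap(2)[OF fg]] E(1)
  show ?thesis
    by (rule feqI[OF X Y feq_cmap(2)[OF fg] feq_cmap(1)[OF fg] _ _ E(2,3) cneg_closed[OF _ Y E(4)]])
      (simp_all add: eq Obj_small mod_add_add_neg)
qed

text \<open>The two factorizations combine to one through the direct sum of the acyclic
  complexes.\<close>

lemma feq_trans: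
  assumes X: "cpx X" and Y: "cpx Y" and fg: "feq X Y f g" and gh: "feq X Y g h"
  shows "feq X Y f h"
proof -
  obtain E a b where E: "E \<in> Obj" "acyclic_cpx E" "a \<in> cmaps X E" "b \<in> cmaps E Y"
    and eq: "\<And>n x. x \<in> el X n \<Longrightarrow> f n x = g n x \<oplus>\<^bsub>Deg Y n\<^esub> b n (a n x)"
    using feqE[OF fg] by metis
  obtain E' a' b' where E': "E' \<in> Obj" "acyclic_cpx E'" "a' \<in> cmaps X E'" "b' \<in> cmaps E' Y"
    and eq': "\<And>n x. x \<in> el X n \<Longrightarrow> g n x = h n x \<oplus>\<^bsub>Deg Y n\<^esub> b' n (a' n x)"
    using feqE[OF gh] by metis
  note [simp] = X Y cmap_simps[OF X _ E(3)] cmap_simps[OF _ Y E(4)] E(1)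
    cmap_simps[OF X _ E'(3)] cmap_simps[OF _ Y E'(4)] E'(1) cmap_simps[OF X Y feq_cmap(2)[OF gh]]
  show ?thesis
  proof (rule feqI[OF X Y feq_cmap(1)[OF fg] feq_cmap(2)[OF gh]])
    show "cpx (dsum E E')" "acyclic_cpx (dsum E E')" using acyclic_dsum[OF _ _ E(2) E'(2)] by simp_all
    show "usmall (dsum E E')" by (rule usmall_dsum) (use Obj_small in auto)
    show "cpair X a a' \<in> cmaps X (dsum E E')" "ccopair E E' Y b b' \<in> cmaps (dsum E E') Y"
      using cpair_closed[OF X _ _ E(3) E'(3)] ccopair_closed[OF _ _ Y E(4) E'(4)] by auto
    fix n x assume "x \<in> el X n"
    then show "f n x = h n x \<oplus>\<^bsub>Deg Y n\<^esub> ccopair E E' Y b b' n (cpair X a a' n x)"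
      by (simp add: eq eq' cpair_def ccopair_def mod_ac)
  qed
qed

lemma feq_comp_left:
  assumes X: "cpx X" and Y: "cpx Y" and Z: "cpx Z"
    and fg: "feq X Y f g" and h: "h \<in> cmaps Y Z"
  shows "feq X Z (ccomp X h f) (ccomp X h g)"
proof -
  obtain E a b where E: "E \<in> Obj" "acyclic_cpx E" "a \<in> cmaps X E" "b \<in> cmaps E Y"
    and eq: "\<And>n x. x \<in> el X n \<Longrightarrow> f n x = g n x \<oplus>\<^bsub>Deg Y n\<^esub> b n (a n x)"
    using feqE[OF fg] by metis
  note [simp] = X Y Z cmap_simps[OF X _ E(3)] cmap_simps[OF _ Y E(4)] cmap_simps[OF X Y feq_cmap(2)[OF fg]] E(1)
    cmap_simps[OF Y Z h]
  show ?thesis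
    by (rule feqI[OF X Z ccomp_closed[OF X Y Z feq_cmap(1)[OF fg] h] ccomp_closed[OF X Y Z feq_cmap(2)[OF fg] h]
          _ _ E(2,3) ccomp_closed[OF _ Y Z E(4) h]])
      (simp_all add: eq Obj_small)
qed

lemma feq_comp_right:
  assumes X: "cpx X" and Y: "cpx Y" and Z: "cpx Z"
    and fg: "feq Y Z f g" and h: "h \<in> cmaps X Y"
  shows "feq X Z (ccomp X f h) (ccomp X g h)"
proof -
  obtain E a b where E: "E \<in> Obj" "acyclic_cpx E" "a \<in> cmaps Y E" "b \<in> cmaps E Z"
    and eq: "\<And>n x. x \<in> el Y n \<Longrightarrow> f n x = g n x \<oplus>\<^bsub>Deg Z n\<^esub> b n (a n x)"
    using feqE[OF fg] by metis
  note [simp] = X Y Z E(1) cmap_simps[OF X Y h]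
  show ?thesis
    by (rule feqI[OF X Z ccomp_closed[OF X Y Z h feq_cmap(1)[OF fg]] ccomp_closed[OF X Y Z h feq_cmap(2)[OF fg]]
          _ _ E(2) ccomp_closed[OF X Y _ h E(3)] E(4)])
      (simp_all add: eq Obj_small)
qed

lemma feq_unshift:
  assumes X: "cpx X" and Y: "cpx Y" and fg: "feq X Y f g"
  shows "feq (unshift X) (unshift Y) (unshift_map f) (unshift_map g)"
proof -
  obtain E a b where E: "E \<in> Obj" "acyclic_cpx E" "a \<in> cmaps X E" "b \<in> cmaps E Y"
    and eq: "\<And>n x. x \<in> el X n \<Longrightarrow> f n x = g n x \<oplus>\<^bsub>Deg Y n\<^esub> b n (a n x)"
    using feqE[OF fg] by metis
  show ?thesis
    by (rule feqI[of _ _ _ _ "unshift E" "unshift_map a" "unshift_map b"])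
      (use X Y E Obj_small eq feq_cmap[OF fg] in
        \<open>simp_all add: unshift_map_closed acyclic_unshift\<close>, simp_all add: unshift_map_def)
qed

definition csub where "csub X Y f g = cres X (\<lambda>n x. f n x \<oplus>\<^bsub>Deg Y n\<^esub> \<ominus>\<^bsub>Deg Y n\<^esub> g n x)"

lemma csub_apply [simp]:
  "x \<in> el X n \<Longrightarrow> csub X Y f g n x = f n x \<oplus>\<^bsub>Deg Y n\<^esub> \<ominus>\<^bsub>Deg Y n\<^esub> g n x"
  by (simp add: csub_def)

lemma csub_closed:
  assumes X: "cpx X" and Y: "cpx Y"
    and f: "f \<in> cmaps X Y" and g: "g \<in> cmaps X Y"
  shows "csub X Y f g \<in> cmaps X Y"
  unfolding csub_def
  by (rule cres_mapsI[OF X])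
    (use X Y cmap_simps[OF X Y f] cmap_simps[OF X Y g] in \<open>simp_all add: mod_ac mod_lin\<close>)

text \<open>A null-homotopy of f - g is the same as an extension of f - g from \<open>X\<close> to
  the cone of the identity of \<open>X\<close>, which is acyclic. The component \<open>h n\<close>
  lowers the degree from n + 1 to n.\<close>

lemma feq_homotopy:
  assumes X: "cpx X" "usmall X" and Y: "cpx Y"
    and f: "f \<in> cmaps X Y" and g: "g \<in> cmaps X Y"
    and h: "\<And>n. h n \<in> lmaps (Deg X (n + 1)) (Deg Y n)"
    and eq: "\<And>n x. x \<in> el X (n + 1) \<Longrightarrow> f (n + 1) x = g (n + 1) x \<oplus>\<^bsub>Deg Y (n + 1)\<^esub>
      (Diff Y n (h n x) \<oplus>\<^bsub>Deg Y (n + 1)\<^esub> h (n + 1) (Diff X (n + 1) x))"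
  shows "feq X Y f g"
proof (rule feqI[OF X(1) Y f g])
  note hs = lin_simps[OF complex_module[OF X(1)] complex_module[OF Y] h]
  note [simp] = X Y cmap_simps[OF X(1) Y f] cmap_simps[OF X(1) Y g] hs
  let ?E = "cone X X (cid X)"
  show "cpx ?E" "acyclic_cpx ?E" "usmall ?E"
    using cone_complex[OF X(1,1)] acyclic_cone[OF X(1,1)] usmall_cone[OF X(2,2)] by simp_all
  show "cone_in X X \<in> cmaps X ?E" using cone_in_closed[OF X(1,1)] by simp
  show "cone_out X X (cid X) Y h (csub X Y f g) \<in> cmaps ?E Y"
  proof (rule cone_out_closed[OF X(1,1) Y _ csub_closed[OF X(1) Y f g] h])
    fix n x assume x: "x \<in> el X (n + 1)"
    let ?k = "Diff Y n (h n x) \<oplus>\<^bsub>Deg Y (n + 1)\<^esub> h (n + 1) (Diff X (n + 1) x)"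
    have "csub X Y f g (n + 1) (cid X (n + 1) x) =
      (?k \<oplus>\<^bsub>Deg Y (n + 1)\<^esub> g (n + 1) x) \<oplus>\<^bsub>Deg Y (n + 1)\<^esub> \<ominus>\<^bsub>Deg Y (n + 1)\<^esub> g (n + 1) x"
      using x eq[OF x] by (simp add: mod_ac)
    also have "\<dots> = ?k" by (rule mod_add_add_neg) (use x in simp_all)
    finally show "csub X Y f g (n + 1) (cid X (n + 1) x) = ?k" .
  qed simp
  fix n x assume "x \<in> el X n"
  then show "f n x = g n x \<oplus>\<^bsub>Deg Y n\<^esub> cone_out X X (cid X) Y h (csub X Y f g) n (cone_in X X n x)"
    by (simp add: cone_out_def cone_in_def)
qed

end

section \<open>Fractions in the derived category\<close>

lemma (in cring) Ch_simps [simp]: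
  "Hom (Ch R) = cochain_maps R" "Ident (Ch R) X = cid X" "Comp (Ch R) X Y Z g f = ccomp X g f"
  by (simp_all add: Ch_def cid_def cres_def ccomp_def)

sublocale derived_category \<subseteq>
  localizable_category "Ch R :: (('r, 'u) cochain_complex, int \<Rightarrow> 'u \<Rightarrow> 'u) category" "quasi_isos R"
  by unfold_locales
    (auto simp: quasi_isos_def intro: ccomp_closed[OF Obj_complex Obj_complex Obj_complex])

context derived_category
begin

lemma zeq_join: "\<lbrakk>zeq X Y u w; zeq X Y v w\<rbrakk> \<Longrightarrow> zeq X Y u v"
  by (blast intro: zz_eq.sym zz_eq.trans)

lemma zeq_replace: "\<lbrakk>zeq X Y u v; zeq X Y u u'; zeq X Y v v'\<rbrakk> \<Longrightarrow> zeq X Y u' v'"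
  by (blast intro: zz_eq.sym zz_eq.trans)

lemma quasi_isos_Obj [simp]: "\<lbrakk>X \<in> Obj; Y \<in> Obj\<rbrakk> \<Longrightarrow> f \<in> quasi_isos R X Y \<longleftrightarrow> qi X Y f"
  by (simp add: quasi_isos_iff)

lemma zz_cmap: "\<lbrakk>X \<in> Obj; Y \<in> Obj; f \<in> cmaps X Y\<rbrakk> \<Longrightarrow> zz X [Fwd X Y f] Y"
  by simp

lemma zz_qi: "\<lbrakk>X \<in> Obj; Y \<in> Obj; qi X Y f\<rbrakk> \<Longrightarrow> zz X [Fwd X Y f] Y"
  by (simp add: qi_cmap)

lemma zeq_ccomp:
  assumes "X \<in> Obj" "Y \<in> Obj" "Z \<in> Obj" "f \<in> cmaps X Y" "g \<in> cmaps Y Z"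
    "h \<in> cmaps X Z" "\<And>n x. x \<in> el X n \<Longrightarrow> g n (f n x) = h n x"
  shows "zeq X Z ([Fwd X Y f] @ [Fwd Y Z g]) [Fwd X Z h]"
proof (rule zeq_comp)
  show "Comp (Ch R) X Y Z g f = h"
    using assms by (auto intro!: cmap_eqI[of _ X Z] ccomp_closed[of X Y Z])
qed (use assms in auto)

lemma zeq_cid: "X \<in> Obj \<Longrightarrow> zeq X X [Fwd X X (cid X)] []"
  using zz_eq.ident[of X "Ch R" "quasi_isos R"] by simp

lemma zeq_cancel_qi:
  assumes "X \<in> Obj" "Y \<in> Obj" "qi X Y s" "zz Y u Z" "zz Y v Z"
    and "zeq X Z ([Fwd X Y s] @ u) ([Fwd X Y s] @ v)"
  shows "zeq Y Z u v"
  using zeq_cancel_left[of X Y s] assms by simp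

lemma zeq_cancel_qi_right:
  assumes "X \<in> Obj" "Y \<in> Obj" "qi X Y s" "zz Z u X" "zz Z v X"
    and "zeq Z Y (u @ [Fwd X Y s]) (v @ [Fwd X Y s])"
  shows "zeq Z X u v"
  using zeq_cancel_right[of X Y s] assms by simp

lemma ziso_qi: "\<lbrakk>X \<in> Obj; Y \<in> Obj; qi X Y s\<rbrakk> \<Longrightarrow> ziso X Y [Fwd X Y s] [Bwd X Y s]"
  using ziso_W by simp

text \<open>Both sections of the projection \<open>X \<oplus> E \<rightarrow> X\<close> given by \<open>0\<close> and by \<open>a\<close> become its inverse.\<close>

lemma feq_zeq:
  assumes X: "X \<in> Obj" and Y: "Y \<in> Obj" and fg: "feq X Y f g"
  shows "zeq X Y [Fwd X Y f] [Fwd X Y g]"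
proof -
  obtain E a b where E: "E \<in> Obj" "acyclic_cpx E" "a \<in> cmaps X E" "b \<in> cmaps E Y"
    and eq: "\<And>n x. x \<in> el X n \<Longrightarrow> f n x = g n x \<oplus>\<^bsub>Deg Y n\<^esub> b n (a n x)"
    using feqE[OF fg] by metis
  have f: "f \<in> cmaps X Y" and g: "g \<in> cmaps X Y" using feq_cmap[OF fg] by auto
  have X': "cpx X" and Y': "cpx Y" and E': "cpx E" using X Y E(1) by auto
  have S0: "cpx (dsum X E)" using X' E' by simp
  obtain S \<theta> \<psi> where S: "S \<in> Obj" "qi (dsum X E) S \<theta>" "qi S (dsum X E) \<psi>"
    "\<And>n x. x \<in> el (dsum X E) n \<Longrightarrow> \<psi> n (\<theta> n x) = x"
    using transportE[OF S0 usmall_dsum] Obj_small X E(1) by metis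
  have S': "cpx S" using S by simp
  note [simp] = X Y E(1) S(1) X' Y' E' S' cmap_simps[OF X' E' E(3)] cmap_simps[OF E' Y' E(4)]
    cmap_simps[OF S0 S' qi_cmap[OF S(2)]] cmap_simps[OF S' S0 qi_cmap[OF S(3)]]
    cmap_simps[OF X' Y' f] cmap_simps[OF X' Y' g]
  define p where "p = ccomp S (cfst X E) \<psi>"
  define m where "m = ccomp S (ccopair X E Y g b) \<psi>"
  define i where "i = ccomp X \<theta> (cinl X E)"
  define j where "j = ccomp X \<theta> (cpair X (cid X) a)"
  have p: "qi S X p" unfolding p_def
    by (rule qi_trans[OF S' S0 X' S(3) qi_cfst[OF X' E' E(2)]])
  have m: "m \<in> cmaps S Y" unfolding m_def
    by (rule ccomp_closed[OF S' S0 Y' qi_cmap[OF S(3)] ccopair_closed[OF X' E' Y' g E(4)]])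
  have i: "i \<in> cmaps X S" unfolding i_def
    by (rule ccomp_closed[OF X' S0 S' cinl_closed[OF X' E'] qi_cmap[OF S(2)]])
  have j: "j \<in> cmaps X S" unfolding j_def
    by (rule ccomp_closed[OF X' S0 S' cpair_closed[OF X' X' E' cid_closed[OF X'] E(3)] qi_cmap[OF S(2)]])
  \<comment> \<open>The map \<open>m\<close> is \<open>g\<close> on \<open>X\<close> and
    \<open>b\<close> on \<open>E\<close>; hence it gives \<open>g\<close> on the first section and g
    + b a = f on the second.\<close>
  have ev: "p n (i n x) = x" "p n (j n x) = x" "m n (i n x) = g n x" "m n (j n x) = f n x"
    if "x \<in> el X n" for n x
    using that S(4)
    by (simp_all add: p_def i_def j_def m_def cinl_def cpair_def cfst_def ccopair_def eq)
  have "zeq X X ([Fwd X S i] @ [Fwd S X p]) [Fwd X X (cid X)]"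
    "zeq X X ([Fwd X S j] @ [Fwd S X p]) [Fwd X X (cid X)]"
    by (rule zeq_ccomp[OF X S(1) X i qi_cmap[OF p]]; use ev in simp)
      (rule zeq_ccomp[OF X S(1) X j qi_cmap[OF p]]; use ev in simp)
  then have "zeq X X ([Fwd X S i] @ [Fwd S X p]) ([Fwd X S j] @ [Fwd S X p])"
    by (rule zeq_join)
  then have "zeq X S [Fwd X S i] [Fwd X S j]"
    by (rule zeq_cancel_qi_right[OF S(1) X p, rotated 2]) (use i j in simp_all)
  then have "zeq X Y ([Fwd X S i] @ [Fwd S Y m]) ([Fwd X S j] @ [Fwd S Y m])"
    by (rule zeq_cong[OF _ zz_cmap[OF S(1) Y m]])
  then have "zeq X Y [Fwd X Y g] [Fwd X Y f]"
  proof (rule zeq_replace)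
    show "zeq X Y ([Fwd X S i] @ [Fwd S Y m]) [Fwd X Y g]"
      "zeq X Y ([Fwd X S j] @ [Fwd S Y m]) [Fwd X Y f]"
      by (rule zeq_ccomp[OF X S(1) Y i m g]; use ev in simp)
      (rule zeq_ccomp[OF X S(1) Y j m f]; use ev in simp)
  qed
  then show ?thesis by (rule zz_eq.sym)
qed

text \<open>If f t = g t + b a, the pair (t, a) is a quasi-isomorphism from \<open>X1\<close> to the
  sum of \<open>X\<close> and \<open>E\<close>, so its cone is acyclic. The map (f - g, - b) kills
  (t, a), extends to that cone, and thereby factors f - g through it.\<close>

lemma feq_cancel_right:
  assumes X: "X \<in> Obj" and X1: "X1 \<in> Obj" and Y: "Y \<in> Obj" and t: "qi X1 X t"
    and f: "f \<in> cmaps X Y" and g: "g \<in> cmaps X Y"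
    and fg: "feq X1 Y (ccomp X1 f t) (ccomp X1 g t)"
  shows "feq X Y f g"
proof -
  obtain E a b where E: "E \<in> Obj" "acyclic_cpx E" "a \<in> cmaps X1 E" "b \<in> cmaps E Y"
    and eq: "\<And>n x. x \<in> el X1 n \<Longrightarrow> ccomp X1 f t n x = ccomp X1 g t n x \<oplus>\<^bsub>Deg Y n\<^esub> b n (a n x)"
    using feqE[OF fg] by metis
  have X': "cpx X" and Y': "cpx Y" and E': "cpx E" and X1': "cpx X1"
    using X Y E(1) X1 by auto
  let ?c = "cpair X1 t a" and ?S = "dsum X E"
  have S: "cpx ?S" using X' E' by simp
  have c: "qi X1 ?S ?c" by (rule qi_cpair[OF X1' X' E' E(2) t E(3)])
  let ?K = "cone X1 ?S ?c" and ?g = "ccopair X E Y (csub X Y f g) (cneg E Y b)"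
  have g': "?g \<in> cmaps ?S Y"
    by (rule ccopair_closed[OF X' E' Y' csub_closed[OF X' Y' f g] cneg_closed[OF E' Y' E(4)]])
  note [simp] = X Y E(1) X1 X' Y' E' X1' cmap_simps[OF X1' E' E(3)] cmap_simps[OF E' Y' E(4)]
    cmap_simps[OF X' Y' f] cmap_simps[OF X' Y' g] cmap_simps[OF X1' X' qi_cmap[OF t]]
  \<comment> \<open>The composite with (t, a) vanishes on the nose, so the zero null-homotopy
    suffices to extend to the cone.\<close>
  define h where "h = (\<lambda>n. \<lambda>x\<in>el X1 (n + 1). zr Y n)"
  have h: "h n \<in> lmaps (Deg X1 (n + 1)) (Deg Y n)" for n
    unfolding h_def by (rule lin_restrictI) auto
  show ?thesis
  proof (rule feqI[OF X' Y' f g])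
    show "cpx ?K" by (rule cone_complex[OF X1' S qi_cmap[OF c]])
    show "acyclic_cpx ?K" by (rule acyclic_cone[OF X1' S c])
    show "usmall ?K" using usmall_cone[OF _ usmall_dsum] Obj_small X1 X E(1) by metis
    show "ccomp X (cone_in X1 ?S) (cinl X E) \<in> cmaps X ?K"
      by (rule ccomp_closed[OF X' S _ cinl_closed[OF X' E'] cone_in_closed[OF X1' S qi_cmap[OF c]]])
        (rule cone_complex[OF X1' S qi_cmap[OF c]])
    show "cone_out X1 ?S ?c Y h ?g \<in> cmaps ?K Y"
    proof (rule cone_out_closed[OF X1' S Y' qi_cmap[OF c] g' h])
      fix n x assume x: "x \<in> el X1 (n + 1)"
      let ?Y = "Deg Y (n + 1)"
      have "f (n + 1) (t (n + 1) x) = g (n + 1) (t (n + 1) x) \<oplus>\<^bsub>?Y\<^esub> b (n + 1) (a (n + 1) x)"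
        using eq[OF x] x by simp
      then have "?g (n + 1) (?c (n + 1) x) = ((b (n + 1) (a (n + 1) x) \<oplus>\<^bsub>?Y\<^esub> g (n + 1) (t (n + 1) x))
        \<oplus>\<^bsub>?Y\<^esub> \<ominus>\<^bsub>?Y\<^esub> g (n + 1) (t (n + 1) x)) \<oplus>\<^bsub>?Y\<^esub> \<ominus>\<^bsub>?Y\<^esub> b (n + 1) (a (n + 1) x)"
        using x by (simp add: ccopair_def cpair_def mod_ac)
      also have "\<dots> = \<zero>\<^bsub>?Y\<^esub>" using x by (subst mod_add_add_neg) simp_all
      finally show "?g (n + 1) (?c (n + 1) x) =
        Diff Y n (h n x) \<oplus>\<^bsub>Deg Y (n + 1)\<^esub> h (n + 1) (Diff X1 (n + 1) x)"
        using x by (simp add: h_def)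
    qed
    fix n x assume "x \<in> el X n"
    then show "f n x = g n x \<oplus>\<^bsub>Deg Y n\<^esub>
      cone_out X1 ?S ?c Y h ?g n (ccomp X (cone_in X1 ?S) (cinl X E) n x)"
      by (simp add: cone_out_def cone_in_def cinl_def h_def ccopair_def)
  qed
qed

text \<open>Dual to \<open>feq_cancel_right\<close>: if s f = s g + b a, then (s, - b) is a
  quasi-isomorphism that kills (f - g, a), and f - g factors through its cone. The cone carries a
  shift, so the factorization is found for the shifted maps.\<close>

lemma feq_cancel_left:
  assumes X: "X \<in> Obj" and Y: "Y \<in> Obj" and Y1: "Y1 \<in> Obj" and s: "qi Y Y1 s"
    and f: "f \<in> cmaps X Y" and g: "g \<in> cmaps X Y"
    and fg: "feq X Y1 (ccomp X s f) (ccomp X s g)"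
  shows "feq X Y f g"
proof -
  obtain E a b where E: "E \<in> Obj" "acyclic_cpx E" "a \<in> cmaps X E" "b \<in> cmaps E Y1"
    and eq: "\<And>n x. x \<in> el X n \<Longrightarrow> ccomp X s f n x = ccomp X s g n x \<oplus>\<^bsub>Deg Y1 n\<^esub> b n (a n x)"
    using feqE[OF fg] by metis
  have X': "cpx X" and Y': "cpx Y" and E': "cpx E" and Y1': "cpx Y1"
    using X Y E(1) Y1 by auto
  let ?c = "ccopair Y E Y1 s (cneg E Y1 b)" and ?S = "dsum Y E"
  have S: "cpx ?S" using Y' E' by simp
  have c: "qi ?S Y1 ?c" by (rule qi_ccopair[OF Y' Y1' E' E(2) s cneg_closed[OF E' Y1' E(4)]])
  let ?K = "cone ?S Y1 ?c"
  have K: "cpx ?K" by (rule cone_complex[OF S Y1' qi_cmap[OF c]])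
  note [simp] = X Y E(1) Y1 X' Y' E' Y1' cmap_simps[OF X' E' E(3)] cmap_simps[OF E' Y1' E(4)]
    cmap_simps[OF X' Y' f] cmap_simps[OF X' Y' g] cmap_simps[OF Y' Y1' qi_cmap[OF s]]
  \<comment> \<open>Elements killed by (s, - b) become cocycle-like in the cone when the last
    component is 0; this makes \<open>u\<close> a chain map on the shift of
    \<open>X\<close>.\<close>
  define u where "u = cres (shift X) (\<lambda>n x. ((csub X Y f g (n + 1) x, a (n + 1) x), zr Y1 n))"
  define v where "v = cres ?K (\<lambda>n z. fst (fst z))"
  have u: "u \<in> cmaps (shift X) ?K"
    unfolding u_def
  proof (rule cres_mapsI)
    fix n x assume "x \<in> el (shift X) n"
    then have x: "x \<in> el X (n + 1)" by simp
    let ?Y = "Deg Y1 (n + 1)"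
    have "s (n + 1) (f (n + 1) x) = s (n + 1) (g (n + 1) x) \<oplus>\<^bsub>?Y\<^esub> b (n + 1) (a (n + 1) x)"
      using eq[OF x] x by simp
    then have "?c (n + 1) (csub X Y f g (n + 1) x, a (n + 1) x) =
      ((b (n + 1) (a (n + 1) x) \<oplus>\<^bsub>?Y\<^esub> s (n + 1) (g (n + 1) x))
        \<oplus>\<^bsub>?Y\<^esub> \<ominus>\<^bsub>?Y\<^esub> s (n + 1) (g (n + 1) x)) \<oplus>\<^bsub>?Y\<^esub> \<ominus>\<^bsub>?Y\<^esub> b (n + 1) (a (n + 1) x)"
      using x by (simp add: ccopair_def mod_ac)
    also have "\<dots> = \<zero>\<^bsub>?Y\<^esub>" using x by (subst mod_add_add_neg) simp_all
    finally have "?c (n + 1) (csub X Y f g (n + 1) x, a (n + 1) x) = \<zero>\<^bsub>?Y\<^esub>" .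
    then show "Diff ?K n ((csub X Y f g (n + 1) x, a (n + 1) x), zr Y1 n) =
      ((csub X Y f g (n + 1 + 1) (Diff (shift X) n x), a (n + 1 + 1) (Diff (shift X) n x)), zr Y1 (n + 1))"
      using x by (simp add: mod_lin)
  qed (auto simp: mod_ac mod_lin)
  have v: "v \<in> cmaps ?K (shift Y)"
    unfolding v_def by (rule cres_mapsI[OF K]) auto
  have "feq (shift X) (shift Y) (shift_map f) (shift_map g)"
  proof (rule feqI[OF _ _ shift_map_closed[OF X' Y' f] shift_map_closed[OF X' Y' g] K _ _ u v])
    show "acyclic_cpx ?K" by (rule acyclic_cone[OF S Y1' c])
    show "usmall ?K" using usmall_cone[OF usmall_dsum] Obj_small Y1 Y E(1) by metis
    fix n x assume "x \<in> el (shift X) n"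
    then show "shift_map f n x = shift_map g n x \<oplus>\<^bsub>Deg (shift Y) n\<^esub> v n (u n x)"
      by (simp add: shift_map_def u_def v_def)
  qed simp_all
  from feq_unshift[OF _ _ this] show ?thesis by (simp add: unshift_shift)
qed

text \<open>A homotopy pushout. The homotopy fibre \<open>?F\<close> of \<open>s\<close> is acyclic
  and projects to \<open>X\<close>; the cone of its map to \<open>A\<close> receives
  \<open>A\<close> by a quasi-isomorphism and receives \<open>Y\<close> through the fibre component.
  The square commutes up to homotopy, which is enough for \<open>feq\<close>.\<close>

lemma pushout_qi:
  assumes X: "X \<in> Obj" and Y: "Y \<in> Obj" and A: "A \<in> Obj"
    and s: "qi X Y s" and a: "a \<in> cmaps X A"
  obtains Z t c where "Z \<in> Obj" "qi A Z t" "c \<in> cmaps Y Z" "feq X Z (ccomp X c s) (ccomp X t a)"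
proof -
  have X': "cpx X" and Y': "cpx Y" and A': "cpx A" using X Y A by auto
  note s' = qi_cmap[OF s]
  note [simp] = X Y A X' Y' A' cmap_simps[OF X' Y' s'] cmap_simps[OF X' A' a]
  let ?C = "cone X Y s"
  let ?F = "unshift ?C"
  have C: "cpx ?C" by (rule cone_complex[OF X' Y' s'])
  have F: "cpx ?F" "acyclic_cpx ?F"
    using C acyclic_unshift[OF C acyclic_cone[OF X' Y' s]] by simp_all
  define \<phi> where "\<phi> = cres ?F (\<lambda>n z. a n (fst z))"
  have \<phi>: "\<phi> \<in> cmaps ?F A"
    unfolding \<phi>_def
  proof (rule cres_mapsI[OF F(1)])
    fix n z assume "z \<in> el ?F n"
    then obtain x y where z: "z = (x, y)" "x \<in> el X n" "y \<in> el Y (n - 1)" by auto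
    then have "Diff ?C (n - 1) (x, y) = (\<ominus>\<^bsub>Deg X (n + 1)\<^esub> Diff X n x, s n x \<oplus>\<^bsub>Deg Y n\<^esub> Diff Y (n - 1) y)"
      using cone_simps(2)[of x X "n - 1" y Y s] by simp
    then show "Diff A n (a n (fst z)) = a (n + 1) (fst (Diff ?F n z))"
      using z by (simp del: cone_simps(2))
  qed auto
  let ?D = "cone ?F A \<phi>"
  have D: "cpx ?D" by (rule cone_complex[OF F(1) A' \<phi>])
  have t0: "qi A ?D (cone_in ?F A)" by (rule qi_cone_in[OF F(1) A' \<phi> F(2)])
  \<comment> \<open>The sign makes the square commute rather than anticommute up to the homotopy
    below.\<close>
  define c where "c = cres Y (\<lambda>n y. ((zr X (n + 1), \<ominus>\<^bsub>Deg Y n\<^esub> y), zr A n))"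
  have c: "c \<in> cmaps Y ?D"
    unfolding c_def by (rule cres_mapsI) (auto simp: mod_lin \<phi>_def)
  have feq0: "feq X ?D (ccomp X c s) (ccomp X (cone_in ?F A) a)"
  proof (rule feq_homotopy[OF X' _ D ccomp_closed[OF X' Y' D s' c] ccomp_closed[OF X' A' D a qi_cmap[OF t0]]])
    show "usmall X" using Obj_small X by blast
    let ?h = "\<lambda>n. \<lambda>x\<in>el X (n + 1). ((\<ominus>\<^bsub>Deg X (n + 1)\<^esub> x, zr Y n), zr A n)"
    show "?h n \<in> lmaps (Deg X (n + 1)) (Deg ?D n)" for n
      by (rule lin_restrictI) (auto simp: mod_lin)
    fix n x assume "x \<in> el X (n + 1)"
    then show "ccomp X c s (n + 1) x = ccomp X (cone_in ?F A) a (n + 1) x \<oplus>\<^bsub>Deg ?D (n + 1)\<^esub>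
      (Diff ?D n (?h n x) \<oplus>\<^bsub>Deg ?D (n + 1)\<^esub> ?h (n + 1) (Diff X (n + 1) x))"
      by (simp add: c_def cone_in_def \<phi>_def mod_lin)
  qed
  have "usmall ?C" using usmall_cone Obj_small X Y by metis
  then have "usmall ?F" by (simp del: cone_simps)
  then have "usmall ?D" using usmall_cone[of ?F A] Obj_small A by metis
  then obtain Z \<theta> \<psi> where Z: "Z \<in> Obj" "qi ?D Z \<theta>" using transportE[OF D] by metis
  have Z': "cpx Z" using Z by simp
  have \<theta>: "\<theta> \<in> cmaps ?D Z" by (rule qi_cmap[OF Z(2)])
  show ?thesis
  proof (rule that[OF Z(1), of "ccomp A \<theta> (cone_in ?F A)" "ccomp Y \<theta> c"])
    show "qi A Z (ccomp A \<theta> (cone_in ?F A))" by (rule qi_trans[OF A' D Z' t0 Z(2)])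
    show "ccomp Y \<theta> c \<in> cmaps Y Z" by (rule ccomp_closed[OF Y' D Z' c \<theta>])
    have "ccomp X (ccomp Y \<theta> c) s = ccomp X \<theta> (ccomp X c s)"
      "ccomp X (ccomp A \<theta> (cone_in ?F A)) a = ccomp X \<theta> (ccomp X (cone_in ?F A) a)"
      by (auto simp: ccomp_cres cres_def fun_eq_iff)
    then show "feq X Z (ccomp X (ccomp Y \<theta> c) s) (ccomp X (ccomp A \<theta> (cone_in ?F A)) a)"
      using feq_comp_left[OF X' D Z' feq0 \<theta>] by simp
  qed
qed

text \<open>A homotopy pullback, constructed one degree shifted as the cone of the composite from
  \<open>A\<close> through \<open>Y\<close> to the cone of \<open>s\<close>. That cone is acyclic,
  so the projection to the shift of \<open>A\<close> is a quasi-isomorphism; everything is unshifted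
  at the end.\<close>

lemma pullback_qi:
  assumes X: "X \<in> Obj" and Y: "Y \<in> Obj" and A: "A \<in> Obj"
    and s: "qi X Y s" and a: "a \<in> cmaps A Y"
  obtains Z t c where "Z \<in> Obj" "qi Z A t" "c \<in> cmaps Z X" "feq Z Y (ccomp Z s c) (ccomp Z a t)"
proof -
  have X': "cpx X" and Y': "cpx Y" and A': "cpx A" using X Y A by auto
  note s' = qi_cmap[OF s]
  note [simp] = X Y A X' Y' A' cmap_simps[OF X' Y' s'] cmap_simps[OF A' Y' a]
  let ?E = "cone X Y s"
  have E: "cpx ?E" "acyclic_cpx ?E"
    using cone_complex[OF X' Y' s'] acyclic_cone[OF X' Y' s] by simp_all
  let ?\<psi> = "ccomp A (cone_in X Y) a"
  have \<psi>: "?\<psi> \<in> cmaps A ?E"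
    by (rule ccomp_closed[OF A' Y' E(1) a cone_in_closed[OF X' Y' s']])
  let ?D = "cone A ?E ?\<psi>"
  have D: "cpx ?D" by (rule cone_complex[OF A' E(1) \<psi>])
  have p: "qi ?D (shift A) (cone_pr A ?E ?\<psi>)" by (rule qi_cone_pr[OF A' E(1) \<psi> E(2)])
  \<comment> \<open>The sign is forced by the homotopy - y: its two terms add up to - a \<alpha> - s
    x.\<close>
  define q where "q = cres ?D (\<lambda>n z. \<ominus>\<^bsub>Deg X (n + 1)\<^esub> fst (snd z))"
  have q: "q \<in> cmaps ?D (shift X)"
    unfolding q_def by (rule cres_mapsI[OF D]) (auto simp: mod_lin cone_in_def)
  have ss: "shift_map s \<in> cmaps (shift X) (shift Y)"
    and sa: "shift_map a \<in> cmaps (shift A) (shift Y)"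
    using shift_map_closed[OF X' Y' s'] shift_map_closed[OF A' Y' a] by simp_all
  have sX: "cpx (shift X)" "cpx (shift Y)" "cpx (shift A)" by simp_all
  have us: "usmall ?D" using usmall_cone[OF _ usmall_cone] Obj_small A X Y by metis
  have feq0: "feq ?D (shift Y) (ccomp ?D (shift_map s) q) (ccomp ?D (shift_map a) (cone_pr A ?E ?\<psi>))"
  proof (rule feq_homotopy[OF D us sX(2) ccomp_closed[OF D sX(1,2) q ss] ccomp_closed[OF D sX(3,2) qi_cmap[OF p] sa]])
    let ?h = "\<lambda>n. \<lambda>z\<in>el ?D (n + 1). \<ominus>\<^bsub>Deg Y (n + 1)\<^esub> snd (snd z)"
    show "?h n \<in> lmaps (Deg ?D (n + 1)) (Deg (shift Y) n)" for n
      by (rule lin_restrictI[OF _ _ _ complex_module[OF D]]) (auto simp: mod_lin)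
    fix n z assume z: "z \<in> el ?D (n + 1)"
    then obtain \<alpha> x y where zz: "z = (\<alpha>, x, y)" "\<alpha> \<in> el A (n + 1 + 1)"
      "x \<in> el X (n + 1 + 1)" "y \<in> el Y (n + 1)" by auto
    have h2: "?h (n + 1) (Diff ?D (n + 1) z) = \<ominus>\<^bsub>Deg Y (n + 1 + 1)\<^esub> snd (snd (Diff ?D (n + 1) z))"
      using Diff_simps(1)[OF D z] by (simp only: restrict_apply' )
    show "ccomp ?D (shift_map s) q (n + 1) z = ccomp ?D (shift_map a) (cone_pr A ?E ?\<psi>) (n + 1) z
      \<oplus>\<^bsub>Deg (shift Y) (n + 1)\<^esub> (Diff (shift Y) n (?h n z) \<oplus>\<^bsub>Deg (shift Y) (n + 1)\<^esub> ?h (n + 1) (Diff ?D (n + 1) z))"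
      unfolding h2 using zz z
      by (simp add: q_def cone_pr_def cone_in_def shift_map_def mod_lin mod_ac)
  qed
  obtain W \<theta> \<psi> where W: "W \<in> Obj" "qi W ?D \<psi>" using transportE[OF D us] by metis
  have W': "cpx W" using W by simp
  note \<psi>' = qi_cmap[OF W(2)]
  let ?t = "ccomp W (cone_pr A ?E ?\<psi>) \<psi>" and ?c = "ccomp W q \<psi>"
  have t: "qi W (shift A) ?t" by (rule qi_trans[OF W' D sX(3) W(2) p])
  have c: "?c \<in> cmaps W (shift X)" by (rule ccomp_closed[OF W' D sX(1) \<psi>' q])
  have eqs: "ccomp W (ccomp ?D (shift_map s) q) \<psi> = ccomp W (shift_map s) ?c"
    "ccomp W (ccomp ?D (shift_map a) (cone_pr A ?E ?\<psi>)) \<psi> = ccomp W (shift_map a) ?t"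
    using cmap_simps(1)[OF W' D \<psi>'] by (auto simp: ccomp_cres cres_def fun_eq_iff)
  have "feq W (shift Y) (ccomp W (shift_map s) ?c) (ccomp W (shift_map a) ?t)"
    using feq_comp_right[OF W' D sX(2) feq0 \<psi>'] unfolding eqs .
  note f1 = feq_unshift[OF W' sX(2) this]
  have eq2: "unshift_map (ccomp W (shift_map k) l) = ccomp (unshift W) k (unshift_map l)" for k l
    by (simp add: unshift_map_def ccomp_def shift_map_def)
  show ?thesis
  proof (rule that[of "unshift W" "unshift_map ?t" "unshift_map ?c"])
    show "unshift W \<in> Obj" using W(1) by simp
    show "qi (unshift W) A (unshift_map ?t)" using qi_unshift[OF W' sX(3) t] by (simp add: unshift_shift)
    show "unshift_map ?c \<in> cmaps (unshift W) X"
      using unshift_map_closed[OF W' sX(1) c] by (simp add: unshift_shift)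
    show "feq (unshift W) Y (ccomp (unshift W) s (unshift_map ?c)) (ccomp (unshift W) a (unshift_map ?t))"
      using f1 by (simp add: eq2 unshift_shift)
  qed
qed

section \<open>Zigzags compared with roofs\<close>

lemma ccomp_assoc:
  assumes "cpx A" "cpx B" "t \<in> cmaps A B"
  shows "ccomp A (ccomp B g f) t = ccomp A g (ccomp A f t)"
  using cmap_simps(1)[OF assms] by (auto simp: ccomp_cres cres_def fun_eq_iff)

lemma ccomp_cid_right:
  assumes X: "cpx X" and Y: "cpx Y" and f: "f \<in> cmaps X Y"
  shows "ccomp X f (cid X) = f"
proof (rule cmap_eqI[OF ccomp_closed[OF X X Y cid_closed[OF X] f] f])
  fix n x assume "x \<in> el X n"
  then show "ccomp X f (cid X) n x = f n x" by simp
qed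

lemma ccomp_cid_left:
  assumes X: "cpx X" and Y: "cpx Y" and f: "f \<in> cmaps X Y"
  shows "ccomp X (cid Y) f = f"
proof (rule cmap_eqI[OF ccomp_closed[OF X Y Y f cid_closed[OF Y]] f])
  fix n x assume "x \<in> el X n"
  then show "ccomp X (cid Y) f n x = f n x" using cmap_simps(1)[OF X Y f] by simp
qed

text \<open>Uses the zero homotopy, whose cone supplies the acyclic object demanded by the
  definition.\<close>

lemma feq_refl:
  assumes X: "X \<in> Obj" and Y: "cpx Y" and f: "f \<in> cmaps X Y"
  shows "feq X Y f f"
proof (rule feq_homotopy[of _ _ _ _ "\<lambda>n. \<lambda>x\<in>el X (n + 1). zr Y n"])
  show "(\<lambda>x\<in>el X (n + 1). zr Y n) \<in> lmaps (Deg X (n + 1)) (Deg Y n)" for n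
    by (rule lin_restrictI) (use X Y in auto)
qed (use X Y f Obj_small cmap_simps(1)[OF _ Y f] in auto)

lemma zeq_feq_comp:
  assumes "X \<in> Obj" "Y \<in> Obj" "Z \<in> Obj" "f \<in> cmaps X Y" "g \<in> cmaps Y Z"
  shows "zeq X Z ([Fwd X Y f] @ [Fwd Y Z g]) [Fwd X Z (ccomp X g f)]"
  by (rule zeq_ccomp) (use assms ccomp_closed[of X Y Z] in auto)

text \<open>\<open>A\<close> with \<open>a\<close> and \<open>b\<close> is, up to \<open>feq\<close>, the two ends of a cone with vertex \<open>A\<close> over the
  zigzag \<open>w\<close> from \<open>X\<close>.\<close>

fun ladder :: "('r, 'u) cochain_complex \<Rightarrow> ('r, 'u) cochain_complex \<Rightarrow>
    (('r, 'u) cochain_complex, int \<Rightarrow> 'u \<Rightarrow> 'u) letter list \<Rightarrow>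
    (int \<Rightarrow> 'u \<Rightarrow> 'u) \<Rightarrow> (int \<Rightarrow> 'u \<Rightarrow> 'u) \<Rightarrow> bool" where
  "ladder A X [] a b \<longleftrightarrow> feq A X a b"
| "ladder A X (Fwd P Q f # w) a b \<longleftrightarrow> ladder A Q w (ccomp A f a) b"
| "ladder A X (Bwd P Q s # w) a b \<longleftrightarrow>
     (\<exists>c\<in>cmaps A P. feq A X (ccomp A s c) a \<and> ladder A P w c b)"

lemma ladder_cong:
  assumes A: "A \<in> Obj"
  shows "\<lbrakk>zz X w Y; feq A X a a'; ladder A X w a b\<rbrakk> \<Longrightarrow> ladder A X w a' b"
proof (induction w arbitrary: X a a')
  case Nil
  then have "X \<in> Obj" by auto
  then have X: "cpx X" by simp
  have "feq A X a b" using Nil by simp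
  then show ?case using feq_trans[OF _ X feq_sym[OF _ X Nil(2)]] A by simp
next
  case (Cons l w)
  show ?case
  proof (cases l)
    case (Fwd P Q f)
    then have o: "X \<in> Obj" "Q \<in> Obj" "f \<in> cmaps X Q" "zz Q w Y"
      using Cons.prems(1) zz_Ob by auto
    have "feq A Q (ccomp A f a) (ccomp A f a')"
      by (rule feq_comp_left[OF _ _ _ Cons.prems(2) o(3)]) (use A o in auto)
    then show ?thesis using Cons.IH[OF o(4)] Cons.prems(3) Fwd by simp
  next
    case (Bwd P Q s)
    then have o: "X \<in> Obj" using Cons.prems(1) zz_Ob by auto
    obtain c where "c \<in> cmaps A P" "feq A X (ccomp A s c) a" "ladder A P w c b"
      using Cons.prems(3) Bwd by auto
    moreover from this have "feq A X (ccomp A s c) a'"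
      using feq_trans[OF _ _ _ Cons.prems(2)] A o by simp
    ultimately show ?thesis using Bwd by auto
  qed
qed

lemma ladder_end:
  assumes A: "A \<in> Obj"
  shows "\<lbrakk>zz X w Y; ladder A X w a b\<rbrakk> \<Longrightarrow> b \<in> cmaps A Y"
proof (induction w arbitrary: X a)
  case (Cons l w)
  then show ?case by (cases l) auto
qed (auto dest: feq_cmap)

text \<open>All conditions in \<open>ladder\<close> are postcompositions up to \<open>feq\<close>,
  and \<open>feq\<close> is stable under precomposition; so the vertex may be changed along any
  chain map.\<close>

lemma ladder_restrict:
  assumes A: "A \<in> Obj" and B: "B \<in> Obj" and t: "t \<in> cmaps B A"
  shows "\<lbrakk>zz X w Y; ladder A X w a b\<rbrakk> \<Longrightarrow> ladder B X w (ccomp B a t) (ccomp B b t)"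
proof (induction w arbitrary: X a)
  case Nil
  then have X: "cpx X" and "feq A X a b" by auto
  then show ?case using feq_comp_right[OF Obj_complex[OF B] Obj_complex[OF A] X _ t] by simp
next
  case (Cons l w)
  show ?case
  proof (cases l)
    case (Fwd P Q f)
    then have "zz Q w Y" "ladder A Q w (ccomp A f a) b" using Cons.prems by auto
    then show ?thesis using Cons.IH[of Q "ccomp A f a"] Fwd A B by (simp add: ccomp_assoc[OF _ _ t])
  next
    case (Bwd P Q s)
    then have o: "X \<in> Obj" "P \<in> Obj" "zz P w Y" using Cons.prems(1) zz_Ob by auto
    obtain c where c: "c \<in> cmaps A P" "feq A X (ccomp A s c) a" "ladder A P w c b"
      using Cons.prems(2) Bwd by auto
    have "feq B X (ccomp B (ccomp A s c) t) (ccomp B a t)"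
      by (rule feq_comp_right[OF _ _ _ c(2) t]) (use A B o in auto)
    then have "feq B X (ccomp B s (ccomp B c t)) (ccomp B a t)" using A B by (simp add: ccomp_assoc[OF _ _ t])
    moreover have "ccomp B c t \<in> cmaps B P" using ccomp_closed[OF _ _ _ t c(1)] A B o by simp
    moreover have "ladder B P w (ccomp B c t) (ccomp B b t)" using Cons.IH[OF o(3) c(3)] .
    ultimately show ?thesis using Bwd by auto
  qed
qed

text \<open>The value \<open>m\<close> at the middle object is existential because a backward letter
  asks for a lift and does not compute one.\<close>

lemma ladder_append:
  assumes A: "A \<in> Obj"
  shows "\<lbrakk>zz X u Y; zz Y v Z; a \<in> cmaps A X\<rbrakk> \<Longrightarrow>
    ladder A X (u @ v) a b \<longleftrightarrow> (\<exists>m\<in>cmaps A Y. ladder A X u a m \<and> ladder A Y v m b)"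
proof (induction u arbitrary: X a)
  case Nil
  then have X: "X = Y" "X \<in> Obj" by auto
  show ?case
  proof
    assume "ladder A X ([] @ v) a b"
    then show "\<exists>m\<in>cmaps A Y. ladder A X [] a m \<and> ladder A Y v m b"
      using X feq_refl[OF A _ Nil(3)] Nil(3) by auto
  next
    assume "\<exists>m\<in>cmaps A Y. ladder A X [] a m \<and> ladder A Y v m b"
    then obtain m where m: "feq A X a m" "ladder A Y v m b" by auto
    have "feq A Y m a" using feq_sym[OF _ _ m(1)] A X by simp
    then show "ladder A X ([] @ v) a b" using ladder_cong[OF A Nil(2) _ m(2)] X by simp
  qed
next
  case (Cons l u)
  show ?case
  proof (cases l)
    case (Fwd P Q f)
    then have o: "X \<in> Obj" "Q \<in> Obj" "f \<in> cmaps X Q" "zz Q u Y"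
      using Cons.prems(1) zz_Ob by auto
    then have "ccomp A f a \<in> cmaps A Q" using ccomp_closed[OF _ _ _ Cons.prems(3) o(3)] A by simp
    then show ?thesis using Cons.IH[OF o(4) Cons.prems(2)] Fwd by simp
  next
    case (Bwd P Q s)
    then have "zz P u Y" using Cons.prems(1) by auto
    then show ?thesis using Cons.IH[OF _ Cons.prems(2)] Bwd by auto
  qed
qed

text \<open>Every ladder over \<open>u\<close> becomes, after pulling its vertex back along a
  quasi-isomorphism, a ladder over \<open>v\<close> with the same two ends. The refinement is
  necessary because lifts along backward letters exist only after it.\<close>

definition ladder_le where
  "ladder_le X u v \<longleftrightarrow> (\<forall>A\<in>Obj. \<forall>a\<in>cmaps A X. \<forall>b. ladder A X u a b \<longrightarrow>
     (\<exists>B\<in>Obj. \<exists>t. qi B A t \<and> ladder B X v (ccomp B a t) (ccomp B b t)))"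

lemma ladder_leI:
  assumes "zz X v Y"
    and "\<And>A a b. \<lbrakk>A \<in> Obj; a \<in> cmaps A X; ladder A X u a b\<rbrakk> \<Longrightarrow> ladder A X v a b"
  shows "ladder_le X u v"
  unfolding ladder_le_def
proof (intro ballI allI impI)
  fix A a b assume A: "A \<in> Obj" and a: "a \<in> cmaps A X" "ladder A X u a b"
  have v: "ladder A X v a b" using assms(2) A a by blast
  have X: "X \<in> Obj" "Y \<in> Obj" using assms(1) zz_Ob by auto
  have "b \<in> cmaps A Y" using ladder_end[OF A assms(1) v] .
  then show "\<exists>B\<in>Obj. \<exists>t. qi B A t \<and> ladder B X v (ccomp B a t) (ccomp B b t)"
    using v ccomp_cid_right[OF Obj_complex[OF A] _ a(1)] ccomp_cid_right[of A Y b] A X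
    by (intro bexI[OF _ A] exI[of _ "cid A"]) simp
qed

lemma ladder_le_trans:
  assumes "ladder_le X u v" "ladder_le X v w" "X \<in> Obj"
  shows "ladder_le X u w"
  unfolding ladder_le_def
proof (intro ballI allI impI)
  fix A a b assume A: "A \<in> Obj" and a: "a \<in> cmaps A X" "ladder A X u a b"
  obtain B t where B: "B \<in> Obj" "qi B A t" "ladder B X v (ccomp B a t) (ccomp B b t)"
    using assms(1) A a unfolding ladder_le_def by blast
  note t = qi_cmap[OF B(2)]
  have at: "ccomp B a t \<in> cmaps B X"
    by (rule ccomp_closed[OF _ _ _ t a(1)]) (use A B assms(3) in auto)
  obtain C s where C: "C \<in> Obj" "qi C B s"
    "ladder C X w (ccomp C (ccomp B a t) s) (ccomp C (ccomp B b t) s)"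
    using assms(2) B(1,3) at unfolding ladder_le_def by blast
  have "qi C A (ccomp C t s)" by (rule qi_trans[OF _ _ _ C(2) B(2)]) (use A B C in auto)
  then show "\<exists>B\<in>Obj. \<exists>t. qi B A t \<and> ladder B X w (ccomp B a t) (ccomp B b t)"
    using C(3) B(1) C(1)
    by (intro bexI[OF _ C(1)] exI[of _ "ccomp C t s"]) (simp add: ccomp_assoc[OF _ _ qi_cmap[OF C(2)]])
qed

text \<open>Refine the vertex for the first half, restrict the ladder over the second half to the
  refined vertex, and refine once more.\<close>

lemma ladder_le_append:
  assumes u: "ladder_le X u u'" "zz X u Y" "zz X u' Y" and v: "ladder_le Y v v'" "zz Y v Z" "zz Y v' Z"
  shows "ladder_le X (u @ v) (u' @ v')"
  unfolding ladder_le_def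
proof (intro ballI allI impI)
  have XY: "X \<in> Obj" "Y \<in> Obj" using u zz_Ob by auto
  fix A a b assume A: "A \<in> Obj" and a: "a \<in> cmaps A X" "ladder A X (u @ v) a b"
  obtain m where m: "m \<in> cmaps A Y" "ladder A X u a m" "ladder A Y v m b"
    using a(2) ladder_append[OF A u(2) v(2) a(1)] by auto
  obtain B t where B: "B \<in> Obj" "qi B A t" "ladder B X u' (ccomp B a t) (ccomp B m t)"
    using u(1) A a(1) m(2) unfolding ladder_le_def by blast
  note t = qi_cmap[OF B(2)]
  have mt: "ccomp B m t \<in> cmaps B Y"
    by (rule ccomp_closed[OF _ _ _ t m(1)]) (use A B XY in auto)
  obtain C s where C: "C \<in> Obj" "qi C B s"
    "ladder C Y v' (ccomp C (ccomp B m t) s) (ccomp C (ccomp B b t) s)"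
    using v(1) B(1) mt ladder_restrict[OF A B(1) t v(2) m(3)] unfolding ladder_le_def by blast
  note s = qi_cmap[OF C(2)]
  have "ladder C X u' (ccomp C (ccomp B a t) s) (ccomp C (ccomp B m t) s)"
    by (rule ladder_restrict[OF B(1) C(1) s u(3) B(3)])
  moreover have at: "ccomp B a t \<in> cmaps B X"
    by (rule ccomp_closed[OF _ _ _ t a(1)]) (use A B XY in auto)
  moreover have "ccomp C (ccomp B a t) s \<in> cmaps C X"
    by (rule ccomp_closed[OF _ _ _ s at]) (use C B XY in auto)
  moreover have "ccomp C (ccomp B m t) s \<in> cmaps C Y"
    by (rule ccomp_closed[OF _ _ _ s mt]) (use C B XY in auto)
  ultimately have "ladder C X (u' @ v') (ccomp C (ccomp B a t) s) (ccomp C (ccomp B b t) s)"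
    using ladder_append[OF C(1) u(3) v(3)] C(3) by blast
  moreover have "qi C A (ccomp C t s)" by (rule qi_trans[OF _ _ _ C(2) B(2)]) (use A B C in auto)
  ultimately show "\<exists>B\<in>Obj. \<exists>t. qi B A t \<and> ladder B X (u' @ v') (ccomp B a t) (ccomp B b t)"
    using B(1) C(1)
    by (intro bexI[OF _ C(1)] exI[of _ "ccomp C t s"]) (simp add: ccomp_assoc[OF _ _ s])
qed

text \<open>Induction over the generating relations. Only the two relations for formal inverses have
  content: one uses left cancellation of quasi-isomorphisms, the other the homotopy
  pullback.\<close>

lemma zeq_ladder_le: "zeq X Y u v \<Longrightarrow> ladder_le X u v \<and> ladder_le X v u"
proof (induction rule: zz_eq.induct)
  case (refl X w Y)
  then show ?case by (auto intro: ladder_leI)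
next
  case (sym X Y u v)
  then show ?case by blast
next
  case (trans X Y u v w)
  have "X \<in> Obj" using trans.hyps(1) zeq_zz zz_Ob by blast
  then show ?case using trans.IH ladder_le_trans by blast
next
  case (append X Y u u' Z v v')
  have "zz X u Y" "zz X u' Y" "zz Y v Z" "zz Y v' Z" using append.hyps zeq_zz by blast+
  then show ?case using append.IH ladder_le_append by blast
next
  case (ident X)
  then have "zz X [] X" "zz X [Fwd X X (cid X)] X" by auto
  moreover have "ccomp A (cid X) a = a" if "A \<in> Obj" "a \<in> cmaps A X" for A a
    using ccomp_cid_left[OF _ _ that(2)] that(1) ident by simp
  ultimately show ?case by (auto intro!: ladder_leI)
next
  case (comp X Y Z f g)
  then have fg: "f \<in> cmaps X Y" "g \<in> cmaps Y Z" "X \<in> Obj" "Y \<in> Obj" "Z \<in> Obj" by auto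
  then have gf: "ccomp X g f \<in> cmaps X Z" by (simp add: ccomp_closed[of X Y Z])
  have eq: "ccomp A g (ccomp A f a) = ccomp A (ccomp X g f) a" if "A \<in> Obj" "a \<in> cmaps A X" for A a
    using that(1) fg by (simp add: ccomp_assoc[OF _ _ that(2)])
  have "zz X [Fwd X Y f, Fwd Y Z g] Z" "zz X [Fwd X Z (ccomp X g f)] Z" using fg gf by auto
  then show ?case by (auto intro!: ladder_leI simp: eq)
next
  case (inv1 X Y s)
  then have s: "X \<in> Obj" "Y \<in> Obj" "qi X Y s" by auto
  have z: "zz X [] X" "zz X [Fwd X Y s, Bwd X Y s] X" using s qi_cmap[OF s(3)] by auto
  have "ladder_le X [Fwd X Y s, Bwd X Y s] []"
  proof (rule ladder_leI[OF z(1)])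
    fix A a b assume A: "A \<in> Obj" "a \<in> cmaps A X" "ladder A X [Fwd X Y s, Bwd X Y s] a b"
    then obtain c where c: "c \<in> cmaps A X" "feq A Y (ccomp A s c) (ccomp A s a)" "feq A X c b" by auto
    \<comment> \<open>The lift chosen by the backward letter can only be the given map, because
      quasi-isomorphisms are left cancellable for \<open>feq\<close>.\<close>
    have "feq A X c a" by (rule feq_cancel_left[OF A(1) s c(1) A(2) c(2)])
    then have "feq A X a b" using feq_trans[OF _ _ feq_sym c(3)] A s by simp
    then show "ladder A X [] a b" by simp
  qed
  moreover have "ladder_le X [] [Fwd X Y s, Bwd X Y s]"
  proof (rule ladder_leI[OF z(2)])
    fix A a b assume A: "A \<in> Obj" "a \<in> cmaps A X" "ladder A X [] a b"
    have "feq A Y (ccomp A s a) (ccomp A s a)"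
      by (rule feq_refl[OF A(1)]) (use A s ccomp_closed[OF _ _ _ A(2) qi_cmap[OF s(3)]] in auto)
    then show "ladder A X [Fwd X Y s, Bwd X Y s] a b" using A by auto
  qed
  ultimately show ?case by blast
next
  case (inv2 X Y s)
  then have s: "X \<in> Obj" "Y \<in> Obj" "qi X Y s" by auto
  have z: "zz Y [] Y" "zz Y [Bwd X Y s, Fwd X Y s] Y" using s qi_cmap[OF s(3)] by auto
  have "ladder_le Y [Bwd X Y s, Fwd X Y s] []"
  proof (rule ladder_leI[OF z(1)])
    fix A a b assume A: "A \<in> Obj" "a \<in> cmaps A Y" "ladder A Y [Bwd X Y s, Fwd X Y s] a b"
    then obtain c where c: "feq A Y (ccomp A s c) a" "feq A Y (ccomp A s c) b" by auto
    have "feq A Y a b" using feq_trans[OF _ _ feq_sym c(2)] c A s by simp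
    then show "ladder A Y [] a b" by simp
  qed
  moreover have "ladder_le Y [] [Bwd X Y s, Fwd X Y s]"
    unfolding ladder_le_def
  proof (intro ballI allI impI)
    fix A a b assume A: "A \<in> Obj" and a: "a \<in> cmaps A Y" "ladder A Y [] a b"
    \<comment> \<open>The map \<open>a\<close> need not lift along \<open>s\<close>; it does so
      after passing to the vertex of a homotopy pullback.\<close>
    obtain Z t c where Z: "Z \<in> Obj" "qi Z A t" "c \<in> cmaps Z X" "feq Z Y (ccomp Z s c) (ccomp Z a t)"
      using pullback_qi[OF s(1,2) A s(3) a(1)] by blast
    have "feq Z Y (ccomp Z a t) (ccomp Z b t)"
      by (rule feq_comp_right[OF _ _ _ _ qi_cmap[OF Z(2)]]) (use a A Z s in auto)
    then have "feq Z Y (ccomp Z s c) (ccomp Z b t)" using feq_trans[OF _ _ Z(4)] Z s by simp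
    then show "\<exists>B\<in>Obj. \<exists>t. qi B A t \<and> ladder B Y [Bwd X Y s, Fwd X Y s] (ccomp B a t) (ccomp B b t)"
      using Z by (intro bexI[OF _ Z(1)] exI[of _ t]) auto
  qed
  ultimately show ?case by blast
qed

text \<open>The identity of \<open>X\<close> and \<open>f\<close> form a ladder over the one-letter
  zigzag of \<open>f\<close>. Comparison gives a ladder over \<open>g\<close> after a
  quasi-isomorphism \<open>t\<close>, that is, g t and f t are \<open>feq\<close>, and
  \<open>t\<close> cancels. Together with \<open>feq_zeq\<close>, equality in the derived category
  is now decided by \<open>feq\<close>.\<close>

theorem zeq_imp_feq:
  assumes X: "X \<in> Obj" and Y: "Y \<in> Obj" and f: "f \<in> cmaps X Y" and g: "g \<in> cmaps X Y"
    and z: "zeq X Y [Fwd X Y f] [Fwd X Y g]"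
  shows "feq X Y f g"
proof -
  have "ladder X X [Fwd X Y f] (cid X) f"
    using feq_refl[OF X _ f] ccomp_cid_right[OF _ _ f] X Y f by simp
  then obtain B t where B: "B \<in> Obj" "qi B X t" "ladder B X [Fwd X Y g] (ccomp B (cid X) t) (ccomp B f t)"
    using zeq_ladder_le[OF z] X unfolding ladder_le_def using cid_closed[OF Obj_complex[OF X]] by blast
  moreover have "ccomp B (cid X) t = t" using ccomp_cid_left[OF _ _ qi_cmap[OF B(2)]] B X by simp
  ultimately have "feq B Y (ccomp B g t) (ccomp B f t)" by simp
  then have gf: "feq X Y g f" by (rule feq_cancel_right[OF X B(1) Y B(2) g f])
  then show ?thesis using feq_sym[OF _ _ gf] X Y by simp
qed

text \<open>The vertex \<open>A\<close> with a map to the start of the zigzag is carried along to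
  make the induction work: a forward letter is composed with it, a backward letter is absorbed by a
  homotopy pullback that refines the vertex.\<close>

lemma right_roof_aux:
  "\<lbrakk>zz X w Y; A \<in> Obj; a \<in> cmaps A X\<rbrakk> \<Longrightarrow> \<exists>B\<in>Obj. \<exists>t b. qi B A t \<and> b \<in> cmaps B Y \<and>
    zeq B Y ([Fwd B X (ccomp B a t)] @ w) [Fwd B Y b]"
proof (induction w arbitrary: X A a)
  case Nil
  then have X: "X = Y" "X \<in> Obj" by auto
  have "zz A [Fwd A X a] X" using zz_cmap[OF Nil(2) X(2) Nil(3)] .
  then show ?case using Nil X
      ccomp_cid_right[OF Obj_complex[OF Nil(2)] _ Nil(3)]
    by (intro bexI[OF _ Nil(2)] exI[of _ "cid A"] exI[of _ a] conjI) (simp_all add: zz_eq.refl)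
next
  case (Cons l w)
  show ?case
  proof (cases l)
    case (Fwd P Q f)
    then have o: "l = Fwd X Q f" "X \<in> Obj" "Q \<in> Obj" "f \<in> cmaps X Q" "zz Q w Y"
      using Cons.prems(1) zz_Ob by auto
    have "ccomp A f a \<in> cmaps A Q"
      using ccomp_closed[OF _ _ _ Cons.prems(3) o(4)] Cons.prems(2) o by simp
    then obtain B t b where B: "B \<in> Obj" "qi B A t" "b \<in> cmaps B Y"
      "zeq B Y ([Fwd B Q (ccomp B (ccomp A f a) t)] @ w) [Fwd B Y b]"
      using Cons.IH[OF o(5) Cons.prems(2)] by blast
    have at: "ccomp B a t \<in> cmaps B X"
      using ccomp_closed[OF _ _ _ qi_cmap[OF B(2)] Cons.prems(3)] Cons.prems(2) B o by simp
    have "zeq B Q ([Fwd B X (ccomp B a t)] @ [Fwd X Q f]) [Fwd B Q (ccomp B (ccomp A f a) t)]"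
      using zeq_feq_comp[OF B(1) o(2,3) at o(4)] B(1) Cons.prems(2)
      by (simp add: ccomp_assoc[OF _ _ qi_cmap[OF B(2)]])
    then have "zeq B Y (([Fwd B X (ccomp B a t)] @ [Fwd X Q f]) @ w) [Fwd B Y b]"
      using zeq_cong[OF _ o(5)] zz_eq.trans[OF _ B(4)] by blast
    then show ?thesis using B o by auto
  next
    case (Bwd P Q s)
    then have o: "l = Bwd P X s" "X \<in> Obj" "P \<in> Obj" "qi P X s" "zz P w Y"
      using Cons.prems(1) zz_Ob by auto
    \<comment> \<open>The pullback replaces the inverse of \<open>s\<close> after \<open>a\<close>
      by the chain map \<open>c\<close> on a refined vertex.\<close>
    obtain A1 t1 c where A1: "A1 \<in> Obj" "qi A1 A t1" "c \<in> cmaps A1 P"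
      "feq A1 X (ccomp A1 s c) (ccomp A1 a t1)"
      using pullback_qi[OF o(3,2) Cons.prems(2) o(4) Cons.prems(3)] by blast
    obtain B t b where B: "B \<in> Obj" "qi B A1 t" "b \<in> cmaps B Y"
      "zeq B Y ([Fwd B P (ccomp B c t)] @ w) [Fwd B Y b]"
      using Cons.IH[OF o(5) A1(1,3)] by blast
    note t = qi_cmap[OF B(2)]
    have c: "cpx A" "cpx B" "cpx A1" "cpx X" "cpx P"
      using A1 B o Cons.prems by auto
    have ct: "ccomp B c t \<in> cmaps B P" using ccomp_closed[OF c(2,3,5) t A1(3)] .
    have tt: "qi B A (ccomp B t1 t)" by (rule qi_trans[OF c(2,3,1) B(2) A1(2)])
    have "feq B X (ccomp B (ccomp A1 s c) t) (ccomp B (ccomp A1 a t1) t)"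
      by (rule feq_comp_right[OF c(2,3,4) A1(4) t])
    then have fe: "feq B X (ccomp B s (ccomp B c t)) (ccomp B a (ccomp B t1 t))"
      by (simp add: ccomp_assoc[OF c(2,3) t])
    have W: "zz X [Bwd P X s] P" using o by simp
    have "zeq B X [Fwd B X (ccomp B a (ccomp B t1 t))] ([Fwd B P (ccomp B c t)] @ [Fwd P X s])"
      using feq_zeq[OF B(1) o(2) fe] zeq_feq_comp[OF B(1) o(3,2) ct qi_cmap[OF o(4)]]
      by (meson zz_eq.sym zz_eq.trans)
    from zeq_cong[OF this W]
    have "zeq B P ([Fwd B X (ccomp B a (ccomp B t1 t))] @ [Bwd P X s])
      ([Fwd B P (ccomp B c t)] @ [Fwd P X s] @ [Bwd P X s])" by simp
    moreover have "zeq P P ([Fwd P X s] @ [Bwd P X s]) []" using zz_eq.inv1[of P "Ch R" X s "quasi_isos R"] o by simp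
    then have "zeq B P ([Fwd B P (ccomp B c t)] @ [Fwd P X s] @ [Bwd P X s]) ([Fwd B P (ccomp B c t)] @ [])"
      by (rule zeq_cong2[OF zz_cmap[OF B(1) o(3) ct]])
    ultimately have "zeq B P ([Fwd B X (ccomp B a (ccomp B t1 t))] @ [Bwd P X s]) ([Fwd B P (ccomp B c t)] @ [])"
      by (rule zz_eq.trans)
    from zeq_cong[OF this o(5)]
    have "zeq B Y ([Fwd B X (ccomp B a (ccomp B t1 t))] @ [Bwd P X s] @ w) ([Fwd B P (ccomp B c t)] @ w)" by simp
    then have "zeq B Y ([Fwd B X (ccomp B a (ccomp B t1 t))] @ l # w) [Fwd B Y b]"
      using zz_eq.trans[OF _ B(4)] o(1) by simp
    then show ?thesis using B(1,3) tt by blast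
  qed
qed

lemma right_roof:
  assumes "zz X w Y"
  obtains A t b where "A \<in> Obj" "qi A X t" "b \<in> cmaps A Y" "zeq A Y ([Fwd A X t] @ w) [Fwd A Y b]"
proof -
  have X: "X \<in> Obj" using assms zz_Ob by auto
  obtain B t b where B: "B \<in> Obj" "qi B X t" "b \<in> cmaps B Y"
    "zeq B Y ([Fwd B X (ccomp B (cid X) t)] @ w) [Fwd B Y b]"
    using right_roof_aux[OF assms X cid_closed] X by auto
  moreover have "ccomp B (cid X) t = t" using ccomp_cid_left[OF _ _ qi_cmap[OF B(2)]] B X by simp
  ultimately show ?thesis using that by simp
qed

text \<open>A right roof is turned around by a homotopy pushout of its two legs.\<close>

lemma left_roof:
  assumes w: "zz X w Y"
  obtains N r g where "N \<in> Obj" "qi Y N r" "g \<in> cmaps X N" "zeq X N (w @ [Fwd Y N r]) [Fwd X N g]"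
proof -
  have XY: "X \<in> Obj" "Y \<in> Obj" using w zz_Ob by auto
  obtain A t b where A: "A \<in> Obj" "qi A X t" "b \<in> cmaps A Y" "zeq A Y ([Fwd A X t] @ w) [Fwd A Y b]"
    using right_roof[OF w] by blast
  obtain N r g where N: "N \<in> Obj" "qi Y N r" "g \<in> cmaps X N" "feq A N (ccomp A g t) (ccomp A r b)"
    using pushout_qi[OF A(1) XY A(2,3)] by blast
  have r: "zz Y [Fwd Y N r] N" using zz_qi[OF XY(2) N(1,2)] .
  have "zeq A N (([Fwd A X t] @ w) @ [Fwd Y N r]) [Fwd A N (ccomp A r b)]"
    using zeq_cong[OF A(4) r] zeq_feq_comp[OF A(1) XY(2) N(1) A(3) qi_cmap[OF N(2)]] by (rule zz_eq.trans)
  moreover have "zeq A N ([Fwd A X t] @ [Fwd X N g]) [Fwd A N (ccomp A r b)]"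
    using zeq_feq_comp[OF A(1) XY(1) N(1) qi_cmap[OF A(2)] N(3)] feq_zeq[OF A(1) N(1,4)]
    by (rule zz_eq.trans)
  ultimately have "zeq A N (([Fwd A X t] @ w) @ [Fwd Y N r]) ([Fwd A X t] @ [Fwd X N g])"
    by (rule zeq_join)
  then have "zeq A N ([Fwd A X t] @ (w @ [Fwd Y N r])) ([Fwd A X t] @ [Fwd X N g])"
    unfolding append_assoc .
  then have "zeq X N (w @ [Fwd Y N r]) [Fwd X N g]"
    by (rule zeq_cancel_qi[OF A(1) XY(1) A(2) zz_appendI[OF w r] zz_cmap[OF XY(1) N(1,3)]])
  then show ?thesis using that N by blast
qed

end

section \<open>Localizing subcategories of the derived category\<close>

context derived_category
begin

section \<open>Zero maps, scalars and vanishing of morphisms in the derived category\<close>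

lemma zeq_meet: "\<lbrakk>zeq X Y w u; zeq X Y w v\<rbrakk> \<Longrightarrow> zeq X Y u v"
  by (blast intro: zz_eq.sym zz_eq.trans)

lemma zeq_Bwd:
  assumes "P \<in> Obj" "X \<in> Obj" "qi P X s" "zz A u P" "zeq A X (u @ [Fwd P X s]) v"
  shows "zeq A P u (v @ [Bwd P X s])"
proof -
  have s: "zz X [Bwd P X s] P" "s \<in> quasi_isos R P X" using assms by auto
  have "zeq A P ((u @ [Fwd P X s]) @ [Bwd P X s]) (v @ [Bwd P X s])"
    by (rule zeq_cong[OF assms(5) s(1)])
  moreover have "zeq A P (u @ ([Fwd P X s] @ [Bwd P X s])) (u @ [])"
    using zeq_cong2[OF assms(4) zz_eq.inv1[where C = "Ch R" and W = "quasi_isos R", OF assms(1,2) s(2)]]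
    by simp
  ultimately show ?thesis unfolding append_assoc append_Nil2 using zeq_meet by blast
qed

text \<open>For a backward letter \<open>s\<close>, the zero map to the source of \<open>s\<close>
  is the zero map to its target followed by the inverse of \<open>s\<close>, since composing it with
  \<open>s\<close> gives zero.\<close>

lemma zeq_czero:
  assumes A: "A \<in> Obj"
  shows "zz X w Y \<Longrightarrow> zeq A Y ([Fwd A X (czero A X)] @ w) [Fwd A Y (czero A Y)]"
proof (induction w arbitrary: X)
  case Nil
  then have X: "X \<in> Obj" "X = Y" by auto
  have "zz A [Fwd A X (czero A X)] X" using A X by simp
  then show ?case using X by (simp add: zz_eq.refl)
next
  case (Cons l w)
  show ?case
  proof (cases l)
    case (Fwd P Q f)
    then have o: "l = Fwd X Q f" "X \<in> Obj" "Q \<in> Obj" "f \<in> cmaps X Q" "zz Q w Y"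
      using Cons.prems zz_Ob by auto
    have "zeq A Q ([Fwd A X (czero A X)] @ [Fwd X Q f]) [Fwd A Q (czero A Q)]"
      by (rule zeq_ccomp[OF A o(2,3) _ o(4)]) (use A o cmap_simps[OF _ _ o(4)] in auto)
    from zz_eq.trans[OF zeq_cong[OF this o(5)] Cons.IH[OF o(5)]] show ?thesis using o(1) by simp
  next
    case (Bwd P Q s)
    then have o: "l = Bwd P X s" "X \<in> Obj" "P \<in> Obj" "qi P X s" "zz P w Y"
      using Cons.prems zz_Ob by auto
    have "zeq A X ([Fwd A P (czero A P)] @ [Fwd P X s]) [Fwd A X (czero A X)]"
      by (rule zeq_ccomp[OF A o(3,2) _ qi_cmap[OF o(4)]]) (use A o cmap_simps[OF _ _ qi_cmap[OF o(4)]] in auto)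
    then have "zeq A P [Fwd A P (czero A P)] ([Fwd A X (czero A X)] @ [Bwd P X s])"
      by (rule zeq_Bwd[OF o(3,2,4), rotated]) (use A o in simp)
    from zz_eq.trans[OF zeq_cong[OF zz_eq.sym[OF this] o(5)] Cons.IH[OF o(5)]]
    show ?thesis using o(1) by simp
  qed
qed

definition csmult where "csmult r X = cres X (\<lambda>n x. r \<odot>\<^bsub>Deg X n\<^esub> x)"

lemma csmult_apply [simp]: "x \<in> el X n \<Longrightarrow> csmult r X n x = r \<odot>\<^bsub>Deg X n\<^esub> x"
  by (simp add: csmult_def)

lemma csmult_closed [simp]: "\<lbrakk>cpx X; r \<in> carrier R\<rbrakk> \<Longrightarrow> csmult r X \<in> cmaps X X"
  unfolding csmult_def by (rule cres_mapsI) (auto simp: mod_lin intro: mod_smult_comm)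

text \<open>Multiplication by \<open>r\<close> commutes with all chain maps, hence with their formal
  inverses; so it is a natural endomorphism of the identity of the derived category.\<close>

lemma zeq_csmult:
  assumes r: "r \<in> carrier R"
  shows "zz X w Y \<Longrightarrow> zeq X Y ([Fwd X X (csmult r X)] @ w) (w @ [Fwd Y Y (csmult r Y)])"
proof (induction w arbitrary: X)
  case Nil
  then have X: "X \<in> Obj" "X = Y" by auto
  have "zz X [Fwd X X (csmult r X)] X" using r X by simp
  then show ?case using X by (simp add: zz_eq.refl)
next
  case (Cons l w)
  have comm: "zeq P Q ([Fwd P P (csmult r P)] @ [Fwd P Q f]) ([Fwd P Q f] @ [Fwd Q Q (csmult r Q)])"
    if o: "P \<in> Obj" "Q \<in> Obj" "f \<in> cmaps P Q" for P Q f
  proof -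
    have h: "ccomp P f (csmult r P) \<in> cmaps P Q"
      using o r ccomp_closed[of P P Q] by simp
    have "zeq P Q ([Fwd P P (csmult r P)] @ [Fwd P Q f]) [Fwd P Q (ccomp P f (csmult r P))]"
      by (rule zeq_ccomp[OF o(1,1,2) _ o(3) h]) (use o r in auto)
    moreover have "zeq P Q ([Fwd P Q f] @ [Fwd Q Q (csmult r Q)]) [Fwd P Q (ccomp P f (csmult r P))]"
      by (rule zeq_ccomp[OF o(1,2,2) o(3) _ h]) (use o r cmap_simps[OF _ _ o(3)] in auto)
    ultimately show ?thesis by (rule zeq_join)
  qed
  show ?case
  proof (cases l)
    case (Fwd P Q f)
    then have o: "l = Fwd X Q f" "X \<in> Obj" "Q \<in> Obj" "f \<in> cmaps X Q" "zz Q w Y"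
      using Cons.prems zz_Ob by auto
    have "zeq X Y (([Fwd X X (csmult r X)] @ [Fwd X Q f]) @ w) (([Fwd X Q f] @ [Fwd Q Q (csmult r Q)]) @ w)"
      by (rule zeq_cong[OF comm[OF o(2,3,4)] o(5)])
    moreover have "zeq X Y ([Fwd X Q f] @ ([Fwd Q Q (csmult r Q)] @ w)) ([Fwd X Q f] @ (w @ [Fwd Y Y (csmult r Y)]))"
      by (rule zeq_cong2[OF zz_cmap[OF o(2,3,4)] Cons.IH[OF o(5)]])
    ultimately show ?thesis using o(1) zz_eq.trans by fastforce
  next
    case (Bwd P Q s)
    then have o: "l = Bwd P X s" "X \<in> Obj" "P \<in> Obj" "qi P X s" "zz P w Y"
      using Cons.prems zz_Ob by auto
    have B: "zz X [Bwd P X s] P" using o by simp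
    have rP: "zz P [Fwd P P (csmult r P)] P" and rX: "zz X [Fwd X X (csmult r X)] X"
      using o r by auto
    have "zeq X X ([Bwd P X s] @ ([Fwd P P (csmult r P)] @ [Fwd P X s])) ([Bwd P X s] @ ([Fwd P X s] @ [Fwd X X (csmult r X)]))"
      by (rule zeq_cong2[OF B comm[OF o(3,2) qi_cmap[OF o(4)]]])
    moreover have "zeq X X (([Bwd P X s] @ [Fwd P X s]) @ [Fwd X X (csmult r X)]) ([] @ [Fwd X X (csmult r X)])"
      by (rule zeq_cong[OF _ rX]) (use zz_eq.inv2[of P "Ch R" X s "quasi_isos R"] o in simp)
    ultimately have "zeq X X (([Bwd P X s] @ [Fwd P P (csmult r P)]) @ [Fwd P X s]) [Fwd X X (csmult r X)]"
      using zz_eq.trans by fastforce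
    then have "zeq X P ([Bwd P X s] @ [Fwd P P (csmult r P)]) ([Fwd X X (csmult r X)] @ [Bwd P X s])"
      by (rule zeq_Bwd[OF o(3,2,4) zz_appendI[OF B rP]])
    then have "zeq X Y (([Fwd X X (csmult r X)] @ [Bwd P X s]) @ w) (([Bwd P X s] @ [Fwd P P (csmult r P)]) @ w)"
      by (rule zeq_cong[OF zz_eq.sym o(5)])
    moreover have "zeq X Y ([Bwd P X s] @ ([Fwd P P (csmult r P)] @ w)) ([Bwd P X s] @ (w @ [Fwd Y Y (csmult r Y)]))"
      by (rule zeq_cong2[OF B Cons.IH[OF o(5)]])
    ultimately show ?thesis using o(1) zz_eq.trans by fastforce
  qed
qed

text \<open>On \<open>M\<close> the scalars \<open>r\<close> and 0 coincide. By naturality they act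
  equally on morphisms from \<open>X\<close>, so each morphism becomes zero after precomposition
  with \<open>r\<close> on \<open>X\<close>, which is invertible.\<close>

lemma hom_trivial_csmult:
  assumes X: "X \<in> Obj" and M: "M \<in> Obj" and r: "r \<in> carrier R" and q: "qi X X (csmult r X)"
    and z: "\<And>n x. x \<in> el M n \<Longrightarrow> r \<odot>\<^bsub>Deg M n\<^esub> x = zr M n"
  shows "hom_trivial X M"
proof -
  have "zeq X M ([Fwd X X (csmult r X)] @ u) [Fwd X M (czero X M)]" if u: "zz X u M" for u
  proof -
    have "csmult r M = csmult \<zero> M" using M z by (auto simp: csmult_def cres_def fun_eq_iff)
    then have "zeq X M ([Fwd X X (csmult r X)] @ u) ([Fwd X X (csmult \<zero> X)] @ u)"
      using zeq_join[OF zeq_csmult[OF r u]] zeq_csmult[OF zero_closed u] by (simp only:)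
    moreover have "csmult \<zero> X = czero X X" using X by (auto simp: csmult_def czero_def cres_def fun_eq_iff)
    then have "zeq X M ([Fwd X X (csmult \<zero> X)] @ u) [Fwd X M (czero X M)]"
      using zeq_czero[OF X u] by (simp only:)
    ultimately show ?thesis by (rule zz_eq.trans)
  qed
  then have "zeq X M ([Fwd X X (csmult r X)] @ u) ([Fwd X X (csmult r X)] @ v)"
    if "zz X u M" "zz X v M" for u v
    using that zeq_join by blast
  then show ?thesis
    unfolding hom_trivial_def using zeq_cancel_qi[OF X X q] by blast
qed

text \<open>The identity of \<open>X\<close> equals the zero map, so every zigzag out of
  \<open>X\<close> is zero.\<close>

lemma hom_trivial_zero:
  assumes X: "X \<in> Obj" and z: "\<And>n. el X n = {zr X n}"
  shows "hom_trivial X M"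
  unfolding hom_trivial_def
proof (intro allI impI)
  fix u v assume uv: "zz X u M" "zz X v M"
  have "czero X X = cid X" using z by (auto simp: czero_def cid_def cres_def fun_eq_iff)
  have "zeq X M w [Fwd X M (czero X M)]" if w: "zz X w M" for w
  proof -
    have "zeq X M ([Fwd X X (cid X)] @ w) [Fwd X M (czero X M)]"
      using zeq_czero[OF X w] \<open>czero X X = cid X\<close> by (simp only:)
    moreover have "zeq X M ([Fwd X X (cid X)] @ w) w" using zeq_cong[OF zeq_cid[OF X] w] by simp
    ultimately show ?thesis using zeq_meet by blast
  qed
  then show "zeq X M u v" using uv zeq_join by blast
qed

text \<open>With \<open>i : Y \<rightarrow> Z = cone f\<close>, a map \<open>g : Z \<rightarrow> N\<close> with \<open>g i = b a\<close>, where \<open>a\<close> maps \<open>Y\<close> to an acyclic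
  complex \<open>E\<close>, factors through \<open>Z \<rightarrow> cone (a f : X \<rightarrow> E)\<close>, and the latter is a copy of \<open>X[1]\<close>.\<close>

lemma hom_trivial_cone:
  assumes X: "X \<in> Obj" and Y: "Y \<in> Obj" and Z: "Z \<in> Obj" and M: "M \<in> Obj"
    and f: "f \<in> cmaps X Y" and \<theta>: "\<theta> \<in> cochain_isos R (cone X Y f) Z"
    and hY: "hom_trivial Y M" and hX: "hom_trivial (shift X) M"
  shows "hom_trivial Z M"
proof -
  have c: "cpx X" "cpx Y" "cpx Z" using X Y Z by auto
  let ?C = "cone X Y f"
  have C: "cpx ?C" by (rule cone_complex[OF c(1,2) f])
  obtain \<psi> where \<psi>: "\<psi> \<in> cochain_isos R Z ?C" "\<And>n x. x \<in> el ?C n \<Longrightarrow> \<psi> n (\<theta> n x) = x"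
    "\<And>n z. z \<in> el Z n \<Longrightarrow> \<theta> n (\<psi> n z) = z"
    using iso_inverse[OF C c(3) \<theta>] by blast
  have \<theta>': "\<theta> \<in> cmaps ?C Z" and \<psi>': "\<psi> \<in> cmaps Z ?C"
    using \<theta> \<psi>(1) by (auto simp: cochain_isos_def)
  define i where "i = ccomp Y \<theta> (cone_in X Y)"
  have i: "i \<in> cmaps Y Z"
    unfolding i_def by (rule ccomp_closed[OF c(2) C c(3) cone_in_closed[OF c(1,2) f] \<theta>'])
  have zero: "\<exists>N r. N \<in> Obj \<and> qi M N r \<and> zeq Z N (u @ [Fwd M N r]) [Fwd Z N (czero Z N)]"
    if u: "zz Z u M" for u
  proof -
    \<comment> \<open>\<open>feq\<close> speaks about chain maps only, so \<open>M\<close> is first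
      replaced by a quasi-isomorphic \<open>N\<close> to which the morphism is represented by a
      chain map.\<close>
    obtain N r g where N: "N \<in> Obj" "qi M N r" "g \<in> cmaps Z N"
      "zeq Z N (u @ [Fwd M N r]) [Fwd Z N g]"
      using left_roof[OF u] by blast
    have N': "cpx N" using N by simp
    have hYN: "hom_trivial Y N" and hXN: "hom_trivial (shift X) N"
      using hom_trivial_iso_right ziso_qi[OF M N(1,2)] hY hX by blast+
    have gi: "ccomp Y g i \<in> cmaps Y N" by (rule ccomp_closed[OF c(2,3) N' i N(3)])
    have "zeq Y N [Fwd Y N (ccomp Y g i)] [Fwd Y N (czero Y N)]"
      using hYN zz_cmap[OF Y N(1) gi] zz_cmap[OF Y N(1)] c(2) N' unfolding hom_trivial_def by simp
    then have "feq Y N (ccomp Y g i) (czero Y N)"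
      by (intro zeq_imp_feq[OF Y N(1) gi]) (use c N' in simp_all)
    then obtain E a b where E: "E \<in> Obj" "acyclic_cpx E" "a \<in> cmaps Y E" "b \<in> cmaps E N"
      and eq: "\<And>n y. y \<in> el Y n \<Longrightarrow> ccomp Y g i n y = czero Y N n y \<oplus>\<^bsub>Deg N n\<^esub> b n (a n y)"
      using feqE by metis
    have E': "cpx E" using E by simp
    note [simp] = X Y Z c N' E' cmap_simps[OF c(1,2) f] cmap_simps[OF c(2) E' E(3)] cmap_simps[OF E' N' E(4)]
      cmap_simps[OF c(3) N' N(3)] cmap_simps[OF C c(3) \<theta>'] cmap_simps[OF c(3) C \<psi>'] C
    have gb: "g n (\<theta> n (zr X (n + 1), y)) = b n (a n y)" if "y \<in> el Y n" for n y
      using eq[OF that] that by (simp add: i_def cone_in_def)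
    have af: "ccomp X a f \<in> cmaps X E" by (rule ccomp_closed[OF c(1,2) E' f E(3)])
    let ?Q = "cone X E (ccomp X a f)"
    have Q: "cpx ?Q" by (rule cone_complex[OF c(1) E' af])
    have pQ: "qi ?Q (shift X) (cone_pr X E (ccomp X a f))" by (rule qi_cone_pr[OF c(1) E' af E(2)])
    define m where "m = cres ?C (\<lambda>n (x, y). (x, a n y))"
    have m: "m \<in> cmaps ?C ?Q"
      unfolding m_def by (rule cres_mapsI[OF C]) auto
    \<comment> \<open>The restriction of \<open>g\<close> to the summand of the cone coming from
      \<open>X\<close>. As \<open>g\<close> is a chain map, this is a null-homotopy of b a f, which
      lets \<open>b\<close> extend to the cone \<open>?Q\<close>.\<close>
    define h where "h = (\<lambda>n. \<lambda>x\<in>el X (n + 1). g n (\<theta> n (x, zr Y n)))"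
    have h: "h n \<in> lmaps (Deg X (n + 1)) (Deg N n)" for n
    proof -
      have th: "\<theta> n (x \<oplus>\<^bsub>Deg X (n + 1)\<^esub> x', zr Y n) =
        \<theta> n (x, zr Y n) \<oplus>\<^bsub>Deg Z n\<^esub> \<theta> n (x', zr Y n)"
        if "x \<in> el X (n + 1)" "x' \<in> el X (n + 1)" for x x'
        using that cmap_simps(2)[OF C c(3) \<theta>', of "(x, zr Y n)" n "(x', zr Y n)"] by simp
      have ts: "\<theta> n (k \<odot>\<^bsub>Deg X (n + 1)\<^esub> x, zr Y n) = k \<odot>\<^bsub>Deg Z n\<^esub> \<theta> n (x, zr Y n)"
        if "x \<in> el X (n + 1)" "k \<in> carrier R" for x k
        using that cmap_simps(3)[OF C c(3) \<theta>', of k "(x, zr Y n)" n] by simp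
      show ?thesis unfolding h_def
        by (rule lin_restrictI) (simp_all add: th ts)
    qed
    let ?g = "cone_out X E (ccomp X a f) N h b"
    have g: "?g \<in> cmaps ?Q N"
    proof (rule cone_out_closed[OF c(1) E' N' af E(4) h])
      fix n x assume x: "x \<in> el X (n + 1)"
      let ?dx = "Diff X (n + 1) x" and ?z = "\<theta> n (x, zr Y n)"
      have "Diff Z n ?z = \<theta> (n + 1) (\<ominus>\<^bsub>Deg X (n + 1 + 1)\<^esub> ?dx, f (n + 1) x)"
        using x cmap_simps(6)[OF C c(3) \<theta>', of "(x, zr Y n)" n] by simp
      also have "\<dots> = \<theta> (n + 1) (\<ominus>\<^bsub>Deg X (n + 1 + 1)\<^esub> ?dx, zr Y (n + 1))
          \<oplus>\<^bsub>Deg Z (n + 1)\<^esub> \<theta> (n + 1) (zr X (n + 1 + 1), f (n + 1) x)"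
        using x cmap_simps(2)[OF C c(3) \<theta>', of "(\<ominus>\<^bsub>Deg X (n + 1 + 1)\<^esub> ?dx, zr Y (n + 1))" "n + 1"
            "(zr X (n + 1 + 1), f (n + 1) x)"] by simp
      also have "\<theta> (n + 1) (\<ominus>\<^bsub>Deg X (n + 1 + 1)\<^esub> ?dx, zr Y (n + 1)) =
          \<ominus>\<^bsub>Deg Z (n + 1)\<^esub> \<theta> (n + 1) (?dx, zr Y (n + 1))"
        using x cmap_simps(5)[OF C c(3) \<theta>', where x = "(?dx, zr Y (n + 1))" and n = "n + 1"] by simp
      finally have "g (n + 1) (Diff Z n ?z) = g (n + 1) (\<ominus>\<^bsub>Deg Z (n + 1)\<^esub> \<theta> (n + 1) (?dx, zr Y (n + 1)) \<oplus>\<^bsub>Deg Z (n + 1)\<^esub> \<theta> (n + 1) (zr X (n + 1 + 1), f (n + 1) x))"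
        by (simp only:)
      then have "Diff N n (h n x) = \<ominus>\<^bsub>Deg N (n + 1)\<^esub> h (n + 1) ?dx \<oplus>\<^bsub>Deg N (n + 1)\<^esub> b (n + 1) (a (n + 1) (f (n + 1) x))"
        using x by (simp add: gb h_def)
      then show "b (n + 1) (ccomp X a f (n + 1) x) = Diff N n (h n x) \<oplus>\<^bsub>Deg N (n + 1)\<^esub> h (n + 1) ?dx"
        using x lin_simps(1)[OF complex_module[OF c(1)] complex_module[OF N'] h[of "n + 1"], of ?dx] by (simp add: mod_ac)
    qed
    have "usmall ?Q" using usmall_cone Obj_small X E(1) by metis
    then obtain Q' \<tau> \<sigma> where Q': "Q' \<in> Obj" "qi ?Q Q' \<tau>" "qi Q' ?Q \<sigma>"
      "\<And>n x. x \<in> el ?Q n \<Longrightarrow> \<sigma> n (\<tau> n x) = x"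
      using transportE[OF Q] by metis
    have cQ': "cpx Q'" using Q' by simp
    have "qi Q' (shift X) (ccomp Q' (cone_pr X E (ccomp X a f)) \<sigma>)"
      by (rule qi_trans[OF cQ' Q _ Q'(3) pQ]) simp
    then have hQ: "hom_trivial Q' N"
      using hom_trivial_iso_left[OF hXN] ziso_sym ziso_qi[OF Q'(1) Obj_shift[OF X]] by blast
    let ?m = "ccomp Z (ccomp ?C \<tau> m) \<psi>" and ?k = "ccomp Q' ?g \<sigma>"
    have m': "?m \<in> cmaps Z Q'"
      by (rule ccomp_closed[OF c(3) C cQ' \<psi>' ccomp_closed[OF C Q cQ' m qi_cmap[OF Q'(2)]]])
    have k: "?k \<in> cmaps Q' N" by (rule ccomp_closed[OF cQ' Q N' qi_cmap[OF Q'(3)] g])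
    have "zeq Z N ([Fwd Z Q' ?m] @ [Fwd Q' N ?k]) [Fwd Z N g]"
    proof (rule zeq_ccomp[OF Z Q'(1) N(1) m' k N(3)])
      fix n z assume z: "z \<in> el Z n"
      then have "\<psi> n z \<in> el ?C n" by (simp del: cone_simps)
      then obtain x y where xy: "\<psi> n z = (x, y)" "x \<in> el X (n + 1)" "y \<in> el Y n" by auto
      then have m1: "m n (\<psi> n z) = (x, a n y)" by (simp add: m_def)
      have mc: "(x, a n y) \<in> el ?Q n" using xy by simp
      have tc: "\<tau> n (x, a n y) \<in> el Q' n" using cmap_simps(1)[OF Q cQ' qi_cmap[OF Q'(2)] mc] .
      have pc: "\<psi> n z \<in> el ?C n" using xy by simp
      have "z = \<theta> n (x, y)" using \<psi>(3)[OF z] xy(1) by simp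
      also have "\<dots> = \<theta> n ((x, zr Y n) \<oplus>\<^bsub>Deg ?C n\<^esub> (zr X (n + 1), y))" using xy by simp
      also have "\<dots> = \<theta> n (x, zr Y n) \<oplus>\<^bsub>Deg Z n\<^esub> \<theta> n (zr X (n + 1), y)"
        using xy by (intro cmap_simps(2)[OF C c(3) \<theta>']) simp_all
      finally have "g n z = g n (\<theta> n (x, zr Y n)) \<oplus>\<^bsub>Deg N n\<^esub> g n (\<theta> n (zr X (n + 1), y))"
        using xy by simp
      moreover have "?k n (?m n z) = ?g n (x, a n y)"
        using z pc tc m1 Q'(4)[OF mc] by (simp del: cone_simps)
      ultimately show "?k n (?m n z) = g n z" using xy mc gb[OF xy(3)]
        by (simp add: cone_out_def h_def)
    qed
    moreover have "zeq Q' N [Fwd Q' N ?k] [Fwd Q' N (czero Q' N)]"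
      using hQ zz_cmap[OF Q'(1) N(1) k] zz_cmap[OF Q'(1) N(1)] cQ' N' unfolding hom_trivial_def by simp
    then have "zeq Z N ([Fwd Z Q' ?m] @ [Fwd Q' N ?k]) ([Fwd Z Q' ?m] @ [Fwd Q' N (czero Q' N)])"
      by (rule zeq_cong2[OF zz_cmap[OF Z Q'(1) m']])
    moreover have "zeq Z N ([Fwd Z Q' ?m] @ [Fwd Q' N (czero Q' N)]) [Fwd Z N (czero Z N)]"
      by (rule zeq_ccomp[OF Z Q'(1) N(1) m']) (use cQ' cmap_simps[OF c(3) cQ' m'] in auto)
    ultimately have "zeq Z N [Fwd Z N g] [Fwd Z N (czero Z N)]"
      using zeq_replace zz_eq.refl zz_eq.trans zz_eq.sym by blast
    then show ?thesis using N(1,2) zz_eq.trans[OF N(4)] by blast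
  qed
  show ?thesis
    unfolding hom_trivial_def
  proof (intro allI impI)
    have k: "zeq Z M u ([Fwd Z M (czero Z M)])" if u: "zz Z u M" for u
    proof -
      obtain N r where N: "N \<in> Obj" "qi M N r" "zeq Z N (u @ [Fwd M N r]) [Fwd Z N (czero Z N)]"
        using zero[OF u] by blast
      have "zeq Z N ([Fwd Z M (czero Z M)] @ [Fwd M N r]) [Fwd Z N (czero Z N)]"
        by (rule zeq_czero[OF Z zz_qi[OF M N(1,2)]])
      then have "zeq Z N (u @ [Fwd M N r]) ([Fwd Z M (czero Z M)] @ [Fwd M N r])"
        using N(3) zeq_join by blast
      then show ?thesis
        by (rule zeq_cancel_qi_right[OF M N(1,2) u, rotated]) (use Z M in simp)
    qed
    fix u v assume "zz Z u M" "zz Z v M"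
    then show "zeq Z M u v" using k zeq_join by blast
  qed
qed

section \<open>The shift on zigzags\<close>

lemma shift_map_cid: "shift_map (cid X) = cid (shift X)"
  by (simp add: shift_map_def cid_def cres_def restrict_def)

lemma shift_map_ccomp: "shift_map (ccomp X g f) = ccomp (shift X) (shift_map g) (shift_map f)"
  by (simp add: shift_map_def ccomp_def)

lemma unshift_map_cid: "unshift_map (cid X) = cid (unshift X)"
  by (simp add: unshift_map_def cid_def cres_def restrict_def)

lemma unshift_map_ccomp: "unshift_map (ccomp X g f) = ccomp (unshift X) (unshift_map g) (unshift_map f)"
  by (simp add: unshift_map_def ccomp_def)

abbreviation shift_zz where "shift_zz \<equiv> map (map_letter shift shift_map)"
abbreviation unshift_zz where "unshift_zz \<equiv> map (map_letter unshift unshift_map)"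

lemma shift_zz:
  shows "zz X w Y \<Longrightarrow> zz (shift X) (shift_zz w) (shift Y)"
    and "zeq X Y u v \<Longrightarrow> zeq (shift X) (shift Y) (shift_zz u) (shift_zz v)"
proof -
  have "shift_map f \<in> quasi_isos R (shift X) (shift Y)"
    if "X \<in> Obj" "Y \<in> Obj" "f \<in> quasi_isos R X Y" for X Y f
    using that by (simp add: qi_shift)
  then show "zz X w Y \<Longrightarrow> zz (shift X) (shift_zz w) (shift Y)"
    "zeq X Y u v \<Longrightarrow> zeq (shift X) (shift Y) (shift_zz u) (shift_zz v)"
    by (auto intro!: zz_map zeq_map simp: shift_map_closed shift_map_cid shift_map_ccomp)
qed

lemma unshift_zz:
  shows "zz X w Y \<Longrightarrow> zz (unshift X) (unshift_zz w) (unshift Y)"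
    and "zeq X Y u v \<Longrightarrow> zeq (unshift X) (unshift Y) (unshift_zz u) (unshift_zz v)"
proof -
  have "unshift_map f \<in> quasi_isos R (unshift X) (unshift Y)"
    if "X \<in> Obj" "Y \<in> Obj" "f \<in> quasi_isos R X Y" for X Y f
    using that by (simp add: qi_unshift)
  then show "zz X w Y \<Longrightarrow> zz (unshift X) (unshift_zz w) (unshift Y)"
    "zeq X Y u v \<Longrightarrow> zeq (unshift X) (unshift Y) (unshift_zz u) (unshift_zz v)"
    by (auto intro!: zz_map zeq_map simp: unshift_map_closed unshift_map_cid unshift_map_ccomp)
qed

text \<open>Shift and unshift are strictly inverse on complexes; the zigzag hypothesis is what
  guarantees that all objects in the letters are complexes.\<close>

lemma zz_letters:
  "zz X w Y \<Longrightarrow> unshift_zz (shift_zz w) = w \<and> shift_zz (unshift_zz w) = w"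
proof (induction w arbitrary: X)
  case (Cons l w)
  show ?case
  proof (cases l)
    case (Fwd P Q f)
    then have "zz Q w Y" "P \<in> Obj" "Q \<in> Obj" using Cons.prems zz_Ob by auto
    then show ?thesis using Cons.IH Fwd by (simp add: unshift_shift shift_unshift)
  next
    case (Bwd P Q f)
    then have "zz P w Y" "P \<in> Obj" "Q \<in> Obj" using Cons.prems zz_Ob by auto
    then show ?thesis using Cons.IH Bwd by (simp add: unshift_shift shift_unshift)
  qed
qed simp

text \<open>Shift and unshift preserve equality of zigzags and undo each other, so Hom sets
  correspond bijectively.\<close>

lemma hom_trivial_shift:
  assumes X: "X \<in> Obj" and M: "M \<in> Obj"
  shows "hom_trivial (shift X) (shift M) \<longleftrightarrow> hom_trivial X M"
proof
  assume h: "hom_trivial (shift X) (shift M)"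
  show "hom_trivial X M"
    unfolding hom_trivial_def
  proof (intro allI impI)
    fix u v assume uv: "zz X u M" "zz X v M"
    then have "zeq (shift X) (shift M) (shift_zz u) (shift_zz v)"
      using h shift_zz(1) by (auto simp: hom_trivial_def)
    from unshift_zz(2)[OF this] show "zeq X M u v"
      using uv zz_letters X M by (simp add: unshift_shift)
  qed
next
  assume h: "hom_trivial X M"
  show "hom_trivial (shift X) (shift M)"
    unfolding hom_trivial_def
  proof (intro allI impI)
    fix u v assume uv: "zz (shift X) u (shift M)" "zz (shift X) v (shift M)"
    have "zz X (unshift_zz u) M" "zz X (unshift_zz v) M"
      using unshift_zz(1)[OF uv(1)] unshift_zz(1)[OF uv(2)] X M by (simp_all add: unshift_shift)
    then have "zeq X M (unshift_zz u) (unshift_zz v)" using h by (auto simp: hom_trivial_def)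
    from shift_zz(2)[OF this] show "zeq (shift X) (shift M) u v"
      using zz_letters[OF uv(1)] zz_letters[OF uv(2)] by simp
  qed
qed


subsection \<open>Complexes concentrated in one degree\<close>

text \<open>The zero modules in the other degrees keep the operations of \<open>M\<close> and only
  shrink the carrier; thus all degrees share one type and one zero element.\<close>

definition conc :: "int \<Rightarrow> ('r, 'x) module \<Rightarrow> ('r, 'x) cochain_complex" where
  "conc k M =
     \<lparr>Deg = (\<lambda>n. if n = k then M else M\<lparr>carrier := {\<zero>\<^bsub>M\<^esub>}\<rparr>),
      Diff = (\<lambda>n. \<lambda>x\<in>(if n = k then carrier M else {\<zero>\<^bsub>M\<^esub>}). \<zero>\<^bsub>M\<^esub>)\<rparr>"

lemma zero_module:
  assumes "module R M"
  shows "module R (M\<lparr>carrier := {\<zero>\<^bsub>M\<^esub>}\<rparr>)"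
proof (rule moduleI)
  show "abelian_group (M\<lparr>carrier := {\<zero>\<^bsub>M\<^esub>}\<rparr>)" by (rule abelian_groupI) (use assms in auto)
qed (use assms is_cring in auto)

lemma conc_simps:
  "Deg (conc k M) n = (if n = k then M else M\<lparr>carrier := {\<zero>\<^bsub>M\<^esub>}\<rparr>)"
  "zr (conc k M) n = \<zero>\<^bsub>M\<^esub>"
  "x \<in> el (conc k M) n \<Longrightarrow> Diff (conc k M) n x = \<zero>\<^bsub>M\<^esub>"
  by (auto simp: conc_def)

lemma conc_Obj:
  assumes M: "module R M" and "small_in U (carrier M)"
  shows "conc k M \<in> Obj"
proof -
  have m: "module R (Deg (conc k M) n)" for n using M by (simp add: conc_simps zero_module)
  have "cpx (conc k M)"
  proof (rule is_complexI[OF m])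
    fix n
    have "(\<lambda>x\<in>el (conc k M) n. \<zero>\<^bsub>M\<^esub>) \<in> lmaps (Deg (conc k M) n) (Deg (conc k M) (n + 1))"
      by (rule lin_restrictI[OF _ _ _ m]) (use M in \<open>auto simp: conc_simps\<close>)
    moreover have "(\<lambda>x\<in>el (conc k M) n. \<zero>\<^bsub>M\<^esub>) = Diff (conc k M) n"
      by (auto simp: conc_def)
    ultimately show "Diff (conc k M) n \<in> lmaps (Deg (conc k M) n) (Deg (conc k M) (n + 1))" by simp
    fix x assume x: "x \<in> el (conc k M) n"
    have "\<zero>\<^bsub>M\<^esub> \<in> el (conc k M) (n + 1)" using M by (simp add: conc_simps)
    then show "Diff (conc k M) (n + 1) (Diff (conc k M) n x) = zr (conc k M) (n + 1 + 1)"
      using x by (simp add: conc_simps(2,3))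
  qed
  moreover have "small_in U (el (conc k M) n)" for n
    using assms M by (auto simp: conc_simps intro: small_in_subset)
  ultimately show ?thesis by (simp add: Obj_iff)
qed

text \<open>A strict equality: all differentials vanish, so the sign of the shift is
  invisible.\<close>

lemma shift_conc:
  assumes M: "module R M"
  shows "shift (conc (k + 1) M) = conc k M"
proof (rule cochain_complex.equality)
  show "Deg (shift (conc (k + 1) M)) = Deg (conc k M)"
    by (auto simp: conc_simps)
  have "Diff (shift (conc (k + 1) M)) n = Diff (conc k M) n" for n
    unfolding shift_def using M zero_module[OF M] module_minus_zero[of M] module_minus_zero[OF zero_module[OF M]]
    by (auto simp: conc_def fun_eq_iff)
  then show "Diff (shift (conc (k + 1) M)) = Diff (conc k M)" by blast
qed simp

text \<open>The left orthogonal of all shifts of \<open>M\<close>. Ranging over every degree k makes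
  it stable under the shift in both directions.\<close>

definition hom_null :: "('r, 'u) module \<Rightarrow> ('r, 'u) cochain_complex set" where
  "hom_null M = {X \<in> Obj. \<forall>k. hom_trivial X (conc k M)}"

lemma Ob_Der [simp]: "Ob (Der R) = Obj"
  by (simp add: Der_def)

text \<open>Closure under triangles is the vanishing of Hom from a cone; closure under coproducts is
  formal from the universal property.\<close>

lemma hom_null_localizing:
  assumes M: "module R M" "small_in U (carrier M)"
  shows "localizing_subcat R (hom_null M)"
proof -
  note cM = conc_Obj[OF M]
  have iso: "Y \<in> hom_null M" if XY: "X \<in> hom_null M" "Y \<in> Obj" "cat_iso (Der R) X Y \<noteq> {}" for X Y
  proof -
    obtain u v where "ziso X Y u v" using XY(3) by (auto simp: Der_def cat_iso_loc)
    then show ?thesis using XY(1,2) hom_trivial_iso_left unfolding hom_null_def by blast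
  qed
  have sh: "X \<in> hom_null M \<longleftrightarrow> shift X \<in> hom_null M" if X: "X \<in> Obj" for X
  proof -
    have "hom_trivial (shift X) (conc k M) \<longleftrightarrow> hom_trivial X (conc (k + 1) M)" for k
      using hom_trivial_shift[OF X cM[of "k + 1"]] shift_conc[OF M(1)] by simp
    then have "(\<forall>k. hom_trivial (shift X) (conc k M)) \<longleftrightarrow> (\<forall>k. hom_trivial X (conc k M))"
      using all_int_Suc[of "\<lambda>k. hom_trivial X (conc k M)"] by simp
    then show ?thesis using X by (simp add: hom_null_def)
  qed
  have ne: "conc 0 (M\<lparr>carrier := {\<zero>\<^bsub>M\<^esub>}\<rparr>) \<in> hom_null M"
  proof -
    have o: "conc 0 (M\<lparr>carrier := {\<zero>\<^bsub>M\<^esub>}\<rparr>) \<in> Obj"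
      by (rule conc_Obj[OF zero_module[OF M(1)]]) (use small_in_subset[OF M(2)] M in simp)
    then show ?thesis using hom_trivial_zero[OF o] by (simp add: hom_null_def conc_simps)
  qed
  have tri: "Z \<in> hom_null M"
    if XY: "X \<in> hom_null M" "Y \<in> hom_null M" and Z: "Z \<in> Obj" and d: "distinguished R X Y Z u v w" for X Y Z u v w
  proof -
    obtain X' Y' Z' f i p a b c where st: "standard_triangle R X' Y' Z' f i p"
      and iso': "a \<in> cat_iso (Der R) X X'" "b \<in> cat_iso (Der R) Y Y'" "c \<in> cat_iso (Der R) Z Z'"
      using d unfolding distinguished_def by blast
    obtain \<theta> where o: "X' \<in> Obj" "Y' \<in> Obj" "Z' \<in> Obj" "f \<in> cmaps X' Y'"
      "\<theta> \<in> cochain_isos R (cone X' Y' f) Z'"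
      using st unfolding standard_triangle_def by blast
    \<comment> \<open>The isomorphisms of triangles move the question to a standard triangle, whose
      third object is a cone.\<close>
    have X': "X' \<in> hom_null M" and Y': "Y' \<in> hom_null M" using iso XY o iso' by blast+
    have "shift X' \<in> hom_null M" using sh X' o by blast
    then have "Z' \<in> hom_null M"
      using hom_trivial_cone[OF o(1,2,3) cM o(4,5)] Y' o(3) by (simp add: hom_null_def)
    moreover have "cat_iso (Der R) Z' Z \<noteq> {}"
      using iso'(3) ziso_sym by (fastforce simp: Der_def cat_iso_loc)
    ultimately show ?thesis using iso Z by blast
  qed
  have cop: "X \<in> hom_null M"
    if "F ` I \<subseteq> hom_null M" "is_coproduct (Der R) I F X \<iota>" for I :: "'u set" and F X \<iota>
  proof -
    have "X \<in> Obj" using that(2) unfolding is_coproduct_def Ob_Der by blast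
    moreover have "hom_trivial X (conc k M)" for k
      using hom_trivial_coproduct[OF that(2)[unfolded Der_def], of "conc k M"] that(1)
      by (auto simp: hom_null_def)
    ultimately show ?thesis by (simp add: hom_null_def)
  qed
  have "triangulated_subcat R (hom_null M)"
    unfolding triangulated_subcat_def Ob_Der
  proof (intro conjI ballI allI impI)
    show "hom_null M \<subseteq> Obj" by (auto simp: hom_null_def)
    show "hom_null M \<noteq> {}" using ne by blast
  qed (use iso sh tri in blast)+
  then show ?thesis
    unfolding localizing_subcat_def using cop by blast
qed

text \<open>A linear map \<open>\<phi>\<close> from degree 0 extends to a chain map to
  \<open>M\<close> in degree 0. If that were zero in the derived category it would factor through an
  acyclic complex, where the image of \<open>x\<close> is a coboundary; coboundaries go to zero in a
  complex without differentials.\<close>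

lemma hom_null_not:
  assumes X: "X \<in> Obj" and M: "module R M" "small_in U (carrier M)"
    and \<phi>: "\<phi> \<in> lmaps (Deg X 0) M" and x: "x \<in> el X 0" "\<phi> x \<noteq> \<zero>\<^bsub>M\<^esub>"
    and z: "\<And>n. n \<noteq> 0 \<Longrightarrow> el X n = {zr X n}"
  shows "X \<notin> hom_null M"
proof
  assume "X \<in> hom_null M"
  then have h: "hom_trivial X (conc 0 M)" by (simp add: hom_null_def)
  have c: "conc 0 M \<in> Obj" by (rule conc_Obj[OF M])
  have cc: "cpx X" "cpx (conc 0 M)" using X c by auto
  define f where "f = cres X (\<lambda>n x. if n = 0 then \<phi> x else \<zero>\<^bsub>M\<^esub>)"
  note ls = lin_simps[OF complex_module[OF cc(1)] M(1) \<phi>]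
  have d0: "Diff X n y = zr X (n + 1)" if "y \<in> el X n" for n y
    using that z[of n] z[of "n + 1"] cc(1) Diff_simps(1)[OF cc(1) that] by (cases "n = 0") auto
  have f: "f \<in> cmaps X (conc 0 M)"
    unfolding f_def
  proof (rule cres_mapsI[OF cc(1)])
    fix n y assume y: "y \<in> el X n"
    show k: "(if n = 0 then \<phi> y else \<zero>\<^bsub>M\<^esub>) \<in> el (conc 0 M) n"
      using y ls(1)[of y] M by (auto simp: conc_simps)
    then show "Diff (conc 0 M) n (if n = 0 then \<phi> y else \<zero>\<^bsub>M\<^esub>) =
       (if n + 1 = 0 then \<phi> (Diff X n y) else \<zero>\<^bsub>M\<^esub>)"
      using d0[OF y] ls(4) by (auto simp: conc_simps(3))
  qed (use ls M in \<open>auto simp: conc_simps\<close>)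
  have "zeq X (conc 0 M) [Fwd X (conc 0 M) f] [Fwd X (conc 0 M) (czero X (conc 0 M))]"
    using h zz_cmap[OF X c f] zz_cmap[OF X c] cc unfolding hom_trivial_def by simp
  then have "feq X (conc 0 M) f (czero X (conc 0 M))"
    by (intro zeq_imp_feq[OF X c f]) (use cc in simp_all)
  then obtain E a b where E: "E \<in> Obj" "acyclic_cpx E" "a \<in> cmaps X E" "b \<in> cmaps E (conc 0 M)"
    and eq: "\<And>n x. x \<in> el X n \<Longrightarrow> f n x = czero X (conc 0 M) n x \<oplus>\<^bsub>Deg (conc 0 M) n\<^esub> b n (a n x)"
    using feqE by metis
  have E': "cpx E" using E by simp
  note as = cmap_simps[OF cc(1) E' E(3)] and bs = cmap_simps[OF E' cc(2) E(4)]
  \<comment> \<open>Degree 0 is written as -1 + 1 to match the indexing of acyclicity.\<close>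
  have ax: "a 0 x \<in> el E (-1 + 1)" using as(1) x by simp
  have "Diff E (- 1 + 1) (a 0 x) = a (0 + 1) (Diff X 0 x)" using as(6)[OF x(1)] by simp
  also have "\<dots> = zr E (- 1 + 1 + 1)" using d0[OF x(1)] as(4) by simp
  finally obtain e where e: "e \<in> el E (- 1)" "a 0 x = Diff E (- 1) e"
    using acyclicE[OF E(2) ax] by blast
  have "b 0 (a 0 x) = Diff (conc 0 M) (- 1) (b (- 1) e)" using bs(6)[OF e(1)] e(2) by simp
  also have "\<dots> = \<zero>\<^bsub>M\<^esub>" using bs(1)[OF e(1)] by (simp add: conc_simps(3))
  finally have "\<phi> x = \<zero>\<^bsub>M\<^esub>" using eq[OF x(1)] x(1) M(1) by (simp add: f_def conc_simps)
  then show False using x(2) by simp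
qed


subsection \<open>Closure properties\<close>

lemma localizing_Obj: "localizing_subcat R L \<Longrightarrow> X \<in> L \<Longrightarrow> X \<in> Obj"
  unfolding localizing_subcat_def triangulated_subcat_def Ob_Der by blast

lemma localizing_ziso:
  assumes "localizing_subcat R L" "X \<in> L" "Y \<in> Obj" "ziso X Y u v"
  shows "Y \<in> L"
proof -
  have "cat_iso (Der R) X Y \<noteq> {}" using assms(4) by (auto simp: Der_def cat_iso_loc)
  then show ?thesis using assms unfolding localizing_subcat_def triangulated_subcat_def Ob_Der by blast
qed

lemma localizing_qi:
  assumes L: "localizing_subcat R L" and X: "X \<in> L" and Y: "Y \<in> Obj" and s: "qi X Y s \<or> qi Y X s"
  shows "Y \<in> L"
proof -
  have "X \<in> Obj" by (rule localizing_Obj[OF L X])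
  then have "\<exists>u v. ziso X Y u v" using s ziso_qi[of X Y s] ziso_sym[OF ziso_qi[of Y X s]] Y by blast
  then show ?thesis using localizing_ziso[OF L X Y] by blast
qed

lemma localizing_shift:
  "localizing_subcat R L \<Longrightarrow> X \<in> Obj \<Longrightarrow> shift X \<in> L \<longleftrightarrow> X \<in> L"
  unfolding localizing_subcat_def triangulated_subcat_def Ob_Der by blast

lemma localizing_distinguished:
  "\<lbrakk>localizing_subcat R L; X \<in> L; Y \<in> L; Z \<in> Obj; distinguished R X Y Z u v w\<rbrakk> \<Longrightarrow> Z \<in> L"
  unfolding localizing_subcat_def triangulated_subcat_def Ob_Der by blast

text \<open>The standard triangle is compared with itself by identities, represented by empty
  zigzags. What remains is that the explicit maps of the standard triangle are chain maps.\<close>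

lemma cone_distinguished:
  assumes X: "X \<in> Obj" and Y: "Y \<in> Obj" and Z: "Z \<in> Obj"
    and f: "f \<in> cmaps X Y" and \<theta>: "\<theta> \<in> cochain_isos R (cone X Y f) Z"
  obtains u v w where "distinguished R X Y Z u v w"
proof -
  have c: "cpx X" "cpx Y" "cpx Z" using X Y Z by auto
  let ?C = "cone X Y f"
  have C: "cpx ?C" by (rule cone_complex[OF c(1,2) f])
  obtain \<psi> where \<psi>: "\<psi> \<in> cochain_isos R Z ?C" "\<And>n x. x \<in> el ?C n \<Longrightarrow> \<psi> n (\<theta> n x) = x"
    "\<And>n z. z \<in> el Z n \<Longrightarrow> \<theta> n (\<psi> n z) = z"
    using iso_inverse[OF C c(3) \<theta>] by blast
  have \<theta>': "\<theta> \<in> cmaps ?C Z" "\<And>n. bij_betw (\<theta> n) (el ?C n) (el Z n)"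
    and \<psi>': "\<psi> \<in> cmaps Z ?C"
    using \<theta> \<psi>(1) by (auto simp: cochain_isos_def)
  define i where "i = (\<lambda>n. \<lambda>y\<in>el Y n. \<theta> n (zr X (n + 1), y))"
  define p where "p = (\<lambda>n. \<lambda>z\<in>el Z n. fst (inv_into (el ?C n) (\<theta> n) z))"
  have st: "standard_triangle R X Y Z f i p"
    unfolding standard_triangle_def using X Y Z f \<theta> i_def p_def by blast
  have i: "i \<in> cmaps Y Z"
  proof -
    have "i = ccomp Y \<theta> (cone_in X Y)" by (simp add: i_def cone_in_def ccomp_cres cres_def restrict_def fun_eq_iff)
    then show ?thesis using ccomp_closed[OF c(2) C c(3) cone_in_closed[OF c(1,2) f] \<theta>'(1)] by simp
  qed
  have p: "p \<in> cmaps Z (shift X)"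
  proof -
    have "inv_into (el ?C n) (\<theta> n) z = \<psi> n z" if z: "z \<in> el Z n" for n z
    proof (rule inv_into_f_eq)
      show "inj_on (\<theta> n) (el ?C n)" using \<theta>'(2) by (simp add: bij_betw_def)
      show "\<psi> n z \<in> el ?C n" using cmap_simps(1)[OF c(3) C \<psi>' z] .
    qed (rule \<psi>(3)[OF z])
    then have "p = ccomp Z (cone_pr X Y f) \<psi>"
      using cmap_simps(1)[OF c(3) C \<psi>']
      by (auto simp: p_def cone_pr_def ccomp_cres cres_def fun_eq_iff simp del: cone_simps)
    then show ?thesis
      using ccomp_closed[OF c(3) C _ \<psi>' cone_pr_closed[OF c(1,2) f]] c(1) by simp
  qed
  have zz: "zz X [Fwd X Y f] Y" "zz Y [Fwd Y Z i] Z" "zz Z [Fwd Z (shift X) p] (shift X)"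
    using X Y Z f i p by auto
  have nil: "zz P [] P" if "P \<in> Obj" for P using that by simp
  have id: "zcl P P [] \<in> cat_iso (Der R) P P" if P: "P \<in> Obj" for P
  proof -
    have "ziso P P [] []" using nil[OF P] zz_eq.refl[OF nil[OF P]] by (simp add: ziso_def)
    then show ?thesis by (auto simp: Der_def cat_iso_loc)
  qed
  have der_id: "der_shift R X X (zcl X X []) = zcl (shift X) (shift X) []"
  proof -
    have "zcl (shift X) (shift X) (shift_zz w) = zcl (shift X) (shift X) []" if "w \<in> zcl X X []" for w
    proof -
      have "zeq X X [] w" using that by (simp add: zz_class_def)
      from shift_zz(2)[OF this] have "zeq (shift X) (shift X) [] (shift_zz w)" by simp
      then show ?thesis using zcl_eq[OF nil[OF Obj_shift[OF X]]] by blast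
    qed
    moreover have "[] \<in> zcl X X []" using zz_eq.refl[OF nil[OF X]] by (simp add: zz_class_def)
    ultimately show ?thesis unfolding der_shift_def by blast
  qed
  have comp: "Comp (Der R) P Q Q (zcl Q Q []) (zcl P Q w) = zcl P Q w"
    "Comp (Der R) P P Q (zcl P Q w) (zcl P P []) = zcl P Q w" if "zz P w Q" for P Q w
    using Comp_loc[OF that nil] Comp_loc[OF nil that] zz_Ob[OF that] by (auto simp: Der_def)
  have "distinguished R X Y Z (der_map R X Y f) (der_map R Y Z i) (der_map R Z (shift X) p)"
    unfolding distinguished_def
  proof (intro conjI exI)
    show "standard_triangle R X Y Z f i p" by (rule st)
    show "zcl X X [] \<in> cat_iso (Der R) X X" "zcl Y Y [] \<in> cat_iso (Der R) Y Y" "zcl Z Z [] \<in> cat_iso (Der R) Z Z"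
      using id X Y Z by auto
  qed (use zz comp der_id in \<open>auto simp: der_map_def Der_def Hom_loc\<close>)
  then show ?thesis using that by blast
qed

text \<open>Form in which closure under triangles is used: the cone keeps its own carrier type, and
  any object quasi-isomorphic to it is reached.\<close>

lemma localizing_cone:
  assumes L: "localizing_subcat R L" and X: "X \<in> L" and Y: "Y \<in> L"
    and f: "f \<in> cmaps X Y"
    and Z: "Z \<in> Obj" and s: "qi (cone X Y f) Z s"
  shows "Z \<in> L"
proof -
  have o: "X \<in> Obj" "Y \<in> Obj" using localizing_Obj[OF L] X Y by auto
  have C: "cpx (cone X Y f)" by (rule cone_complex) (use o f in auto)
  have us: "usmall (cone X Y f)" using usmall_cone Obj_small o by metis
  obtain W \<theta> where W: "W \<in> Obj" "\<theta> \<in> cochain_isos R (cone X Y f) W" using transport[OF C us] by blast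
  obtain u v w where "distinguished R X Y W u v w" using cone_distinguished[OF o W(1) f W(2)] by blast
  then have WL: "W \<in> L"
    using localizing_distinguished[OF L X Y W(1)] by blast
  have W': "cpx W" and Z': "cpx Z" using W Z by auto
  obtain \<psi> where \<psi>: "\<psi> \<in> cochain_isos R W (cone X Y f)"
    "\<And>n x. x \<in> el (cone X Y f) n \<Longrightarrow> \<psi> n (\<theta> n x) = x"
    "\<And>n z. z \<in> el W n \<Longrightarrow> \<theta> n (\<psi> n z) = z"
    using iso_inverse[OF C W' W(2)] by blast
  have "qi W Z (ccomp W s \<psi>)" by (rule qi_trans[OF W' C Z' qi_bij[OF W' C \<psi>(1)] s])
  then show ?thesis using localizing_qi[OF L WL Z] by blast
qed

end

section \<open>Countable direct sums\<close>

definition nat_sum :: "(nat \<Rightarrow> ('z, 'x) module) \<Rightarrow> ('z, nat \<Rightarrow> 'x) module" where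
  "nat_sum M =
     \<lparr>carrier = {x. (\<forall>i. x i \<in> carrier (M i)) \<and> (\<exists>K. \<forall>i\<ge>K. x i = \<zero>\<^bsub>M i\<^esub>)},
      mult = undefined, one = undefined,
      zero = (\<lambda>i. \<zero>\<^bsub>M i\<^esub>),
      add = (\<lambda>x y i. x i \<oplus>\<^bsub>M i\<^esub> y i),
      smult = (\<lambda>r x i. r \<odot>\<^bsub>M i\<^esub> x i)\<rparr>"

primrec psum :: "('z, 'x) module \<Rightarrow> (nat \<Rightarrow> 'x) \<Rightarrow> nat \<Rightarrow> 'x" where
  "psum N s 0 = \<zero>\<^bsub>N\<^esub>"
| "psum N s (Suc K) = psum N s K \<oplus>\<^bsub>N\<^esub> s K"

text \<open>The sum of finitely many nonzero terms, taken up to the least bound of the support. By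
  \<open>nat_lift_eq\<close> every larger bound gives the same value, so sums of several sequences
  can be compared at a common bound.\<close>

definition nat_lift :: "(nat \<Rightarrow> ('z, 'x) module) \<Rightarrow> ('z, 'y) module \<Rightarrow> (nat \<Rightarrow> 'x \<Rightarrow> 'y) \<Rightarrow> (nat \<Rightarrow> 'x) \<Rightarrow> 'y" where
  "nat_lift M N g x = psum N (\<lambda>i. g i (x i)) (LEAST K. \<forall>i\<ge>K. x i = \<zero>\<^bsub>M i\<^esub>)"

definition nat_in :: "(nat \<Rightarrow> ('z, 'x) module) \<Rightarrow> nat \<Rightarrow> 'x \<Rightarrow> nat \<Rightarrow> 'x" where
  "nat_in M j x = (\<lambda>i. if i = j then x else \<zero>\<^bsub>M i\<^esub>)"

lemma nat_sum_simps [simp]: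
  "\<zero>\<^bsub>nat_sum M\<^esub> = (\<lambda>i. \<zero>\<^bsub>M i\<^esub>)"
  "x \<oplus>\<^bsub>nat_sum M\<^esub> y = (\<lambda>i. x i \<oplus>\<^bsub>M i\<^esub> y i)"
  "r \<odot>\<^bsub>nat_sum M\<^esub> x = (\<lambda>i. r \<odot>\<^bsub>M i\<^esub> x i)"
  by (simp_all add: nat_sum_def)

lemma nat_sum_carrier:
  "x \<in> carrier (nat_sum M) \<longleftrightarrow> (\<forall>i. x i \<in> carrier (M i)) \<and> (\<exists>K. \<forall>i\<ge>K. x i = \<zero>\<^bsub>M i\<^esub>)"
  by (simp add: nat_sum_def)

lemma nat_sumD: "x \<in> carrier (nat_sum M) \<Longrightarrow> x i \<in> carrier (M i)"
  by (simp add: nat_sum_carrier)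

lemma nat_sumE:
  assumes "x \<in> carrier (nat_sum M)"
  obtains K where "\<And>i. i \<ge> K \<Longrightarrow> x i = \<zero>\<^bsub>M i\<^esub>"
  using assms by (auto simp: nat_sum_carrier)

lemma nat_sumE2:
  assumes "x \<in> carrier (nat_sum M)" "y \<in> carrier (nat_sum N)"
  obtains K where "\<And>i. i \<ge> K \<Longrightarrow> x i = \<zero>\<^bsub>M i\<^esub>" "\<And>i. i \<ge> K \<Longrightarrow> y i = \<zero>\<^bsub>N i\<^esub>"
proof -
  obtain K L where "\<And>i. i \<ge> K \<Longrightarrow> x i = \<zero>\<^bsub>M i\<^esub>" "\<And>i. i \<ge> L \<Longrightarrow> y i = \<zero>\<^bsub>N i\<^esub>"
    using nat_sumE[OF assms(1)] nat_sumE[OF assms(2)] by metis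
  then show ?thesis using that[of "max K L"] by simp
qed

context cring
begin

lemma nat_sum_map:
  assumes "x \<in> carrier (nat_sum M)" "\<And>i. x i \<in> carrier (M i) \<Longrightarrow> h i (x i) \<in> carrier (N i)"
    "\<And>i. h i \<zero>\<^bsub>M i\<^esub> = \<zero>\<^bsub>N i\<^esub>"
  shows "(\<lambda>i. h i (x i)) \<in> carrier (nat_sum N)"
  using assms unfolding nat_sum_carrier by metis

lemma nat_sum_add:
  assumes "\<And>i. module R (M i)" "x \<in> carrier (nat_sum M)" "y \<in> carrier (nat_sum M)"
  shows "(\<lambda>i. x i \<oplus>\<^bsub>M i\<^esub> y i) \<in> carrier (nat_sum M)"
proof -
  obtain K where "\<And>i. i \<ge> K \<Longrightarrow> x i = \<zero>\<^bsub>M i\<^esub>" "\<And>i. i \<ge> K \<Longrightarrow> y i = \<zero>\<^bsub>M i\<^esub>"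
    using nat_sumE2[OF assms(2,3)] by blast
  then have "\<forall>i\<ge>K. x i \<oplus>\<^bsub>M i\<^esub> y i = \<zero>\<^bsub>M i\<^esub>" using assms(1) by simp
  then show ?thesis using assms nat_sumD[OF assms(2)] nat_sumD[OF assms(3)]
    unfolding nat_sum_carrier by auto
qed

lemma nat_sum_zero: "(\<And>i. module R (M i)) \<Longrightarrow> (\<lambda>i. \<zero>\<^bsub>M i\<^esub>) \<in> carrier (nat_sum M)"
  by (simp add: nat_sum_carrier)

lemma nat_sum_neg:
  assumes "\<And>i. module R (M i)" "x \<in> carrier (nat_sum M)"
  shows "(\<lambda>i. \<ominus>\<^bsub>M i\<^esub> x i) \<in> carrier (nat_sum M)"
  by (rule nat_sum_map[OF assms(2)]) (use assms(1) in auto)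

lemma nat_sum_smult:
  assumes "\<And>i. module R (M i)" "x \<in> carrier (nat_sum M)" "r \<in> carrier R"
  shows "(\<lambda>i. r \<odot>\<^bsub>M i\<^esub> x i) \<in> carrier (nat_sum M)"
  by (rule nat_sum_map[OF assms(2)]) (use assms in auto)

lemma nat_sum_module:
  assumes M: "\<And>i. module R (M i)"
  shows "module R (nat_sum M)"
proof (rule moduleI)
  note cl = nat_sum_add[OF M] nat_sum_zero[OF M] nat_sum_neg[OF M] nat_sum_smult[OF M]
  show "abelian_group (nat_sum M)"
  proof (rule abelian_groupI)
    fix x assume x: "x \<in> carrier (nat_sum M)"
    then show "\<exists>y\<in>carrier (nat_sum M). y \<oplus>\<^bsub>nat_sum M\<^esub> x = \<zero>\<^bsub>nat_sum M\<^esub>"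
      using M by (intro bexI[OF _ cl(3)[OF x]]) (simp add: nat_sumD)
  qed (use M cl in \<open>auto simp: mod_ac nat_sumD\<close>)
qed (use M nat_sum_add[OF M] nat_sum_smult[OF M] in
  \<open>auto simp: mod_lin module.smult_l_distr[of R] module.smult_assoc1[of R] is_cring nat_sumD\<close>)

lemma nat_sum_lin:
  assumes M: "\<And>i. module R (M i)" and N: "\<And>i. module R (N i)" and h: "\<And>i. h i \<in> lmaps (M i) (N i)"
  shows "(\<lambda>x\<in>carrier (nat_sum M). \<lambda>i. h i (x i)) \<in> lmaps (nat_sum M) (nat_sum N)"
proof (rule lin_restrictI[OF _ _ _ nat_sum_module[OF M]])
  note hs = lin_simps[OF M N h]
  fix x assume x: "x \<in> carrier (nat_sum M)"
  then have xi: "x i \<in> carrier (M i)" for i by (rule nat_sumD)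
  show "(\<lambda>i. h i (x i)) \<in> carrier (nat_sum N)" by (rule nat_sum_map[OF x]) (use hs in auto)
  show "(\<lambda>i. h i ((r \<odot>\<^bsub>nat_sum M\<^esub> x) i)) = r \<odot>\<^bsub>nat_sum N\<^esub> (\<lambda>i. h i (x i))" if "r \<in> carrier R" for r
    using hs(3)[OF that xi] by simp
  fix y assume "y \<in> carrier (nat_sum M)"
  then have yi: "y i \<in> carrier (M i)" for i by (rule nat_sumD)
  show "(\<lambda>i. h i ((x \<oplus>\<^bsub>nat_sum M\<^esub> y) i)) = (\<lambda>i. h i (x i)) \<oplus>\<^bsub>nat_sum N\<^esub> (\<lambda>i. h i (y i))"
    using hs(2)[OF xi yi] by simp
qed

lemma psum_closed:
  assumes "module R N" "\<And>i. s i \<in> carrier N"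
  shows "psum N s K \<in> carrier N"
  using assms by (induction K) auto

lemma psum_stable:
  assumes "module R N" "\<And>i. s i \<in> carrier N" "\<And>i. i \<ge> K \<Longrightarrow> s i = \<zero>\<^bsub>N\<^esub>" "K \<le> L"
  shows "psum N s L = psum N s K"
  using assms(4)
proof (induction L rule: dec_induct)
  case (step L)
  then show ?case using assms psum_closed[OF assms(1,2)] by simp
qed simp

lemma psum_add:
  assumes "module R N" "\<And>i. s i \<in> carrier N" "\<And>i. t i \<in> carrier N"
  shows "psum N (\<lambda>i. s i \<oplus>\<^bsub>N\<^esub> t i) K = psum N s K \<oplus>\<^bsub>N\<^esub> psum N t K"
  using assms psum_closed[OF assms(1,2)] psum_closed[OF assms(1,3)] by (induction K) (simp_all add: mod_ac)

lemma psum_hom: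
  assumes "module R N" "\<And>i. s i \<in> carrier N" "h \<zero>\<^bsub>N\<^esub> = \<zero>\<^bsub>P\<^esub>"
    "\<And>x y. \<lbrakk>x \<in> carrier N; y \<in> carrier N\<rbrakk> \<Longrightarrow> h (x \<oplus>\<^bsub>N\<^esub> y) = h x \<oplus>\<^bsub>P\<^esub> h y"
  shows "h (psum N s K) = psum P (\<lambda>i. h (s i)) K"
  using assms psum_closed[OF assms(1,2)] by (induction K) simp_all

lemma nat_lift_eq:
  assumes N: "module R N" and x: "x \<in> carrier (nat_sum M)" and K: "\<And>i. i \<ge> K \<Longrightarrow> x i = \<zero>\<^bsub>M i\<^esub>"
    and g: "\<And>i. g i (x i) \<in> carrier N" "\<And>i. g i \<zero>\<^bsub>M i\<^esub> = \<zero>\<^bsub>N\<^esub>"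
  shows "nat_lift M N g x = psum N (\<lambda>i. g i (x i)) K"
proof -
  let ?L = "LEAST K. \<forall>i\<ge>K. x i = \<zero>\<^bsub>M i\<^esub>"
  have K': "\<forall>i\<ge>K. x i = \<zero>\<^bsub>M i\<^esub>" using K by blast
  have L: "\<forall>i\<ge>?L. x i = \<zero>\<^bsub>M i\<^esub>" "?L \<le> K"
    by (rule LeastI[of "\<lambda>K. \<forall>i\<ge>K. x i = \<zero>\<^bsub>M i\<^esub>", OF K'])
      (rule Least_le[of "\<lambda>K. \<forall>i\<ge>K. x i = \<zero>\<^bsub>M i\<^esub>", OF K'])
  have "psum N (\<lambda>i. g i (x i)) K = psum N (\<lambda>i. g i (x i)) ?L"
  proof (rule psum_stable[OF N g(1) _ L(2)])
    fix i assume "?L \<le> i"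
    then have "x i = \<zero>\<^bsub>M i\<^esub>" using L(1) by blast
    then show "g i (x i) = \<zero>\<^bsub>N\<^esub>" by (simp only: g(2))
  qed
  then show ?thesis by (simp add: nat_lift_def)
qed

lemma nat_lift_add:
  assumes M: "\<And>i. module R (M i)" and N: "module R N" and g: "\<And>i. g i \<in> lmaps (M i) N"
    and x: "x \<in> carrier (nat_sum M)" and y: "y \<in> carrier (nat_sum M)"
  shows "nat_lift M N g (\<lambda>i. x i \<oplus>\<^bsub>M i\<^esub> y i) = nat_lift M N g x \<oplus>\<^bsub>N\<^esub> nat_lift M N g y"
proof -
  note gs = lin_simps[OF M N g]
  obtain K where K: "\<And>i. i \<ge> K \<Longrightarrow> x i = \<zero>\<^bsub>M i\<^esub>" "\<And>i. i \<ge> K \<Longrightarrow> y i = \<zero>\<^bsub>M i\<^esub>"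
    using nat_sumE2[OF x y] by blast
  have "nat_lift M N g (\<lambda>i. x i \<oplus>\<^bsub>M i\<^esub> y i) = psum N (\<lambda>i. g i (x i \<oplus>\<^bsub>M i\<^esub> y i)) K"
    by (rule nat_lift_eq[OF N nat_sum_add[OF M x y]]) (use K M N gs nat_sumD[OF x] nat_sumD[OF y] in auto)
  moreover have "nat_lift M N g x = psum N (\<lambda>i. g i (x i)) K" "nat_lift M N g y = psum N (\<lambda>i. g i (y i)) K"
    using nat_lift_eq[OF N x] nat_lift_eq[OF N y] K gs nat_sumD[OF x] nat_sumD[OF y] by simp_all
  ultimately show ?thesis
    using psum_add[OF N, of "\<lambda>i. g i (x i)" "\<lambda>i. g i (y i)"] gs nat_sumD[OF x] nat_sumD[OF y] by simp
qed

text \<open>Naturality in both variables, general enough to give compatibility with differentials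
  and with scalars as special cases.\<close>

lemma nat_lift_hom:
  assumes M: "\<And>i. module R (M i)" and N: "module R N" and g: "\<And>i. g i \<in> lmaps (M i) N"
    and M': "\<And>i. module R (M' i)" and P: "module R P" and g': "\<And>i. g' i \<in> lmaps (M' i) P"
    and x: "x \<in> carrier (nat_sum M)"
    and h: "h \<zero>\<^bsub>N\<^esub> = \<zero>\<^bsub>P\<^esub>" "\<And>x y. \<lbrakk>x \<in> carrier N; y \<in> carrier N\<rbrakk> \<Longrightarrow> h (x \<oplus>\<^bsub>N\<^esub> y) = h x \<oplus>\<^bsub>P\<^esub> h y"
    and k: "\<And>i y. y \<in> carrier (M i) \<Longrightarrow> k i y \<in> carrier (M' i)" "\<And>i. k i \<zero>\<^bsub>M i\<^esub> = \<zero>\<^bsub>M' i\<^esub>"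
    and hk: "\<And>i y. y \<in> carrier (M i) \<Longrightarrow> h (g i y) = g' i (k i y)"
  shows "h (nat_lift M N g x) = nat_lift M' P g' (\<lambda>i. k i (x i))"
proof -
  note gs = lin_simps[OF M N g] and gs' = lin_simps[OF M' P g']
  obtain K where K: "\<And>i. i \<ge> K \<Longrightarrow> x i = \<zero>\<^bsub>M i\<^esub>" using nat_sumE[OF x] by blast
  have "nat_lift M N g x = psum N (\<lambda>i. g i (x i)) K"
    using nat_lift_eq[OF N x] K gs nat_sumD[OF x] by simp
  moreover have "h (psum N (\<lambda>i. g i (x i)) K) = psum P (\<lambda>i. h (g i (x i))) K"
    by (rule psum_hom[OF N _ h]) (use gs nat_sumD[OF x] in auto)
  moreover have "nat_lift M' P g' (\<lambda>i. k i (x i)) = psum P (\<lambda>i. g' i (k i (x i))) K"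
    by (rule nat_lift_eq[OF P nat_sum_map[OF x]]) (use K k gs' nat_sumD[OF x] in auto)
  ultimately show ?thesis using hk nat_sumD[OF x] by simp
qed

lemma nat_lift_closed:
  assumes M: "\<And>i. module R (M i)" and N: "module R N" and g: "\<And>i. g i \<in> lmaps (M i) N"
    and x: "x \<in> carrier (nat_sum M)"
  shows "nat_lift M N g x \<in> carrier N"
  unfolding nat_lift_def
  by (rule psum_closed[OF N]) (use lin_simps[OF M N g] nat_sumD[OF x] in auto)

lemma nat_in_closed:
  assumes "\<And>i. module R (M i)" "x \<in> carrier (M j)"
  shows "nat_in M j x \<in> carrier (nat_sum M)"
proof -
  have "\<forall>i\<ge>Suc j. nat_in M j x i = \<zero>\<^bsub>M i\<^esub>" by (simp add: nat_in_def)
  then have "\<exists>K. \<forall>i\<ge>K. nat_in M j x i = \<zero>\<^bsub>M i\<^esub>" by blast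
  then show ?thesis using assms unfolding nat_sum_carrier by (simp add: nat_in_def)
qed

lemma nat_lift_in:
  assumes M: "\<And>i. module R (M i)" and N: "module R N" and g: "\<And>i. g i \<in> lmaps (M i) N"
    and x: "x \<in> carrier (M j)"
  shows "nat_lift M N g (nat_in M j x) = g j x"
proof -
  note gs = lin_simps[OF M N g]
  have c: "g i (nat_in M j x i) \<in> carrier N" for i using gs x M by (simp add: nat_in_def)
  have "nat_lift M N g (nat_in M j x) = psum N (\<lambda>i. g i (nat_in M j x i)) (Suc j)"
    by (rule nat_lift_eq[OF N nat_in_closed[of M, OF M x], of "Suc j" g, OF _ c]) (use gs in \<open>auto simp: nat_in_def\<close>)
  moreover have "psum N (\<lambda>i. g i (nat_in M j x i)) k = \<zero>\<^bsub>N\<^esub>" if "k \<le> j" for k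
    using that by (induction k) (use gs N in \<open>auto simp: nat_in_def\<close>)
  ultimately show ?thesis using N gs x M by (simp add: nat_in_def)
qed

text \<open>A finitely supported sequence is the sum of its components. This reduces statements on
  additive maps out of the direct sum to the summands.\<close>

lemma nat_lift_self:
  assumes M: "\<And>i. module R (M i)" and x: "x \<in> carrier (nat_sum M)"
  obtains K where "\<And>i. i \<ge> K \<Longrightarrow> x i = \<zero>\<^bsub>M i\<^esub>" "x = psum (nat_sum M) (\<lambda>i. nat_in M i (x i)) K"
proof -
  obtain K where K: "\<And>i. i \<ge> K \<Longrightarrow> x i = \<zero>\<^bsub>M i\<^esub>" using nat_sumE[OF x] by blast
  have "psum (nat_sum M) (\<lambda>i. nat_in M i (x i)) k j = (if j < k then x j else \<zero>\<^bsub>M j\<^esub>)" for k j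
  proof (induction k)
    case (Suc k)
    then show ?case using M nat_sumD[OF x] by (auto simp: nat_in_def)
  qed simp
  then have "x = psum (nat_sum M) (\<lambda>i. nat_in M i (x i)) K"
    using K by (auto simp: fun_eq_iff not_less)
  then show ?thesis using that K by blast
qed


subsection \<open>Direct sums of complexes\<close>

definition csum :: "(nat \<Rightarrow> ('z, 'x) cochain_complex) \<Rightarrow> ('z, nat \<Rightarrow> 'x) cochain_complex" where
  "csum X =
     \<lparr>Deg = (\<lambda>n. nat_sum (\<lambda>i. Deg (X i) n)),
      Diff = (\<lambda>n. \<lambda>x\<in>carrier (nat_sum (\<lambda>i. Deg (X i) n)). \<lambda>i. Diff (X i) n (x i))\<rparr>"

lemma csum_simps [simp]:
  "Deg (csum X) n = nat_sum (\<lambda>i. Deg (X i) n)"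
  "x \<in> carrier (nat_sum (\<lambda>i. Deg (X i) n)) \<Longrightarrow> Diff (csum X) n x = (\<lambda>i. Diff (X i) n (x i))"
  by (simp_all add: csum_def)

lemma csum_Diff_closed:
  assumes "\<And>i. cpx (X i)" "x \<in> carrier (nat_sum (\<lambda>i. Deg (X i) n))"
  shows "(\<lambda>i. Diff (X i) n (x i)) \<in> carrier (nat_sum (\<lambda>i. Deg (X i) (n + 1)))"
  by (rule nat_sum_map[OF assms(2), of "\<lambda>i. Diff (X i) n"]) (use assms(1) in auto)

lemma csum_complex:
  assumes X: "\<And>i. cpx (X i)"
  shows "cpx (csum X)"
proof (rule is_complexI)
  fix n
  have M: "module R (nat_sum (\<lambda>i. Deg (X i) n))" for n by (rule nat_sum_module) (use X in simp)
  then show "module R (Deg (csum X) n)" by simp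
  have "(\<lambda>x\<in>carrier (nat_sum (\<lambda>i. Deg (X i) n)). \<lambda>i. Diff (X i) n (x i)) \<in>
    lmaps (nat_sum (\<lambda>i. Deg (X i) n)) (nat_sum (\<lambda>i. Deg (X i) (n + 1)))"
    by (rule nat_sum_lin) (use X complex_Diff in auto)
  then show "Diff (csum X) n \<in> lmaps (Deg (csum X) n) (Deg (csum X) (n + 1))"
    by (simp add: csum_def)
  fix x assume "x \<in> el (csum X) n"
  then have x: "x \<in> carrier (nat_sum (\<lambda>i. Deg (X i) n))" by simp
  have "x i \<in> el (X i) n" for i using nat_sumD[OF x] .
  then show "Diff (csum X) (n + 1) (Diff (csum X) n x) = zr (csum X) (n + 1 + 1)"
    using X x csum_Diff_closed[OF X x] by simp
qed

definition csum_map where "csum_map X g = cres (csum X) (\<lambda>n x i. g i n (x i))"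
definition csum_in where "csum_in X j = cres (X j) (\<lambda>n. nat_in (\<lambda>i. Deg (X i) n) j)"
definition csum_lift where
  "csum_lift X Y g = cres (csum X) (\<lambda>n. nat_lift (\<lambda>i. Deg (X i) n) (Deg Y n) (\<lambda>i. g i n))"

lemma csum_map_apply:
  "x \<in> carrier (nat_sum (\<lambda>i. Deg (X i) n)) \<Longrightarrow> csum_map X g n x = (\<lambda>i. g i n (x i))"
  by (simp add: csum_map_def)

lemma csum_map_mem:
  assumes X: "\<And>i. cpx (X i)" and Y: "\<And>i. cpx (Y i)"
    and g: "\<And>i. g i \<in> cmaps (X i) (Y i)" and x: "x \<in> carrier (nat_sum (\<lambda>i. Deg (X i) n))"
  shows "(\<lambda>i. g i n (x i)) \<in> carrier (nat_sum (\<lambda>i. Deg (Y i) n))"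
  by (rule nat_sum_map[OF x, of "\<lambda>i. g i n"]) (use cmap_simps[OF X Y g] in auto)

lemma csum_map_closed:
  assumes X: "\<And>i. cpx (X i)" and Y: "\<And>i. cpx (Y i)"
    and g: "\<And>i. g i \<in> cmaps (X i) (Y i)"
  shows "csum_map X g \<in> cmaps (csum X) (csum Y)"
proof (rule cochain_mapsI)
  fix n
  have "(\<lambda>x\<in>carrier (nat_sum (\<lambda>i. Deg (X i) n)). \<lambda>i. g i n (x i)) \<in>
    lmaps (nat_sum (\<lambda>i. Deg (X i) n)) (nat_sum (\<lambda>i. Deg (Y i) n))"
    by (rule nat_sum_lin) (use X Y cochain_maps_lin[OF g] in auto)
  then show "csum_map X g n \<in> lmaps (Deg (csum X) n) (Deg (csum Y) n)"
    by (simp add: csum_map_def cres_def)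
  fix x assume "x \<in> el (csum X) n"
  then have x: "x \<in> carrier (nat_sum (\<lambda>i. Deg (X i) n))" by simp
  show "Diff (csum Y) n (csum_map X g n x) = csum_map X g (n + 1) (Diff (csum X) n x)"
    using csum_map_mem[OF X Y g x] x csum_Diff_closed[OF X x] cmap_simps(6)[OF X Y g nat_sumD[OF x]]
    by (simp add: csum_map_apply)
qed

lemma csum_in_closed:
  assumes X: "\<And>i. cpx (X i)"
  shows "csum_in X j \<in> cmaps (X j) (csum X)"
  unfolding csum_in_def
proof (rule cres_mapsI[OF X])
  have M: "module R (Deg (X i) n)" for i n using X by simp
  show "nat_in (\<lambda>i. Deg (X i) n) j x \<in> el (csum X) n" if "x \<in> el (X j) n" for n x
    using nat_in_closed[of "\<lambda>i. Deg (X i) n", OF M that] by simp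
  then show "Diff (csum X) n (nat_in (\<lambda>i. Deg (X i) n) j x) = nat_in (\<lambda>i. Deg (X i) (n + 1)) j (Diff (X j) n x)"
    if "x \<in> el (X j) n" for n x
    using that X by (auto simp: nat_in_def)
qed (use X in \<open>auto simp: nat_in_def\<close>)

lemma csum_lift_closed:
  assumes X: "\<And>i. cpx (X i)" and Y: "cpx Y"
    and g: "\<And>i. g i \<in> cmaps (X i) Y"
  shows "csum_lift X Y g \<in> cmaps (csum X) Y"
  unfolding csum_lift_def
proof (rule cres_mapsI[OF csum_complex[OF X]])
  have M: "module R (Deg (X i) n)" for i n using X by simp
  have N: "module R (Deg Y n)" for n using Y by simp
  have gl: "g i n \<in> lmaps (Deg (X i) n) (Deg Y n)" for i n using cochain_maps_lin[OF g] .
  fix n x assume "x \<in> el (csum X) n"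
  then have x: "x \<in> carrier (nat_sum (\<lambda>i. Deg (X i) n))" by simp
  show "nat_lift (\<lambda>i. Deg (X i) n) (Deg Y n) (\<lambda>i. g i n) x \<in> el Y n"
    by (rule nat_lift_closed[OF M N gl x])
  show "Diff Y n (nat_lift (\<lambda>i. Deg (X i) n) (Deg Y n) (\<lambda>i. g i n) x) =
    nat_lift (\<lambda>i. Deg (X i) (n + 1)) (Deg Y (n + 1)) (\<lambda>i. g i (n + 1)) (Diff (csum X) n x)"
    unfolding csum_simps(2)[OF x]
    by (rule nat_lift_hom[OF M N gl M N gl x]) (use X Y cmap_simps[OF X Y g] in auto)
  show "nat_lift (\<lambda>i. Deg (X i) n) (Deg Y n) (\<lambda>i. g i n) (r \<odot>\<^bsub>Deg (csum X) n\<^esub> x) =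
    r \<odot>\<^bsub>Deg Y n\<^esub> nat_lift (\<lambda>i. Deg (X i) n) (Deg Y n) (\<lambda>i. g i n) x" if r: "r \<in> carrier R" for r
    unfolding csum_simps nat_sum_simps
    by (rule nat_lift_hom[OF M N gl M N gl x, symmetric]) (use r X Y cmap_simps[OF X Y g] in \<open>auto simp: mod_lin\<close>)
  fix y assume "y \<in> el (csum X) n"
  then have y: "y \<in> carrier (nat_sum (\<lambda>i. Deg (X i) n))" by simp
  show "nat_lift (\<lambda>i. Deg (X i) n) (Deg Y n) (\<lambda>i. g i n) (x \<oplus>\<^bsub>Deg (csum X) n\<^esub> y) =
    nat_lift (\<lambda>i. Deg (X i) n) (Deg Y n) (\<lambda>i. g i n) x \<oplus>\<^bsub>Deg Y n\<^esub>
    nat_lift (\<lambda>i. Deg (X i) n) (Deg Y n) (\<lambda>i. g i n) y"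
    unfolding csum_simps nat_sum_simps by (rule nat_lift_add[OF M N gl x y])
qed

lemma csum_lift_in:
  assumes X: "\<And>i. cpx (X i)" and Y: "cpx Y"
    and g: "\<And>i. g i \<in> cmaps (X i) Y" and x: "x \<in> el (X j) n"
  shows "csum_lift X Y g n (csum_in X j n x) = g j n x"
proof -
  have M: "module R (Deg (X i) n)" for i n using X by simp
  have N: "module R (Deg Y n)" for n using Y by simp
  have gl: "g i n \<in> lmaps (Deg (X i) n) (Deg Y n)" for i n using cochain_maps_lin[OF g] .
  show ?thesis
    using nat_lift_in[of "\<lambda>i. Deg (X i) n", OF M N gl x] nat_in_closed[of "\<lambda>i. Deg (X i) n", OF M x] x
    by (simp add: csum_lift_def csum_in_def)
qed

text \<open>If k - l factors through an acyclic \<open>E i\<close> on each summand, it factors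
  through the direct sum of the \<open>E i\<close>. This is the reason why \<open>feq\<close> can be
  tested on summands.\<close>

lemma csum_diff_factor:
  assumes X: "\<And>i. cpx (X i)" and Y: "cpx Y" and E: "\<And>i. cpx (E i)"
    and k: "k \<in> cmaps (csum X) Y" and l: "l \<in> cmaps (csum X) Y"
    and a: "\<And>i. a i \<in> cmaps (X i) (E i)" and b: "\<And>i. b i \<in> cmaps (E i) Y"
    and eq: "\<And>i n x. x \<in> el (X i) n \<Longrightarrow>
      k n (csum_in X i n x) = l n (csum_in X i n x) \<oplus>\<^bsub>Deg Y n\<^esub> b i n (a i n x)"
    and x: "x \<in> carrier (nat_sum (\<lambda>i. Deg (X i) n))"
  shows "k n x = l n x \<oplus>\<^bsub>Deg Y n\<^esub> csum_lift E Y b n (csum_map X a n x)"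
proof -
  have C: "cpx (csum X)" by (rule csum_complex[OF X])
  have M: "module R (Deg (X i) n)" for i n using X by simp
  have M': "module R (Deg (E i) n)" for i n using E by simp
  have N: "module R (Deg Y n)" for n using Y by simp
  have bl: "b i n \<in> lmaps (Deg (E i) n) (Deg Y n)" for i n using cochain_maps_lin[OF b] .
  let ?M = "\<lambda>i. Deg (X i) n"
  obtain K where K: "\<And>i. i \<ge> K \<Longrightarrow> x i = \<zero>\<^bsub>?M i\<^esub>" "x = psum (nat_sum ?M) (\<lambda>i. nat_in ?M i (x i)) K"
    using nat_lift_self[of ?M, OF M x] by blast
  have inc: "nat_in ?M i (x i) \<in> carrier (nat_sum ?M)" for i
    using nat_in_closed[of ?M, OF M] nat_sumD[OF x] by blast
  have h: "h n x = psum (Deg Y n) (\<lambda>i. h n (nat_in ?M i (x i))) K" if h: "h \<in> cmaps (csum X) Y" for h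
  proof -
    have "h n x = h n (psum (nat_sum ?M) (\<lambda>i. nat_in ?M i (x i)) K)" by (rule arg_cong[OF K(2)])
    also have "\<dots> = psum (Deg Y n) (\<lambda>i. h n (nat_in ?M i (x i))) K"
      by (rule psum_hom[OF nat_sum_module[of ?M, OF M] inc])
        (use cmap_simps(2,4)[OF C Y h, where n = n] in simp_all)
    finally show ?thesis .
  qed
  have in_eq: "csum_in X i n (x i) = nat_in ?M i (x i)" for i
    using nat_sumD[OF x] by (simp add: csum_in_def)
  have bc: "b i n (a i n (x i)) \<in> el Y n" for i
    using cmap_simps(1)[OF E Y b] cmap_simps(1)[OF X E a] nat_sumD[OF x] by blast
  have lc: "l n (nat_in ?M i (x i)) \<in> el Y n" for i
    using cmap_simps(1)[OF C Y l] inc by simp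
  have "k n x = psum (Deg Y n) (\<lambda>i. l n (nat_in ?M i (x i)) \<oplus>\<^bsub>Deg Y n\<^esub> b i n (a i n (x i))) K"
    using h[OF k] eq[OF nat_sumD[OF x]] in_eq by simp
  also have "\<dots> = l n x \<oplus>\<^bsub>Deg Y n\<^esub> psum (Deg Y n) (\<lambda>i. b i n (a i n (x i))) K"
    using psum_add[OF N lc bc] h[OF l] by simp
  also have "psum (Deg Y n) (\<lambda>i. b i n (a i n (x i))) K = csum_lift E Y b n (csum_map X a n x)"
  proof -
    have m: "(\<lambda>i. a i n (x i)) \<in> carrier (nat_sum (\<lambda>i. Deg (E i) n))" by (rule csum_map_mem[OF X E a x])
    have "nat_lift (\<lambda>i. Deg (E i) n) (Deg Y n) (\<lambda>i. b i n) (\<lambda>i. a i n (x i)) = psum (Deg Y n) (\<lambda>i. b i n (a i n (x i))) K"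
      by (rule nat_lift_eq[OF N m, of K "\<lambda>i. b i n", OF _ bc]) (use K(1) cmap_simps(4)[OF X E a] cmap_simps(4)[OF E Y b] in auto)
    then show ?thesis using m x by (simp add: csum_lift_def csum_map_apply)
  qed
  finally show ?thesis .
qed

text \<open>Witnesses are chosen separately in each component; where zero is a witness it is taken,
  so that the resulting sequence has finite support.\<close>

lemma nat_sum_choice:
  assumes M: "\<And>i. module R (M i)" and K: "\<And>i. i \<ge> (K::nat) \<Longrightarrow> P i \<zero>\<^bsub>M i\<^esub>"
    and ex: "\<And>i. \<exists>z\<in>carrier (M i). P i z"
  obtains z where "z \<in> carrier (nat_sum M)" "\<And>i. P i (z i)"
proof -
  obtain z where z: "\<And>i. z i \<in> carrier (M i) \<and> P i (z i)" using ex by metis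
  let ?z = "\<lambda>i. if i < K then z i else \<zero>\<^bsub>M i\<^esub>"
  have "?z \<in> carrier (nat_sum M)" unfolding nat_sum_carrier using z M by (auto intro: exI[of _ K])
  then show ?thesis using that[of ?z] z K by (simp add: not_less)
qed

lemma acyclic_csum:
  assumes X: "\<And>i. cpx (X i)" and a: "\<And>i. acyclic_cpx (X i)"
  shows "acyclic_cpx (csum X)"
  unfolding acyclic_cpx_def
proof (intro allI ballI impI)
  fix n x assume "x \<in> el (csum X) (n + 1)" "Diff (csum X) (n + 1) x = zr (csum X) (n + 1 + 1)"
  then have x: "x \<in> carrier (nat_sum (\<lambda>i. Deg (X i) (n + 1)))"
    and dx: "\<And>i. Diff (X i) (n + 1) (x i) = zr (X i) (n + 1 + 1)" by (auto dest: fun_cong)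
  have M: "module R (Deg (X i) n)" for i n using X by simp
  obtain K where K: "\<And>i. i \<ge> K \<Longrightarrow> x i = zr (X i) (n + 1)" using nat_sumE[OF x] by blast
  have ex: "\<exists>z\<in>el (X i) n. x i = Diff (X i) n z" for i
    using acyclicE[OF a nat_sumD[OF x] dx] by blast
  obtain z where z: "z \<in> carrier (nat_sum (\<lambda>i. Deg (X i) n))" "\<And>i. x i = Diff (X i) n (z i)"
    using nat_sum_choice[of "\<lambda>i. Deg (X i) n" K "\<lambda>i z. x i = Diff (X i) n z", OF M _ ex] K X by auto
  have "x = Diff (csum X) n z" using z by auto
  then show "\<exists>z\<in>el (csum X) n. x = Diff (csum X) n z" using z by auto
qed

lemma qi_csum_map:
  assumes X: "\<And>i. cpx (X i)" and Y: "\<And>i. cpx (Y i)" and g: "\<And>i. qi (X i) (Y i) (g i)"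
  shows "qi (csum X) (csum Y) (csum_map X g)"
proof (rule qiI[OF csum_map_closed[OF X Y qi_cmap[OF g]]])
  have M: "module R (Deg (X i) n)" and N: "module R (Deg (Y i) n)" for i n using X Y by simp_all
  {
    fix n x y
    assume "x \<in> el (csum X) (n + 1)" "y \<in> el (csum Y) n"
      "Diff (csum X) (n + 1) x = zr (csum X) (n + 1 + 1)" "csum_map X g (n + 1) x = Diff (csum Y) n y"
    then have x: "x \<in> carrier (nat_sum (\<lambda>i. Deg (X i) (n + 1)))" and y: "y \<in> carrier (nat_sum (\<lambda>i. Deg (Y i) n))"
      and dx: "\<And>i. Diff (X i) (n + 1) (x i) = zr (X i) (n + 1 + 1)"
      and gx: "\<And>i. g i (n + 1) (x i) = Diff (Y i) n (y i)"
      by (auto simp: csum_map_apply dest: fun_cong)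
    obtain K where K: "\<And>i. i \<ge> K \<Longrightarrow> x i = zr (X i) (n + 1)" using nat_sumE[OF x] by blast
    have ex: "\<exists>z\<in>el (X i) n. x i = Diff (X i) n z" for i
      using qi_inj[OF g nat_sumD[OF x] nat_sumD[OF y] dx gx] by blast
    obtain z where z: "z \<in> carrier (nat_sum (\<lambda>i. Deg (X i) n))" "\<And>i. x i = Diff (X i) n (z i)"
      using nat_sum_choice[of "\<lambda>i. Deg (X i) n" K "\<lambda>i z. x i = Diff (X i) n z", OF M _ ex] K X by auto
    have "x = Diff (csum X) n z" using z by auto
    then show "\<exists>z\<in>el (csum X) n. x = Diff (csum X) n z" using z by auto
  next
    fix n y
    assume "y \<in> el (csum Y) (n + 1)" "Diff (csum Y) (n + 1) y = zr (csum Y) (n + 1 + 1)"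
    then have y: "y \<in> carrier (nat_sum (\<lambda>i. Deg (Y i) (n + 1)))"
      and dy: "\<And>i. Diff (Y i) (n + 1) (y i) = zr (Y i) (n + 1 + 1)" by (auto dest: fun_cong)
    obtain K where K: "\<And>i. i \<ge> K \<Longrightarrow> y i = zr (Y i) (n + 1)" using nat_sumE[OF y] by blast
    let ?P = "\<lambda>i x z. Diff (X i) (n + 1) x = zr (X i) (n + 1 + 1) \<and>
        y i = g i (n + 1) x \<oplus>\<^bsub>Deg (Y i) (n + 1)\<^esub> Diff (Y i) n z"
    have ex: "\<exists>x\<in>el (X i) (n + 1). \<exists>z\<in>el (Y i) n. ?P i x z" for i
      using qi_surj[OF g nat_sumD[OF y] dy] by metis
    have g0: "g i m (zr (X i) m) = zr (Y i) m" for i m using cmap_simps(4)[OF X Y qi_cmap[OF g]] .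
    have P0: "?P i (zr (X i) (n + 1)) (zr (Y i) n)" if "i \<ge> K" for i using K[OF that] X Y g0 by simp
    have e1: "\<exists>z\<in>el (Y i) n. ?P i (zr (X i) (n + 1)) z" if "i \<ge> K" for i
      using P0[OF that] N mod_closed(2) by blast
    \<comment> \<open>Two rounds of choice. The cocycles \<open>x i\<close> must be forced to be
      zero beyond the support of \<open>y\<close>, for only then is zero an admissible choice of
      \<open>z i\<close> there.\<close>
    obtain x where x: "x \<in> carrier (nat_sum (\<lambda>i. Deg (X i) (n + 1)))"
      "\<And>i. (i \<ge> K \<longrightarrow> x i = zr (X i) (n + 1)) \<and> (\<exists>z\<in>el (Y i) n. ?P i (x i) z)"
    proof (rule nat_sum_choice[of "\<lambda>i. Deg (X i) (n + 1)" K
          "\<lambda>i x. (i \<ge> K \<longrightarrow> x = zr (X i) (n + 1)) \<and> (\<exists>z\<in>el (Y i) n. ?P i x z)", OF M])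
      fix i
      show "\<exists>x\<in>el (X i) (n + 1). (i \<ge> K \<longrightarrow> x = zr (X i) (n + 1)) \<and>
        (\<exists>z\<in>el (Y i) n. ?P i x z)"
      proof (cases "i \<ge> K")
        case True
        then show ?thesis using e1[OF True] M mod_closed(2) by blast
      next
        case False
        then show ?thesis using ex[of i] by blast
      qed
    qed (use e1 in blast)+
    obtain z where z: "z \<in> carrier (nat_sum (\<lambda>i. Deg (Y i) n))" "\<And>i. ?P i (x i) (z i)"
    proof (rule nat_sum_choice[of "\<lambda>i. Deg (Y i) n" K "\<lambda>i z. ?P i (x i) z", OF N])
      fix i assume "K \<le> i"
      then show "?P i (x i) (zr (Y i) n)" using x(2)[of i] P0 by simp
    qed (use x(2) in blast)+
    have "Diff (csum X) (n + 1) x = zr (csum X) (n + 1 + 1)"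
      "y = csum_map X g (n + 1) x \<oplus>\<^bsub>Deg (csum Y) (n + 1)\<^esub> Diff (csum Y) n z"
      using x(1) z by (auto simp: csum_map_apply)
    then show "\<exists>x\<in>el (csum X) (n + 1). \<exists>z\<in>el (csum Y) n.
        Diff (csum X) (n + 1) x = zr (csum X) (n + 1 + 1) \<and>
        y = csum_map X g (n + 1) x \<oplus>\<^bsub>Deg (csum Y) (n + 1)\<^esub> Diff (csum Y) n z"
      using x(1) z(1) csum_simps(1) by metis
  }
qed

end

section \<open>Direct sums of complexes as coproducts in the derived category\<close>

context derived_category
begin

text \<open>A finitely supported sequence is coded by the list of its values up to a bound, and
  lists over a small set form a small set.\<close>

lemma usmall_csum:
  fixes X :: "nat \<Rightarrow> ('r, 'u) cochain_complex"
  assumes "\<And>i. X i \<in> Obj"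
  shows "usmall (csum X)"
proof
  fix n
  let ?M = "\<lambda>i. Deg (X i) n"
  let ?A = "\<Union>i. carrier (?M i)"
  let ?f = "\<lambda>xs i. if i < length xs then xs ! i else \<zero>\<^bsub>?M i\<^esub>"
  have "small_in U ?A" by (rule small_in_UN[OF small_in_nat]) (use Obj_small assms in blast)
  then have "small_in U (?f ` lists ?A)" by (intro small_in_image small_in_lists)
  moreover have "carrier (nat_sum ?M) \<subseteq> ?f ` lists ?A"
  proof
    fix x assume x: "x \<in> carrier (nat_sum ?M)"
    obtain K where K: "\<And>i. i \<ge> K \<Longrightarrow> x i = \<zero>\<^bsub>?M i\<^esub>" using nat_sumE[OF x] by blast
    have "x = ?f (map x [0..<K])" using K by (auto simp: fun_eq_iff)
    moreover have "x i \<in> ?A" for i using nat_sumD[OF x, of i] by blast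
    then have "map x [0..<K] \<in> lists ?A" by (simp add: in_lists_conv_set del: UN_iff)
    ultimately show "x \<in> ?f ` lists ?A" by blast
  qed
  ultimately show "small_in U (el (csum X) n)" using small_in_subset by simp
qed

text \<open>Each given morphism is a right roof with vertex \<open>A i\<close>. The sum of the legs
  to \<open>X i\<close> is again a quasi-isomorphism, so the sum of the roofs is a roof out of the
  direct sum.\<close>

lemma csum_coproduct_exists:
  fixes X :: "nat \<Rightarrow> ('r, 'u) cochain_complex"
  assumes X: "\<And>i. X i \<in> Obj" and S: "S \<in> Obj" and \<theta>: "qi (csum X) S \<theta>" "qi S (csum X) \<theta>'"
    and Y: "Y \<in> Obj" and w: "\<And>i. zz (X i) (w i) Y"
  obtains h where "zz S h Y" "\<And>i. zeq (X i) Y ([Fwd (X i) S (ccomp (X i) \<theta> (csum_in X i))] @ h) (w i)"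
proof -
  have cX: "cpx (X i)" for i using X by simp
  have cS: "cpx S" and cY: "cpx Y" using S Y by auto
  have C: "cpx (csum X)" by (rule csum_complex[OF cX])
  have "\<exists>A t b. A \<in> Obj \<and> qi A (X i) t \<and> b \<in> cmaps A Y \<and>
      zeq A Y ([Fwd A (X i) t] @ w i) [Fwd A Y b]" for i
    using right_roof[OF w[of i]] by metis
  then obtain A t b where A: "\<And>i. A i \<in> Obj" "\<And>i. qi (A i) (X i) (t i)"
    "\<And>i. b i \<in> cmaps (A i) Y" "\<And>i. zeq (A i) Y ([Fwd (A i) (X i) (t i)] @ w i) [Fwd (A i) Y (b i)]"
    by metis
  have cA: "cpx (A i)" for i using A by simp
  have CA: "cpx (csum A)" by (rule csum_complex[OF cA])
  obtain T \<tau> \<sigma> where T: "T \<in> Obj" "qi (csum A) T \<tau>" "qi T (csum A) \<sigma>"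
    "\<And>n x. x \<in> el (csum A) n \<Longrightarrow> \<sigma> n (\<tau> n x) = x"
    using transportE[OF CA usmall_csum[OF A(1)]] by metis
  have cT: "cpx T" using T by simp
  let ?p = "ccomp T (ccomp (csum A) \<theta> (csum_map A t)) \<sigma>"
  let ?b = "ccomp T (csum_lift A Y b) \<sigma>"
  have tm: "qi (csum A) S (ccomp (csum A) \<theta> (csum_map A t))"
    by (rule qi_trans[OF CA C cS qi_csum_map[OF cA cX A(2)] \<theta>(1)])
  have p: "qi T S ?p" by (rule qi_trans[OF cT CA cS T(3) tm])
  have b: "?b \<in> cmaps T Y"
    by (rule ccomp_closed[OF cT CA cY qi_cmap[OF T(3)] csum_lift_closed[OF cA cY A(3)]])
  \<comment> \<open>Back along the sum of the quasi-isomorphisms \<open>t i\<close>, then forward by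
    the map induced by the \<open>b i\<close>; \<open>T\<close> is the copy of the sum of the
    \<open>A i\<close> over \<open>'u\<close>.\<close>
  let ?h = "[Bwd T S ?p] @ [Fwd T Y ?b]"
  have h: "zz S ?h Y" using S T(1) Y p b by simp
  have "zeq (X i) Y ([Fwd (X i) S (ccomp (X i) \<theta> (csum_in X i))] @ ?h) (w i)" for i
  proof -
    let ?\<iota> = "ccomp (X i) \<theta> (csum_in X i)" and ?j = "ccomp (A i) \<tau> (csum_in A i)"
    have \<iota>: "?\<iota> \<in> cmaps (X i) S" by (rule ccomp_closed[OF cX C cS csum_in_closed[OF cX] qi_cmap[OF \<theta>(1)]])
    have j: "?j \<in> cmaps (A i) T" by (rule ccomp_closed[OF cA CA cT csum_in_closed[OF cA] qi_cmap[OF T(2)]])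
    note ti = qi_cmap[OF A(2)[of i]]
    have inA: "csum_in A i n x \<in> carrier (nat_sum (\<lambda>i. Deg (A i) n))" if "x \<in> el (A i) n" for n x
      using cmap_simps(1)[OF cA CA csum_in_closed[OF cA] that] by simp
    have mapin: "csum_map A t n (csum_in A i n x) = csum_in X i n (t i n x)"
      if x: "x \<in> el (A i) n" for n x
      using inA[OF x] x cmap_simps(1)[OF cA cX ti x] cmap_simps(4)[OF cA cX qi_cmap[OF A(2)]]
      by (auto simp: csum_map_apply csum_in_def nat_in_def)
    have jx: "\<sigma> n (?j n x) = csum_in A i n x" "?j n x \<in> el T n" if "x \<in> el (A i) n" for n x
      using that T(4) inA cmap_simps(1)[OF cA cT j that] by simp_all
    have ta: "zz (A i) [Fwd (A i) (X i) (t i)] (X i)" by (rule zz_qi[OF A(1) X A(2)])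
    let ?tt = "ccomp (A i) ?\<iota> (t i)"
    have tt: "?tt \<in> cmaps (A i) S" by (rule ccomp_closed[OF cA cX cS ti \<iota>])
    have e1: "zeq (A i) S ([Fwd (A i) (X i) (t i)] @ [Fwd (X i) S ?\<iota>]) [Fwd (A i) S ?tt]"
      by (rule zeq_feq_comp[OF A(1) X S ti \<iota>])
    have e2: "zeq (A i) S ([Fwd (A i) T ?j] @ [Fwd T S ?p]) [Fwd (A i) S ?tt]"
    proof (rule zeq_ccomp[OF A(1) T(1) S j qi_cmap[OF p] tt])
      fix n x assume x: "x \<in> el (A i) n"
      then show "?p n (?j n x) = ?tt n x"
        using jx[OF x] inA[OF x] mapin[OF x] cmap_simps(1)[OF cA cX ti x]
        by (simp del: ccomp_apply add: ccomp_apply[where f = \<sigma>] ccomp_apply[where f = "csum_map A t"]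
            ccomp_apply[where f = "t i"] ccomp_apply[where g = \<theta> and f = "csum_in X i"])
    qed
    have e3: "zeq (A i) Y ([Fwd (A i) T ?j] @ [Fwd T Y ?b]) [Fwd (A i) Y (b i)]"
    proof (rule zeq_ccomp[OF A(1) T(1) Y j b A(3)])
      fix n x assume x: "x \<in> el (A i) n"
      then show "?b n (?j n x) = b i n x"
        using jx[OF x] csum_lift_in[of A Y b, OF cA cY A(3) x]
        by (simp del: ccomp_apply add: ccomp_apply[where f = \<sigma>])
    qed
    have z1: "zz T [Fwd T S ?p] S" by (rule zz_qi[OF T(1) S p])
    have pp: "zeq T T ([Fwd T S ?p] @ [Bwd T S ?p]) []"
      using zz_eq.inv1[of T "Ch R" S ?p "quasi_isos R"] T(1) S p by simp
    have "zeq (A i) Y (([Fwd (A i) (X i) (t i)] @ [Fwd (X i) S ?\<iota>]) @ ?h) (([Fwd (A i) T ?j] @ [Fwd T S ?p]) @ ?h)"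
      by (rule zeq_cong[OF zeq_join[OF e1 e2] h])
    moreover have "zeq (A i) Y (([Fwd (A i) T ?j] @ ([Fwd T S ?p] @ [Bwd T S ?p])) @ [Fwd T Y ?b]) (([Fwd (A i) T ?j] @ []) @ [Fwd T Y ?b])"
      by (rule zeq_cong[OF zeq_cong2[OF zz_cmap[OF A(1) T(1) j] pp] zz_cmap[OF T(1) Y b]])
    then have "zeq (A i) Y (([Fwd (A i) T ?j] @ [Fwd T S ?p]) @ ?h) ([Fwd (A i) T ?j] @ [Fwd T Y ?b])"
      by simp
    then have "zeq (A i) Y (([Fwd (A i) T ?j] @ [Fwd T S ?p]) @ ?h) ([Fwd (A i) (X i) (t i)] @ w i)"
      using e3 A(4)[of i] zeq_join zz_eq.trans by blast
    ultimately have "zeq (A i) Y (([Fwd (A i) (X i) (t i)] @ [Fwd (X i) S ?\<iota>]) @ ?h) ([Fwd (A i) (X i) (t i)] @ w i)"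
      by (rule zz_eq.trans)
    then have "zeq (A i) Y ([Fwd (A i) (X i) (t i)] @ ([Fwd (X i) S ?\<iota>] @ ?h)) ([Fwd (A i) (X i) (t i)] @ w i)"
      unfolding append_assoc .
    then show ?thesis
      by (rule zeq_cancel_qi[OF A(1) X A(2) zz_appendI[OF zz_cmap[OF X S \<iota>] h] w])
  qed
  then show ?thesis using that h by blast
qed

text \<open>Both morphisms are represented by chain maps to one object \<open>N\<close>. On every
  summand they are \<open>feq\<close>, hence on the direct sum, and so they are equal in the derived
  category.\<close>

lemma csum_coproduct_unique:
  fixes X :: "nat \<Rightarrow> ('r, 'u) cochain_complex"
  assumes X: "\<And>i. X i \<in> Obj" and S: "S \<in> Obj" and \<theta>: "qi (csum X) S \<theta>" "qi S (csum X) \<theta>'"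
    and \<theta>\<theta>': "\<And>n x. x \<in> el S n \<Longrightarrow> \<theta> n (\<theta>' n x) = x"
    and uv: "zz S u Y" "zz S v Y"
    and eq: "\<And>i. zeq (X i) Y ([Fwd (X i) S (ccomp (X i) \<theta> (csum_in X i))] @ u)
      ([Fwd (X i) S (ccomp (X i) \<theta> (csum_in X i))] @ v)"
  shows "zeq S Y u v"
proof -
  have Y: "Y \<in> Obj" using uv zz_Ob by auto
  have cX: "cpx (X i)" for i using X by simp
  have cS: "cpx S" and cY: "cpx Y" using S Y by auto
  have C: "cpx (csum X)" by (rule csum_complex[OF cX])
  let ?\<iota> = "\<lambda>i. ccomp (X i) \<theta> (csum_in X i)"
  have \<iota>: "?\<iota> i \<in> cmaps (X i) S" for i
    by (rule ccomp_closed[OF cX C cS csum_in_closed[OF cX] qi_cmap[OF \<theta>(1)]])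
  obtain P r k where P: "P \<in> Obj" "qi Y P r" "k \<in> cmaps S P" "zeq S P (u @ [Fwd Y P r]) [Fwd S P k]"
    using left_roof[OF uv(1)] by blast
  have r: "zz Y [Fwd Y P r] P" by (rule zz_qi[OF Y P(1,2)])
  \<comment> \<open>The second left roof is taken of \<open>v\<close> already prolonged by
    \<open>r\<close>; only so do both chain maps end in the same object.\<close>
  obtain N s l where N: "N \<in> Obj" "qi P N s" "l \<in> cmaps S N"
    "zeq S N ((v @ [Fwd Y P r]) @ [Fwd P N s]) [Fwd S N l]"
    using left_roof[OF zz_appendI[OF uv(2) r]] by blast
  have cN: "cpx N" and cP: "cpx P" using N P by auto
  have s: "zz P [Fwd P N s] N" by (rule zz_qi[OF P(1) N(1,2)])
  let ?k = "ccomp S s k"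
  have k: "?k \<in> cmaps S N" by (rule ccomp_closed[OF cS cP cN P(3) qi_cmap[OF N(2)]])
  have u': "zeq S N ((u @ [Fwd Y P r]) @ [Fwd P N s]) [Fwd S N ?k]"
    using zeq_cong[OF P(4) s] zeq_feq_comp[OF S P(1) N(1) P(3) qi_cmap[OF N(2)]] by (rule zz_eq.trans)
  have fe: "feq (X i) N (ccomp (X i) ?k (?\<iota> i)) (ccomp (X i) l (?\<iota> i))" for i
  proof (rule zeq_imp_feq[OF X N(1) ccomp_closed[OF cX cS cN \<iota> k] ccomp_closed[OF cX cS cN \<iota> N(3)]])
    have \<iota>z: "zz (X i) [Fwd (X i) S (?\<iota> i)] S" by (rule zz_cmap[OF X S \<iota>])
    have "zeq (X i) N (([Fwd (X i) S (?\<iota> i)] @ u) @ ([Fwd Y P r] @ [Fwd P N s]))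
        (([Fwd (X i) S (?\<iota> i)] @ v) @ ([Fwd Y P r] @ [Fwd P N s]))"
      by (rule zeq_cong[OF eq zz_appendI[OF r s]])
    then have 1: "zeq (X i) N ([Fwd (X i) S (?\<iota> i)] @ ((u @ [Fwd Y P r]) @ [Fwd P N s]))
        ([Fwd (X i) S (?\<iota> i)] @ ((v @ [Fwd Y P r]) @ [Fwd P N s]))"
      unfolding append_assoc .
    have 2: "zeq (X i) N ([Fwd (X i) S (?\<iota> i)] @ [Fwd S N ?k]) ([Fwd (X i) S (?\<iota> i)] @ [Fwd S N l])"
      by (rule zeq_replace[OF 1 zeq_cong2[OF \<iota>z u'] zeq_cong2[OF \<iota>z N(4)]])
    show "zeq (X i) N [Fwd (X i) N (ccomp (X i) ?k (?\<iota> i))] [Fwd (X i) N (ccomp (X i) l (?\<iota> i))]"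
      by (rule zeq_replace[OF 2 zeq_feq_comp[OF X S N(1) \<iota> k] zeq_feq_comp[OF X S N(1) \<iota> N(3)]])
  qed
  have "\<exists>E a b. E \<in> Obj \<and> acyclic_cpx E \<and> a \<in> cmaps (X i) E \<and> b \<in> cmaps E N \<and>
    (\<forall>n. \<forall>x\<in>el (X i) n. ccomp (X i) ?k (?\<iota> i) n x = ccomp (X i) l (?\<iota> i) n x \<oplus>\<^bsub>Deg N n\<^esub> b n (a n x))" for i
    using fe[of i] unfolding feq_def by blast
  then obtain E a b where E: "\<And>i. E i \<in> Obj" "\<And>i. acyclic_cpx (E i)" "\<And>i. a i \<in> cmaps (X i) (E i)"
    "\<And>i. b i \<in> cmaps (E i) N"
    "\<And>i n x. x \<in> el (X i) n \<Longrightarrow>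
      ccomp (X i) ?k (?\<iota> i) n x = ccomp (X i) l (?\<iota> i) n x \<oplus>\<^bsub>Deg N n\<^esub> b i n (a i n x)"
    by metis
  have cE: "cpx (E i)" for i using E by simp
  have CE: "cpx (csum E)" by (rule csum_complex[OF cE])
  note \<theta>m = qi_cmap[OF \<theta>(1)] and \<theta>m' = qi_cmap[OF \<theta>(2)]
  have "feq S N ?k l"
  proof (rule feqI[OF cS cN k N(3) CE usmall_csum[OF E(1)] acyclic_csum[OF cE E(2)]])
    show "ccomp S (csum_map X a) \<theta>' \<in> cmaps S (csum E)"
      by (rule ccomp_closed[OF cS C CE \<theta>m' csum_map_closed[OF cX cE E(3)]])
    show "csum_lift E N b \<in> cmaps (csum E) N" by (rule csum_lift_closed[OF cE cN E(4)])
    fix n x assume x: "x \<in> el S n"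
    have y: "\<theta>' n x \<in> carrier (nat_sum (\<lambda>i. Deg (X i) n))" using cmap_simps(1)[OF cS C \<theta>m' x] by simp
    have "ccomp (csum X) ?k \<theta> n (\<theta>' n x) = ccomp (csum X) l \<theta> n (\<theta>' n x) \<oplus>\<^bsub>Deg N n\<^esub>
      csum_lift E N b n (csum_map X a n (\<theta>' n x))"
    proof (rule csum_diff_factor[OF cX cN cE ccomp_closed[OF C cS cN \<theta>m k] ccomp_closed[OF C cS cN \<theta>m N(3)] E(3,4) _ y])
      fix i m z assume z: "z \<in> el (X i) m"
      have "csum_in X i m z \<in> el (csum X) m" by (rule cmap_simps(1)[OF cX C csum_in_closed[OF cX] z])
      then show "ccomp (csum X) ?k \<theta> m (csum_in X i m z) =
        ccomp (csum X) l \<theta> m (csum_in X i m z) \<oplus>\<^bsub>Deg N m\<^esub> b i m (a i m z)"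
        using E(5)[OF z] z by simp
    qed
    then show "?k n x = l n x \<oplus>\<^bsub>Deg N n\<^esub> csum_lift E N b n (ccomp S (csum_map X a) \<theta>' n x)"
      using x y \<theta>\<theta>'[OF x] by simp
  qed
  then have kl: "zeq S N [Fwd S N ?k] [Fwd S N l]" by (rule feq_zeq[OF S N(1)])
  have "zeq S N ((u @ [Fwd Y P r]) @ [Fwd P N s]) [Fwd S N l]" using u' kl by (rule zz_eq.trans)
  then have "zeq S N ((u @ [Fwd Y P r]) @ [Fwd P N s]) ((v @ [Fwd Y P r]) @ [Fwd P N s])"
    using N(4) by (rule zeq_join)
  then have "zeq S P (u @ [Fwd Y P r]) (v @ [Fwd Y P r])"
    by (rule zeq_cancel_qi_right[OF P(1) N(1,2) zz_appendI[OF uv(1) r] zz_appendI[OF uv(2) r]])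
  then show ?thesis by (rule zeq_cancel_qi_right[OF Y P(1,2) uv])
qed

text \<open>The direct sum is identified with a coproduct in the derived category, to which the
  definition of a localizing subcategory applies.\<close>

lemma localizing_csum:
  fixes X :: "nat \<Rightarrow> ('r, 'u) cochain_complex"
  assumes L: "localizing_subcat R L" and X: "\<And>i. X i \<in> L"
    and Z: "Z \<in> Obj" and s: "qi (csum X) Z s"
  shows "Z \<in> L"
proof -
  have XO: "X i \<in> Obj" for i using localizing_Obj[OF L X] .
  have cX: "cpx (X i)" for i using XO by simp
  have C: "cpx (csum X)" by (rule csum_complex[OF cX])
  obtain S \<theta> \<theta>' where S: "S \<in> Obj" "qi (csum X) S \<theta>" "qi S (csum X) \<theta>'"
    "\<And>n x. x \<in> el (csum X) n \<Longrightarrow> \<theta>' n (\<theta> n x) = x"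
    "\<And>n x. x \<in> el S n \<Longrightarrow> \<theta> n (\<theta>' n x) = x"
    using transportE[OF C usmall_csum[OF XO]] by metis
  have cS: "cpx S" using S by simp
  let ?\<iota> = "\<lambda>i. ccomp (X i) \<theta> (csum_in X i)"
  have \<iota>: "?\<iota> i \<in> cmaps (X i) S" for i
    by (rule ccomp_closed[OF cX C cS csum_in_closed[OF cX] qi_cmap[OF S(2)]])
  have \<iota>z: "zz (X i) [Fwd (X i) S (?\<iota> i)] S" for i by (rule zz_cmap[OF XO S(1) \<iota>])
  \<comment> \<open>Coproducts in the definition are indexed by small subsets of \<open>'u\<close>,
    so the natural numbers are embedded there.\<close>
  obtain e :: "nat \<Rightarrow> 'u" where e: "inj e"
    using infinite_countable_subset[OF infinite_universe] by blast
  let ?F = "\<lambda>u. X (inv_into UNIV e u)" and ?I = "\<lambda>u. zcl (X (inv_into UNIV e u)) S [Fwd (X (inv_into UNIV e u)) S (?\<iota> (inv_into UNIV e u))]"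
  have [simp]: "inv_into UNIV e (e i) = i" for i using e by simp
  have "is_coproduct (Der R) (range e) ?F S ?I"
    unfolding is_coproduct_def Ob_Der
  proof (intro conjI ballI allI impI)
    show "S \<in> Obj" by (rule S(1))
    show "?F u \<in> Obj" for u by (rule XO)
    show "?I u \<in> Hom (Der R) (?F u) S" for u using \<iota>z by (auto simp: Der_def Hom_loc)
    fix Y g assume Y: "Y \<in> Obj" and g: "\<forall>u\<in>range e. g u \<in> Hom (Der R) (?F u) Y"
    have "\<exists>w. zz (X i) w Y \<and> g (e i) = zcl (X i) Y w" for i
      using g by (auto simp: Der_def Hom_loc)
    then obtain w where w: "\<And>i. zz (X i) (w i) Y" "\<And>i. g (e i) = zcl (X i) Y (w i)" by metis
    obtain h where h: "zz S h Y" "\<And>i. zeq (X i) Y ([Fwd (X i) S (?\<iota> i)] @ h) (w i)"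
      using csum_coproduct_exists[OF XO S(1,2,3) Y w(1)] by blast
    show "\<exists>!h. h \<in> Hom (Der R) S Y \<and> (\<forall>u\<in>range e. Comp (Der R) (?F u) S Y h (?I u) = g u)"
    proof (rule ex1I[of _ "zcl S Y h"])
      have "Comp (Der R) (X i) S Y (zcl S Y h) (zcl (X i) S [Fwd (X i) S (?\<iota> i)]) = g (e i)" for i
        using Comp_loc[OF \<iota>z h(1), of i] zcl_eq[OF zz_appendI[OF \<iota>z h(1)]] h(2) w(2)
        unfolding Der_def by metis
      then show "zcl S Y h \<in> Hom (Der R) S Y \<and> (\<forall>u\<in>range e. Comp (Der R) (?F u) S Y (zcl S Y h) (?I u) = g u)"
        using h(1) by (auto simp: Der_def Hom_loc)
      fix k assume k: "k \<in> Hom (Der R) S Y \<and> (\<forall>u\<in>range e. Comp (Der R) (?F u) S Y k (?I u) = g u)"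
      then obtain v where v: "zz S v Y" "k = zcl S Y v" by (auto simp: Der_def Hom_loc)
      have "zcl (X i) Y ([Fwd (X i) S (?\<iota> i)] @ v) = zcl (X i) Y (w i)" for i
      proof -
        have "Comp (Der R) (X i) S Y (zcl S Y v) (zcl (X i) S [Fwd (X i) S (?\<iota> i)]) = zcl (X i) Y (w i)"
          using k v(2) w(2)[of i] by auto
        then show ?thesis using Comp_loc[OF \<iota>z v(1), of i] unfolding Der_def by simp
      qed
      then have "zeq (X i) Y ([Fwd (X i) S (?\<iota> i)] @ v) (w i)" for i
        using zcl_eq[OF zz_appendI[OF \<iota>z v(1)]] by blast
      then have "zeq S Y v h"
        using csum_coproduct_unique[OF XO S(1,2,3,5) v(1) h(1)] h(2) zeq_join by blast
      then show "k = zcl S Y h" using zcl_eq[OF v(1)] v(2) by blast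
    qed
  qed
  moreover have "small (range e)"
    using small_in_image[OF small_in_nat[of UNIV], of e] by (simp add: small_def small_in_def)
  moreover have "?F ` range e \<subseteq> L" using X by auto
  ultimately have "S \<in> L" using L unfolding localizing_subcat_def by blast
  moreover have "qi S Z (ccomp S s \<theta>')" by (rule qi_trans[OF cS C _ S(3) s]) (use Z in simp)
  ultimately show ?thesis using localizing_qi[OF L _ Z] by blast
qed

end

section \<open>Localizations of the ring\<close>

context cring
begin

text \<open>Injectivity is stated as a trivial kernel, which is the condition checked in practice;
  \<open>acts_bij_inj\<close> gives the usual form.\<close>

definition acts_bij :: "'a \<Rightarrow> ('a, 'x) module \<Rightarrow> bool" where
  "acts_bij f N \<longleftrightarrow> (\<forall>x\<in>carrier N. f \<odot>\<^bsub>N\<^esub> x = \<zero>\<^bsub>N\<^esub> \<longrightarrow> x = \<zero>\<^bsub>N\<^esub>) \<and>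
     (\<forall>x\<in>carrier N. \<exists>y\<in>carrier N. f \<odot>\<^bsub>N\<^esub> y = x)"

text \<open>Characterizes \<open>N\<close> as a copy of \<open>R\<^sub>f\<close>, with \<open>e\<close> the image of \<open>1\<close>.\<close>

definition is_loc :: "'a \<Rightarrow> ('a, 'x) module \<Rightarrow> 'x \<Rightarrow> bool" where
  "is_loc f N e \<longleftrightarrow> module R N \<and> e \<in> carrier N \<and> acts_bij f N \<and>
     (\<forall>x\<in>carrier N. \<exists>m::nat. \<exists>r\<in>carrier R. f [^] m \<odot>\<^bsub>N\<^esub> x = r \<odot>\<^bsub>N\<^esub> e) \<and>
     (\<forall>r\<in>carrier R. r \<odot>\<^bsub>N\<^esub> e = \<zero>\<^bsub>N\<^esub> \<longrightarrow> (\<exists>m::nat. f [^] m \<otimes> r = \<zero>))"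

lemma smult_smult:
  "\<lbrakk>module R N; r \<in> carrier R; s \<in> carrier R; x \<in> carrier N\<rbrakk> \<Longrightarrow> r \<odot>\<^bsub>N\<^esub> (s \<odot>\<^bsub>N\<^esub> x) = (r \<otimes> s) \<odot>\<^bsub>N\<^esub> x"
  by (simp add: module.smult_assoc1[of R])

lemma acts_bij_inj:
  assumes "acts_bij f N" "module R N" "f \<in> carrier R" "x \<in> carrier N" "y \<in> carrier N" "f \<odot>\<^bsub>N\<^esub> x = f \<odot>\<^bsub>N\<^esub> y"
  shows "x = y"
proof -
  have "f \<odot>\<^bsub>N\<^esub> (x \<oplus>\<^bsub>N\<^esub> \<ominus>\<^bsub>N\<^esub> y) = f \<odot>\<^bsub>N\<^esub> y \<oplus>\<^bsub>N\<^esub> \<ominus>\<^bsub>N\<^esub> (f \<odot>\<^bsub>N\<^esub> y)"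
    using assms by (simp add: mod_lin)
  also have "\<dots> = \<zero>\<^bsub>N\<^esub>" using assms by simp
  finally have "x \<oplus>\<^bsub>N\<^esub> \<ominus>\<^bsub>N\<^esub> y = \<zero>\<^bsub>N\<^esub>" using assms unfolding acts_bij_def by simp
  then show ?thesis using mod_eq_iff[of N x y] assms by simp
qed

lemma acts_bij_one: "module R N \<Longrightarrow> acts_bij \<one> N"
  by (auto simp: acts_bij_def)

text \<open>Multiplications commute, and a composite of commuting maps is bijective only if both
  are.\<close>

lemma acts_bij_mult:
  assumes "module R N" "f \<in> carrier R" "g \<in> carrier R"
  shows "acts_bij (f \<otimes> g) N \<longleftrightarrow> acts_bij f N \<and> acts_bij g N"
proof
  assume b: "acts_bij (f \<otimes> g) N"
  have *: "acts_bij h N" if h: "h \<in> carrier R" "k \<in> carrier R" "acts_bij (h \<otimes> k) N" for h k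
    unfolding acts_bij_def
  proof (intro conjI ballI impI)
    fix x assume x: "x \<in> carrier N" "h \<odot>\<^bsub>N\<^esub> x = \<zero>\<^bsub>N\<^esub>"
    have "(h \<otimes> k) \<odot>\<^bsub>N\<^esub> x = k \<odot>\<^bsub>N\<^esub> (h \<odot>\<^bsub>N\<^esub> x)"
      unfolding smult_smult[OF assms(1) h(2,1) x(1)] by (simp only: m_comm[OF h(1,2)])
    also have "\<dots> = \<zero>\<^bsub>N\<^esub>" using x(2) assms(1) h by simp
    finally have "(h \<otimes> k) \<odot>\<^bsub>N\<^esub> x = \<zero>\<^bsub>N\<^esub>" .
    then show "x = \<zero>\<^bsub>N\<^esub>" using h(3) x(1) by (simp add: acts_bij_def)
  next
    fix x assume "x \<in> carrier N"
    then obtain y where y: "y \<in> carrier N" "(h \<otimes> k) \<odot>\<^bsub>N\<^esub> y = x" using h(3) by (auto simp: acts_bij_def)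
    then have "h \<odot>\<^bsub>N\<^esub> (k \<odot>\<^bsub>N\<^esub> y) = x" using assms(1) h by (simp add: smult_smult)
    then show "\<exists>y\<in>carrier N. h \<odot>\<^bsub>N\<^esub> y = x" using y(1) assms(1) h by (intro bexI[of _ "k \<odot>\<^bsub>N\<^esub> y"]) auto
  qed
  show "acts_bij f N \<and> acts_bij g N" using *[of f g] *[of g f] b assms m_comm[of f g] by simp
next
  assume b: "acts_bij f N \<and> acts_bij g N"
  show "acts_bij (f \<otimes> g) N"
    unfolding acts_bij_def
  proof (intro conjI ballI impI)
    fix x assume x: "x \<in> carrier N" "(f \<otimes> g) \<odot>\<^bsub>N\<^esub> x = \<zero>\<^bsub>N\<^esub>"
    then have "f \<odot>\<^bsub>N\<^esub> (g \<odot>\<^bsub>N\<^esub> x) = \<zero>\<^bsub>N\<^esub>" using assms by (simp add: smult_smult)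
    moreover have "g \<odot>\<^bsub>N\<^esub> x \<in> carrier N" using assms x by simp
    ultimately have "g \<odot>\<^bsub>N\<^esub> x = \<zero>\<^bsub>N\<^esub>" using b unfolding acts_bij_def by blast
    then show "x = \<zero>\<^bsub>N\<^esub>" using b x(1) unfolding acts_bij_def by blast
  next
    fix x assume "x \<in> carrier N"
    then obtain y where y: "y \<in> carrier N" "f \<odot>\<^bsub>N\<^esub> y = x" using b unfolding acts_bij_def by blast
    then obtain z where z: "z \<in> carrier N" "g \<odot>\<^bsub>N\<^esub> z = y" using b unfolding acts_bij_def by blast
    have "(f \<otimes> g) \<odot>\<^bsub>N\<^esub> z = x" using y z assms smult_smult[of N f g z] by simp
    then show "\<exists>y\<in>carrier N. (f \<otimes> g) \<odot>\<^bsub>N\<^esub> y = x" using z by blast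
  qed
qed

lemma acts_bij_pow: "\<lbrakk>module R N; f \<in> carrier R; acts_bij f N\<rbrakk> \<Longrightarrow> acts_bij (f [^] (m::nat)) N"
  by (induction m) (auto simp: acts_bij_one acts_bij_mult)

lemma is_locD:
  assumes "is_loc f N e"
  shows "module R N" "e \<in> carrier N" "acts_bij f N"
    "\<And>x. x \<in> carrier N \<Longrightarrow> \<exists>m::nat. \<exists>r\<in>carrier R. f [^] m \<odot>\<^bsub>N\<^esub> x = r \<odot>\<^bsub>N\<^esub> e"
    "\<And>r. \<lbrakk>r \<in> carrier R; r \<odot>\<^bsub>N\<^esub> e = \<zero>\<^bsub>N\<^esub>\<rbrakk> \<Longrightarrow> \<exists>m::nat. f [^] m \<otimes> r = \<zero>"
  using assms by (auto simp: is_loc_def)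

lemma localization_ann:
  assumes P: "module R P" "acts_bij f P" "p \<in> carrier P" and f: "f \<in> carrier R" and r: "r \<in> carrier R"
    and "f [^] (m::nat) \<otimes> r = \<zero>"
  shows "r \<odot>\<^bsub>P\<^esub> p = \<zero>\<^bsub>P\<^esub>"
proof -
  have "f [^] m \<odot>\<^bsub>P\<^esub> (r \<odot>\<^bsub>P\<^esub> p) = \<zero>\<^bsub>P\<^esub>" using assms by (simp add: smult_smult)
  then show ?thesis using acts_bij_pow[OF P(1) f P(2), of m] P r unfolding acts_bij_def by simp
qed

text \<open>The universal property from the characterization alone. If \<open>f^n\<close> x = s e in
  \<open>N\<close>, the image of \<open>x\<close> has to be the unique y with \<open>f^n\<close> y =
  s p.\<close>

lemma localization_map:
  assumes N: "is_loc f N e" and f: "f \<in> carrier R"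
    and P: "module R P" "acts_bij f P" "p \<in> carrier P"
  obtains h where "h \<in> lmaps N P" "h e = p"
proof -
  have mN: "module R N" "e \<in> carrier N" by (rule is_locD[OF N])+
  have fc: "f [^] (m::nat) \<in> carrier R" for m using f by simp
  \<comment> \<open>The value does not depend on the chosen fraction: the difference of two
    cross-multiplied numerators annihilates \<open>e\<close>, hence is killed by a power of
    \<open>f\<close>, hence annihilates \<open>p\<close>.\<close>
  have key: "f [^] m \<odot>\<^bsub>P\<^esub> y = r \<odot>\<^bsub>P\<^esub> p"
    if y: "y \<in> carrier P" "f [^] (n::nat) \<odot>\<^bsub>P\<^esub> y = s \<odot>\<^bsub>P\<^esub> p" "f [^] n \<odot>\<^bsub>N\<^esub> x = s \<odot>\<^bsub>N\<^esub> e"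
      and x: "x \<in> carrier N" "f [^] (m::nat) \<odot>\<^bsub>N\<^esub> x = r \<odot>\<^bsub>N\<^esub> e" and rs: "r \<in> carrier R" "s \<in> carrier R"
    for x y m n r s
  proof -
    let ?t = "f [^] n \<otimes> r \<oplus> \<ominus> (f [^] m \<otimes> s)"
    have t: "?t \<in> carrier R" using fc rs by simp
    have neg: "(\<ominus> a) \<odot>\<^bsub>Q\<^esub> q = \<ominus>\<^bsub>Q\<^esub> (a \<odot>\<^bsub>Q\<^esub> q)" if "module R Q" "a \<in> carrier R" "q \<in> carrier Q"
      for a q and Q :: "('a, 'z) module"
      using module.smult_l_minus[OF that] .
    have "?t \<odot>\<^bsub>N\<^esub> e = f [^] n \<odot>\<^bsub>N\<^esub> (r \<odot>\<^bsub>N\<^esub> e) \<oplus>\<^bsub>N\<^esub> \<ominus>\<^bsub>N\<^esub> (f [^] m \<odot>\<^bsub>N\<^esub> (s \<odot>\<^bsub>N\<^esub> e))"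
      using mN fc rs module.smult_l_minus[OF mN(1)] by (simp add: module.smult_l_distr[of R] smult_smult)
    also have "\<dots> = f [^] n \<odot>\<^bsub>N\<^esub> (f [^] m \<odot>\<^bsub>N\<^esub> x) \<oplus>\<^bsub>N\<^esub> \<ominus>\<^bsub>N\<^esub> (f [^] m \<odot>\<^bsub>N\<^esub> (f [^] n \<odot>\<^bsub>N\<^esub> x))"
      by (simp only: y(3) x(2))
    also have "\<dots> = \<zero>\<^bsub>N\<^esub>" using mN fc x(1) mod_smult_comm[of N "f [^] n" "f [^] m" x] by simp
    finally obtain k :: nat where "f [^] k \<otimes> ?t = \<zero>" using is_locD(5)[OF N t] by blast
    then have "?t \<odot>\<^bsub>P\<^esub> p = \<zero>\<^bsub>P\<^esub>" by (rule localization_ann[OF P f t])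
    then have "f [^] n \<odot>\<^bsub>P\<^esub> (r \<odot>\<^bsub>P\<^esub> p) \<oplus>\<^bsub>P\<^esub> \<ominus>\<^bsub>P\<^esub> (f [^] m \<odot>\<^bsub>P\<^esub> (s \<odot>\<^bsub>P\<^esub> p)) = \<zero>\<^bsub>P\<^esub>"
      using P fc rs module.smult_l_minus[OF P(1)] by (simp add: module.smult_l_distr[of R] smult_smult)
    then have "f [^] n \<odot>\<^bsub>P\<^esub> (r \<odot>\<^bsub>P\<^esub> p) = f [^] m \<odot>\<^bsub>P\<^esub> (s \<odot>\<^bsub>P\<^esub> p)"
      using P fc rs by (subst mod_eq_iff[OF P(1)]) simp_all
    also have "\<dots> = f [^] n \<odot>\<^bsub>P\<^esub> (f [^] m \<odot>\<^bsub>P\<^esub> y)"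
      unfolding y(2)[symmetric] using P fc y(1) mod_smult_comm[of P] by blast
    finally have "r \<odot>\<^bsub>P\<^esub> p = f [^] m \<odot>\<^bsub>P\<^esub> y"
      using acts_bij_inj[OF acts_bij_pow[OF P(1) f P(2)] P(1) fc] P fc rs y(1) by simp
    then show ?thesis ..
  qed
  have "\<exists>y\<in>carrier P. \<exists>(n::nat) s. s \<in> carrier R \<and> f [^] n \<odot>\<^bsub>P\<^esub> y = s \<odot>\<^bsub>P\<^esub> p \<and> f [^] n \<odot>\<^bsub>N\<^esub> x = s \<odot>\<^bsub>N\<^esub> e"
    if x: "x \<in> carrier N" for x
  proof -
    obtain n :: nat and s where s: "s \<in> carrier R" "f [^] n \<odot>\<^bsub>N\<^esub> x = s \<odot>\<^bsub>N\<^esub> e"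
      using is_locD(4)[OF N x] by blast
    moreover obtain y where "y \<in> carrier P" "f [^] n \<odot>\<^bsub>P\<^esub> y = s \<odot>\<^bsub>P\<^esub> p"
      using acts_bij_pow[OF P(1) f P(2), of n] P s(1) unfolding acts_bij_def by (metis mod_closed(4))
    ultimately show ?thesis by blast
  qed
  then obtain h n s where h: "\<And>x. x \<in> carrier N \<Longrightarrow> h x \<in> carrier P \<and> s x \<in> carrier R \<and>
      f [^] (n x :: nat) \<odot>\<^bsub>P\<^esub> h x = s x \<odot>\<^bsub>P\<^esub> p \<and> f [^] (n x) \<odot>\<^bsub>N\<^esub> x = s x \<odot>\<^bsub>N\<^esub> e"
    by metis
  have hc: "h x \<in> carrier P" if "x \<in> carrier N" for x using h[OF that] by blast
  have hx: "f [^] m \<odot>\<^bsub>P\<^esub> h x = r \<odot>\<^bsub>P\<^esub> p" if "x \<in> carrier N" "r \<in> carrier R" "f [^] (m::nat) \<odot>\<^bsub>N\<^esub> x = r \<odot>\<^bsub>N\<^esub> e" for x m r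
    using key[of "h x" "n x" "s x" x m r] h[OF that(1)] that by blast
  have cancel: "u = v" if "f [^] (m::nat) \<odot>\<^bsub>P\<^esub> u = f [^] m \<odot>\<^bsub>P\<^esub> v" "u \<in> carrier P" "v \<in> carrier P" for m u v
    using acts_bij_inj[OF acts_bij_pow[OF P(1) f P(2)] P(1) fc] that by blast
  have "(\<lambda>x\<in>carrier N. h x) \<in> lmaps N P"
  proof (rule lin_restrictI[OF hc _ _ mN(1)])
    fix x y assume xy: "x \<in> carrier N" "y \<in> carrier N"
    obtain m r l q where x: "r \<in> carrier R" "f [^] (m::nat) \<odot>\<^bsub>N\<^esub> x = r \<odot>\<^bsub>N\<^esub> e"
      and y: "q \<in> carrier R" "f [^] (l::nat) \<odot>\<^bsub>N\<^esub> y = q \<odot>\<^bsub>N\<^esub> e" using h[OF xy(1)] h[OF xy(2)] by blast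
    have pw: "f [^] (m + l) \<odot>\<^bsub>Q\<^esub> u = f [^] l \<odot>\<^bsub>Q\<^esub> (f [^] m \<odot>\<^bsub>Q\<^esub> u)"
      "f [^] (m + l) \<odot>\<^bsub>Q\<^esub> u = f [^] m \<odot>\<^bsub>Q\<^esub> (f [^] l \<odot>\<^bsub>Q\<^esub> u)"
      if "module R Q" "u \<in> carrier Q" for u and Q :: "('a, 'z) module"
      using that f by (simp_all add: smult_smult nat_pow_mult add.commute[of l m])
    let ?t = "f [^] l \<otimes> r \<oplus> f [^] m \<otimes> q"
    have "f [^] (m + l) \<odot>\<^bsub>N\<^esub> (x \<oplus>\<^bsub>N\<^esub> y) = f [^] l \<odot>\<^bsub>N\<^esub> (r \<odot>\<^bsub>N\<^esub> e) \<oplus>\<^bsub>N\<^esub> f [^] m \<odot>\<^bsub>N\<^esub> (q \<odot>\<^bsub>N\<^esub> e)"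
      using xy mN fc x y f by (simp add: module.smult_r_distr[of R] nat_pow_mult[symmetric] smult_smult[symmetric]
          mod_smult_comm[of N "f [^] m" "f [^] l" x])
    also have "\<dots> = ?t \<odot>\<^bsub>N\<^esub> e" using mN fc x(1) y(1) by (simp add: module.smult_l_distr[of R] smult_smult)
    finally have "f [^] (m + l) \<odot>\<^bsub>P\<^esub> h (x \<oplus>\<^bsub>N\<^esub> y) = ?t \<odot>\<^bsub>P\<^esub> p"
      using hx[of "x \<oplus>\<^bsub>N\<^esub> y" ?t "m + l"] xy mN fc x(1) y(1) by simp
    also have "\<dots> = f [^] l \<odot>\<^bsub>P\<^esub> (r \<odot>\<^bsub>P\<^esub> p) \<oplus>\<^bsub>P\<^esub> f [^] m \<odot>\<^bsub>P\<^esub> (q \<odot>\<^bsub>P\<^esub> p)"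
      using P fc x(1) y(1) by (simp add: module.smult_l_distr[of R] smult_smult)
    also have "\<dots> = f [^] l \<odot>\<^bsub>P\<^esub> (f [^] m \<odot>\<^bsub>P\<^esub> h x) \<oplus>\<^bsub>P\<^esub> f [^] m \<odot>\<^bsub>P\<^esub> (f [^] l \<odot>\<^bsub>P\<^esub> h y)"
      using hx[OF xy(1) x] hx[OF xy(2) y] by (simp only:)
    also have "\<dots> = f [^] (m + l) \<odot>\<^bsub>P\<^esub> (h x \<oplus>\<^bsub>P\<^esub> h y)"
      using P fc f hc[OF xy(1)] hc[OF xy(2)] by (simp add: module.smult_r_distr[of R] nat_pow_mult[symmetric] smult_smult[symmetric]
          mod_smult_comm[of P "f [^] m" "f [^] l" "h x"])
    finally show "h (x \<oplus>\<^bsub>N\<^esub> y) = h x \<oplus>\<^bsub>P\<^esub> h y"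
      by (rule cancel) (use xy hc mN P in auto)
  next
    fix a x assume a: "a \<in> carrier R" "x \<in> carrier N"
    obtain m r where x: "r \<in> carrier R" "f [^] (m::nat) \<odot>\<^bsub>N\<^esub> x = r \<odot>\<^bsub>N\<^esub> e" using h[OF a(2)] by blast
    have "f [^] m \<odot>\<^bsub>N\<^esub> (a \<odot>\<^bsub>N\<^esub> x) = (a \<otimes> r) \<odot>\<^bsub>N\<^esub> e"
      using mN a fc x by (simp add: smult_smult[symmetric] mod_smult_comm[of N "f [^] m" a x])
    then have "f [^] m \<odot>\<^bsub>P\<^esub> h (a \<odot>\<^bsub>N\<^esub> x) = (a \<otimes> r) \<odot>\<^bsub>P\<^esub> p"
      using hx[of "a \<odot>\<^bsub>N\<^esub> x" "a \<otimes> r" m] a x(1) mN by simp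
    also have "\<dots> = a \<odot>\<^bsub>P\<^esub> (f [^] m \<odot>\<^bsub>P\<^esub> h x)" using P a x(1) hx[OF a(2) x] by (simp add: smult_smult)
    also have "\<dots> = f [^] m \<odot>\<^bsub>P\<^esub> (a \<odot>\<^bsub>P\<^esub> h x)" using P fc a hc[OF a(2)] mod_smult_comm[of P] by blast
    finally show "h (a \<odot>\<^bsub>N\<^esub> x) = a \<odot>\<^bsub>P\<^esub> h x"
      by (rule cancel) (use a hc mN P in auto)
  qed
  moreover have "h e = p"
  proof -
    have "f [^] (0::nat) \<odot>\<^bsub>P\<^esub> h e = \<one> \<odot>\<^bsub>P\<^esub> p" by (rule hx) (use mN in simp_all)
    then show ?thesis using hc mN P by simp
  qed
  ultimately show ?thesis using that[of "\<lambda>x\<in>carrier N. h x"] mN by simp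
qed

lemma localization_transfer:
  assumes M: "is_loc f M e" and f: "f \<in> carrier R" and N: "module R N"
    and h: "h \<in> lmaps M N" "bij_betw h (carrier M) (carrier N)"
  shows "is_loc f N (h e)"
proof -
  note mM = is_locD[OF M]
  note hs = lin_simps[OF mM(1) N h(1)]
  have ex: "\<exists>x\<in>carrier M. y = h x" if "y \<in> carrier N" for y using that h(2) by (auto simp: bij_betw_def)
  have inj: "x = y" if "h x = h y" "x \<in> carrier M" "y \<in> carrier M" for x y
    using that h(2) by (auto simp: bij_betw_def inj_on_def)
  have z: "x = \<zero>\<^bsub>M\<^esub>" if "h x = \<zero>\<^bsub>N\<^esub>" "x \<in> carrier M" for x
    using inj[of x "\<zero>\<^bsub>M\<^esub>"] that hs(4) mM(1) by simp
  have fc: "f [^] (m::nat) \<in> carrier R" for m using f by simp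
  show ?thesis
    unfolding is_loc_def
  proof (intro conjI N)
    show "h e \<in> carrier N" using hs(1) mM(2) by blast
    show "acts_bij f N"
      unfolding acts_bij_def
    proof (intro conjI ballI impI)
      fix y assume y: "y \<in> carrier N" "f \<odot>\<^bsub>N\<^esub> y = \<zero>\<^bsub>N\<^esub>"
      then obtain x where x: "x \<in> carrier M" "y = h x" using ex by blast
      have "h (f \<odot>\<^bsub>M\<^esub> x) = \<zero>\<^bsub>N\<^esub>" using y x hs(3)[OF f x(1)] by simp
      then have "f \<odot>\<^bsub>M\<^esub> x = \<zero>\<^bsub>M\<^esub>" using z mM(1) f x by simp
      then show "y = \<zero>\<^bsub>N\<^esub>" using mM(3) x hs(4) unfolding acts_bij_def by auto
    next
      fix y assume "y \<in> carrier N"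
      then obtain x where x: "x \<in> carrier M" "y = h x" using ex by blast
      obtain x' where x': "x' \<in> carrier M" "f \<odot>\<^bsub>M\<^esub> x' = x" using mM(3) x(1) unfolding acts_bij_def by blast
      then have "f \<odot>\<^bsub>N\<^esub> h x' = y" using hs(3)[OF f x'(1)] x by simp
      then show "\<exists>x\<in>carrier N. f \<odot>\<^bsub>N\<^esub> x = y" using hs(1)[OF x'(1)] by blast
    qed
    show "\<forall>x\<in>carrier N. \<exists>m::nat. \<exists>r\<in>carrier R. f [^] m \<odot>\<^bsub>N\<^esub> x = r \<odot>\<^bsub>N\<^esub> h e"
    proof
      fix y assume "y \<in> carrier N"
      then obtain x where x: "x \<in> carrier M" "y = h x" using ex by blast
      obtain m :: nat and r where "r \<in> carrier R" "f [^] m \<odot>\<^bsub>M\<^esub> x = r \<odot>\<^bsub>M\<^esub> e" using mM(4)[OF x(1)] by blast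
      then have "r \<in> carrier R" "f [^] m \<odot>\<^bsub>N\<^esub> y = r \<odot>\<^bsub>N\<^esub> h e"
        using hs(3)[OF fc x(1), of m] hs(3)[OF _ mM(2), of r] x by simp_all
      then show "\<exists>m::nat. \<exists>r\<in>carrier R. f [^] m \<odot>\<^bsub>N\<^esub> y = r \<odot>\<^bsub>N\<^esub> h e" by blast
    qed
    show "\<forall>r\<in>carrier R. r \<odot>\<^bsub>N\<^esub> h e = \<zero>\<^bsub>N\<^esub> \<longrightarrow> (\<exists>m::nat. f [^] m \<otimes> r = \<zero>)"
    proof (intro ballI impI)
      fix r assume r: "r \<in> carrier R" "r \<odot>\<^bsub>N\<^esub> h e = \<zero>\<^bsub>N\<^esub>"
      then have "h (r \<odot>\<^bsub>M\<^esub> e) = \<zero>\<^bsub>N\<^esub>" using hs(3)[OF r(1) mM(2)] by simp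
      then have "r \<odot>\<^bsub>M\<^esub> e = \<zero>\<^bsub>M\<^esub>" using z mM(1,2) r(1) by simp
      then show "\<exists>m::nat. f [^] m \<otimes> r = \<zero>" using mM(5) r(1) by blast
    qed
  qed
qed


subsection \<open>The module of fractions\<close>

lemma frac_rel_iff:
  "((a, m), (b, n)) \<in> frac_rel R f \<longleftrightarrow> a \<in> carrier R \<and> b \<in> carrier R \<and>
    (\<exists>k::nat. f [^] k \<otimes> (f [^] n \<otimes> a) = f [^] k \<otimes> (f [^] m \<otimes> b))"
  by (simp add: frac_rel_def)

lemma frac_rel_equiv:
  assumes f: "f \<in> carrier R"
  shows "equiv (carrier R \<times> UNIV) (frac_rel R f)"
proof (rule equivI)
  show "frac_rel R f \<subseteq> (carrier R \<times> UNIV) \<times> (carrier R \<times> UNIV)" by (auto simp: frac_rel_def)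
  show "refl_on (carrier R \<times> UNIV) (frac_rel R f)" by (auto simp: refl_on_def frac_rel_iff)
  show "sym (frac_rel R f)"
  proof (rule symI)
    fix x y assume "(x, y) \<in> frac_rel R f"
    then obtain a m b n and k :: nat where "x = (a, m)" "y = (b, n)" "a \<in> carrier R" "b \<in> carrier R"
      "f [^] k \<otimes> (f [^] m \<otimes> b) = f [^] k \<otimes> (f [^] n \<otimes> a)"
      by (cases x; cases y) (auto simp: frac_rel_iff dest: HOL.sym)
    then show "(y, x) \<in> frac_rel R f" by (auto simp: frac_rel_iff)
  qed
  show "trans (frac_rel R f)"
  proof (rule transI)
    fix x y z assume "(x, y) \<in> frac_rel R f" "(y, z) \<in> frac_rel R f"
    then obtain a m b n c p k l where e: "x = (a, m)" "y = (b, n)" "z = (c, p)"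
      "a \<in> carrier R" "b \<in> carrier R" "c \<in> carrier R"
      "f [^] (k::nat) \<otimes> (f [^] n \<otimes> a) = f [^] k \<otimes> (f [^] m \<otimes> b)"
      "f [^] (l::nat) \<otimes> (f [^] p \<otimes> b) = f [^] l \<otimes> (f [^] n \<otimes> c)"
      by (cases x; cases y; cases z) (auto simp: frac_rel_iff)
    have fc: "f [^] (i::nat) \<in> carrier R" for i using f by simp
    \<comment> \<open>The exponents k and l come from the two given equalities; the power n of the
      middle denominator is what the chain of equalities introduces.\<close>
    have "f [^] (k + l + n) \<otimes> (f [^] p \<otimes> a) = f [^] l \<otimes> (f [^] p \<otimes> (f [^] k \<otimes> (f [^] n \<otimes> a)))"
      using e(4-6) fc f by (simp add: nat_pow_mult[symmetric] m_ac)
    also have "\<dots> = f [^] k \<otimes> (f [^] m \<otimes> (f [^] l \<otimes> (f [^] p \<otimes> b)))"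
      unfolding e(7) using e(4-6) fc by (simp add: m_ac)
    also have "\<dots> = f [^] (k + l + n) \<otimes> (f [^] m \<otimes> c)"
      unfolding e(8) using e(4-6) fc f by (simp add: nat_pow_mult[symmetric] m_ac)
    finally show "(x, z) \<in> frac_rel R f" using e by (auto simp: frac_rel_iff)
  qed
qed

lemma frac_eq_iff:
  assumes "f \<in> carrier R" "a \<in> carrier R" "b \<in> carrier R"
  shows "frac R f a m = frac R f b n \<longleftrightarrow>
    (\<exists>k::nat. f [^] k \<otimes> (f [^] n \<otimes> a) = f [^] k \<otimes> (f [^] m \<otimes> b))"
  unfolding frac_def using eq_equiv_class_iff[OF frac_rel_equiv[OF assms(1)], of "(a, m)" "(b, n)"] assms
  by (simp add: frac_rel_iff)

lemma frac_mem: "(b, n) \<in> frac R f a m \<longleftrightarrow> ((a, m), (b, n)) \<in> frac_rel R f"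
  by (simp add: frac_def)

lemma frac_expand:
  assumes "f \<in> carrier R" "a \<in> carrier R"
  shows "frac R f a m = frac R f (f [^] (k::nat) \<otimes> a) (m + k)"
  using assms by (subst frac_eq_iff) (auto simp: nat_pow_mult[symmetric] m_ac intro!: exI[of _ 0])

lemma loc_ring_carrier:
  "carrier (loc_ring R f) = {frac R f a m | a m. a \<in> carrier R}"
  by (auto simp: loc_ring_def quotient_def frac_def)

lemma UN_constI: "\<lbrakk>x \<in> A; \<And>y. y \<in> A \<Longrightarrow> F y = c\<rbrakk> \<Longrightarrow> (\<Union>y\<in>A. F y) = c"
  by blast

text \<open>Equal denominators are enough: \<open>loc_ring_two\<close> expands any two fractions to
  a common denominator, and then the module laws reduce to those of the ring.\<close>

lemma frac_add:
  assumes f: "f \<in> carrier R" and a: "a \<in> carrier R" and b: "b \<in> carrier R"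
  shows "frac R f a m \<oplus>\<^bsub>loc_ring R f\<^esub> frac R f b m = frac R f (a \<oplus> b) m"
proof -
  have fc: "f [^] (i::nat) \<in> carrier R" for i using f by simp
  have *: "frac R f (f [^] n' \<otimes> a' \<oplus> f [^] m' \<otimes> b') (m' + n') = frac R f (a \<oplus> b) m"
    if A: "(a', m') \<in> frac R f a m" and B: "(b', n') \<in> frac R f b m" for a' m' b' n'
  proof -
    obtain k l :: nat where e: "a' \<in> carrier R" "b' \<in> carrier R"
      "f [^] k \<otimes> (f [^] m' \<otimes> a) = f [^] k \<otimes> (f [^] m \<otimes> a')"
      "f [^] l \<otimes> (f [^] n' \<otimes> b) = f [^] l \<otimes> (f [^] m \<otimes> b')"
      using A B by (auto simp: frac_mem frac_rel_iff)
    have "f [^] (k + l) \<otimes> (f [^] m \<otimes> (f [^] n' \<otimes> a' \<oplus> f [^] m' \<otimes> b')) =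
      f [^] l \<otimes> (f [^] n' \<otimes> (f [^] k \<otimes> (f [^] m \<otimes> a'))) \<oplus> f [^] k \<otimes> (f [^] m' \<otimes> (f [^] l \<otimes> (f [^] m \<otimes> b')))"
      using e(1,2) fc f by (simp add: nat_pow_mult[symmetric] r_distr m_ac)
    also have "\<dots> = f [^] (k + l) \<otimes> (f [^] (m' + n') \<otimes> (a \<oplus> b))"
      unfolding e(3,4)[symmetric] using a b fc f by (simp add: nat_pow_mult[symmetric] r_distr m_ac)
    finally show ?thesis using e(1,2) a b f by (subst frac_eq_iff) auto
  qed
  have "(a, m) \<in> frac R f a m" "(b, m) \<in> frac R f b m" using a b by (auto simp: frac_mem frac_rel_iff)
  moreover have "(case p of (a', m') \<Rightarrow> \<Union>(b', n')\<in>frac R f b m. frac R f (f [^] n' \<otimes> a' \<oplus> f [^] m' \<otimes> b') (m' + n'))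
      = frac R f (a \<oplus> b) m" if p: "p \<in> frac R f a m" for p
  proof -
    obtain a' m' where p': "p = (a', m')" by (cases p)
    have "(case q of (b', n') \<Rightarrow> frac R f (f [^] n' \<otimes> a' \<oplus> f [^] m' \<otimes> b') (m' + n')) = frac R f (a \<oplus> b) m"
      if "q \<in> frac R f b m" for q
      using *[of a' m' "fst q" "snd q"] p p' that by (simp add: case_prod_beta)
    then show ?thesis unfolding p' prod.case by (rule UN_constI[OF \<open>(b, m) \<in> frac R f b m\<close>])
  qed
  ultimately have "(\<Union>(a', m')\<in>frac R f a m. \<Union>(b', n')\<in>frac R f b m. frac R f (f [^] n' \<otimes> a' \<oplus> f [^] m' \<otimes> b') (m' + n'))
      = frac R f (a \<oplus> b) m"
    by (intro UN_constI)
  then show ?thesis by (simp add: loc_ring_def)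
qed

lemma frac_smult:
  assumes f: "f \<in> carrier R" and a: "a \<in> carrier R" and r: "r \<in> carrier R"
  shows "r \<odot>\<^bsub>loc_ring R f\<^esub> frac R f a m = frac R f (r \<otimes> a) m"
proof -
  have fc: "f [^] (i::nat) \<in> carrier R" for i using f by simp
  have *: "frac R f (r \<otimes> a') m' = frac R f (r \<otimes> a) m" if A: "(a', m') \<in> frac R f a m" for a' m'
  proof -
    obtain k :: nat where e: "a' \<in> carrier R" "f [^] k \<otimes> (f [^] m' \<otimes> a) = f [^] k \<otimes> (f [^] m \<otimes> a')"
      using A by (auto simp: frac_mem frac_rel_iff)
    have "f [^] k \<otimes> (f [^] m \<otimes> (r \<otimes> a')) = r \<otimes> (f [^] k \<otimes> (f [^] m \<otimes> a'))"
      using e(1) fc r by (simp add: m_ac)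
    also have "\<dots> = f [^] k \<otimes> (f [^] m' \<otimes> (r \<otimes> a))"
      unfolding e(2)[symmetric] using a r fc by (simp add: m_ac)
    finally show ?thesis using e(1) a r f by (subst frac_eq_iff) auto
  qed
  have "(a, m) \<in> frac R f a m" using a by (auto simp: frac_mem frac_rel_iff)
  moreover have "(case p of (a', m') \<Rightarrow> frac R f (r \<otimes> a') m') = frac R f (r \<otimes> a) m"
    if "p \<in> frac R f a m" for p
    using *[of "fst p" "snd p"] that by (simp add: case_prod_beta)
  ultimately have "(\<Union>(a', m')\<in>frac R f a m. frac R f (r \<otimes> a') m') = frac R f (r \<otimes> a) m"
    by (intro UN_constI)
  then show ?thesis by (simp add: loc_ring_def)
qed

lemma loc_ring_two:
  assumes f: "f \<in> carrier R" and "x \<in> carrier (loc_ring R f)" "y \<in> carrier (loc_ring R f)"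
  obtains a b m where "a \<in> carrier R" "b \<in> carrier R" "x = frac R f a m" "y = frac R f b m"
proof -
  obtain a m b n where e: "a \<in> carrier R" "b \<in> carrier R" "x = frac R f a m" "y = frac R f b n"
    using assms(2,3) by (auto simp: loc_ring_carrier)
  then show ?thesis using that[of "f [^] n \<otimes> a" "f [^] m \<otimes> b" "m + n"] f
      frac_expand[OF f e(1), of m n] frac_expand[OF f e(2), of n m] by (simp add: add.commute)
qed

lemma loc_ring_zero: "\<zero>\<^bsub>loc_ring R f\<^esub> = frac R f \<zero> 0"
  by (simp add: loc_ring_def)

lemma frac_zero: "f \<in> carrier R \<Longrightarrow> frac R f \<zero> m = \<zero>\<^bsub>loc_ring R f\<^esub>"
  unfolding loc_ring_zero by (subst frac_eq_iff) auto

lemma loc_ring_module: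
  assumes f: "f \<in> carrier R"
  shows "module R (loc_ring R f)"
proof (rule moduleI)
  let ?L = "loc_ring R f"
  note car = loc_ring_carrier
  have mem: "frac R f a m \<in> carrier ?L" if "a \<in> carrier R" for a m using that by (auto simp: car)
  show "abelian_group ?L"
  proof (rule abelian_groupI)
    fix x y assume xy: "x \<in> carrier ?L" "y \<in> carrier ?L"
    obtain a b m where e: "a \<in> carrier R" "b \<in> carrier R" "x = frac R f a m" "y = frac R f b m"
      using loc_ring_two[OF f xy] .
    show "x \<oplus>\<^bsub>?L\<^esub> y \<in> carrier ?L" "x \<oplus>\<^bsub>?L\<^esub> y = y \<oplus>\<^bsub>?L\<^esub> x"
      using e f mem by (simp_all add: frac_add a_comm)
    fix z assume "z \<in> carrier ?L"
    then obtain c n where c: "c \<in> carrier R" "z = frac R f c n" by (auto simp: car)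
    have e': "x = frac R f (f [^] n \<otimes> a) (m + n)" "y = frac R f (f [^] n \<otimes> b) (m + n)"
      "z = frac R f (f [^] m \<otimes> c) (m + n)"
      using frac_expand[OF f e(1), of m n] frac_expand[OF f e(2), of m n] frac_expand[OF f c(1), of n m] e c
      by (simp_all add: add.commute)
    show "(x \<oplus>\<^bsub>?L\<^esub> y) \<oplus>\<^bsub>?L\<^esub> z = x \<oplus>\<^bsub>?L\<^esub> (y \<oplus>\<^bsub>?L\<^esub> z)"
      unfolding e' using e(1,2) c(1) f by (simp add: frac_add a_assoc)
  next
    show "\<zero>\<^bsub>?L\<^esub> \<in> carrier ?L" using mem by (simp add: loc_ring_zero)
    fix x assume "x \<in> carrier ?L"
    then obtain a m where e: "a \<in> carrier R" "x = frac R f a m" by (auto simp: car)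
    show "\<zero>\<^bsub>?L\<^esub> \<oplus>\<^bsub>?L\<^esub> x = x"
      unfolding frac_zero[OF f, of m, symmetric] e(2) using e(1) f by (simp add: frac_add)
    have "frac R f (\<ominus> a) m \<oplus>\<^bsub>?L\<^esub> x = \<zero>\<^bsub>?L\<^esub>" using e f by (simp add: frac_add l_neg frac_zero)
    then show "\<exists>y\<in>carrier ?L. y \<oplus>\<^bsub>?L\<^esub> x = \<zero>\<^bsub>?L\<^esub>" using mem[of "\<ominus> a" m] e(1) by blast
  qed
  fix r s x assume r: "r \<in> carrier R" "s \<in> carrier R" and x: "x \<in> carrier ?L"
  obtain a m where e: "a \<in> carrier R" "x = frac R f a m" using x by (auto simp: car)
  show "(r \<oplus> s) \<odot>\<^bsub>?L\<^esub> x = r \<odot>\<^bsub>?L\<^esub> x \<oplus>\<^bsub>?L\<^esub> s \<odot>\<^bsub>?L\<^esub> x" "(r \<otimes> s) \<odot>\<^bsub>?L\<^esub> x = r \<odot>\<^bsub>?L\<^esub> (s \<odot>\<^bsub>?L\<^esub> x)"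
    using r e f by (simp_all add: frac_add frac_smult l_distr m_assoc)
next
  let ?L = "loc_ring R f"
  show "cring R" by (rule is_cring)
  fix r x assume r: "r \<in> carrier R" and x: "x \<in> carrier ?L"
  obtain a m where e: "a \<in> carrier R" "x = frac R f a m" using x by (auto simp: loc_ring_carrier)
  show "r \<odot>\<^bsub>?L\<^esub> x \<in> carrier ?L"
    using r e f by (auto simp: frac_smult loc_ring_carrier)
  fix y assume y: "y \<in> carrier ?L"
  obtain a b m where "a \<in> carrier R" "b \<in> carrier R" "x = frac R f a m" "y = frac R f b m"
    using loc_ring_two[OF f x y] .
  then show "r \<odot>\<^bsub>?L\<^esub> (x \<oplus>\<^bsub>?L\<^esub> y) = r \<odot>\<^bsub>?L\<^esub> x \<oplus>\<^bsub>?L\<^esub> r \<odot>\<^bsub>?L\<^esub> y"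
    using r f by (simp add: frac_add frac_smult r_distr)
next
  fix x assume "x \<in> carrier (loc_ring R f)"
  then show "\<one> \<odot>\<^bsub>loc_ring R f\<^esub> x = x" using f by (auto simp: loc_ring_carrier frac_smult)
qed

lemma loc_ring_localization:
  assumes f: "f \<in> carrier R"
  shows "is_loc f (loc_ring R f) (frac R f \<one> 0)"
proof -
  let ?L = "loc_ring R f"
  have fc: "f [^] (i::nat) \<in> carrier R" for i using f by simp
  show ?thesis
    unfolding is_loc_def acts_bij_def
  proof (intro conjI ballI impI loc_ring_module[OF f])
    show "frac R f \<one> 0 \<in> carrier ?L" by (auto simp: loc_ring_carrier)
    {
      fix x assume x: "x \<in> carrier ?L" "f \<odot>\<^bsub>?L\<^esub> x = \<zero>\<^bsub>?L\<^esub>"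
      obtain a m where e: "a \<in> carrier R" "x = frac R f a m" using x by (auto simp: loc_ring_carrier)
      have "frac R f (f \<otimes> a) m = frac R f \<zero> 0" using x e f by (simp add: frac_smult loc_ring_zero)
      then obtain k :: nat where "f [^] k \<otimes> (f [^] (0::nat) \<otimes> (f \<otimes> a)) = f [^] k \<otimes> (f [^] m \<otimes> \<zero>)"
        using e f by (auto simp: frac_eq_iff)
      then have "f [^] (Suc k) \<otimes> (f [^] (0::nat) \<otimes> a) = f [^] (Suc k) \<otimes> (f [^] m \<otimes> \<zero>)"
        using e f by (simp add: m_ac)
      then show "x = \<zero>\<^bsub>?L\<^esub>" unfolding e(2) loc_ring_zero using e f by (subst frac_eq_iff) (auto intro: exI[of _ "Suc k"])
    next
      fix x assume "x \<in> carrier ?L"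
      then obtain a m where e: "a \<in> carrier R" "x = frac R f a m" by (auto simp: loc_ring_carrier)
      have "f \<odot>\<^bsub>?L\<^esub> frac R f a (Suc m) = x"
        using e f frac_expand[OF f e(1), of m 1] by (simp add: frac_smult)
      then show "\<exists>y\<in>carrier ?L. f \<odot>\<^bsub>?L\<^esub> y = x" using e by (auto simp: loc_ring_carrier)
      have "f [^] m \<odot>\<^bsub>?L\<^esub> x = a \<odot>\<^bsub>?L\<^esub> frac R f \<one> 0"
        using e f frac_expand[OF f e(1), of 0 m] by (simp add: frac_smult)
      then show "\<exists>m::nat. \<exists>r\<in>carrier R. f [^] m \<odot>\<^bsub>?L\<^esub> x = r \<odot>\<^bsub>?L\<^esub> frac R f \<one> 0" using e by blast
    next
      fix r assume r: "r \<in> carrier R" "r \<odot>\<^bsub>?L\<^esub> frac R f \<one> 0 = \<zero>\<^bsub>?L\<^esub>"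
      then have "frac R f r 0 = frac R f \<zero> 0" using f by (simp add: frac_smult loc_ring_zero)
      then show "\<exists>m::nat. f [^] m \<otimes> r = \<zero>" using r f by (auto simp: frac_eq_iff)
    }
  qed
qed

end

section \<open>Exact sequences and localizing subcategories\<close>

context cring
begin

definition short_exact where
  "short_exact M N P \<phi> \<psi> \<longleftrightarrow> \<phi> \<in> lmaps M N \<and> \<psi> \<in> lmaps N P \<and>
     (\<forall>x\<in>carrier M. \<phi> x = \<zero>\<^bsub>N\<^esub> \<longrightarrow> x = \<zero>\<^bsub>M\<^esub>) \<and> (\<forall>x\<in>carrier M. \<psi> (\<phi> x) = \<zero>\<^bsub>P\<^esub>) \<and>
     (\<forall>y\<in>carrier N. \<psi> y = \<zero>\<^bsub>P\<^esub> \<longrightarrow> (\<exists>x\<in>carrier M. y = \<phi> x)) \<and> (\<forall>z\<in>carrier P. \<exists>y\<in>carrier N. z = \<psi> y)"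

lemma short_exactD:
  assumes "short_exact M N P \<phi> \<psi>"
  shows "\<phi> \<in> lmaps M N" "\<psi> \<in> lmaps N P"
    "\<And>x. \<lbrakk>x \<in> carrier M; \<phi> x = \<zero>\<^bsub>N\<^esub>\<rbrakk> \<Longrightarrow> x = \<zero>\<^bsub>M\<^esub>" "\<And>x. x \<in> carrier M \<Longrightarrow> \<psi> (\<phi> x) = \<zero>\<^bsub>P\<^esub>"
    "\<And>y. \<lbrakk>y \<in> carrier N; \<psi> y = \<zero>\<^bsub>P\<^esub>\<rbrakk> \<Longrightarrow> \<exists>x\<in>carrier M. y = \<phi> x" "\<And>z. z \<in> carrier P \<Longrightarrow> \<exists>y\<in>carrier N. z = \<psi> y"
  using assms unfolding short_exact_def by blast+

lemma lin_maps_compose: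
  assumes M: "module R M" and N: "module R N" and P: "module R P" and h: "h \<in> lmaps M N" and k: "k \<in> lmaps N P"
  shows "(\<lambda>x\<in>carrier M. k (h x)) \<in> lmaps M P"
  by (rule lin_restrictI) (use M in \<open>simp_all add: lin_simps[OF M N h] lin_simps[OF N P k]\<close>)

text \<open>Direct sums of modules have carriers outside \<open>'u\<close>. This replaces the two
  left terms of a sequence by copies over \<open>'u\<close>.\<close>

lemma short_exact_transport:
  assumes M: "module R M" "module R M'" and N: "module R N" "module R N'" and P: "module R P"
    and E: "short_exact M N P \<phi> \<psi>"
    and \<alpha>: "\<alpha> \<in> lmaps M' M" "\<alpha>' \<in> lmaps M M'"
      "\<And>x. x \<in> carrier M \<Longrightarrow> \<alpha> (\<alpha>' x) = x" "\<And>x. x \<in> carrier M' \<Longrightarrow> \<alpha>' (\<alpha> x) = x"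
    and \<beta>: "\<beta> \<in> lmaps N' N" "\<beta>' \<in> lmaps N N'"
      "\<And>x. x \<in> carrier N \<Longrightarrow> \<beta> (\<beta>' x) = x" "\<And>x. x \<in> carrier N' \<Longrightarrow> \<beta>' (\<beta> x) = x"
  shows "short_exact M' N' P (\<lambda>x\<in>carrier M'. \<beta>' (\<phi> (\<alpha> x))) (\<lambda>y\<in>carrier N'. \<psi> (\<beta> y))"
proof -
  note E = short_exactD[OF E]
  note as = lin_simps[OF M(2,1) \<alpha>(1)] and as' = lin_simps[OF M(1,2) \<alpha>(2)]
  note bs = lin_simps[OF N(2,1) \<beta>(1)] and bs' = lin_simps[OF N(1,2) \<beta>(2)]
  note ps = lin_simps[OF M(1) N(1) E(1)]
  have m: "(\<lambda>x\<in>carrier M'. \<beta>' (\<phi> (\<alpha> x))) \<in> lmaps M' N'"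
    by (rule lin_restrictI) (use M(2) in \<open>simp_all add: as ps bs'\<close>)
  show ?thesis
    unfolding short_exact_def
  proof (intro conjI ballI impI m lin_maps_compose[OF N(2,1) P \<beta>(1) E(2)])
    fix x assume x: "x \<in> carrier M'" "(\<lambda>x\<in>carrier M'. \<beta>' (\<phi> (\<alpha> x))) x = \<zero>\<^bsub>N'\<^esub>"
    then have "\<beta> (\<beta>' (\<phi> (\<alpha> x))) = \<zero>\<^bsub>N\<^esub>" using bs(4) by simp
    then have "\<phi> (\<alpha> x) = \<zero>\<^bsub>N\<^esub>" using \<beta>(3) ps(1) as(1) x(1) by simp
    then have "\<alpha> x = \<zero>\<^bsub>M\<^esub>" using E(3) as(1) x(1) by blast
    then show "x = \<zero>\<^bsub>M'\<^esub>" using \<alpha>(4)[OF x(1)] as'(4) by simp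
  next
    fix x assume x: "x \<in> carrier M'"
    then show "(\<lambda>y\<in>carrier N'. \<psi> (\<beta> y)) ((\<lambda>x\<in>carrier M'. \<beta>' (\<phi> (\<alpha> x))) x) = \<zero>\<^bsub>P\<^esub>"
      using E(4) by (simp add: as(1) ps(1) bs'(1) \<beta>(3))
  next
    fix y assume y: "y \<in> carrier N'" "(\<lambda>y\<in>carrier N'. \<psi> (\<beta> y)) y = \<zero>\<^bsub>P\<^esub>"
    then have "\<psi> (\<beta> y) = \<zero>\<^bsub>P\<^esub>" by simp
    then obtain x where x: "x \<in> carrier M" "\<beta> y = \<phi> x" using E(5) bs(1) y(1) by blast
    then show "\<exists>x\<in>carrier M'. y = (\<lambda>x\<in>carrier M'. \<beta>' (\<phi> (\<alpha> x))) x"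
      using \<beta>(4)[OF y(1)] \<alpha>(3) as'(1) by (intro bexI[of _ "\<alpha>' x"]) auto
  next
    fix z assume "z \<in> carrier P"
    then obtain y where "y \<in> carrier N" "z = \<psi> y" using E(6) by blast
    then show "\<exists>y\<in>carrier N'. z = (\<lambda>y\<in>carrier N'. \<psi> (\<beta> y)) y"
      using \<beta>(3) bs'(1) by (intro bexI[of _ "\<beta>' y"]) auto
  qed
qed

end

context derived_category
begin

definition deg0 :: "('r, 'u) cochain_complex \<Rightarrow> bool" where
  "deg0 X \<longleftrightarrow> X \<in> Obj \<and> (\<forall>n. n \<noteq> 0 \<longrightarrow> el X n = {zr X n})"

lemma deg0_Obj: "deg0 X \<Longrightarrow> X \<in> Obj"
  by (simp add: deg0_def)

lemma deg0_zero: "\<lbrakk>deg0 X; x \<in> el X n; n \<noteq> 0\<rbrakk> \<Longrightarrow> x = zr X n"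
  by (auto simp: deg0_def)

lemma deg0_Diff:
  assumes X: "deg0 X" and x: "x \<in> el X n"
  shows "Diff X n x = zr X (n + 1)"
proof (cases "n = 0")
  case True
  have "Diff X n x \<in> el X (n + 1)" by (rule Diff_simps(1)) (use x deg0_Obj[OF X] in auto)
  then show ?thesis by (rule deg0_zero[OF X]) (simp add: True)
next
  case False
  then show ?thesis using deg0_zero[OF X x] deg0_Obj[OF X] by simp
qed

definition ext0 where "ext0 X Y h = cres X (\<lambda>n x. if n = 0 then h x else zr Y n)"

lemma ext0_apply: "x \<in> el X n \<Longrightarrow> ext0 X Y h n x = (if n = 0 then h x else zr Y n)"
  by (simp add: ext0_def)

lemma ext0_closed:
  assumes X: "deg0 X" and Y: "deg0 Y" and h: "h \<in> lmaps (Deg X 0) (Deg Y 0)"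
  shows "ext0 X Y h \<in> cmaps X Y"
proof -
  have c: "cpx X" "cpx Y" using X Y deg0_Obj by auto
  note hs = lin_simps[OF complex_module[OF c(1)] complex_module[OF c(2)] h]
  show ?thesis
    unfolding ext0_def
  proof (rule cres_mapsI[OF c(1)])
    fix n x assume x: "x \<in> el X n"
    show k: "(if n = 0 then h x else zr Y n) \<in> el Y n" using hs(1)[of x] x c by auto
    then show "Diff Y n (if n = 0 then h x else zr Y n) =
        (if n + 1 = 0 then h (Diff X n x) else zr Y (n + 1))"
      using deg0_Diff[OF Y k] deg0_Diff[OF X x] hs(4) by auto
  qed (use hs(2,3) c in auto)
qed

lemma zero_lin: "\<lbrakk>module R M; module R N\<rbrakk> \<Longrightarrow> (\<lambda>x\<in>carrier M. \<zero>\<^bsub>N\<^esub>) \<in> lmaps M N"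
  by (rule lin_restrictI) auto

text \<open>Besides the quasi-isomorphism it returns the inverse linear maps in degree 0, which are
  needed to transport short exact sequences to the copy.\<close>

lemma transport_degree_0:
  fixes X :: "('r, 'x) cochain_complex"
  assumes X: "cpx X" "usmall X" and z: "\<And>n. n \<noteq> 0 \<Longrightarrow> el X n = {zr X n}"
  obtains Z \<theta> \<alpha> \<beta> where "deg0 Z" "qi X Z \<theta>"
    "\<alpha> \<in> lmaps (Deg X 0) (Deg Z 0)" "\<beta> \<in> lmaps (Deg Z 0) (Deg X 0)"
    "\<And>x. x \<in> el X 0 \<Longrightarrow> \<beta> (\<alpha> x) = x" "\<And>z. z \<in> el Z 0 \<Longrightarrow> \<alpha> (\<beta> z) = z"
proof -
  obtain Z \<theta> \<psi> where Z: "Z \<in> Obj" "qi X Z \<theta>" "qi Z X \<psi>"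
    "\<And>n x. x \<in> el X n \<Longrightarrow> \<psi> n (\<theta> n x) = x" "\<And>n z. z \<in> el Z n \<Longrightarrow> \<theta> n (\<psi> n z) = z"
    using transportE[OF X] by metis
  have cZ: "cpx Z" using Z by simp
  note t = cmap_simps[OF X(1) cZ qi_cmap[OF Z(2)]] and p = cmap_simps[OF cZ X(1) qi_cmap[OF Z(3)]]
  have "el Z n = {zr Z n}" if "n \<noteq> 0" for n
  proof -
    have "w = zr Z n" if w: "w \<in> el Z n" for w
    proof -
      have "\<psi> n w = zr X n" using p(1)[OF w] z[OF \<open>n \<noteq> 0\<close>] by blast
      then show ?thesis using Z(5)[OF w] t(4) by metis
    qed
    moreover have "zr Z n \<in> el Z n" using cZ by simp
    ultimately show ?thesis by blast
  qed
  then have "deg0 Z" using Z(1) by (simp add: deg0_def)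
  then show ?thesis
    using that[of Z \<theta> "\<theta> 0" "\<psi> 0", OF _ Z(2) _ _ Z(4,5)] qi_cmap[OF Z(2)] qi_cmap[OF Z(3)] by (simp add: cochain_maps_def)
qed

text \<open>For an injective map the cone is quasi-isomorphic to the cokernel, so the cokernel is
  reached by a triangle.\<close>

lemma localizing_cokernel:
  assumes L: "localizing_subcat R L" and X: "X \<in> L" "deg0 X" and Y: "Y \<in> L" "deg0 Y"
    and Z: "deg0 Z"
    and E: "short_exact (Deg X 0) (Deg Y 0) (Deg Z 0) \<phi> \<psi>"
  shows "Z \<in> L"
proof -
  have c: "cpx X" "cpx Y" "cpx Z" using X Y Z deg0_Obj by auto
  note \<phi> = short_exactD(1)[OF E] and \<psi> = short_exactD(2)[OF E] and inj = short_exactD(3)[OF E]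
    and comp = short_exactD(4)[OF E] and exact = short_exactD(5)[OF E] and surj = short_exactD(6)[OF E]
  let ?f = "ext0 X Y \<phi>" and ?g = "ext0 Y Z \<psi>"
  have f: "?f \<in> cmaps X Y" and g: "?g \<in> cmaps Y Z"
    using ext0_closed X Y Z \<phi> \<psi> by blast+
  let ?h = "\<lambda>n. \<lambda>x\<in>el X (n + 1). zr Z n"
  note [simp] = c cmap_simps[OF c(1,2) f] cmap_simps[OF c(2,3) g]
  have C: "cpx (cone X Y ?f)" by (rule cone_complex[OF c(1,2) f])
  have s: "cone_out X Y ?f Z ?h ?g \<in> cmaps (cone X Y ?f) Z"
  proof (rule cone_out_closed[OF c f g])
    show "?h n \<in> lmaps (Deg X (n + 1)) (Deg Z n)" for n by (rule zero_lin) simp_all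
    fix n x assume x: "x \<in> el X (n + 1)"
    have "?g (n + 1) (?f (n + 1) x) = zr Z (n + 1)"
    proof (cases "n + 1 = 0")
      case True
      then have x0: "x \<in> el X 0" using x by simp
      then have "\<phi> x \<in> el Y 0" using lin_simps(1)[OF _ _ \<phi>] by simp
      then show ?thesis unfolding True using x0 comp by (simp add: ext0_apply)
    next
      case False
      then show ?thesis using x by (simp add: ext0_apply)
    qed
    then show "?g (n + 1) (?f (n + 1) x) = Diff Z n (?h n x) \<oplus>\<^bsub>Deg Z (n + 1)\<^esub> ?h (n + 1) (Diff X (n + 1) x)"
      using x by simp
  qed
  have "qi (cone X Y ?f) Z (cone_out X Y ?f Z ?h ?g)"
  proof (rule qiI[OF s])
    fix n w z
    assume w: "w \<in> el (cone X Y ?f) (n + 1)" "z \<in> el Z n"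
      "Diff (cone X Y ?f) (n + 1) w = zr (cone X Y ?f) (n + 1 + 1)"
      "cone_out X Y ?f Z ?h ?g (n + 1) w = Diff Z n z"
    obtain x y where xy: "w = (x, y)" "x \<in> el X (n + 1 + 1)" "y \<in> el Y (n + 1)"
      using w(1) by auto
    have gy: "?g (n + 1) y = zr Z (n + 1)"
      using w(4) xy deg0_Diff[OF Z w(2)] by (simp add: cone_out_def)
    have fx: "?f (n + 1 + 1) x = zr Y (n + 1 + 1)"
      using w(3) xy deg0_Diff[OF Y(2) xy(3)] by simp
    \<comment> \<open>The first component lives in degree n + 2; injectivity matters only if that
      degree is 0, elsewhere the complex is zero.\<close>
    have x0: "x = zr X (n + 1 + 1)"
    proof (cases "n + 1 + 1 = 0")
      case True
      have "\<phi> x = zr Y 0" "x \<in> el X 0" using fx xy(2) unfolding True by (simp_all add: ext0_apply)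
      then show ?thesis unfolding True by (rule inj[rotated])
    next
      case False
      then show ?thesis using deg0_zero[OF X(2) xy(2)] by simp
    qed
    show "\<exists>v\<in>el (cone X Y ?f) n. w = Diff (cone X Y ?f) n v"
    proof (cases "n + 1 = 0")
      case True
      have "\<psi> y = zr Z 0" "y \<in> el Y 0" using gy xy(3) unfolding True by (simp_all add: ext0_apply)
      then obtain x' where x': "x' \<in> el X 0" "y = \<phi> x'" using exact by blast
      then have "x' \<in> el X (n + 1)" "y = ?f (n + 1) x'" unfolding True by (simp_all add: ext0_apply)
      then show ?thesis using xy(1) x0 deg0_Diff[OF X(2), of x' "n + 1"]
        by (intro bexI[of _ "(x', zr Y n)"]) simp_all
    next
      case False
      then have "y = zr Y (n + 1)" using deg0_zero[OF Y(2) xy(3)] by simp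
      then show ?thesis using xy(1) x0
        by (intro bexI[of _ "(zr X (n + 1), zr Y n)"]) simp_all
    qed
  next
    fix n z assume z: "z \<in> el Z (n + 1)"
    have "\<exists>y\<in>el Y (n + 1). z = ?g (n + 1) y"
    proof (cases "n + 1 = 0")
      case True
      then obtain y where y: "y \<in> el Y 0" "z = \<psi> y" using surj[of z] z by auto
      then show ?thesis unfolding True by (intro bexI[of _ y]) (simp_all add: ext0_apply)
    next
      case False
      then show ?thesis using deg0_zero[OF Z z] by (intro bexI[of _ "zr Y (n + 1)"]) simp_all
    qed
    then obtain y where "y \<in> el Y (n + 1)" "z = ?g (n + 1) y" by blast
    then show "\<exists>x\<in>el (cone X Y ?f) (n + 1). \<exists>w\<in>el Z n.
        Diff (cone X Y ?f) (n + 1) x = zr (cone X Y ?f) (n + 1 + 1) \<and>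
        z = cone_out X Y ?f Z ?h ?g (n + 1) x \<oplus>\<^bsub>Deg Z (n + 1)\<^esub> Diff Z n w"
      using deg0_Diff[OF Y(2)]
      by (intro bexI[of _ "(zr X (n + 1 + 1), y)"] bexI[of _ "zr Z n"]) (simp_all add: cone_out_def)
  qed
  then show ?thesis by (rule localizing_cone[OF L X(1) Y(1) f deg0_Obj[OF Z]])
qed

text \<open>For a surjective map the shift of the kernel is quasi-isomorphic to the cone, and a
  localizing subcategory contains an object as soon as it contains its shift.\<close>

lemma localizing_kernel:
  assumes L: "localizing_subcat R L" and X: "deg0 X" and Y: "Y \<in> L" "deg0 Y"
    and Z: "Z \<in> L" "deg0 Z"
    and E: "short_exact (Deg X 0) (Deg Y 0) (Deg Z 0) \<phi> \<psi>"
  shows "X \<in> L"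
proof -
  have o: "X \<in> Obj" "Y \<in> Obj" "Z \<in> Obj" using X Y Z deg0_Obj by auto
  have c: "cpx X" "cpx Y" "cpx Z" using o by auto
  note \<phi> = short_exactD(1)[OF E] and \<psi> = short_exactD(2)[OF E] and inj = short_exactD(3)[OF E]
    and comp = short_exactD(4)[OF E] and exact = short_exactD(5)[OF E] and surj = short_exactD(6)[OF E]
  let ?f = "ext0 X Y \<phi>" and ?g = "ext0 Y Z \<psi>"
  have f: "?f \<in> cmaps X Y" and g: "?g \<in> cmaps Y Z"
    using ext0_closed X Y Z \<phi> \<psi> by blast+
  note [simp] = c cmap_simps[OF c(1,2) f] cmap_simps[OF c(2,3) g]
  let ?C = "cone Y Z ?g"
  have C: "cpx ?C" by (rule cone_complex[OF c(2,3) g])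
  have gf: "?g n (?f n x) = zr Z n" if x: "x \<in> el X n" for n x
  proof (cases "n = 0")
    case True
    then have x0: "x \<in> el X 0" using x by simp
    then have "\<phi> x \<in> el Y 0" using lin_simps(1)[OF _ _ \<phi>] by simp
    then show ?thesis unfolding True using x0 comp by (simp add: ext0_apply)
  next
    case False
    then show ?thesis using x by (simp add: ext0_apply)
  qed
  \<comment> \<open>The kernel enters through the first summand of the cone; exactness makes the
    second component of the differential vanish.\<close>
  define s where "s = cres (shift X) (\<lambda>n x. (?f (n + 1) x, zr Z n))"
  have s: "s \<in> cmaps (shift X) ?C"
    unfolding s_def
  proof (rule cres_mapsI)
    fix n x assume "x \<in> el (shift X) n"
    then have x: "x \<in> el X (n + 1)" by simp
    show "Diff ?C n (?f (n + 1) x, zr Z n) = (?f (n + 1 + 1) (Diff (shift X) n x), zr Z (n + 1))"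
      using x gf[OF x] by simp
  qed auto
  have sx: "s n x = (?f (n + 1) x, zr Z n)" if "x \<in> el X (n + 1)" for n x
    using that by (simp add: s_def)
  have q: "qi (shift X) ?C s"
  proof (rule qiI[OF s])
    fix n x w
    assume a: "x \<in> el (shift X) (n + 1)" "w \<in> el ?C n" "s (n + 1) x = Diff ?C n w"
    have x: "x \<in> el X (n + 1 + 1)" using a by simp
    obtain y z where "w = (y, z)" "y \<in> el Y (n + 1)" "z \<in> el Z n" using a(2) by auto
    then have fx: "?f (n + 1 + 1) x = zr Y (n + 1 + 1)"
      using a(3) sx[OF x] deg0_Diff[OF Y(2)] by simp
    have "x = zr X (n + 1 + 1)"
    proof (cases "n + 1 + 1 = 0")
      case True
      have "\<phi> x = zr Y 0" "x \<in> el X 0" using fx x unfolding True by (simp_all add: ext0_apply)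
      then show ?thesis unfolding True by (rule inj[rotated])
    next
      case False
      then show ?thesis using deg0_zero[OF X x] by simp
    qed
    then show "\<exists>z\<in>el (shift X) n. x = Diff (shift X) n z"
      by (intro bexI[of _ "zr X (n + 1)"]) simp_all
  next
    fix n w
    assume w: "w \<in> el ?C (n + 1)" "Diff ?C (n + 1) w = zr ?C (n + 1 + 1)"
    obtain y z where yz: "w = (y, z)" "y \<in> el Y (n + 1 + 1)" "z \<in> el Z (n + 1)"
      using w(1) by auto
    have gy: "?g (n + 1 + 1) y = zr Z (n + 1 + 1)"
      using w(2) yz deg0_Diff[OF Z(2) yz(3)] by simp
    have "\<exists>x\<in>el X (n + 1 + 1). y = ?f (n + 1 + 1) x"
    proof (cases "n + 1 + 1 = 0")
      case True
      have "\<psi> y = zr Z 0" "y \<in> el Y 0" using gy yz(2) unfolding True by (simp_all add: ext0_apply)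
      then obtain x where "x \<in> el X 0" "y = \<phi> x" using exact by blast
      then show ?thesis unfolding True by (intro bexI[of _ x]) (simp_all add: ext0_apply)
    next
      case False
      then show ?thesis using deg0_zero[OF Y(2) yz(2)]
        by (intro bexI[of _ "zr X (n + 1 + 1)"]) simp_all
    qed
    then obtain x where x: "x \<in> el X (n + 1 + 1)" "y = ?f (n + 1 + 1) x" by blast
    have "\<exists>y\<in>el Y (n + 1). z = ?g (n + 1) y"
    proof (cases "n + 1 = 0")
      case True
      then obtain y' where "y' \<in> el Y 0" "z = \<psi> y'" using surj[of z] yz(3) by auto
      then show ?thesis unfolding True by (intro bexI[of _ y']) (simp_all add: ext0_apply)
    next
      case False
      then show ?thesis using deg0_zero[OF Z(2) yz(3)]
        by (intro bexI[of _ "zr Y (n + 1)"]) simp_all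
    qed
    then obtain y' where y': "y' \<in> el Y (n + 1)" "z = ?g (n + 1) y'" by blast
    have "Diff (shift X) (n + 1) x = zr (shift X) (n + 1 + 1)"
      using deg0_Diff[OF X x(1)] x(1) by simp
    moreover have "w = s (n + 1) x \<oplus>\<^bsub>Deg ?C (n + 1)\<^esub> Diff ?C n (y', zr Z n)"
      using yz(1) x y' sx[OF x(1)] deg0_Diff[OF Y(2) y'(1)] by simp
    ultimately show "\<exists>x\<in>el (shift X) (n + 1). \<exists>v\<in>el ?C n.
        Diff (shift X) (n + 1) x = zr (shift X) (n + 1 + 1) \<and>
        w = s (n + 1) x \<oplus>\<^bsub>Deg ?C (n + 1)\<^esub> Diff ?C n v"
      using x(1) y'(1) by (intro bexI[of _ x] bexI[of _ "(y', zr Z n)"]) simp_all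
  qed
  have us: "usmall ?C" using usmall_cone Obj_small o by metis
  obtain W \<theta> where W: "W \<in> Obj" "qi ?C W \<theta>" using transportE[OF C us] by metis
  have WL: "W \<in> L" by (rule localizing_cone[OF L Y(1) Z(1) g W])
  have "qi (shift X) W (ccomp (shift X) \<theta> s)" by (rule qi_trans[OF _ C _ q W(2)]) (use W in simp_all)
  then have "shift X \<in> L" using localizing_qi[OF L WL Obj_shift[OF o(1)]] by blast
  then show ?thesis using localizing_shift[OF L o(1)] by blast
qed

text \<open>The sum of \<open>X\<close> and \<open>Y\<close> is the cone of the zero map from the
  unshift of \<open>X\<close> to \<open>Y\<close>; the identity on pairs is an isomorphism of
  complexes.\<close>

lemma localizing_dsum:
  assumes L: "localizing_subcat R L" and X: "X \<in> L" and Y: "Y \<in> L" and Z: "Z \<in> Obj" and s: "qi (dsum X Y) Z s"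
  shows "Z \<in> L"
proof -
  have o: "X \<in> Obj" "Y \<in> Obj" using localizing_Obj[OF L] X Y by auto
  have c: "cpx X" "cpx Y" "cpx Z" using o Z by auto
  have uX: "unshift X \<in> L" using localizing_shift[OF L Obj_unshift[OF o(1)]] X c by (simp add: shift_unshift)
  have z: "czero (unshift X) Y \<in> cmaps (unshift X) Y" using c by simp
  let ?C = "cone (unshift X) Y (czero (unshift X) Y)"
  have C: "cpx ?C" by (rule cone_complex[OF _ c(2) z]) (use c in simp)
  have D: "cpx (dsum X Y)" using c by simp
  define i where "i = cres ?C (\<lambda>n z. z)"
  have "i \<in> cmaps ?C (dsum X Y)"
    unfolding i_def by (rule cres_mapsI[OF C]) (use c in auto)
  moreover have "bij_betw (i n) (el ?C n) (el (dsum X Y) n)" for n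
    by (subst bij_betw_cong[of _ _ "\<lambda>z. z"]) (auto simp: i_def bij_betw_def)
  ultimately have "i \<in> cochain_isos R ?C (dsum X Y)" by (simp add: cochain_isos_def)
  then have "qi ?C (dsum X Y) i" by (rule qi_bij[OF C D])
  then have "qi ?C Z (ccomp ?C s i)" by (rule qi_trans[OF C D c(3) _ s])
  then show ?thesis by (rule localizing_cone[OF L uX Y z Z])
qed

text \<open>A localizing subcategory is nonempty, and the cone of an identity is acyclic, hence
  quasi-isomorphic to zero.\<close>

lemma localizing_zero:
  assumes L: "localizing_subcat R L" and X: "X \<in> Obj" and z: "\<And>n. el X n = {zr X n}"
  shows "X \<in> L"
proof -
  obtain Y where Y: "Y \<in> L" using L unfolding localizing_subcat_def triangulated_subcat_def by blast
  have c: "cpx Y" "cpx X" using localizing_Obj[OF L Y] X by auto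
  let ?C = "cone Y Y (cid Y)"
  have C: "cpx ?C" "acyclic_cpx ?C"
    using cone_complex[OF c(1,1)] acyclic_cone[OF c(1,1)] c by simp_all
  have "qi ?C X (czero ?C X)"
  proof (rule qiI)
    show "czero ?C X \<in> cmaps ?C X" by (rule czero_closed[OF C(1) c(2)])
    fix n x assume "x \<in> el ?C (n + 1)" "Diff ?C (n + 1) x = zr ?C (n + 1 + 1)"
    then show "\<exists>z\<in>el ?C n. x = Diff ?C n z" using acyclicE[OF C(2)] by blast
  next
    fix n x assume x: "x \<in> el X (n + 1)"
    have "x = zr X (n + 1)" using x z by auto
    moreover have "zr ?C (n + 1) \<in> el ?C (n + 1)" "zr X n \<in> el X n"
      using mod_closed(2)[OF complex_module[OF C(1)]] c by simp_all
    moreover have "Diff ?C (n + 1) (zr ?C (n + 1)) = zr ?C (n + 1 + 1)" by (rule Diff_simps(4)[OF C(1)])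
    moreover have "zr X (n + 1) = czero ?C X (n + 1) (zr ?C (n + 1)) \<oplus>\<^bsub>Deg X (n + 1)\<^esub> Diff X n (zr X n)"
      using calculation(2) c by (simp del: cone_simps)
    ultimately show "\<exists>y\<in>el ?C (n + 1). \<exists>w\<in>el X n.
      Diff ?C (n + 1) y = zr ?C (n + 1 + 1) \<and> x = czero ?C X (n + 1) y \<oplus>\<^bsub>Deg X (n + 1)\<^esub> Diff X n w" by metis
  qed
  then show ?thesis by (rule localizing_cone[OF L Y Y cid_closed[OF c(1)] X])
qed

end

section \<open>Short exact sequences of localizations\<close>

context cring
begin

text \<open>Inverting an element that already acts bijectively changes nothing. Applied to powers of
  \<open>f\<close>, this yields closure under roots.\<close>

lemma is_loc_mult:
  assumes N: "is_loc f N e" and f: "f \<in> carrier R" and g: "g \<in> carrier R" and b: "acts_bij g N"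
  shows "is_loc (g \<otimes> f) N e"
proof -
  note D = is_locD[OF N]
  have p: "(g \<otimes> f) [^] (m::nat) = g [^] m \<otimes> f [^] m" for m using nat_pow_distrib[OF g f] .
  show ?thesis
    unfolding is_loc_def
  proof (intro conjI ballI impI D(1,2))
    show "acts_bij (g \<otimes> f) N" using acts_bij_mult[OF D(1) g f] b D(3) by blast
    fix x assume x: "x \<in> carrier N"
    obtain m :: nat and r where r: "r \<in> carrier R" "f [^] m \<odot>\<^bsub>N\<^esub> x = r \<odot>\<^bsub>N\<^esub> e" using D(4)[OF x] by blast
    have "(g \<otimes> f) [^] m \<odot>\<^bsub>N\<^esub> x = g [^] m \<odot>\<^bsub>N\<^esub> (f [^] m \<odot>\<^bsub>N\<^esub> x)"
      using D(1) f g x by (simp add: p smult_smult)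
    also have "\<dots> = (g [^] m \<otimes> r) \<odot>\<^bsub>N\<^esub> e" using D(1,2) g r by (simp add: smult_smult)
    finally have "(g \<otimes> f) [^] m \<odot>\<^bsub>N\<^esub> x = (g [^] m \<otimes> r) \<odot>\<^bsub>N\<^esub> e" .
    then show "\<exists>m::nat. \<exists>r\<in>carrier R. (g \<otimes> f) [^] m \<odot>\<^bsub>N\<^esub> x = r \<odot>\<^bsub>N\<^esub> e" using g r(1) by blast
  next
    fix r assume r: "r \<in> carrier R" "r \<odot>\<^bsub>N\<^esub> e = \<zero>\<^bsub>N\<^esub>"
    then obtain m :: nat where "f [^] m \<otimes> r = \<zero>" using D(5) by blast
    then have "(g \<otimes> f) [^] m \<otimes> r = \<zero>" using f g r(1) by (simp add: p m_assoc)
    then show "\<exists>m::nat. (g \<otimes> f) [^] m \<otimes> r = \<zero>" ..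
  qed
qed

text \<open>Double induction in the manner of Pascal's rule: write the power as one factor u plus
  one factor v times the previous power and use the two neighbouring cases. This avoids the binomial
  theorem.\<close>

lemma power_add_split:
  assumes u: "u \<in> carrier R" and v: "v \<in> carrier R"
  shows "\<exists>p\<in>carrier R. \<exists>q\<in>carrier R. (u \<oplus> v) [^] (m + n :: nat) = p \<otimes> u [^] m \<oplus> q \<otimes> v [^] n"
proof (induction m arbitrary: n)
  case 0
  show ?case using u v by (intro bexI[of _ "(u \<oplus> v) [^] n"] bexI[of _ \<zero>]) simp_all
next
  case (Suc m)
  note IH = Suc
  show ?case
  proof (induction n)
    case 0
    show ?case using u v by (intro bexI[of _ \<zero>] bexI[of _ "(u \<oplus> v) [^] (Suc m)"]) simp_all
  next
    case (Suc n)
    obtain p q where 1: "p \<in> carrier R" "q \<in> carrier R" "(u \<oplus> v) [^] (m + Suc n) = p \<otimes> u [^] m \<oplus> q \<otimes> v [^] (Suc n)"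
      using IH by blast
    obtain p' q' where 2: "p' \<in> carrier R" "q' \<in> carrier R" "(u \<oplus> v) [^] (Suc m + n) = p' \<otimes> u [^] (Suc m) \<oplus> q' \<otimes> v [^] n"
      using Suc by blast
    have e: "(u \<oplus> v) [^] (m + Suc n) = (u \<oplus> v) [^] (Suc m + n)" by simp
    have "(u \<oplus> v) [^] (Suc m + Suc n) = (u \<oplus> v) [^] (m + Suc n) \<otimes> u \<oplus> (u \<oplus> v) [^] (Suc m + n) \<otimes> v"
      unfolding e using u v by (simp add: r_distr)
    also have "\<dots> = (p \<oplus> p' \<otimes> v) \<otimes> u [^] (Suc m) \<oplus> (q \<otimes> u \<oplus> q') \<otimes> v [^] (Suc n)"
      unfolding 1(3) 2(3) using u v 1(1,2) 2(1,2) by (simp add: l_distr r_distr m_ac a_ac)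
    finally show ?case using 1(1,2) 2(1,2) u v by blast
  qed
qed

text \<open>Both maps agree on numerators, and denominators can be cancelled in
  \<open>P\<close>.\<close>

lemma localization_map_unique:
  assumes N: "is_loc f N e" and f: "f \<in> carrier R" and P: "module R P" "acts_bij f P"
    and h: "h \<in> lmaps N P" "k \<in> lmaps N P" "h e = k e" and x: "x \<in> carrier N"
  shows "h x = k x"
proof -
  note D = is_locD[OF N]
  note hs = lin_simps[OF D(1) P(1) h(1)] and ks = lin_simps[OF D(1) P(1) h(2)]
  have fc: "f [^] (m::nat) \<in> carrier R" for m using f by simp
  obtain m :: nat and r where r: "r \<in> carrier R" "f [^] m \<odot>\<^bsub>N\<^esub> x = r \<odot>\<^bsub>N\<^esub> e" using D(4)[OF x] by blast
  have "f [^] m \<odot>\<^bsub>P\<^esub> h x = h (f [^] m \<odot>\<^bsub>N\<^esub> x)" using hs(3)[OF fc x] by simp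
  also have "\<dots> = k (f [^] m \<odot>\<^bsub>N\<^esub> x)" using hs(3)[OF r(1) D(2)] ks(3)[OF r(1) D(2)] h(3) by (simp add: r(2))
  also have "\<dots> = f [^] m \<odot>\<^bsub>P\<^esub> k x" using ks(3)[OF fc x] by simp
  finally show ?thesis
    using acts_bij_inj[OF acts_bij_pow[OF P(1) f P(2)] P(1) fc hs(1)[OF x] ks(1)[OF x]] by simp
qed

lemma pow_kill:
  assumes N: "module R N" "acts_bij f N" "f \<in> carrier R" "x \<in> carrier N" "f [^] (m::nat) \<odot>\<^bsub>N\<^esub> x = \<zero>\<^bsub>N\<^esub>"
  shows "x = \<zero>\<^bsub>N\<^esub>"
  using acts_bij_pow[OF N(1,3,2), of m] N(4,5) unfolding acts_bij_def by blast

lemma pow_inj: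
  assumes N: "module R N" "acts_bij f N" "f \<in> carrier R" "x \<in> carrier N" "y \<in> carrier N"
    "f [^] (m::nat) \<odot>\<^bsub>N\<^esub> x = f [^] m \<odot>\<^bsub>N\<^esub> y"
  shows "x = y"
  using acts_bij_inj[OF acts_bij_pow[OF N(1,3,2), of m] N(1) _ N(4,5,6)] N(3) by simp

lemma pow_root:
  assumes N: "module R N" "acts_bij f N" "f \<in> carrier R" "x \<in> carrier N"
  obtains y where "y \<in> carrier N" "f [^] (m::nat) \<odot>\<^bsub>N\<^esub> y = x"
  using acts_bij_pow[OF N(1,3,2), of m] N(4) unfolding acts_bij_def by blast


subsection \<open>The telescope\<close>

text \<open>The identity minus the shifted multiplication by \<open>b\<close>; its cokernel is the
  sequential colimit of \<open>N\<close> under multiplication by \<open>b\<close>.\<close>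

definition telescope :: "'a \<Rightarrow> ('a, 'x) module \<Rightarrow> (nat \<Rightarrow> 'x) \<Rightarrow> nat \<Rightarrow> 'x" where
  "telescope b N x n = (case n of 0 \<Rightarrow> x 0 | Suc m \<Rightarrow> x (Suc m) \<oplus>\<^bsub>N\<^esub> \<ominus>\<^bsub>N\<^esub> (b \<odot>\<^bsub>N\<^esub> x m))"

lemma telescope_simps [simp]:
  "telescope b N x 0 = x 0" "telescope b N x (Suc m) = x (Suc m) \<oplus>\<^bsub>N\<^esub> \<ominus>\<^bsub>N\<^esub> (b \<odot>\<^bsub>N\<^esub> x m)"
  by (simp_all add: telescope_def)

text \<open>\<open>D\<close> is presented as the colimit of \<open>N\<close> under \<open>b\<close>:
  the map \<open>\<sigma> n\<close> stands for division of the image by the n-th power of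
  \<open>b\<close>. The kernel hypothesis is needed only for \<open>\<sigma> 0\<close>, since
  multiplying by powers of \<open>b\<close> reduces the other maps to it.\<close>

lemma telescope_exact:
  fixes N :: "('a, 'x) module" and D :: "('a, 'y) module"
  assumes N: "module R N" and D: "module R D" and b: "b \<in> carrier R"
    and \<sigma>: "\<And>n. \<sigma> n \<in> lmaps N D"
    and b\<sigma>: "\<And>n x. x \<in> carrier N \<Longrightarrow> b \<odot>\<^bsub>D\<^esub> \<sigma> (Suc n) x = \<sigma> n x"
    and ker: "\<And>x. \<lbrakk>x \<in> carrier N; \<sigma> 0 x = \<zero>\<^bsub>D\<^esub>\<rbrakk> \<Longrightarrow> \<exists>k::nat. b [^] k \<odot>\<^bsub>N\<^esub> x = \<zero>\<^bsub>N\<^esub>"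
    and surj: "\<And>z. z \<in> carrier D \<Longrightarrow> \<exists>n. \<exists>x\<in>carrier N. z = \<sigma> n x"
  shows "short_exact (nat_sum (\<lambda>_. N)) (nat_sum (\<lambda>_. N)) D
    (\<lambda>x\<in>carrier (nat_sum (\<lambda>_. N)). telescope b N x)
    (\<lambda>x\<in>carrier (nat_sum (\<lambda>_. N)). nat_lift (\<lambda>_. N) D \<sigma> x)"
proof -
  let ?S = "nat_sum (\<lambda>_::nat. N)"
  let ?T = "telescope b N"
  note [simp] = N D b
  have S [simp]: "module R ?S" by (rule nat_sum_module) simp
  note \<sigma>s = lin_simps[OF N D \<sigma>]
  have mem: "x i \<in> carrier N" if "x \<in> carrier ?S" for x i using nat_sumD[OF that] .
  have bs: "\<sigma> n (b \<odot>\<^bsub>N\<^esub> x) = b \<odot>\<^bsub>D\<^esub> \<sigma> n x" if "x \<in> carrier N" for n x using \<sigma>s(3)[OF b that] .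
  \<comment> \<open>Consecutive terms cancel because \<open>b\<close> times
    \<open>\<sigma> (Suc n)\<close> is \<open>\<sigma> n\<close>; only the last term
    survives.\<close>
  have ps: "psum D (\<lambda>i. \<sigma> i (?T x i)) (Suc n) = \<sigma> n (x n)" if x: "\<And>i. x i \<in> carrier N" for x n
  proof (induction n)
    case 0
    show ?case using x \<sigma>s(1) by simp
  next
    case (Suc n)
    have "psum D (\<lambda>i. \<sigma> i (?T x i)) (Suc (Suc n)) = \<sigma> n (x n) \<oplus>\<^bsub>D\<^esub> \<sigma> (Suc n) (?T x (Suc n))"
      using Suc by simp
    also have "\<dots> = \<sigma> n (x n) \<oplus>\<^bsub>D\<^esub> (\<sigma> (Suc n) (x (Suc n)) \<oplus>\<^bsub>D\<^esub> \<ominus>\<^bsub>D\<^esub> (b \<odot>\<^bsub>D\<^esub> \<sigma> (Suc n) (x n)))"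
      using x by (simp add: \<sigma>s(2,5) bs)
    also have "\<dots> = \<sigma> (Suc n) (x (Suc n))" using x \<sigma>s(1) by (simp add: b\<sigma> mod_ac)
    finally show ?case .
  qed
  have Tc: "?T x \<in> carrier ?S" if x: "x \<in> carrier ?S" for x
  proof -
    obtain K where K: "\<And>i. i \<ge> K \<Longrightarrow> x i = \<zero>\<^bsub>N\<^esub>" using nat_sumE[OF x] by blast
    have "?T x i \<in> carrier N" for i using mem[OF x] by (cases i) simp_all
    moreover have "?T x i = \<zero>\<^bsub>N\<^esub>" if "i \<ge> Suc K" for i using that K by (cases i) simp_all
    ultimately show ?thesis by (auto simp: nat_sum_carrier)
  qed
  have lift: "nat_lift (\<lambda>_. N) D \<sigma> x = psum D (\<lambda>i. \<sigma> i (x i)) K"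
    if "x \<in> carrier ?S" "\<And>i. i \<ge> K \<Longrightarrow> x i = \<zero>\<^bsub>N\<^esub>" for x K
    by (rule nat_lift_eq) (use that mem[OF that(1)] \<sigma>s in simp_all)
  show ?thesis
    unfolding short_exact_def
  proof (intro conjI ballI impI)
    show "(\<lambda>x\<in>carrier ?S. ?T x) \<in> lmaps ?S ?S"
    proof (rule lin_restrictI[OF Tc _ _ S])
      fix x y assume xy: "x \<in> carrier ?S" "y \<in> carrier ?S"
      have "?T (\<lambda>i. x i \<oplus>\<^bsub>N\<^esub> y i) n = ?T x n \<oplus>\<^bsub>N\<^esub> ?T y n" for n
        using mem[OF xy(1)] mem[OF xy(2)] by (cases n) (simp_all add: mod_lin mod_ac)
      then show "?T (x \<oplus>\<^bsub>?S\<^esub> y) = ?T x \<oplus>\<^bsub>?S\<^esub> ?T y" by (simp add: fun_eq_iff)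
    next
      fix r x assume r: "r \<in> carrier R" and x: "x \<in> carrier ?S"
      have "?T (\<lambda>i. r \<odot>\<^bsub>N\<^esub> x i) n = r \<odot>\<^bsub>N\<^esub> ?T x n" for n
        using r mem[OF x] by (cases n) (simp_all add: mod_lin mod_smult_comm[OF N b r])
      then show "?T (r \<odot>\<^bsub>?S\<^esub> x) = r \<odot>\<^bsub>?S\<^esub> ?T x" by (simp add: fun_eq_iff)
    qed
    show "(\<lambda>x\<in>carrier ?S. nat_lift (\<lambda>_. N) D \<sigma> x) \<in> lmaps ?S D"
    proof (rule lin_restrictI[OF _ _ _ S])
      show "nat_lift (\<lambda>_. N) D \<sigma> x \<in> carrier D" if "x \<in> carrier ?S" for x
        by (rule nat_lift_closed[OF N D \<sigma> that])
      show "nat_lift (\<lambda>_. N) D \<sigma> (x \<oplus>\<^bsub>?S\<^esub> y) = nat_lift (\<lambda>_. N) D \<sigma> x \<oplus>\<^bsub>D\<^esub> nat_lift (\<lambda>_. N) D \<sigma> y"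
        if "x \<in> carrier ?S" "y \<in> carrier ?S" for x y
        using nat_lift_add[OF N D \<sigma> that] by simp
      fix r x assume r: "r \<in> carrier R" and x: "x \<in> carrier ?S"
      have "r \<odot>\<^bsub>D\<^esub> nat_lift (\<lambda>_. N) D \<sigma> x = nat_lift (\<lambda>_. N) D \<sigma> (\<lambda>i. r \<odot>\<^bsub>N\<^esub> x i)"
        by (rule nat_lift_hom[OF N D \<sigma> N D \<sigma> x]) (use r \<sigma>s(3)[OF r] in \<open>simp_all add: mod_lin\<close>)
      then show "nat_lift (\<lambda>_. N) D \<sigma> (r \<odot>\<^bsub>?S\<^esub> x) = r \<odot>\<^bsub>D\<^esub> nat_lift (\<lambda>_. N) D \<sigma> x" by simp
    qed
  next
    fix x assume x: "x \<in> carrier ?S" "(\<lambda>x\<in>carrier ?S. ?T x) x = \<zero>\<^bsub>?S\<^esub>"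
    then have T0: "?T x n = \<zero>\<^bsub>N\<^esub>" for n by (simp add: fun_eq_iff)
    have "x n = \<zero>\<^bsub>N\<^esub>" for n
    proof (induction n)
      case 0
      show ?case using T0[of 0] by simp
    next
      case (Suc n)
      then show ?case using T0[of "Suc n"] mem[OF x(1)] by simp
    qed
    then show "x = \<zero>\<^bsub>?S\<^esub>" by (simp add: fun_eq_iff)
  next
    fix x assume x: "x \<in> carrier ?S"
    obtain K where K: "\<And>i. i \<ge> K \<Longrightarrow> x i = \<zero>\<^bsub>N\<^esub>" using nat_sumE[OF x] by blast
    have "?T x i = \<zero>\<^bsub>N\<^esub>" if "i \<ge> Suc K" for i using that K by (cases i) simp_all
    then have "nat_lift (\<lambda>_. N) D \<sigma> (?T x) = \<sigma> K (x K)"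
      using lift[of "?T x" "Suc K", OF Tc[OF x]] ps[of x K, OF mem[OF x]] by simp
    also have "\<dots> = \<zero>\<^bsub>D\<^esub>" using K \<sigma>s(4) by simp
    finally show "(\<lambda>x\<in>carrier ?S. nat_lift (\<lambda>_. N) D \<sigma> x) ((\<lambda>x\<in>carrier ?S. ?T x) x) = \<zero>\<^bsub>D\<^esub>"
      using x Tc by simp
  next
    fix y assume y: "y \<in> carrier ?S" "(\<lambda>x\<in>carrier ?S. nat_lift (\<lambda>_. N) D \<sigma> x) y = \<zero>\<^bsub>D\<^esub>"
    obtain K where K: "\<And>i. i \<ge> K \<Longrightarrow> y i = \<zero>\<^bsub>N\<^esub>" using nat_sumE[OF y(1)] by blast
    \<comment> \<open>The equation T z = y has exactly one solution among all sequences; the work is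
      to show that it has finite support.\<close>
    define z where "z = rec_nat (y 0) (\<lambda>n w. y (Suc n) \<oplus>\<^bsub>N\<^esub> b \<odot>\<^bsub>N\<^esub> w)"
    have z: "z 0 = y 0" "z (Suc n) = y (Suc n) \<oplus>\<^bsub>N\<^esub> b \<odot>\<^bsub>N\<^esub> z n" for n by (simp_all add: z_def)
    have zc: "z n \<in> carrier N" for n using mem[OF y(1)] by (induction n) (simp_all add: z)
    have Tz: "?T z n = y n" for n
      using zc mem[OF y(1)] by (cases n) (simp_all add: z mod_ac)
    have bp: "b [^] (n::nat) \<odot>\<^bsub>D\<^esub> \<sigma> n x = \<sigma> 0 x" if x: "x \<in> carrier N" for n x
    proof (induction n)
      case 0
      show ?case using \<sigma>s(1) x by simp
    next
      case (Suc n)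
      have "b [^] (Suc n) \<odot>\<^bsub>D\<^esub> \<sigma> (Suc n) x = b [^] n \<odot>\<^bsub>D\<^esub> (b \<odot>\<^bsub>D\<^esub> \<sigma> (Suc n) x)"
        using \<sigma>s(1)[OF x] by (simp add: smult_smult)
      then show ?case using Suc b\<sigma>[OF x] by simp
    qed
    \<comment> \<open>By telescoping, this term is the image of \<open>y\<close> in
      \<open>D\<close>, which is zero.\<close>
    have "\<sigma> K (z K) = psum D (\<lambda>i. \<sigma> i (y i)) (Suc K)" using ps[of z K, OF zc] by (simp add: Tz)
    also have "\<dots> = \<zero>\<^bsub>D\<^esub>" using lift[of y "Suc K", OF y(1)] K y by simp
    finally have "\<sigma> 0 (z K) = \<zero>\<^bsub>D\<^esub>" using bp[OF zc, of K K] by simp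
    then obtain k :: nat where k: "b [^] k \<odot>\<^bsub>N\<^esub> z K = \<zero>\<^bsub>N\<^esub>" using ker[OF zc] by blast
    \<comment> \<open>Beyond the support of \<open>y\<close> the recursion is multiplication by
      \<open>b\<close>, so the power that kills \<open>z K\<close> ends the support of
      \<open>z\<close>.\<close>
    have zK: "z (K + j) = b [^] j \<odot>\<^bsub>N\<^esub> z K" for j
    proof (induction j)
      case 0
      show ?case using zc by simp
    next
      case (Suc j)
      have "z (K + Suc j) = b \<odot>\<^bsub>N\<^esub> (b [^] j \<odot>\<^bsub>N\<^esub> z K)" using Suc zc K[of "Suc (K + j)"] by (simp add: z)
      then show ?case using zc by (simp add: smult_smult m_comm)
    qed
    have "z i = \<zero>\<^bsub>N\<^esub>" if "i \<ge> K + k" for i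
    proof -
      have "i = K + ((i - K - k) + k)" using that by simp
      then have "z i = b [^] ((i - K - k) + k) \<odot>\<^bsub>N\<^esub> z K" using zK[of "(i - K - k) + k"] by simp
      also have "\<dots> = b [^] (i - K - k) \<odot>\<^bsub>N\<^esub> (b [^] k \<odot>\<^bsub>N\<^esub> z K)" using zc by (simp add: smult_smult nat_pow_mult)
      finally show ?thesis by (simp add: k)
    qed
    then have "z \<in> carrier ?S" using zc by (auto simp: nat_sum_carrier)
    then show "\<exists>x\<in>carrier ?S. y = (\<lambda>x\<in>carrier ?S. ?T x) x"
      by (intro bexI[of _ z]) (simp_all add: Tz fun_eq_iff)
  next
    fix d assume "d \<in> carrier D"
    then obtain n x where x: "x \<in> carrier N" "d = \<sigma> n x" using surj by blast
    have "nat_lift (\<lambda>_. N) D \<sigma> (nat_in (\<lambda>_. N) n x) = \<sigma> n x" by (rule nat_lift_in[OF N D \<sigma> x(1)])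
    then show "\<exists>y\<in>carrier ?S. d = (\<lambda>x\<in>carrier ?S. nat_lift (\<lambda>_. N) D \<sigma> x) y"
      using x nat_in_closed[of "\<lambda>_. N", OF N x(1)] by (intro bexI[of _ "nat_in (\<lambda>_. N) n x"]) simp_all
  qed
qed

text \<open>The localization at a b is obtained from the one at \<open>a\<close> by inverting
  \<open>b\<close>, that is, as the colimit of multiplications by \<open>b\<close>.\<close>

lemma localization_telescope:
  fixes N :: "('a, 'x) module" and D :: "('a, 'y) module"
  assumes N: "is_loc a N e" and D: "is_loc (a \<otimes> b) D p"
    and a: "a \<in> carrier R" and b: "b \<in> carrier R"
  obtains \<phi> \<psi> where "short_exact (nat_sum (\<lambda>_. N)) (nat_sum (\<lambda>_. N)) D \<phi> \<psi>"
proof -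
  note dN = is_locD[OF N] and dD = is_locD[OF D]
  note [simp] = dN(1) dD(1) a b
  have aD: "acts_bij a D" and bD: "acts_bij b D" using acts_bij_mult[OF dD(1) a b] dD(3) by auto
  obtain h where h: "h \<in> lmaps N D" "h e = p"
    using localization_map[OF N a dD(1) aD dD(2)] by blast
  note hs = lin_simps[OF dN(1) dD(1) h(1)]
  obtain c where c: "\<And>y. y \<in> carrier D \<Longrightarrow> c y \<in> carrier D \<and> b \<odot>\<^bsub>D\<^esub> c y = y"
    using bD unfolding acts_bij_def by metis
  have cb: "x = y" if "x \<in> carrier D" "y \<in> carrier D" "b \<odot>\<^bsub>D\<^esub> x = b \<odot>\<^bsub>D\<^esub> y" for x y
    using acts_bij_inj[OF bD dD(1) b that] .
  have cl: "(\<lambda>y\<in>carrier D. c y) \<in> lmaps D D"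
  proof (rule lin_restrictI[OF _ _ _ dD(1)])
    show "c x \<in> carrier D" if "x \<in> carrier D" for x using c[OF that] by blast
    fix x y assume xy: "x \<in> carrier D" "y \<in> carrier D"
    show "c (x \<oplus>\<^bsub>D\<^esub> y) = c x \<oplus>\<^bsub>D\<^esub> c y"
      by (rule cb) (use c xy in \<open>simp_all add: mod_lin\<close>)
  next
    fix r y assume r: "r \<in> carrier R" "y \<in> carrier D"
    have "b \<odot>\<^bsub>D\<^esub> (r \<odot>\<^bsub>D\<^esub> c y) = r \<odot>\<^bsub>D\<^esub> y" using c[OF r(2)] mod_smult_comm[OF dD(1) b r(1), of "c y"] by simp
    moreover have "c (r \<odot>\<^bsub>D\<^esub> y) \<in> carrier D" "b \<odot>\<^bsub>D\<^esub> c (r \<odot>\<^bsub>D\<^esub> y) = r \<odot>\<^bsub>D\<^esub> y"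
      using c[of "r \<odot>\<^bsub>D\<^esub> y"] r by simp_all
    moreover have "r \<odot>\<^bsub>D\<^esub> c y \<in> carrier D" using c[OF r(2)] r(1) by simp
    ultimately show "c (r \<odot>\<^bsub>D\<^esub> y) = r \<odot>\<^bsub>D\<^esub> c y" by (metis cb)
  qed
  \<comment> \<open>\<open>\<sigma> n\<close> is \<open>h\<close> divided n times by
    \<open>b\<close>; division by \<open>b\<close> is the linear map \<open>c\<close>, linear
    because \<open>b\<close> acts injectively on \<open>D\<close>.\<close>
  define \<sigma> where "\<sigma> = rec_nat h (\<lambda>_ s. \<lambda>x\<in>carrier N. (\<lambda>y\<in>carrier D. c y) (s x))"
  have \<sigma>: "\<sigma> n \<in> lmaps N D" for n
  proof (induction n)
    case (Suc n)
    have "\<sigma> (Suc n) = (\<lambda>x\<in>carrier N. (\<lambda>y\<in>carrier D. c y) (\<sigma> n x))" by (simp add: \<sigma>_def)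
    then show ?case using lin_maps_compose[OF dN(1) dD(1) dD(1) Suc cl] by (simp only:)
  qed (simp add: \<sigma>_def h)
  note \<sigma>s = lin_simps[OF dN(1) dD(1) \<sigma>]
  have b\<sigma>: "b \<odot>\<^bsub>D\<^esub> \<sigma> (Suc n) x = \<sigma> n x" if "x \<in> carrier N" for n x
    using that c[OF \<sigma>s(1)[OF that, of n]] \<sigma>s(1)[OF that, of n] by (simp add: \<sigma>_def)
  have bp: "b [^] (n::nat) \<odot>\<^bsub>D\<^esub> \<sigma> n x = h x" if x: "x \<in> carrier N" for n x
  proof (induction n)
    case 0
    show ?case using hs(1) x by (simp add: \<sigma>_def)
  next
    case (Suc n)
    have "b [^] (Suc n) \<odot>\<^bsub>D\<^esub> \<sigma> (Suc n) x = b [^] n \<odot>\<^bsub>D\<^esub> (b \<odot>\<^bsub>D\<^esub> \<sigma> (Suc n) x)"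
      using \<sigma>s(1)[OF x] by (simp add: smult_smult)
    then show ?case using Suc b\<sigma>[OF x] by simp
  qed
  have "short_exact (nat_sum (\<lambda>_. N)) (nat_sum (\<lambda>_. N)) D
    (\<lambda>x\<in>carrier (nat_sum (\<lambda>_. N)). telescope b N x)
    (\<lambda>x\<in>carrier (nat_sum (\<lambda>_. N)). nat_lift (\<lambda>_. N) D \<sigma> x)"
  proof (rule telescope_exact[where \<sigma> = \<sigma>, OF dN(1) dD(1) b \<sigma> b\<sigma>])
    fix x assume x: "x \<in> carrier N" "\<sigma> 0 x = \<zero>\<^bsub>D\<^esub>"
    then have hx: "h x = \<zero>\<^bsub>D\<^esub>" by (simp add: \<sigma>_def)
    obtain m :: nat and r where r: "r \<in> carrier R" "a [^] m \<odot>\<^bsub>N\<^esub> x = r \<odot>\<^bsub>N\<^esub> e" using dN(4)[OF x(1)] by blast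
    have "r \<odot>\<^bsub>D\<^esub> p = h (a [^] m \<odot>\<^bsub>N\<^esub> x)" using hs(3)[OF r(1) dN(2)] h(2) r(2) by simp
    also have "\<dots> = \<zero>\<^bsub>D\<^esub>" using hs(3)[of "a [^] m" x] x(1) hx by simp
    finally obtain k :: nat where k: "(a \<otimes> b) [^] k \<otimes> r = \<zero>" using dD(5) r(1) by blast
    \<comment> \<open>The numerator \<open>r\<close> is killed by a power of a b; since
      \<open>a\<close> acts injectively on \<open>N\<close>, its part of that power may be
      dropped.\<close>
    have "a [^] (m + k) \<odot>\<^bsub>N\<^esub> (b [^] k \<odot>\<^bsub>N\<^esub> x) = (a \<otimes> b) [^] k \<odot>\<^bsub>N\<^esub> (a [^] m \<odot>\<^bsub>N\<^esub> x)"
      using x(1) by (simp add: smult_smult nat_pow_distrib nat_pow_mult[symmetric] m_ac)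
    also have "\<dots> = \<zero>\<^bsub>N\<^esub>" unfolding r(2) using r(1) dN(2) by (simp add: smult_smult k)
    finally have "b [^] k \<odot>\<^bsub>N\<^esub> x = \<zero>\<^bsub>N\<^esub>" by (rule pow_kill[OF dN(1,3) a, rotated]) (use x(1) in simp)
    then show "\<exists>k::nat. b [^] k \<odot>\<^bsub>N\<^esub> x = \<zero>\<^bsub>N\<^esub>" by blast
  next
    fix z assume z: "z \<in> carrier D"
    obtain m :: nat and r where r: "r \<in> carrier R" "(a \<otimes> b) [^] m \<odot>\<^bsub>D\<^esub> z = r \<odot>\<^bsub>D\<^esub> p" using dD(4)[OF z] by blast
    obtain x where x: "x \<in> carrier N" "a [^] m \<odot>\<^bsub>N\<^esub> x = r \<odot>\<^bsub>N\<^esub> e"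
      using pow_root[OF dN(1,3) a, of "r \<odot>\<^bsub>N\<^esub> e" m] r(1) dN(2) by auto
    \<comment> \<open>A fraction with denominator a b to the power m is the fraction with
      denominator \<open>a\<close> to the power m, divided m times by \<open>b\<close>.\<close>
    have "(a \<otimes> b) [^] m \<odot>\<^bsub>D\<^esub> \<sigma> m x = a [^] m \<odot>\<^bsub>D\<^esub> (b [^] m \<odot>\<^bsub>D\<^esub> \<sigma> m x)"
      using \<sigma>s(1)[OF x(1)] by (simp add: smult_smult nat_pow_distrib)
    also have "\<dots> = h (a [^] m \<odot>\<^bsub>N\<^esub> x)" using bp[OF x(1)] hs(3)[of "a [^] m" x] x(1) by simp
    also have "\<dots> = (a \<otimes> b) [^] m \<odot>\<^bsub>D\<^esub> z" unfolding x(2) r(2) using hs(3)[OF r(1) dN(2)] h(2) by simp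
    finally have "\<sigma> m x = z" using pow_inj[OF dD(1,3) _ \<sigma>s(1)[OF x(1)] z] by simp
    then show "\<exists>n. \<exists>x\<in>carrier N. z = \<sigma> n x" using x(1) by blast
  qed
  then show ?thesis using that by blast
qed

text \<open>Exactness of the Cech complex for the cover of \<open>D(c)\<close> by \<open>D(u)\<close> and \<open>D(v)\<close>.\<close>

lemma localization_mayer_vietoris:
  fixes N :: "('a, 'x) module" and N1 N2 N3 :: "('a, 'y) module"
  assumes N: "is_loc c N e" and N1: "is_loc u N1 e1" and N2: "is_loc v N2 e2"
    and N3: "is_loc (u \<otimes> v) N3 e3"
    and c: "c \<in> carrier R" and u: "u \<in> carrier R" and v: "v \<in> carrier R"
    and cN: "acts_bij c N1" "acts_bij c N2" "acts_bij c N3"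
    and cover: "\<And>m::nat. \<exists>n::nat. \<exists>s\<in>carrier R. \<exists>t\<in>carrier R. c [^] n = s \<otimes> u [^] m \<oplus> t \<otimes> v [^] m"
  obtains \<phi> \<psi> where "short_exact N (dir_sum N1 N2) N3 \<phi> \<psi>"
proof -
  note d = is_locD[OF N] and d1 = is_locD[OF N1]
    and d2 = is_locD[OF N2] and d3 = is_locD[OF N3]
  note [simp] = d(1) d1(1) d2(1) d3(1) c u v
  have uN: "acts_bij u N3" and vN: "acts_bij v N3" using acts_bij_mult[OF d3(1) u v] d3(3) by auto
  obtain h1 where h1: "h1 \<in> lmaps N N1" "h1 e = e1" using localization_map[OF N c d1(1) cN(1) d1(2)] by blast
  obtain h2 where h2: "h2 \<in> lmaps N N2" "h2 e = e2" using localization_map[OF N c d2(1) cN(2) d2(2)] by blast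
  obtain g1 where g1: "g1 \<in> lmaps N1 N3" "g1 e1 = e3" using localization_map[OF N1 u d3(1) uN d3(2)] by blast
  obtain g2 where g2: "g2 \<in> lmaps N2 N3" "g2 e2 = e3" using localization_map[OF N2 v d3(1) vN d3(2)] by blast
  note h1s = lin_simps[OF d(1) d1(1) h1(1)] and h2s = lin_simps[OF d(1) d2(1) h2(1)]
    and g1s = lin_simps[OF d1(1) d3(1) g1(1)] and g2s = lin_simps[OF d2(1) d3(1) g2(1)]
  \<comment> \<open>Both composites send \<open>e\<close> to \<open>e3\<close>, and maps out of the
    localization at \<open>c\<close> are determined by this value.\<close>
  have gh: "g1 (h1 x) = g2 (h2 x)" if x: "x \<in> carrier N" for x
    using localization_map_unique[OF N c d3(1) cN(3) lin_maps_compose[OF d(1) d1(1) d3(1) h1(1) g1(1)]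
        lin_maps_compose[OF d(1) d2(1) d3(1) h2(1) g2(1)] _ x] h1 h2 g1 g2 d(2) x by simp
  let ?D = "dir_sum N1 N2"
  let ?\<phi> = "\<lambda>x\<in>carrier N. (h1 x, h2 x)"
  let ?\<psi> = "\<lambda>y\<in>carrier ?D. g1 (fst y) \<oplus>\<^bsub>N3\<^esub> \<ominus>\<^bsub>N3\<^esub> g2 (snd y)"
  have "short_exact N ?D N3 ?\<phi> ?\<psi>"
    unfolding short_exact_def
  proof (intro conjI ballI impI)
    show "?\<phi> \<in> lmaps N ?D" by (rule lin_restrictI) (simp_all add: h1s h2s)
    show "?\<psi> \<in> lmaps ?D N3"
    proof (rule lin_restrictI)
      fix x y assume "x \<in> carrier ?D" "y \<in> carrier ?D"
      then show "g1 (fst (x \<oplus>\<^bsub>?D\<^esub> y)) \<oplus>\<^bsub>N3\<^esub> \<ominus>\<^bsub>N3\<^esub> g2 (snd (x \<oplus>\<^bsub>?D\<^esub> y)) =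
        (g1 (fst x) \<oplus>\<^bsub>N3\<^esub> \<ominus>\<^bsub>N3\<^esub> g2 (snd x)) \<oplus>\<^bsub>N3\<^esub> (g1 (fst y) \<oplus>\<^bsub>N3\<^esub> \<ominus>\<^bsub>N3\<^esub> g2 (snd y))"
        by (cases x; cases y) (simp add: g1s g2s mod_lin mod_ac)
    next
      fix r x assume "r \<in> carrier R" "x \<in> carrier ?D"
      then show "g1 (fst (r \<odot>\<^bsub>?D\<^esub> x)) \<oplus>\<^bsub>N3\<^esub> \<ominus>\<^bsub>N3\<^esub> g2 (snd (r \<odot>\<^bsub>?D\<^esub> x)) =
        r \<odot>\<^bsub>N3\<^esub> (g1 (fst x) \<oplus>\<^bsub>N3\<^esub> \<ominus>\<^bsub>N3\<^esub> g2 (snd x))"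
        by (cases x) (simp add: g1s g2s mod_lin)
    qed (auto simp: g1s g2s)
  next
    fix x assume x: "x \<in> carrier N" "?\<phi> x = \<zero>\<^bsub>?D\<^esub>"
    then have hx: "h1 x = \<zero>\<^bsub>N1\<^esub>" "h2 x = \<zero>\<^bsub>N2\<^esub>" by simp_all
    obtain k :: nat and r where r: "r \<in> carrier R" "c [^] k \<odot>\<^bsub>N\<^esub> x = r \<odot>\<^bsub>N\<^esub> e" using d(4)[OF x(1)] by blast
    have "r \<odot>\<^bsub>N1\<^esub> e1 = h1 (c [^] k \<odot>\<^bsub>N\<^esub> x)" using h1s(3)[OF r(1) d(2)] h1(2) r(2) by simp
    also have "\<dots> = \<zero>\<^bsub>N1\<^esub>" using h1s(3)[of "c [^] k" x] x(1) hx by simp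
    finally obtain m1 :: nat where m1: "u [^] m1 \<otimes> r = \<zero>" using d1(5) r(1) by blast
    have "r \<odot>\<^bsub>N2\<^esub> e2 = h2 (c [^] k \<odot>\<^bsub>N\<^esub> x)" using h2s(3)[OF r(1) d(2)] h2(2) r(2) by simp
    also have "\<dots> = \<zero>\<^bsub>N2\<^esub>" using h2s(3)[of "c [^] k" x] x(1) hx by simp
    finally obtain m2 :: nat where m2: "v [^] m2 \<otimes> r = \<zero>" using d2(5) r(1) by blast
    \<comment> \<open>The exponent m1 + m2 makes each summand divisible by the power that kills
      \<open>r\<close>.\<close>
    obtain n :: nat and s t where st: "s \<in> carrier R" "t \<in> carrier R" "c [^] n = s \<otimes> u [^] (m1 + m2) \<oplus> t \<otimes> v [^] (m1 + m2)"
      using cover by blast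
    have "c [^] n \<otimes> r = s \<otimes> u [^] m2 \<otimes> (u [^] m1 \<otimes> r) \<oplus> t \<otimes> v [^] m1 \<otimes> (v [^] m2 \<otimes> r)"
      unfolding st(3) using st(1,2) r(1) by (simp add: nat_pow_mult[symmetric] l_distr r_distr m_ac)
    also have "\<dots> = \<zero>" using st(1,2) by (simp add: m1 m2)
    finally have "c [^] n \<otimes> r = \<zero>" .
    moreover have "c [^] (n + k) \<odot>\<^bsub>N\<^esub> x = c [^] n \<odot>\<^bsub>N\<^esub> (c [^] k \<odot>\<^bsub>N\<^esub> x)"
      using x(1) by (simp add: smult_smult nat_pow_mult)
    ultimately have "c [^] (n + k) \<odot>\<^bsub>N\<^esub> x = \<zero>\<^bsub>N\<^esub>" using r d(2) by (simp add: smult_smult)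
    then show "x = \<zero>\<^bsub>N\<^esub>" by (rule pow_kill[OF d(1,3) c x(1)])
  next
    fix x assume "x \<in> carrier N"
    then show "?\<psi> (?\<phi> x) = \<zero>\<^bsub>N3\<^esub>" using gh h1s(1) h2s(1) g2s(1) by simp
  next
    fix y assume y: "y \<in> carrier ?D" "?\<psi> y = \<zero>\<^bsub>N3\<^esub>"
    obtain y1 y2 where yy: "y = (y1, y2)" "y1 \<in> carrier N1" "y2 \<in> carrier N2" using y(1) by auto
    have g: "g1 y1 = g2 y2" using y yy g1s(1) g2s(1) mod_eq_iff[OF d3(1), of "g1 y1" "g2 y2"] by simp
    obtain m1 :: nat and r where r: "r \<in> carrier R" "u [^] m1 \<odot>\<^bsub>N1\<^esub> y1 = r \<odot>\<^bsub>N1\<^esub> e1" using d1(4)[OF yy(2)] by blast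
    obtain m2 :: nat and s where s: "s \<in> carrier R" "v [^] m2 \<odot>\<^bsub>N2\<^esub> y2 = s \<odot>\<^bsub>N2\<^esub> e2" using d2(4)[OF yy(3)] by blast
    have 1: "u [^] m1 \<odot>\<^bsub>N3\<^esub> g1 y1 = r \<odot>\<^bsub>N3\<^esub> e3"
      using g1s(3)[of "u [^] m1" y1] g1s(3)[OF r(1) d1(2)] yy g1(2) by (simp add: r(2))
    have 2: "v [^] m2 \<odot>\<^bsub>N3\<^esub> g1 y1 = s \<odot>\<^bsub>N3\<^esub> e3"
      using g2s(3)[of "v [^] m2" y2] g2s(3)[OF s(1) d2(2)] yy g2(2) by (simp add: s(2) g)
    let ?w = "v [^] m2 \<otimes> r \<oplus> \<ominus> (u [^] m1 \<otimes> s)"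
    have "?w \<odot>\<^bsub>N3\<^esub> e3 = v [^] m2 \<odot>\<^bsub>N3\<^esub> (r \<odot>\<^bsub>N3\<^esub> e3) \<oplus>\<^bsub>N3\<^esub> \<ominus>\<^bsub>N3\<^esub> (u [^] m1 \<odot>\<^bsub>N3\<^esub> (s \<odot>\<^bsub>N3\<^esub> e3))"
      using r(1) s(1) d3(2) module.smult_l_minus[OF d3(1)] by (simp add: module.smult_l_distr[of R] smult_smult)
    also have "\<dots> = \<zero>\<^bsub>N3\<^esub>"
      unfolding 1[symmetric] 2[symmetric] using g1s(1)[OF yy(2)] mod_smult_comm[OF d3(1), of "u [^] m1" "v [^] m2"] by simp
    finally obtain k :: nat where k: "(u \<otimes> v) [^] k \<otimes> ?w = \<zero>" using d3(5)[of ?w] r(1) s(1) by auto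
    \<comment> \<open>Common exponent for both fractions. The additional k absorbs the factor that
      makes the two numerators agree in \<open>N3\<close>, so afterwards they agree in the ring
      itself.\<close>
    define M where "M = m1 + m2 + k"
    define r' where "r' = u [^] (m2 + k) \<otimes> r"
    define s' where "s' = v [^] (m1 + k) \<otimes> s"
    have rs [simp]: "r' \<in> carrier R" "s' \<in> carrier R" using r(1) s(1) by (simp_all add: r'_def s'_def)
    have "u [^] m2 \<otimes> v [^] m1 \<otimes> ((u \<otimes> v) [^] k \<otimes> ?w) = v [^] M \<otimes> r' \<oplus> \<ominus> (u [^] M \<otimes> s')"
      using r(1) s(1) by (simp add: M_def r'_def s'_def nat_pow_distrib nat_pow_mult[symmetric] r_distr r_minus m_ac)
    then have "v [^] M \<otimes> r' \<oplus> \<ominus> (u [^] M \<otimes> s') = \<zero>" by (simp add: k)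
    then have eq: "v [^] M \<otimes> r' = u [^] M \<otimes> s'" by (metis add.inv_comm add.inv_solve_right' a_inv_closed minus_minus minus_equality nat_pow_closed m_closed rs u v)
    have M1: "u [^] M \<odot>\<^bsub>N1\<^esub> y1 = r' \<odot>\<^bsub>N1\<^esub> e1"
    proof -
      have "u [^] M \<odot>\<^bsub>N1\<^esub> y1 = u [^] (m2 + k) \<odot>\<^bsub>N1\<^esub> (u [^] m1 \<odot>\<^bsub>N1\<^esub> y1)"
        using yy by (simp add: M_def smult_smult nat_pow_mult ac_simps)
      then show ?thesis using r d1(2) by (simp add: r'_def smult_smult)
    qed
    have M2: "v [^] M \<odot>\<^bsub>N2\<^esub> y2 = s' \<odot>\<^bsub>N2\<^esub> e2"
    proof -
      have "v [^] M \<odot>\<^bsub>N2\<^esub> y2 = v [^] (m1 + k) \<odot>\<^bsub>N2\<^esub> (v [^] m2 \<odot>\<^bsub>N2\<^esub> y2)"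
        using yy by (simp add: M_def smult_smult nat_pow_mult ac_simps)
      then show ?thesis using s d2(2) by (simp add: s'_def smult_smult)
    qed
    obtain n :: nat and p q where pq: "p \<in> carrier R" "q \<in> carrier R" "c [^] n = p \<otimes> u [^] M \<oplus> q \<otimes> v [^] M"
      using cover by blast
    let ?t = "p \<otimes> r' \<oplus> q \<otimes> s'"
    \<comment> \<open>Gluing with a partition of unity: the section is (p r' + q s') over the n-th
      power of \<open>c\<close>.\<close>
    obtain x where x: "x \<in> carrier N" "c [^] n \<odot>\<^bsub>N\<^esub> x = ?t \<odot>\<^bsub>N\<^esub> e"
      using pow_root[OF d(1,3) c, of "?t \<odot>\<^bsub>N\<^esub> e" n] d(2) pq(1,2) by auto
    have c1: "c [^] n \<otimes> r' = u [^] M \<otimes> ?t"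
    proof -
      have "c [^] n \<otimes> r' = p \<otimes> (u [^] M \<otimes> r') \<oplus> q \<otimes> (v [^] M \<otimes> r')" unfolding pq(3) using pq(1,2) by (simp add: l_distr r_distr m_ac)
      also have "\<dots> = u [^] M \<otimes> ?t" unfolding eq using pq(1,2) by (simp add: r_distr m_ac)
      finally show ?thesis .
    qed
    have c2: "c [^] n \<otimes> s' = v [^] M \<otimes> ?t"
    proof -
      have "c [^] n \<otimes> s' = p \<otimes> (u [^] M \<otimes> s') \<oplus> q \<otimes> (v [^] M \<otimes> s')" unfolding pq(3) using pq(1,2) by (simp add: l_distr r_distr m_ac)
      also have "\<dots> = v [^] M \<otimes> ?t" unfolding eq[symmetric] using pq(1,2) by (simp add: r_distr m_ac)
      finally show ?thesis .
    qed
    have "u [^] M \<odot>\<^bsub>N1\<^esub> (c [^] n \<odot>\<^bsub>N1\<^esub> h1 x) = u [^] M \<odot>\<^bsub>N1\<^esub> (?t \<odot>\<^bsub>N1\<^esub> e1)"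
      using h1s(3)[of "c [^] n" x] h1s(3)[of ?t e] x pq(1,2) d(2) h1(2) by simp
    also have "\<dots> = c [^] n \<odot>\<^bsub>N1\<^esub> (r' \<odot>\<^bsub>N1\<^esub> e1)" using d1(2) pq(1,2) by (simp add: smult_smult c1)
    also have "\<dots> = u [^] M \<odot>\<^bsub>N1\<^esub> (c [^] n \<odot>\<^bsub>N1\<^esub> y1)"
      unfolding M1[symmetric] by (rule mod_smult_comm[OF d1(1)]) (use yy in simp_all)
    finally have "c [^] n \<odot>\<^bsub>N1\<^esub> h1 x = c [^] n \<odot>\<^bsub>N1\<^esub> y1"
      using pow_inj[OF d1(1,3) u] h1s(1)[OF x(1)] yy by simp
    then have e1: "h1 x = y1" using pow_inj[OF d1(1) cN(1) c] h1s(1)[OF x(1)] yy by simp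
    have "v [^] M \<odot>\<^bsub>N2\<^esub> (c [^] n \<odot>\<^bsub>N2\<^esub> h2 x) = v [^] M \<odot>\<^bsub>N2\<^esub> (?t \<odot>\<^bsub>N2\<^esub> e2)"
      using h2s(3)[of "c [^] n" x] h2s(3)[of ?t e] x pq(1,2) d(2) h2(2) by simp
    also have "\<dots> = c [^] n \<odot>\<^bsub>N2\<^esub> (s' \<odot>\<^bsub>N2\<^esub> e2)" using d2(2) pq(1,2) by (simp add: smult_smult c2)
    also have "\<dots> = v [^] M \<odot>\<^bsub>N2\<^esub> (c [^] n \<odot>\<^bsub>N2\<^esub> y2)"
      unfolding M2[symmetric] by (rule mod_smult_comm[OF d2(1)]) (use yy in simp_all)
    finally have "c [^] n \<odot>\<^bsub>N2\<^esub> h2 x = c [^] n \<odot>\<^bsub>N2\<^esub> y2"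
      using pow_inj[OF d2(1,3) v] h2s(1)[OF x(1)] yy by simp
    then have e2: "h2 x = y2" using pow_inj[OF d2(1) cN(2) c] h2s(1)[OF x(1)] yy by simp
    show "\<exists>x\<in>carrier N. y = ?\<phi> x" using x(1) e1 e2 yy by (intro bexI[of _ x]) simp_all
  next
    fix z assume z: "z \<in> carrier N3"
    obtain m :: nat and r where r: "r \<in> carrier R" "(u \<otimes> v) [^] m \<odot>\<^bsub>N3\<^esub> z = r \<odot>\<^bsub>N3\<^esub> e3" using d3(4)[OF z] by blast
    have uv: "u [^] m \<odot>\<^bsub>N3\<^esub> (v [^] m \<odot>\<^bsub>N3\<^esub> z) = r \<odot>\<^bsub>N3\<^esub> e3" "v [^] m \<odot>\<^bsub>N3\<^esub> (u [^] m \<odot>\<^bsub>N3\<^esub> z) = r \<odot>\<^bsub>N3\<^esub> e3"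
      unfolding r(2)[symmetric] using z by (simp_all add: smult_smult nat_pow_distrib m_comm)
    obtain n :: nat and s t where st: "s \<in> carrier R" "t \<in> carrier R" "c [^] n = s \<otimes> u [^] m \<oplus> t \<otimes> v [^] m"
      using cover by blast
    obtain w1 where w1: "w1 \<in> carrier N1" "u [^] m \<odot>\<^bsub>N1\<^esub> w1 = r \<odot>\<^bsub>N1\<^esub> e1"
      using pow_root[OF d1(1,3) u, of "r \<odot>\<^bsub>N1\<^esub> e1" m] d1(2) r(1) by auto
    obtain w2 where w2: "w2 \<in> carrier N2" "v [^] m \<odot>\<^bsub>N2\<^esub> w2 = r \<odot>\<^bsub>N2\<^esub> e2"
      using pow_root[OF d2(1,3) v, of "r \<odot>\<^bsub>N2\<^esub> e2" m] d2(2) r(1) by auto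
    have "u [^] m \<odot>\<^bsub>N3\<^esub> g1 w1 = u [^] m \<odot>\<^bsub>N3\<^esub> (v [^] m \<odot>\<^bsub>N3\<^esub> z)"
      unfolding uv(1) using g1s(3)[of "u [^] m" w1] g1s(3)[OF r(1) d1(2)] w1 g1(2) by simp
    then have gw1: "g1 w1 = v [^] m \<odot>\<^bsub>N3\<^esub> z" using pow_inj[OF d3(1) uN u] g1s(1)[OF w1(1)] z by simp
    have "v [^] m \<odot>\<^bsub>N3\<^esub> g2 w2 = v [^] m \<odot>\<^bsub>N3\<^esub> (u [^] m \<odot>\<^bsub>N3\<^esub> z)"
      unfolding uv(2) using g2s(3)[of "v [^] m" w2] g2s(3)[OF r(1) d2(2)] w2 g2(2) by simp
    then have gw2: "g2 w2 = u [^] m \<odot>\<^bsub>N3\<^esub> z" using pow_inj[OF d3(1) vN v] g2s(1)[OF w2(1)] z by simp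
    \<comment> \<open>The coefficients are crossed: \<open>w1\<close> maps to \<open>v^m\<close>
      times z, so it is paired with \<open>t\<close>, and \<open>w2\<close> with
      \<open>s\<close>.\<close>
    obtain y1 where y1: "y1 \<in> carrier N1" "c [^] n \<odot>\<^bsub>N1\<^esub> y1 = t \<odot>\<^bsub>N1\<^esub> w1"
      using pow_root[OF d1(1) cN(1) c, of "t \<odot>\<^bsub>N1\<^esub> w1" n] w1(1) st(2) by auto
    obtain y2 where y2: "y2 \<in> carrier N2" "c [^] n \<odot>\<^bsub>N2\<^esub> y2 = s \<odot>\<^bsub>N2\<^esub> w2"
      using pow_root[OF d2(1) cN(2) c, of "s \<odot>\<^bsub>N2\<^esub> w2" n] w2(1) st(1) by auto
    have "c [^] n \<odot>\<^bsub>N3\<^esub> z = t \<odot>\<^bsub>N3\<^esub> (v [^] m \<odot>\<^bsub>N3\<^esub> z) \<oplus>\<^bsub>N3\<^esub> s \<odot>\<^bsub>N3\<^esub> (u [^] m \<odot>\<^bsub>N3\<^esub> z)"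
      unfolding st(3) using st(1,2) z by (simp add: module.smult_l_distr[of R] smult_smult mod_ac)
    also have "\<dots> = g1 (t \<odot>\<^bsub>N1\<^esub> w1) \<oplus>\<^bsub>N3\<^esub> g2 (s \<odot>\<^bsub>N2\<^esub> w2)"
      unfolding gw1[symmetric] gw2[symmetric] using g1s(3)[OF st(2) w1(1)] g2s(3)[OF st(1) w2(1)] by simp
    also have "\<dots> = c [^] n \<odot>\<^bsub>N3\<^esub> (g1 y1 \<oplus>\<^bsub>N3\<^esub> g2 y2)"
      unfolding y1(2)[symmetric] y2(2)[symmetric]
      using g1s(3)[of "c [^] n" y1] g2s(3)[of "c [^] n" y2] y1(1) y2(1) g1s(1) g2s(1) by (simp add: mod_lin)
    finally have "z = g1 y1 \<oplus>\<^bsub>N3\<^esub> g2 y2"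
      using pow_inj[OF d3(1) cN(3) c z] y1(1) y2(1) g1s(1) g2s(1) by simp
    \<comment> \<open>\<open>?\<psi>\<close> is a difference, so the second component is
      negated.\<close>
    then show "\<exists>y\<in>carrier ?D. z = ?\<psi> y"
      using y1(1) y2(1) g2s(1) by (intro bexI[of _ "(y1, \<ominus>\<^bsub>N2\<^esub> y2)"]) (simp_all add: g2s(5))
  qed
  then show ?thesis using that by blast
qed

end

section \<open>Localizing subcategories and radical ideals\<close>

context cring
begin

abbreviation rad where "rad J \<equiv> radical R (Idl J)"
abbreviation rads where "rads \<equiv> carrier (RadId R)"

lemma loc_ring_image: "carrier (loc_ring R f) = (\<lambda>(a, m). frac R f a m) ` (carrier R \<times> UNIV)"
  by (auto simp: loc_ring_carrier)

lemma localization_ne_zero: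
  assumes N: "is_loc f N e" and f: "f \<in> carrier R" and "\<And>m::nat. f [^] m \<noteq> \<zero>"
  shows "e \<noteq> \<zero>\<^bsub>N\<^esub>"
proof
  assume "e = \<zero>\<^bsub>N\<^esub>"
  then have "\<one> \<odot>\<^bsub>N\<^esub> e = \<zero>\<^bsub>N\<^esub>" using is_locD(1)[OF N] by simp
  then obtain m :: nat where "f [^] m \<otimes> \<one> = \<zero>" using is_locD(5)[OF N] by blast
  then show False using assms(3)[of m] f by simp
qed

text \<open>The localization of the quotient ring at the class of \<open>f\<close>, with scalars
  restricted to \<open>R\<close>. The parametrization \<open>F\<close> of the carrier by
  \<open>R\<close> and exponents is recorded because it bounds the cardinality.\<close>

lemma residue_module_exists:
  assumes I: "ideal I R" and f: "f \<in> carrier R" "f \<notin> radical R I"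
  obtains M :: "('a, ('a set \<times> nat) set) module" and F e where "module R M"
    "carrier M = (\<lambda>(a, m). F a m) ` (carrier R \<times> (UNIV :: nat set))"
    "\<And>g x. \<lbrakk>g \<in> I; x \<in> carrier M\<rbrakk> \<Longrightarrow> g \<odot>\<^bsub>M\<^esub> x = \<zero>\<^bsub>M\<^esub>" "acts_bij f M" "e \<in> carrier M" "e \<noteq> \<zero>\<^bsub>M\<^esub>"
proof -
  have Qz: "\<zero>\<^bsub>R Quot I\<^esub> = I" by (simp add: FactRing_def)
  have Qc: "carrier (R Quot I) = (+>) I ` carrier R" by (auto simp: FactRing_def A_RCOSETS_def')
  interpret I: ideal I R by (rule I)
  interpret Q: cring "R Quot I" by (rule I.quotient_is_cring[OF is_cring])
  interpret h: ring_hom_ring R "R Quot I" "(+>) I" by (rule I.rcos_ring_hom_ring)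
  have Iz: "I +> g = \<zero>\<^bsub>R Quot I\<^esub> \<longleftrightarrow> g \<in> I" if "g \<in> carrier R" for g
    unfolding Qz using I.a_rcos_const I.a_rcos_self[OF that] by auto
  let ?f = "I +> f"
  have f': "?f \<in> carrier (R Quot I)" using f(1) by simp
  let ?L = "loc_ring (R Quot I) ?f"
  have L: "Q.is_loc ?f ?L (frac (R Quot I) ?f \<one>\<^bsub>R Quot I\<^esub> 0)" (is "Q.is_loc _ _ ?e")
    by (rule Q.loc_ring_localization[OF f'])
  note LD = Q.is_locD[OF L]
  define M :: "('a, ('a set \<times> nat) set) module" where "M = \<lparr>carrier = carrier ?L, mult = undefined, one = undefined, zero = \<zero>\<^bsub>?L\<^esub>,
    add = (\<oplus>\<^bsub>?L\<^esub>), smult = (\<lambda>r x. (I +> r) \<odot>\<^bsub>?L\<^esub> x)\<rparr>"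
  have M [simp]: "carrier M = carrier ?L" "\<zero>\<^bsub>M\<^esub> = \<zero>\<^bsub>?L\<^esub>" "x \<oplus>\<^bsub>M\<^esub> y = x \<oplus>\<^bsub>?L\<^esub> y" "r \<odot>\<^bsub>M\<^esub> x = (I +> r) \<odot>\<^bsub>?L\<^esub> x" for x y r
    by (simp_all add: M_def)
  note [simp] = LD(1)
  have "module R M"
  proof (rule moduleI)
    show "abelian_group M"
    proof (rule abelian_groupI)
      fix x assume "x \<in> carrier M"
      then show "\<exists>y\<in>carrier M. y \<oplus>\<^bsub>M\<^esub> x = \<zero>\<^bsub>M\<^esub>" by (intro bexI[of _ "\<ominus>\<^bsub>?L\<^esub> x"]) simp_all
    qed (simp_all add: Q.mod_ac)
  qed (simp_all add: is_cring module.smult_l_distr[of "R Quot I"] Q.smult_smult Q.mod_lin)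
  moreover have "carrier M = (\<lambda>(a, m). frac (R Quot I) ?f (I +> a) m) ` (carrier R \<times> UNIV)"
    by (auto simp: Q.loc_ring_carrier Qc)
  moreover have "g \<odot>\<^bsub>M\<^esub> x = \<zero>\<^bsub>M\<^esub>" if "g \<in> I" "x \<in> carrier M" for g x
    using that Iz[of g] I.a_subset by (auto simp: subset_iff)
  moreover have "acts_bij f M" using LD(3) by (simp add: acts_bij_def Q.acts_bij_def)
  \<comment> \<open>No power of the class of \<open>f\<close> vanishes, since \<open>f\<close> is
    outside the radical of \<open>I\<close>; hence 1 survives in the localization.\<close>
  moreover have "?f [^]\<^bsub>R Quot I\<^esub> (m::nat) \<noteq> \<zero>\<^bsub>R Quot I\<^esub>" for m
    using f Iz[of "f [^] m"] by (auto simp: h.hom_nat_pow[symmetric] radical_def)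
  then have "?e \<noteq> \<zero>\<^bsub>M\<^esub>" using Q.localization_ne_zero[OF L f'] by simp
  moreover have "?e \<in> carrier M" using LD(2) by simp
  ultimately show ?thesis by (intro that[of M "\<lambda>a m. frac (R Quot I) ?f (I +> a) m" ?e])
qed

end

context derived_category
begin

text \<open>Weaker in form than \<open>is_loc_complex\<close>: no isomorphism with the concrete
  module of fractions is fixed, so the same complex can be recognized as a localization at several
  elements.\<close>

definition loc_copy :: "'r \<Rightarrow> ('r, 'u) cochain_complex \<Rightarrow> bool" where
  "loc_copy f X \<longleftrightarrow> deg0 X \<and> (\<exists>e. is_loc f (Deg X 0) e)"

lemma loc_copyE:
  assumes "loc_copy f X"
  obtains e where "deg0 X" "is_loc f (Deg X 0) e"
  using assms unfolding loc_copy_def by blast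

lemma is_loc_complex_copy:
  assumes X: "is_loc_complex R f X" and f: "f \<in> carrier R"
  shows "loc_copy f X"
proof -
  have o: "X \<in> Obj" and z: "deg0 X" using X by (auto simp: is_loc_complex_def deg0_def)
  obtain \<phi> where "\<phi> \<in> lmaps (loc_ring R f) (Deg X 0)" "bij_betw \<phi> (carrier (loc_ring R f)) (el X 0)"
    using X unfolding is_loc_complex_def by blast
  then have "is_loc f (Deg X 0) (\<phi> (frac R f \<one> 0))"
    by (intro localization_transfer[OF loc_ring_localization[OF f] f]) (use o in simp_all)
  then show ?thesis using z unfolding loc_copy_def by blast
qed

lemma small_in_bij:
  fixes A :: "'x set"
  assumes "small_in U A"
  obtains e :: "'x \<Rightarrow> 'u" where "inj_on e A"
  using ordLess_imp_ordLeq[OF assms[unfolded small_in_def]] by (auto simp: card_of_ordLeq[symmetric])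

text \<open>Modules of fractions over \<open>R\<close> or over a quotient of \<open>R\<close> are
  covered by \<open>R\<close> times the natural numbers.\<close>

lemma small_in_fractions: "small_in U ((\<lambda>(a, m). F a m) ` (carrier R \<times> (UNIV :: nat set)))"
  by (intro small_in_image small_in_Times small_in_ring small_in_nat)

lemma is_loc_complex_exists:
  assumes f: "f \<in> carrier R"
  obtains X :: "('r, 'u) cochain_complex" where "is_loc_complex R f X"
proof -
  let ?L = "loc_ring R f"
  have s: "small_in U (carrier ?L)" unfolding loc_ring_image by (rule small_in_fractions)
  then obtain e :: "_ \<Rightarrow> 'u" where e: "inj_on e (carrier ?L)" by (rule small_in_bij)
  let ?N = "transport_module ?L e"
  note N = transport_module[OF loc_ring_module[OF f] e]
  have c: "carrier ?N = e ` carrier ?L" by (simp add: transport_module_def)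
  have "conc 0 ?N \<in> Obj" by (rule conc_Obj[OF N(1)]) (use s c in \<open>simp add: small_in_image\<close>)
  moreover have "bij_betw (\<lambda>x\<in>carrier ?L. e x) (carrier ?L) (carrier ?N)"
    using e c by (auto simp: bij_betw_def inj_on_def)
  ultimately have "is_loc_complex R f (conc 0 ?N)"
    unfolding is_loc_complex_def
    by (intro conjI bexI[of _ "\<lambda>x\<in>carrier ?L. e x"]) (use N(2) in \<open>simp_all add: conc_simps\<close>)
  then show ?thesis by (rule that)
qed

lemma loc_copy_exists:
  assumes "f \<in> carrier R"
  obtains X where "loc_copy f X"
  using is_loc_complex_exists[OF assms] is_loc_complex_copy assms by metis

text \<open>The telescope exhibits \<open>P\<close> as the cokernel of an injective endomorphism of
  a countable sum of copies of \<open>X\<close>, and that sum belongs to \<open>L\<close>.\<close>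

lemma localizing_copy_mult:
  assumes L: "localizing_subcat R L" and a: "a \<in> carrier R" and b: "b \<in> carrier R"
    and X: "X \<in> L" "loc_copy a X" and P: "loc_copy (a \<otimes> b) P"
  shows "P \<in> L"
proof -
  obtain e where X0: "deg0 X" and e: "is_loc a (Deg X 0) e" using X(2) by (rule loc_copyE)
  obtain p where P0: "deg0 P" and p: "is_loc (a \<otimes> b) (Deg P 0) p" using P by (rule loc_copyE)
  let ?C = "csum (\<lambda>_::nat. X)"
  have cX: "cpx X" and cP: "cpx P" using deg0_Obj X0 P0 by auto
  have C: "cpx ?C" by (rule csum_complex[OF cX])
  have us: "usmall ?C" by (rule usmall_csum[OF deg0_Obj[OF X0]])
  have "el ?C n = {zr ?C n}" if "n \<noteq> 0" for n
    using X0 that by (auto simp: deg0_def nat_sum_carrier fun_eq_iff)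
  from transport_degree_0[OF C us this]
  obtain S \<theta> \<alpha> \<beta> where S: "deg0 S" "qi ?C S \<theta>"
    "\<alpha> \<in> lmaps (Deg ?C 0) (Deg S 0)" "\<beta> \<in> lmaps (Deg S 0) (Deg ?C 0)"
    "\<And>x. x \<in> el ?C 0 \<Longrightarrow> \<beta> (\<alpha> x) = x" "\<And>z. z \<in> el S 0 \<Longrightarrow> \<alpha> (\<beta> z) = z" by metis
  have SL: "S \<in> L" by (rule localizing_csum[OF L X(1) deg0_Obj[OF S(1)] S(2)])
  obtain \<phi> \<psi> where "short_exact (nat_sum (\<lambda>_::nat. Deg X 0)) (nat_sum (\<lambda>_::nat. Deg X 0)) (Deg P 0) \<phi> \<psi>"
    using localization_telescope[OF e p a b] .
  then have E: "short_exact (Deg ?C 0) (Deg ?C 0) (Deg P 0) \<phi> \<psi>" by simp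
  have m: "module R (Deg ?C 0)" "module R (Deg S 0)" "module R (Deg P 0)"
    using complex_module[OF C] complex_module[OF cP] deg0_Obj[OF S(1)] by auto
  from short_exact_transport[where \<alpha> = \<beta> and \<alpha>' = \<alpha> and \<beta> = \<beta> and \<beta>' = \<alpha>, OF m(1,2) m(1,2,3) E S(4,3,5,6) S(4,3,5,6)]
  show ?thesis by (rule localizing_cokernel[OF L SL S(1) SL S(1) P0])
qed

text \<open>The overlap terms are multiples of \<open>a\<close> and \<open>b\<close>, hence in
  \<open>L\<close> by \<open>localizing_copy_mult\<close>; \<open>P\<close> is then the kernel of a
  surjection between members of \<open>L\<close>.\<close>

lemma localizing_copy_add:
  assumes L: "localizing_subcat R L" and a: "a \<in> carrier R" and b: "b \<in> carrier R"
    and X: "X \<in> L" "loc_copy a X" and Y: "Y \<in> L" "loc_copy b Y" and P: "loc_copy (a \<oplus> b) P"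
  shows "P \<in> L"
proof -
  let ?c = "a \<oplus> b"
  \<comment> \<open>The cover of D(c) is by D(a c) and D(b c): with the factor c present, c acts
    bijectively on every term of the sequence.\<close>
  let ?u = "a \<otimes> ?c" and ?v = "b \<otimes> ?c"
  have c: "?c \<in> carrier R" and u: "?u \<in> carrier R" and v: "?v \<in> carrier R" using a b by simp_all
  obtain p where P0: "deg0 P" and p: "is_loc ?c (Deg P 0) p" using P by (rule loc_copyE)
  obtain A where A: "loc_copy ?u A" using loc_copy_exists[OF u] .
  obtain B where B: "loc_copy ?v B" using loc_copy_exists[OF v] .
  obtain D where D: "loc_copy (?u \<otimes> ?v) D" using loc_copy_exists[of "?u \<otimes> ?v"] u v by auto
  have AL: "A \<in> L" by (rule localizing_copy_mult[OF L a c X A])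
  have BL: "B \<in> L" by (rule localizing_copy_mult[OF L b c Y B])
  have DL: "D \<in> L" by (rule localizing_copy_mult[OF L u v AL A D])
  obtain e1 where A0: "deg0 A" and e1: "is_loc ?u (Deg A 0) e1" using A by (rule loc_copyE)
  obtain e2 where B0: "deg0 B" and e2: "is_loc ?v (Deg B 0) e2" using B by (rule loc_copyE)
  obtain e3 where D0: "deg0 D" and e3: "is_loc (?u \<otimes> ?v) (Deg D 0) e3" using D by (rule loc_copyE)
  have o: "A \<in> Obj" "B \<in> Obj" "D \<in> Obj" "P \<in> Obj" using deg0_Obj A0 B0 D0 P0 by auto
  note [simp] = Obj_complex[OF o(1)] Obj_complex[OF o(2)] Obj_complex[OF o(3)] Obj_complex[OF o(4)]
  have mA: "module R (Deg A 0)" and mB: "module R (Deg B 0)" and mD: "module R (Deg D 0)" and mP: "module R (Deg P 0)" by simp_all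
  have cA: "acts_bij ?c (Deg A 0)" using acts_bij_mult[OF mA a c] is_locD(3)[OF e1] by simp
  have cB: "acts_bij ?c (Deg B 0)" using acts_bij_mult[OF mB b c] is_locD(3)[OF e2] by simp
  have cD: "acts_bij ?c (Deg D 0)"
    using acts_bij_mult[OF mD a c] acts_bij_mult[OF mD u v] is_locD(3)[OF e3] by simp
  have cover: "\<exists>n::nat. \<exists>s\<in>carrier R. \<exists>t\<in>carrier R. ?c [^] n = s \<otimes> ?u [^] m \<oplus> t \<otimes> ?v [^] m" for m :: nat
  proof -
    obtain s t where st: "s \<in> carrier R" "t \<in> carrier R" "?c [^] (m + m) = s \<otimes> a [^] m \<oplus> t \<otimes> b [^] m"
      using power_add_split[OF a b, of m m] by blast
    \<comment> \<open>The exponent 2m splits into multiples of the m-th powers of \<open>a\<close>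
      and \<open>b\<close>; a further factor \<open>c^m\<close> turns these into powers of
      \<open>?u\<close> and \<open>?v\<close>.\<close>
    have "?c [^] (m + m + m) = (s \<otimes> a [^] m \<oplus> t \<otimes> b [^] m) \<otimes> ?c [^] m"
      using c by (simp add: nat_pow_mult[symmetric] st(3)[symmetric])
    also have "\<dots> = s \<otimes> (a [^] m \<otimes> ?c [^] m) \<oplus> t \<otimes> (b [^] m \<otimes> ?c [^] m)"
      using l_distr[of "s \<otimes> a [^] m" "t \<otimes> b [^] m" "?c [^] m"] st(1,2) a b c by (simp add: m_assoc)
    also have "\<dots> = s \<otimes> ?u [^] m \<oplus> t \<otimes> ?v [^] m" by (simp only: nat_pow_distrib[OF a c] nat_pow_distrib[OF b c])
    finally show ?thesis using st(1,2) by blast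
  qed
  obtain \<phi> \<psi> where E: "short_exact (Deg P 0) (dir_sum (Deg A 0) (Deg B 0)) (Deg D 0) \<phi> \<psi>"
    using localization_mayer_vietoris[OF p e1 e2 e3 c u v cA cB cD cover] .
  let ?C = "dsum A B"
  have C: "cpx ?C" by simp
  have us: "usmall ?C" using usmall_dsum Obj_small o(1,2) by metis
  have "el ?C n = {zr ?C n}" if "n \<noteq> 0" for n
    using A0 B0 that by (auto simp: deg0_def)
  from transport_degree_0[OF C us this]
  obtain S \<theta> \<alpha> \<beta> where S: "deg0 S" "qi ?C S \<theta>"
    "\<alpha> \<in> lmaps (Deg ?C 0) (Deg S 0)" "\<beta> \<in> lmaps (Deg S 0) (Deg ?C 0)"
    "\<And>x. x \<in> el ?C 0 \<Longrightarrow> \<beta> (\<alpha> x) = x" "\<And>z. z \<in> el S 0 \<Longrightarrow> \<alpha> (\<beta> z) = z" by metis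
  have SL: "S \<in> L" by (rule localizing_dsum[OF L AL BL deg0_Obj[OF S(1)] S(2)])
  have E': "short_exact (Deg P 0) (Deg ?C 0) (Deg D 0) \<phi> \<psi>" using E by simp
  have m: "module R (Deg ?C 0)" "module R (Deg S 0)" using complex_module[OF C] deg0_Obj[OF S(1)] by auto
  have i: "(\<lambda>x\<in>el P 0. x) \<in> lmaps (Deg P 0) (Deg P 0)" by (rule lin_restrictI) simp_all
  have "short_exact (Deg P 0) (Deg S 0) (Deg D 0)
      (\<lambda>x\<in>el P 0. \<alpha> (\<phi> ((\<lambda>x\<in>el P 0. x) x))) (\<lambda>y\<in>el S 0. \<psi> (\<beta> y))"
    by (rule short_exact_transport[OF mP mP m mD E' i i _ _ S(4,3)]) (use S(5,6) in simp_all)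
  then show ?thesis by (rule localizing_kernel[OF L P0 SL S(1) DL D0])
qed

text \<open>The elements whose localization lies in \<open>L\<close> form an ideal containing
  \<open>J\<close>, and roots are adjoined at the end.\<close>

lemma localizing_copies_radical:
  assumes L: "localizing_subcat R L" and J: "J \<subseteq> carrier R" and LJ: "\<And>g X. \<lbrakk>g \<in> J; is_loc_complex R g X\<rbrakk> \<Longrightarrow> X \<in> L"
    and f: "f \<in> rad J" and P: "loc_copy f P"
  shows "P \<in> L"
proof -
  define A where "A = {a \<in> carrier R. \<exists>X\<in>L. loc_copy a X}"
  have A: "a \<in> A \<Longrightarrow> a \<in> carrier R \<and> (\<exists>X\<in>L. loc_copy a X)" for a by (simp add: A_def)
  have memA: "a \<in> A" if "a \<in> carrier R" "\<And>X. loc_copy a X \<Longrightarrow> X \<in> L" for a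
    using that loc_copy_exists[OF that(1)] unfolding A_def by blast
  have mult: "a \<otimes> b \<in> A" if "a \<in> A" "b \<in> carrier R" for a b
  proof (rule memA)
    show "a \<otimes> b \<in> carrier R" using A[OF that(1)] that(2) by simp
    fix P assume "loc_copy (a \<otimes> b) P"
    then show "P \<in> L" using A[OF that(1)] that(2) localizing_copy_mult[OF L] by blast
  qed
  have "subgroup A (add_monoid R)"
  proof (rule add.subgroupI)
    show "A \<subseteq> carrier R" by (auto simp: A_def)
    \<comment> \<open>The localization at 0 is the zero module, because 0 acts injectively on
      it.\<close>
    have "\<zero> \<in> A"
    proof (rule memA)
      fix X assume "loc_copy \<zero> X"
      then obtain e where X: "deg0 X" and e: "is_loc \<zero> (Deg X 0) e" by (rule loc_copyE)
      have c: "cpx X" using deg0_Obj[OF X] by simp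
      have "x = zr X 0" if "x \<in> el X 0" for x
        using is_locD(3)[OF e] that c unfolding acts_bij_def by simp
      then have "el X n = {zr X n}" for n
        using X mod_closed(2)[OF complex_module[OF c]] unfolding deg0_def by (cases "n = 0") blast+
      then show "X \<in> L" by (rule localizing_zero[OF L deg0_Obj[OF X]])
    qed simp
    then show "A \<noteq> {}" by blast
    fix a assume a: "a \<in> A"
    have "a \<otimes> \<ominus> \<one> \<in> A" by (rule mult[OF a]) simp
    then show "\<ominus> a \<in> A" using A[OF a] by (simp add: r_minus)
    fix b assume b: "b \<in> A"
    show "a \<oplus> b \<in> A"
    proof (rule memA)
      show "a \<oplus> b \<in> carrier R" using A[OF a] A[OF b] by simp
      fix P assume "loc_copy (a \<oplus> b) P"
      then show "P \<in> L" using A[OF a] A[OF b] localizing_copy_add[OF L] by blast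
    qed
  qed
  then have "ideal A R" by (rule idealI[OF ring_axioms]) (use mult A m_comm in auto)
  moreover have "J \<subseteq> A"
  proof
    fix g assume g: "g \<in> J"
    then have gR: "g \<in> carrier R" using J by blast
    then obtain X :: "('r, 'u) cochain_complex" where "is_loc_complex R g X" using is_loc_complex_exists by blast
    then show "g \<in> A" using LJ[OF g] is_loc_complex_copy gR unfolding A_def by blast
  qed
  ultimately have I: "Idl J \<subseteq> A" by (rule genideal_minimal)
  obtain n :: nat where n: "f \<in> carrier R" "f [^] n \<in> A" using f I by (auto simp: radical_def)
  obtain X where X: "X \<in> L" "loc_copy (f [^] n) X" using A[OF n(2)] by blast
  obtain p where P0: "deg0 P" and p: "is_loc f (Deg P 0) p" using P by (rule loc_copyE)
  \<comment> \<open>\<open>P\<close> is also a localization at \<open>f^n\<close> times f, a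
    multiple of an element already known to belong to \<open>A\<close>.\<close>
  have "acts_bij (f [^] n) (Deg P 0)"
    by (rule acts_bij_pow[OF is_locD(1)[OF p] n(1) is_locD(3)[OF p]])
  then have "is_loc (f [^] n \<otimes> f) (Deg P 0) p" by (intro is_loc_mult[OF p]) (use n in simp_all)
  then have "loc_copy (f [^] n \<otimes> f) P" using P0 unfolding loc_copy_def by blast
  then show ?thesis by (rule localizing_copy_mult[OF L _ n(1) X, rotated]) (use n in simp)
qed

text \<open>
  \<open>R\<^sub>f\<close> is separated from the \<open>R\<^sub>g\<close>, \<open>g \<in> J\<close>, by the nonzero module \<open>(R/I)\<^sub>f\<close> with \<open>I\<close> the ideal
  generated by \<open>J\<close>: multiplication by \<open>g\<close> is invertible on \<open>R\<^sub>g\<close> and zero on \<open>(R/I)\<^sub>f\<close>.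
\<close>

lemma localizing_separates:
  assumes J: "J \<subseteq> carrier R" and f: "f \<in> carrier R" "f \<notin> rad J"
  obtains L where "localizing_subcat R L" "\<And>g X. \<lbrakk>g \<in> J; loc_copy g X\<rbrakk> \<Longrightarrow> X \<in> L" "\<And>X. loc_copy f X \<Longrightarrow> X \<notin> L"
proof -
  obtain M :: "('r, ('r set \<times> nat) set) module" and F e where M: "module R M"
    "carrier M = (\<lambda>(a, m). F a m) ` (carrier R \<times> (UNIV :: nat set))"
    "\<And>g x. \<lbrakk>g \<in> Idl J; x \<in> carrier M\<rbrakk> \<Longrightarrow> g \<odot>\<^bsub>M\<^esub> x = \<zero>\<^bsub>M\<^esub>" "acts_bij f M" "e \<in> carrier M" "e \<noteq> \<zero>\<^bsub>M\<^esub>"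
    using residue_module_exists[OF genideal_ideal[OF J] f] by metis
  have sM: "small_in U (carrier M)" unfolding M(2) by (rule small_in_fractions)
  then obtain \<epsilon> :: "_ \<Rightarrow> 'u" where \<epsilon>: "inj_on \<epsilon> (carrier M)" by (rule small_in_bij)
  define N where "N = transport_module M \<epsilon>"
  have c: "carrier N = \<epsilon> ` carrier M" by (simp add: N_def transport_module_def)
  have N: "module R N" and lin: "(\<lambda>x\<in>carrier M. \<epsilon> x) \<in> lmaps M N"
    unfolding N_def by (rule transport_module[OF M(1) \<epsilon>])+
  have \<epsilon>z: "\<epsilon> \<zero>\<^bsub>M\<^esub> = \<zero>\<^bsub>N\<^esub>" by (simp add: N_def transport_module_def)
  have \<epsilon>s: "r \<odot>\<^bsub>N\<^esub> \<epsilon> x = \<epsilon> (r \<odot>\<^bsub>M\<^esub> x)" if "r \<in> carrier R" "x \<in> carrier M" for r x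
    using lin_simps(3)[OF M(1) N lin that] that M(1) by simp
  have \<epsilon>i: "x = \<zero>\<^bsub>M\<^esub>" if "\<epsilon> x = \<zero>\<^bsub>N\<^esub>" "x \<in> carrier M" for x
    using inj_onD[OF \<epsilon>, of x "\<zero>\<^bsub>M\<^esub>"] that \<epsilon>z M(1) by simp
  have sN: "small_in U (carrier N)" unfolding c by (rule small_in_image[OF sM])
  have kill: "g \<odot>\<^bsub>N\<^esub> x = \<zero>\<^bsub>N\<^esub>" if g: "g \<in> J" and x: "x \<in> carrier N" for g x
  proof -
    have "g \<in> Idl J" "g \<in> carrier R" using g J genideal_self[OF J] by auto
    then show ?thesis using x M(3) \<epsilon>s \<epsilon>z unfolding c by auto
  qed
  have bN: "acts_bij f N"
    unfolding acts_bij_def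
  proof (intro conjI ballI impI)
    fix x assume "x \<in> carrier N" "f \<odot>\<^bsub>N\<^esub> x = \<zero>\<^bsub>N\<^esub>"
    then obtain y where y: "y \<in> carrier M" "x = \<epsilon> y" "\<epsilon> (f \<odot>\<^bsub>M\<^esub> y) = \<zero>\<^bsub>N\<^esub>" using \<epsilon>s f(1) unfolding c by auto
    then have "f \<odot>\<^bsub>M\<^esub> y = \<zero>\<^bsub>M\<^esub>" using \<epsilon>i f(1) M(1) by simp
    then show "x = \<zero>\<^bsub>N\<^esub>" using M(4) y \<epsilon>z unfolding acts_bij_def by auto
  next
    fix x assume "x \<in> carrier N"
    then obtain y where y: "y \<in> carrier M" "x = \<epsilon> y" unfolding c by auto
    then obtain w where "w \<in> carrier M" "f \<odot>\<^bsub>M\<^esub> w = y" using M(4) unfolding acts_bij_def by blast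
    then show "\<exists>w\<in>carrier N. f \<odot>\<^bsub>N\<^esub> w = x" using y \<epsilon>s f(1) unfolding c by auto
  qed
  have eN: "\<epsilon> e \<in> carrier N" "\<epsilon> e \<noteq> \<zero>\<^bsub>N\<^esub>" using M(5,6) \<epsilon>i c by auto
  show ?thesis
  proof (rule that[OF hom_null_localizing[OF N sN]])
    fix g X assume g: "g \<in> J" and "loc_copy g X"
    then obtain x where X: "deg0 X" and x: "is_loc g (Deg X 0) x" by (auto elim: loc_copyE)
    have gR: "g \<in> carrier R" using g J by blast
    have o: "X \<in> Obj" by (rule deg0_Obj[OF X])
    have cX: "cpx X" using o by simp
    \<comment> \<open>Bijectivity in every degree makes multiplication by \<open>g\<close> an
      isomorphism of complexes, while \<open>g\<close> annihilates the target; this is what forces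
      all morphisms to vanish.\<close>
    have "bij_betw (csmult g X n) (el X n) (el X n)" for n
    proof (cases "n = 0")
      case True
      have b: "acts_bij g (Deg X 0)" by (rule is_locD(3)[OF x])
      have "inj_on (csmult g X 0) (el X 0)"
        using acts_bij_inj[OF b complex_module[OF cX] gR] by (auto simp: inj_on_def)
      moreover have "csmult g X 0 ` el X 0 = el X 0"
      proof
        show "csmult g X 0 ` el X 0 \<subseteq> el X 0" using cX gR by auto
        show "el X 0 \<subseteq> csmult g X 0 ` el X 0"
        proof
          fix y assume "y \<in> el X 0"
          then obtain w where "w \<in> el X 0" "g \<odot>\<^bsub>Deg X 0\<^esub> w = y" using b unfolding acts_bij_def by blast
          then show "y \<in> csmult g X 0 ` el X 0" by (intro image_eqI[of _ _ w]) simp_all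
        qed
      qed
      ultimately show ?thesis unfolding True bij_betw_def by blast
    next
      case False
      then have z: "el X n = {zr X n}" using X by (simp add: deg0_def)
      have "csmult g X n (zr X n) = zr X n" using cX gR by simp
      then show ?thesis unfolding z by (simp add: bij_betw_def)
    qed
    then have q: "qi X X (csmult g X)"
      by (intro qi_bij cX) (use cX gR in \<open>simp add: cochain_isos_def\<close>)
    have "hom_trivial X (conc k N)" for k
    proof (rule hom_trivial_csmult[OF o conc_Obj[OF N sN] gR q])
      fix n y assume "y \<in> el (conc k N) n"
      then show "g \<odot>\<^bsub>Deg (conc k N) n\<^esub> y = zr (conc k N) n"
        using kill[OF g, of y] N gR by (auto simp: conc_simps split: if_splits)
    qed
    then show "X \<in> hom_null N" using o by (simp add: hom_null_def)
  next
    fix X assume "loc_copy f X"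
    then obtain x where X: "deg0 X" and x: "is_loc f (Deg X 0) x" by (auto elim: loc_copyE)
    \<comment> \<open>The universal property gives a map that sends 1 to a nonzero element, so Hom
      does not vanish.\<close>
    obtain h where h: "h \<in> lmaps (Deg X 0) N" "h x = \<epsilon> e"
      using localization_map[OF x f(1) N bN eN(1)] .
    show "X \<notin> hom_null N"
      by (rule hom_null_not[OF deg0_Obj[OF X] N sN h(1) is_locD(2)[OF x]])
        (use h(2) eN(2) X in \<open>simp_all add: deg0_def\<close>)
  qed
qed

end

section \<open>Complete lattices, finite elements and isomorphisms\<close>

text \<open>Suprema are selected by \<open>SOME\<close>; antisymmetry identifies the selected
  element with any least upper bound found by hand.\<close>

lemma sup_eqI:
  assumes "partial_order L" "least L s (Upper L A)"
  shows "\<Squnion>\<^bsub>L\<^esub>A = s"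
proof -
  have "least L (\<Squnion>\<^bsub>L\<^esub>A) (Upper L A)" unfolding sup_def using assms(2) by (rule someI)
  then show ?thesis using assms(2) partial_order.le_antisym[OF assms(1)] unfolding least_def by blast
qed

lemma inf_eqI:
  assumes "partial_order L" "greatest L i (Lower L A)"
  shows "\<Sqinter>\<^bsub>L\<^esub>A = i"
  using sup_eqI[of "inv_gorder L" i A] assms by (simp add: dual_order_iff)

text \<open>Treating the bounds as joins and meets of the empty set lets one transport argument
  cover bounds and binary operations.\<close>

lemma bottom_eq_sup: "\<bottom>\<^bsub>L\<^esub> = \<Squnion>\<^bsub>L\<^esub>{}"
  by (simp add: bottom_def sup_def Upper_def)

lemma top_eq_inf: "\<top>\<^bsub>L\<^esub> = \<Sqinter>\<^bsub>L\<^esub>{}"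
  by (simp add: top_def inf_def Lower_def)

lemma complete_lattice_partial_order: "complete_lattice L \<Longrightarrow> partial_order L"
  by (simp add: complete_lattice_def)

lemma sup_least:
  assumes "complete_lattice L" "A \<subseteq> carrier L"
  shows "least L (\<Squnion>\<^bsub>L\<^esub>A) (Upper L A)"
  using complete_lattice.sup_exists[OF assms] sup_eqI[OF complete_lattice_partial_order[OF assms(1)]] by metis

lemma inf_greatest:
  assumes "complete_lattice L" "A \<subseteq> carrier L"
  shows "greatest L (\<Sqinter>\<^bsub>L\<^esub>A) (Lower L A)"
  using complete_lattice.inf_exists[OF assms] inf_eqI[OF complete_lattice_partial_order[OF assms(1)]] by metis

lemma sup_mem: "\<lbrakk>complete_lattice L; A \<subseteq> carrier L\<rbrakk> \<Longrightarrow> \<Squnion>\<^bsub>L\<^esub>A \<in> carrier L"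
  using sup_least[of L A] unfolding least_def by blast

lemma inf_mem: "\<lbrakk>complete_lattice L; A \<subseteq> carrier L\<rbrakk> \<Longrightarrow> \<Sqinter>\<^bsub>L\<^esub>A \<in> carrier L"
  using inf_greatest[of L A] unfolding greatest_def by blast


subsection \<open>Sublattices\<close>

text \<open>A supremum computed in \<open>L\<close> is still least among the fewer upper bounds
  available in \<open>S\<close>, provided that it lies in \<open>S\<close>.\<close>

lemma sublattice_bounds:
  assumes L: "complete_lattice L" and S: "sublattice L S" and A: "A \<subseteq> S"
  shows "\<Squnion>\<^bsub>L\<^esub>A \<in> S \<Longrightarrow> least (L\<lparr>carrier := S\<rparr>) (\<Squnion>\<^bsub>L\<^esub>A) (Upper (L\<lparr>carrier := S\<rparr>) A)"
    and "\<Sqinter>\<^bsub>L\<^esub>A \<in> S \<Longrightarrow> greatest (L\<lparr>carrier := S\<rparr>) (\<Sqinter>\<^bsub>L\<^esub>A) (Lower (L\<lparr>carrier := S\<rparr>) A)"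
proof -
  have SL: "S \<subseteq> carrier L" using S by (simp add: sublattice_def)
  then have AL: "A \<subseteq> carrier L" using A by blast
  show "least (L\<lparr>carrier := S\<rparr>) (\<Squnion>\<^bsub>L\<^esub>A) (Upper (L\<lparr>carrier := S\<rparr>) A)" if "\<Squnion>\<^bsub>L\<^esub>A \<in> S"
  proof -
    have "Upper (L\<lparr>carrier := S\<rparr>) A = Upper L A \<inter> S" unfolding Upper_def using SL A by auto
    then show ?thesis using sup_least[OF L AL] that unfolding least_def by auto
  qed
  show "greatest (L\<lparr>carrier := S\<rparr>) (\<Sqinter>\<^bsub>L\<^esub>A) (Lower (L\<lparr>carrier := S\<rparr>) A)" if "\<Sqinter>\<^bsub>L\<^esub>A \<in> S"
  proof -
    have "Lower (L\<lparr>carrier := S\<rparr>) A = Lower L A \<inter> S" unfolding Lower_def using SL A by auto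
    then show ?thesis using inf_greatest[OF L AL] that unfolding greatest_def by auto
  qed
qed

lemma sublattice_bounded_lattice:
  assumes L: "complete_lattice L" and S: "sublattice L S"
  shows "bounded_lattice (L\<lparr>carrier := S\<rparr>)" (is "bounded_lattice ?P")
    and "\<lbrakk>x \<in> S; y \<in> S\<rbrakk> \<Longrightarrow> x \<squnion>\<^bsub>L\<lparr>carrier := S\<rparr>\<^esub> y = x \<squnion>\<^bsub>L\<^esub> y"
    and "\<lbrakk>x \<in> S; y \<in> S\<rbrakk> \<Longrightarrow> x \<sqinter>\<^bsub>L\<lparr>carrier := S\<rparr>\<^esub> y = x \<sqinter>\<^bsub>L\<^esub> y"
    and "\<bottom>\<^bsub>L\<lparr>carrier := S\<rparr>\<^esub> = \<bottom>\<^bsub>L\<^esub>" and "\<top>\<^bsub>L\<lparr>carrier := S\<rparr>\<^esub> = \<top>\<^bsub>L\<^esub>"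
proof -
  interpret L: complete_lattice L by (rule L)
  have SL: "S \<subseteq> carrier L" using S by (simp add: sublattice_def)
  have P: "partial_order ?P"
  proof
    fix x y z assume "x \<in> carrier ?P" "y \<in> carrier ?P" "z \<in> carrier ?P" "x .=\<^bsub>?P\<^esub> y" "y .=\<^bsub>?P\<^esub> z"
    then show "x .=\<^bsub>?P\<^esub> z" using L.eq_is_equal by simp
  qed (use SL L.eq_is_equal in \<open>auto dest: L.le_trans[OF _ _ subsetD[OF SL] subsetD[OF SL] subsetD[OF SL]]\<close>)
  note b = sublattice_bounds[OF L S]
  have joins: "\<Squnion>\<^bsub>L\<^esub>{x, y} \<in> S" and meets: "\<Sqinter>\<^bsub>L\<^esub>{x, y} \<in> S" if "x \<in> S" "y \<in> S" for x y
    using S that by (auto simp: sublattice_def join_def meet_def)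
  have bot: "\<Squnion>\<^bsub>L\<^esub>{} \<in> S" and top: "\<Sqinter>\<^bsub>L\<^esub>{} \<in> S"
    using S by (simp_all add: sublattice_def bottom_eq_sup top_eq_inf)
  have bj: "least ?P (\<Squnion>\<^bsub>L\<^esub>{x, y}) (Upper ?P {x, y})" and bm: "greatest ?P (\<Sqinter>\<^bsub>L\<^esub>{x, y}) (Lower ?P {x, y})"
    if "x \<in> S" "y \<in> S" for x y
    by (rule b; use that joins meets in simp)+
  have bb: "least ?P (\<Squnion>\<^bsub>L\<^esub>{}) (Upper ?P {})" and bt: "greatest ?P (\<Sqinter>\<^bsub>L\<^esub>{}) (Lower ?P {})"
    by (rule b; use bot top in simp)+
  show "bounded_lattice ?P"
  proof (intro bounded_lattice.intro lattice.intro upper_semilattice.intro lower_semilattice.intro P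
      upper_semilattice_axioms.intro lower_semilattice_axioms.intro weak_partial_order_bottom.intro
      weak_partial_order_top.intro weak_partial_order_bottom_axioms.intro weak_partial_order_top_axioms.intro
      partial_order.axioms(1)[OF P])
    show "\<exists>s. least ?P s (Upper ?P {x, y})" if "x \<in> carrier ?P" "y \<in> carrier ?P" for x y using bj that by auto
    show "\<exists>s. greatest ?P s (Lower ?P {x, y})" if "x \<in> carrier ?P" "y \<in> carrier ?P" for x y using bm that by auto
    show "\<exists>x. least ?P x (carrier ?P)" using bb by (auto simp: Upper_def)
    show "\<exists>x. greatest ?P x (carrier ?P)" using bt by (auto simp: Lower_def)
  qed
  show "x \<squnion>\<^bsub>?P\<^esub> y = x \<squnion>\<^bsub>L\<^esub> y" "x \<sqinter>\<^bsub>?P\<^esub> y = x \<sqinter>\<^bsub>L\<^esub> y" if "x \<in> S" "y \<in> S"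
    unfolding join_def meet_def using sup_eqI[OF P bj] inf_eqI[OF P bm] that by auto
  show "\<bottom>\<^bsub>?P\<^esub> = \<bottom>\<^bsub>L\<^esub>" "\<top>\<^bsub>?P\<^esub> = \<top>\<^bsub>L\<^esub>"
    unfolding bottom_eq_sup top_eq_inf using sup_eqI[OF P bb] inf_eqI[OF P bt] by auto
qed

lemma sublattice_distributive:
  assumes L: "complete_lattice L" and S: "sublattice L S"
    and D: "\<And>x y z. \<lbrakk>x \<in> S; y \<in> S; z \<in> S\<rbrakk> \<Longrightarrow> x \<sqinter>\<^bsub>L\<^esub> (y \<squnion>\<^bsub>L\<^esub> z) = (x \<sqinter>\<^bsub>L\<^esub> y) \<squnion>\<^bsub>L\<^esub> (x \<sqinter>\<^bsub>L\<^esub> z)"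
  shows "distributive_lattice (L\<lparr>carrier := S\<rparr>)"
proof -
  have c: "x \<squnion>\<^bsub>L\<^esub> y \<in> S" "x \<sqinter>\<^bsub>L\<^esub> y \<in> S" if "x \<in> S" "y \<in> S" for x y
    using S that by (auto simp: sublattice_def)
  show ?thesis
    unfolding distributive_lattice_def
    using sublattice_bounded_lattice(1)[OF L S] D c by (simp add: sublattice_bounded_lattice(2,3)[OF L S])
qed


section \<open>Finite elements of a complete lattice\<close>

lemma finite_elements_carrier: "c \<in> finite_elements L \<Longrightarrow> c \<in> carrier L"
  by (simp add: finite_elements_def)

lemma finite_elements_subset: "finite_elements L \<subseteq> carrier L"
  by (rule subsetI) (rule finite_elements_carrier)

lemma finite_elementsD:
  "\<lbrakk>c \<in> finite_elements L; S \<subseteq> carrier L; c \<sqsubseteq>\<^bsub>L\<^esub> \<Squnion>\<^bsub>L\<^esub>S\<rbrakk> \<Longrightarrow> \<exists>K\<subseteq>S. finite K \<and> c \<sqsubseteq>\<^bsub>L\<^esub> \<Squnion>\<^bsub>L\<^esub>K"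
  by (simp add: finite_elements_def)

lemma finite_elementsI:
  "\<lbrakk>c \<in> carrier L; \<And>S. \<lbrakk>S \<subseteq> carrier L; c \<sqsubseteq>\<^bsub>L\<^esub> \<Squnion>\<^bsub>L\<^esub>S\<rbrakk> \<Longrightarrow> \<exists>K\<subseteq>S. finite K \<and> c \<sqsubseteq>\<^bsub>L\<^esub> \<Squnion>\<^bsub>L\<^esub>K\<rbrakk> \<Longrightarrow> c \<in> finite_elements L"
  by (simp add: finite_elements_def)


subsection \<open>Transport along isomorphisms of posets\<close>

lemma poset_iso_least:
  assumes iso: "poset_iso A B \<phi>" and S: "S \<subseteq> carrier A" and x: "x \<in> carrier A"
  shows "least B (\<phi> x) (Upper B (\<phi> ` S)) \<longleftrightarrow> least A x (Upper A S)"
proof -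
  have iso_image: "\<phi> ` carrier A = carrier B" using iso by (simp add: poset_iso_def bij_betw_def)
  have iso_le: "\<phi> x \<sqsubseteq>\<^bsub>B\<^esub> \<phi> y \<longleftrightarrow> x \<sqsubseteq>\<^bsub>A\<^esub> y" if "x \<in> carrier A" "y \<in> carrier A" for x y
    using iso that by (simp add: poset_iso_def order_emb_def)
  have mem: "\<phi> y \<in> Upper B (\<phi> ` S) \<longleftrightarrow> y \<in> Upper A S" if "y \<in> carrier A" for y
  proof -
    have "(\<forall>s\<in>S. \<phi> s \<sqsubseteq>\<^bsub>B\<^esub> \<phi> y) \<longleftrightarrow> (\<forall>s\<in>S. s \<sqsubseteq>\<^bsub>A\<^esub> y)" using S iso_le that by (intro ball_cong) auto
    moreover have "S \<inter> carrier A = S" "\<phi> ` S \<inter> carrier B = \<phi> ` S" using S iso_image by blast+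
    ultimately show ?thesis using that imageI[OF that, of \<phi>, unfolded iso_image] by (simp add: Upper_def Ball_def[symmetric])
  qed
  have sub: "Upper A S \<subseteq> carrier A" "Upper B (\<phi> ` S) \<subseteq> carrier B" by (auto simp: Upper_def)
  have im: "Upper B (\<phi> ` S) = \<phi> ` Upper A S"
  proof
    show "Upper B (\<phi> ` S) \<subseteq> \<phi> ` Upper A S"
    proof
      fix z assume z: "z \<in> Upper B (\<phi> ` S)"
      then obtain y where y: "y \<in> carrier A" "z = \<phi> y" using subsetD[OF sub(2) z] iso_image by blast
      then show "z \<in> \<phi> ` Upper A S" using z mem[OF y(1)] by simp
    qed
    show "\<phi> ` Upper A S \<subseteq> Upper B (\<phi> ` S)"
    proof
      fix z assume "z \<in> \<phi> ` Upper A S"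
      then obtain y where y: "y \<in> Upper A S" "z = \<phi> y" by (rule imageE)
      then show "z \<in> Upper B (\<phi> ` S)" using mem[OF subsetD[OF sub(1) y(1)]] by simp
    qed
  qed
  have "(\<forall>y\<in>Upper B (\<phi> ` S). \<phi> x \<sqsubseteq>\<^bsub>B\<^esub> y) \<longleftrightarrow> (\<forall>y\<in>Upper A S. x \<sqsubseteq>\<^bsub>A\<^esub> y)"
    unfolding im by (simp add: iso_le[OF x subsetD[OF sub(1)]])
  then show ?thesis unfolding least_def using mem[OF x] sub by simp
qed

text \<open>Passing to the inverse order yields the statements on greatest lower bounds from those
  on least upper bounds.\<close>

lemma poset_iso_dual: "poset_iso A B \<phi> \<Longrightarrow> poset_iso (inv_gorder A) (inv_gorder B) \<phi>"
  by (simp add: poset_iso_def dual_order_iff order_emb_def weak_partial_order.dual_weak_order)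

context
  fixes A :: "'a gorder" and B :: "'b gorder" and \<phi>
  assumes iso: "poset_iso A B \<phi>"
begin

lemma iso_po: "partial_order A" "partial_order B"
  using iso by (simp_all add: poset_iso_def)

lemma iso_image: "\<phi> ` carrier A = carrier B"
  using iso by (simp add: poset_iso_def bij_betw_def)

lemma iso_le: "\<lbrakk>x \<in> carrier A; y \<in> carrier A\<rbrakk> \<Longrightarrow> \<phi> x \<sqsubseteq>\<^bsub>B\<^esub> \<phi> y \<longleftrightarrow> x \<sqsubseteq>\<^bsub>A\<^esub> y"
  using iso by (simp add: poset_iso_def order_emb_def)

lemma iso_mem: "x \<in> carrier A \<Longrightarrow> \<phi> x \<in> carrier B"
  using iso_image by blast

lemma iso_inj: "\<lbrakk>\<phi> x = \<phi> y; x \<in> carrier A; y \<in> carrier A\<rbrakk> \<Longrightarrow> x = y"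
  using iso by (auto simp: poset_iso_def bij_betw_def inj_on_def)

lemmas iso_least = poset_iso_least[OF iso]
lemmas iso_greatest = poset_iso_least[OF poset_iso_dual[OF iso], simplified]

lemma iso_complete_lattice:
  assumes B: "complete_lattice B"
  shows "complete_lattice A"
proof (intro complete_lattice.intro complete_lattice_axioms.intro iso_po(1))
  fix S assume S: "S \<subseteq> carrier A"
  then have S': "\<phi> ` S \<subseteq> carrier B" using iso_mem by blast
  obtain x where x: "x \<in> carrier A" "\<phi> x = \<Squnion>\<^bsub>B\<^esub>(\<phi> ` S)" using sup_mem[OF B S'] iso_image by (metis imageE)
  then show "\<exists>s. least A s (Upper A S)" using sup_least[OF B S'] iso_least[OF S x(1)] by metis
  obtain y where y: "y \<in> carrier A" "\<phi> y = \<Sqinter>\<^bsub>B\<^esub>(\<phi> ` S)" using inf_mem[OF B S'] iso_image by (metis imageE)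
  then show "\<exists>s. greatest A s (Lower A S)" using inf_greatest[OF B S'] iso_greatest[OF S y(1)] by metis
qed

context
  assumes B: "complete_lattice B"
begin

lemmas iso_cl = iso_complete_lattice[OF B]

lemma iso_sup: "S \<subseteq> carrier A \<Longrightarrow> \<phi> (\<Squnion>\<^bsub>A\<^esub>S) = \<Squnion>\<^bsub>B\<^esub>(\<phi> ` S)"
  using sup_eqI[OF iso_po(2)] iso_least sup_least[OF iso_cl] sup_mem[OF iso_cl] by metis

lemma iso_inf: "S \<subseteq> carrier A \<Longrightarrow> \<phi> (\<Sqinter>\<^bsub>A\<^esub>S) = \<Sqinter>\<^bsub>B\<^esub>(\<phi> ` S)"
  using inf_eqI[OF iso_po(2)] iso_greatest inf_greatest[OF iso_cl] inf_mem[OF iso_cl] by metis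

lemma iso_ops:
  assumes "x \<in> carrier A" "y \<in> carrier A"
  shows "\<phi> (x \<squnion>\<^bsub>A\<^esub> y) = \<phi> x \<squnion>\<^bsub>B\<^esub> \<phi> y" "\<phi> (x \<sqinter>\<^bsub>A\<^esub> y) = \<phi> x \<sqinter>\<^bsub>B\<^esub> \<phi> y"
    "x \<squnion>\<^bsub>A\<^esub> y \<in> carrier A" "x \<sqinter>\<^bsub>A\<^esub> y \<in> carrier A"
  using assms iso_sup[of "{x, y}"] iso_inf[of "{x, y}"] sup_mem[OF iso_cl, of "{x, y}"] inf_mem[OF iso_cl, of "{x, y}"]
  by (simp_all add: join_def meet_def)

lemma iso_bounds: "\<phi> \<bottom>\<^bsub>A\<^esub> = \<bottom>\<^bsub>B\<^esub>" "\<phi> \<top>\<^bsub>A\<^esub> = \<top>\<^bsub>B\<^esub>" "\<bottom>\<^bsub>A\<^esub> \<in> carrier A" "\<top>\<^bsub>A\<^esub> \<in> carrier A"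
  using iso_sup[of "{}"] iso_inf[of "{}"] sup_mem[OF iso_cl, of "{}"] inf_mem[OF iso_cl, of "{}"]
  by (simp_all add: bottom_eq_sup top_eq_inf)

text \<open>Finiteness is defined by the order alone: families and finite subfamilies correspond
  under \<open>\<phi>\<close>, and suprema are preserved.\<close>

lemma iso_finite_elements:
  assumes c: "c \<in> carrier A"
  shows "\<phi> c \<in> finite_elements B \<longleftrightarrow> c \<in> finite_elements A"
proof -
  have le: "\<phi> c \<sqsubseteq>\<^bsub>B\<^esub> \<Squnion>\<^bsub>B\<^esub>(\<phi> ` S) \<longleftrightarrow> c \<sqsubseteq>\<^bsub>A\<^esub> \<Squnion>\<^bsub>A\<^esub>S" if "S \<subseteq> carrier A" for S
    using iso_le[OF c sup_mem[OF iso_cl that]] iso_sup[OF that] by simp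
  show ?thesis
  proof
    assume f: "\<phi> c \<in> finite_elements B"
    show "c \<in> finite_elements A"
    proof (rule finite_elementsI[OF c])
      fix S assume S: "S \<subseteq> carrier A" "c \<sqsubseteq>\<^bsub>A\<^esub> \<Squnion>\<^bsub>A\<^esub>S"
      have "\<phi> ` S \<subseteq> carrier B" using S(1) iso_image by blast
      moreover have "\<phi> c \<sqsubseteq>\<^bsub>B\<^esub> \<Squnion>\<^bsub>B\<^esub>(\<phi> ` S)" using S(2) le[OF S(1)] by blast
      ultimately have "\<exists>K\<subseteq>\<phi> ` S. finite K \<and> \<phi> c \<sqsubseteq>\<^bsub>B\<^esub> \<Squnion>\<^bsub>B\<^esub>K" by (rule finite_elementsD[OF f])
      then obtain K where K: "K \<subseteq> \<phi> ` S" "finite K" "\<phi> c \<sqsubseteq>\<^bsub>B\<^esub> \<Squnion>\<^bsub>B\<^esub>K" by blast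
      obtain K' where K': "K' \<subseteq> S" "finite K'" "K = \<phi> ` K'" using finite_subset_image[OF K(2,1)] by blast
      have "c \<sqsubseteq>\<^bsub>A\<^esub> \<Squnion>\<^bsub>A\<^esub>K'" using le[OF order.trans[OF K'(1) S(1)]] K(3) unfolding K'(3) by blast
      then show "\<exists>K\<subseteq>S. finite K \<and> c \<sqsubseteq>\<^bsub>A\<^esub> \<Squnion>\<^bsub>A\<^esub>K" using K' by blast
    qed
  next
    assume f: "c \<in> finite_elements A"
    show "\<phi> c \<in> finite_elements B"
    proof (rule finite_elementsI[OF iso_mem[OF c]])
      fix S assume S: "S \<subseteq> carrier B" "\<phi> c \<sqsubseteq>\<^bsub>B\<^esub> \<Squnion>\<^bsub>B\<^esub>S"
      obtain S' where S': "S' \<subseteq> carrier A" "S = \<phi> ` S'" using S(1) unfolding iso_image[symmetric] by (rule subset_imageE)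
      have "c \<sqsubseteq>\<^bsub>A\<^esub> \<Squnion>\<^bsub>A\<^esub>S'" using le[OF S'(1)] S(2) unfolding S'(2) by blast
      then obtain K where K: "K \<subseteq> S'" "finite K" "c \<sqsubseteq>\<^bsub>A\<^esub> \<Squnion>\<^bsub>A\<^esub>K" using finite_elementsD[OF f S'(1)] by blast
      have "\<phi> c \<sqsubseteq>\<^bsub>B\<^esub> \<Squnion>\<^bsub>B\<^esub>(\<phi> ` K)" using le[OF order.trans[OF K(1) S'(1)]] K(3) by blast
      moreover have "\<phi> ` K \<subseteq> S" "finite (\<phi> ` K)" using K S'(2) by auto
      ultimately show "\<exists>K\<subseteq>S. finite K \<and> \<phi> c \<sqsubseteq>\<^bsub>B\<^esub> \<Squnion>\<^bsub>B\<^esub>K" by blast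
    qed
  qed
qed

lemma iso_sublattice:
  assumes S: "sublattice B (finite_elements B)"
  shows "sublattice A (finite_elements A)"
proof -
  have c: "x \<in> carrier A" "\<phi> x \<in> finite_elements B" if "x \<in> finite_elements A" for x
    using that iso_finite_elements[OF finite_elements_carrier[OF that]] finite_elements_carrier[OF that] by simp_all
  note S' = S[unfolded sublattice_def]
  have "x \<squnion>\<^bsub>A\<^esub> y \<in> finite_elements A" "x \<sqinter>\<^bsub>A\<^esub> y \<in> finite_elements A"
    if xy: "x \<in> finite_elements A" "y \<in> finite_elements A" for x y
  proof -
    note o = iso_ops[OF c(1)[OF xy(1)] c(1)[OF xy(2)]]
    have "\<phi> x \<squnion>\<^bsub>B\<^esub> \<phi> y \<in> finite_elements B" "\<phi> x \<sqinter>\<^bsub>B\<^esub> \<phi> y \<in> finite_elements B"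
      using S' c(2)[OF xy(1)] c(2)[OF xy(2)] by blast+
    then show "x \<squnion>\<^bsub>A\<^esub> y \<in> finite_elements A" "x \<sqinter>\<^bsub>A\<^esub> y \<in> finite_elements A"
      using iso_finite_elements[OF o(3)] iso_finite_elements[OF o(4)] o(1,2) by simp_all
  qed
  moreover have "\<bottom>\<^bsub>A\<^esub> \<in> finite_elements A" "\<top>\<^bsub>A\<^esub> \<in> finite_elements A"
    using S' iso_finite_elements[OF iso_bounds(3)] iso_finite_elements[OF iso_bounds(4)] iso_bounds(1,2) by simp_all
  ultimately show ?thesis using finite_elements_subset unfolding sublattice_def by simp
qed

lemma iso_distributive:
  assumes S: "sublattice B (finite_elements B)"
    and D: "\<And>x y z. \<lbrakk>x \<in> carrier B; y \<in> carrier B; z \<in> carrier B\<rbrakk> \<Longrightarrow>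
      x \<sqinter>\<^bsub>B\<^esub> (y \<squnion>\<^bsub>B\<^esub> z) = (x \<sqinter>\<^bsub>B\<^esub> y) \<squnion>\<^bsub>B\<^esub> (x \<sqinter>\<^bsub>B\<^esub> z)"
  shows "distributive_lattice (finite_part A)"
  unfolding finite_part_def
proof (rule sublattice_distributive[OF iso_cl iso_sublattice[OF S]])
  fix x y z assume "x \<in> finite_elements A" "y \<in> finite_elements A" "z \<in> finite_elements A"
  then have c: "x \<in> carrier A" "y \<in> carrier A" "z \<in> carrier A" by (simp_all add: finite_elements_carrier)
  show "x \<sqinter>\<^bsub>A\<^esub> (y \<squnion>\<^bsub>A\<^esub> z) = (x \<sqinter>\<^bsub>A\<^esub> y) \<squnion>\<^bsub>A\<^esub> (x \<sqinter>\<^bsub>A\<^esub> z)"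
    by (rule iso_inj) (use c D iso_mem in \<open>simp_all add: iso_ops\<close>)
qed

lemma iso_lattice_iso:
  assumes S: "sublattice B (finite_elements B)"
  shows "lattice_iso (finite_part A) (finite_part B) \<phi>"
proof -
  note SA = iso_sublattice[OF S]
  note a = sublattice_bounded_lattice[OF iso_cl SA] and b = sublattice_bounded_lattice[OF B S]
  have c: "x \<in> carrier A" "\<phi> x \<in> finite_elements B" if "x \<in> finite_elements A" for x
    using that iso_finite_elements[OF finite_elements_carrier[OF that]] finite_elements_carrier[OF that] by simp_all
  have "bij_betw \<phi> (finite_elements A) (finite_elements B)"
    unfolding bij_betw_def
  proof
    show "inj_on \<phi> (finite_elements A)" using c(1) iso_inj by (meson inj_onI)
    show "\<phi> ` finite_elements A = finite_elements B"
    proof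
      show "\<phi> ` finite_elements A \<subseteq> finite_elements B" using c(2) by blast
      show "finite_elements B \<subseteq> \<phi> ` finite_elements A"
      proof
        fix y assume y: "y \<in> finite_elements B"
        then obtain x where x: "x \<in> carrier A" "y = \<phi> x" using finite_elements_carrier[OF y] iso_image by blast
        then have "x \<in> finite_elements A" using y iso_finite_elements[OF x(1)] by simp
        then show "y \<in> \<phi> ` finite_elements A" using x(2) by blast
      qed
    qed
  qed
  moreover have "lattice (A\<lparr>carrier := finite_elements A\<rparr>)" "lattice (B\<lparr>carrier := finite_elements B\<rparr>)"
    using a(1) b(1) by (simp_all add: bounded_lattice_def)
  moreover have "\<phi> (x \<squnion>\<^bsub>A\<lparr>carrier := finite_elements A\<rparr>\<^esub> y) = \<phi> x \<squnion>\<^bsub>B\<lparr>carrier := finite_elements B\<rparr>\<^esub> \<phi> y"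
    "\<phi> (x \<sqinter>\<^bsub>A\<lparr>carrier := finite_elements A\<rparr>\<^esub> y) = \<phi> x \<sqinter>\<^bsub>B\<lparr>carrier := finite_elements B\<rparr>\<^esub> \<phi> y"
    if "x \<in> finite_elements A" "y \<in> finite_elements A" for x y
    unfolding a(2)[OF that] a(3)[OF that] b(2)[OF c(2)[OF that(1)] c(2)[OF that(2)]] b(3)[OF c(2)[OF that(1)] c(2)[OF that(2)]]
    by (rule iso_ops(1)[OF c(1)[OF that(1)] c(1)[OF that(2)]] iso_ops(2)[OF c(1)[OF that(1)] c(1)[OF that(2)]])+
  ultimately show ?thesis
    unfolding lattice_iso_def join_pres_def meet_pres_def finite_part_def a(4,5) b(4,5) using iso_bounds(1,2) by simp
qed

end
end


section \<open>The lattice of radical ideals\<close>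

context cring
begin

lemma radical_mono: "I \<subseteq> J \<Longrightarrow> radical R I \<subseteq> radical R J"
  by (auto simp: radical_def)

lemma radical_superset: "I \<subseteq> carrier R \<Longrightarrow> I \<subseteq> radical R I"
proof
  fix x assume "I \<subseteq> carrier R" "x \<in> I"
  then show "x \<in> radical R I" unfolding radical_def by (auto intro!: exI[of _ "1::nat"])
qed

lemma radical_idem: "radical R (radical R I) = radical R I"
proof
  show "radical R (radical R I) \<subseteq> radical R I"
    by (auto simp: radical_def nat_pow_pow)
  show "radical R I \<subseteq> radical R (radical R I)" by (rule radical_superset) (auto simp: radical_def)
qed

lemma ideal_mem:
  assumes "ideal I R"
  shows "I \<subseteq> carrier R" "\<zero> \<in> I" "\<lbrakk>x \<in> I; y \<in> I\<rbrakk> \<Longrightarrow> x \<oplus> y \<in> I" "\<lbrakk>x \<in> I; r \<in> carrier R\<rbrakk> \<Longrightarrow> r \<otimes> x \<in> I"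
    "\<lbrakk>x \<in> I; r \<in> carrier R\<rbrakk> \<Longrightarrow> x \<otimes> r \<in> I"
proof -
  interpret ideal I R by (rule assms)
  show "I \<subseteq> carrier R" by (rule a_subset)
  show "\<zero> \<in> I" by simp
  show "x \<oplus> y \<in> I" if "x \<in> I" "y \<in> I" using that by simp
  show "r \<otimes> x \<in> I" "x \<otimes> r \<in> I" if "x \<in> I" "r \<in> carrier R" using that I_l_closed I_r_closed by auto
qed

lemma idealI_comm:
  assumes I: "I \<subseteq> carrier R" "\<zero> \<in> I" and add: "\<And>x y. \<lbrakk>x \<in> I; y \<in> I\<rbrakk> \<Longrightarrow> x \<oplus> y \<in> I"
    and mult: "\<And>x r. \<lbrakk>x \<in> I; r \<in> carrier R\<rbrakk> \<Longrightarrow> r \<otimes> x \<in> I"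
  shows "ideal I R"
proof (rule idealI[OF ring_axioms])
  show "subgroup I (add_monoid R)"
  proof (rule add.subgroupI[OF I(1)])
    fix a assume a: "a \<in> I"
    have "\<ominus> \<one> \<otimes> a \<in> I" by (rule mult[OF a]) simp
    then show "\<ominus> a \<in> I" using a I(1) by (simp add: l_minus subset_iff)
  qed (use I(2) add in auto)
  show "a \<otimes> x \<in> I" if "a \<in> I" "x \<in> carrier R" for a x
    using mult[OF that] m_comm[of a x] that I(1) by (auto simp: subset_iff)
qed (use mult in auto)

text \<open>If \<open>x^m\<close> and \<open>y^n\<close> lie in \<open>I\<close>, then
  \<open>power_add_split\<close> puts the power m + n of x + y into \<open>I\<close>.\<close>

lemma radical_ideal:
  assumes "ideal I R"
  shows "ideal (radical R I) R"
proof (rule idealI_comm)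
  note I = ideal_mem[OF assms]
  show "radical R I \<subseteq> carrier R" by (auto simp: radical_def)
  show "\<zero> \<in> radical R I" using radical_superset[OF I(1)] I(2) by blast
  fix x assume "x \<in> radical R I"
  then obtain m :: nat where x: "x \<in> carrier R" "x [^] m \<in> I" by (auto simp: radical_def)
  show "r \<otimes> x \<in> radical R I" if r: "r \<in> carrier R" for r
    using I(4)[OF x(2), of "r [^] m"] r x(1) by (auto simp: radical_def nat_pow_distrib)
  fix y assume "y \<in> radical R I"
  then obtain n :: nat where y: "y \<in> carrier R" "y [^] n \<in> I" by (auto simp: radical_def)
  obtain p q where pq: "p \<in> carrier R" "q \<in> carrier R" "(x \<oplus> y) [^] (m + n) = p \<otimes> x [^] m \<oplus> q \<otimes> y [^] n"
    using power_add_split[OF x(1) y(1)] by blast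
  then have "(x \<oplus> y) [^] (m + n) \<in> I" using I(3,4) x(2) y(2) by simp
  then show "x \<oplus> y \<in> radical R I" using x(1) y(1) by (auto simp: radical_def)
qed

lemma radical_carrier: "radical R (carrier R) = carrier R"
  using radical_superset[of "carrier R"] by (auto simp: radical_def)

lemma RadId_simps [simp]:
  "rads = {I. ideal I R \<and> radical R I = I}"
  "x \<sqsubseteq>\<^bsub>RadId R\<^esub> y \<longleftrightarrow> x \<subseteq> y" "x .=\<^bsub>RadId R\<^esub> y \<longleftrightarrow> x = y"
  by (simp_all add: RadId_def)

lemma radical_Idl_RadId: "S \<subseteq> carrier R \<Longrightarrow> rad S \<in> rads"
  using radical_ideal[OF genideal_ideal] radical_idem by simp

lemma RadId_sub: "I \<in> rads \<Longrightarrow> I \<subseteq> carrier R"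
  using ideal_mem(1) by simp

lemma radical_Idl_subset_iff:
  assumes "S \<subseteq> carrier R" "I \<in> rads"
  shows "rad S \<subseteq> I \<longleftrightarrow> S \<subseteq> I"
proof
  assume "rad S \<subseteq> I"
  then show "S \<subseteq> I"
    using genideal_self[OF assms(1)] radical_superset[OF ideal_mem(1)[OF genideal_ideal[OF assms(1)]]] by blast
next
  assume "S \<subseteq> I"
  then have "Idl S \<subseteq> I" using genideal_minimal assms(2) by simp
  then show "rad S \<subseteq> I" using radical_mono[of "Idl S" I] assms(2) by simp
qed

lemma radical_Idl_self:
  assumes "I \<in> rads"
  shows "rad I = I"
proof -
  have "Idl I = I" using genideal_self[OF RadId_sub[OF assms]] genideal_minimal[of I I] assms by auto
  then show ?thesis using assms by simp
qed

lemma subset_radical_Idl: "S \<subseteq> carrier R \<Longrightarrow> S \<subseteq> rad S"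
  using radical_Idl_subset_iff[of S "rad S"] radical_Idl_RadId by blast

lemma RadId_partial_order: "partial_order (RadId R)"
  by standard (auto simp: RadId_def)

lemma RadId_sup_least:
  assumes "S \<subseteq> rads"
  shows "least (RadId R) (rad (\<Union>S)) (Upper (RadId R) S)"
proof -
  have c: "\<Union>S \<subseteq> carrier R" using assms RadId_sub by blast
  show ?thesis
    using radical_Idl_RadId[OF c] radical_Idl_subset_iff[OF c] subset_radical_Idl[OF c] assms
    unfolding least_def Upper_def by (auto simp del: RadId_simps(1) simp: RadId_simps(2))
qed

text \<open>The family is nonempty because the intersection of the empty family is the whole type
  and not the carrier of \<open>R\<close>; the top element is treated separately.\<close>

lemma RadId_inf_greatest:
  assumes "S \<subseteq> rads" "S \<noteq> {}"
  shows "greatest (RadId R) (\<Inter>S) (Lower (RadId R) S)"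
proof -
  have "ideal (\<Inter>S) R" using assms by (intro i_Intersect) auto
  moreover have "radical R (\<Inter>S) = \<Inter>S"
  proof
    show "radical R (\<Inter>S) \<subseteq> \<Inter>S" using assms(1) radical_mono[of "\<Inter>S"] by fastforce
    show "\<Inter>S \<subseteq> radical R (\<Inter>S)" by (rule radical_superset[OF ideal_mem(1)]) fact
  qed
  ultimately have "\<Inter>S \<in> rads" by simp
  then show ?thesis using assms unfolding greatest_def Lower_def by (auto simp del: RadId_simps(1) simp: RadId_simps(2))
qed

lemma RadId_top: "greatest (RadId R) (carrier R) (rads)"
  using RadId_sub oneideal radical_carrier by (auto simp: greatest_def)

lemma RadId_complete_lattice: "complete_lattice (RadId R)"
  by (rule partial_order.complete_lattice_criterion1[OF RadId_partial_order]) (use RadId_top RadId_inf_greatest in blast)+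

lemma RadId_sup: "S \<subseteq> rads \<Longrightarrow> \<Squnion>\<^bsub>RadId R\<^esub>S = rad (\<Union>S)"
  by (rule sup_eqI[OF RadId_partial_order RadId_sup_least])

lemma RadId_ops:
  assumes "I \<in> rads" "J \<in> rads"
  shows "I \<squnion>\<^bsub>RadId R\<^esub> J = rad (I \<union> J)" "I \<sqinter>\<^bsub>RadId R\<^esub> J = I \<inter> J"
  unfolding join_def meet_def
  using RadId_sup[of "{I, J}"] inf_eqI[OF RadId_partial_order RadId_inf_greatest[of "{I, J}"]] assms by simp_all

lemma RadId_bounds: "\<bottom>\<^bsub>RadId R\<^esub> = radical R (Idl {})" "\<top>\<^bsub>RadId R\<^esub> = carrier R"
proof -
  show "\<bottom>\<^bsub>RadId R\<^esub> = radical R (Idl {})" using RadId_sup[of "{}"] by (simp add: bottom_eq_sup)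
  have "greatest (RadId R) (carrier R) (Lower (RadId R) {})" using RadId_top by (simp add: Lower_def)
  then show "\<top>\<^bsub>RadId R\<^esub> = carrier R" using inf_eqI[OF RadId_partial_order] by (simp add: top_eq_inf)
qed

text \<open>Used to extend a statement "p b lies in I" from generators p to the whole ideal they
  generate.\<close>

lemma ideal_colon:
  assumes I: "ideal I R" and b: "b \<in> carrier R"
  shows "ideal {p \<in> carrier R. p \<otimes> b \<in> I} R"
proof (rule idealI_comm)
  note I = ideal_mem[OF I]
  show "\<zero> \<in> {p \<in> carrier R. p \<otimes> b \<in> I}" using I(2) b by simp
  show "x \<oplus> y \<in> {p \<in> carrier R. p \<otimes> b \<in> I}" if "x \<in> {p \<in> carrier R. p \<otimes> b \<in> I}" "y \<in> {p \<in> carrier R. p \<otimes> b \<in> I}" for x y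
    using that I(3) b by (simp add: l_distr)
  show "r \<otimes> x \<in> {p \<in> carrier R. p \<otimes> b \<in> I}" if "x \<in> {p \<in> carrier R. p \<otimes> b \<in> I}" "r \<in> carrier R" for x r
    using that I(4) b by (simp add: m_assoc)
qed auto

text \<open>Only one inclusion needs an argument: an element a of x with a power in the ideal of y
  and z has its next power in the ideal generated by the two intersections.\<close>

lemma RadId_distrib:
  assumes x: "x \<in> rads" and y: "y \<in> rads" and z: "z \<in> rads"
  shows "x \<sqinter>\<^bsub>RadId R\<^esub> (y \<squnion>\<^bsub>RadId R\<^esub> z) = (x \<sqinter>\<^bsub>RadId R\<^esub> y) \<squnion>\<^bsub>RadId R\<^esub> (x \<sqinter>\<^bsub>RadId R\<^esub> z)"
proof -
  have c: "x \<subseteq> carrier R" "y \<subseteq> carrier R" "z \<subseteq> carrier R" using x y z RadId_sub by auto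
  have yz: "rad (y \<union> z) \<in> rads" by (rule radical_Idl_RadId) (use c in blast)
  have m: "x \<inter> y \<in> rads" "x \<inter> z \<in> rads"
    using RadId_inf_greatest[of "{x, y}"] RadId_inf_greatest[of "{x, z}"] x y z by (auto simp: greatest_def)
  let ?K = "Idl (x \<inter> y \<union> x \<inter> z)"
  have cK: "x \<inter> y \<union> x \<inter> z \<subseteq> carrier R" using c by blast
  have K: "ideal ?K R" by (rule genideal_ideal[OF cK])
  have "x \<inter> rad (y \<union> z) = radical R ?K"
  proof
    show "x \<inter> rad (y \<union> z) \<subseteq> radical R ?K"
    proof
      fix a assume a: "a \<in> x \<inter> rad (y \<union> z)"
      then obtain n :: nat where n: "a \<in> carrier R" "a [^] n \<in> Idl (y \<union> z)" by (auto simp: radical_def)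
      \<comment> \<open>Multiplying by \<open>a\<close>, which lies in x, moves elements of y and z
        into the intersections with x.\<close>
      have "y \<union> z \<subseteq> {p \<in> carrier R. p \<otimes> a \<in> ?K}"
      proof
        fix p assume p: "p \<in> y \<union> z"
        then have "p \<in> carrier R" using c by blast
        moreover have "p \<otimes> a \<in> x \<inter> y \<union> x \<inter> z"
          using p a n(1) calculation ideal_mem(4)[of x a p] ideal_mem(5)[of y p a] ideal_mem(5)[of z p a] x y z by auto
        ultimately show "p \<in> {p \<in> carrier R. p \<otimes> a \<in> ?K}" using genideal_self[OF cK] by blast
      qed
      then have "Idl (y \<union> z) \<subseteq> {p \<in> carrier R. p \<otimes> a \<in> ?K}" by (rule genideal_minimal[OF ideal_colon[OF K n(1)]])
      then have "a [^] (Suc n) \<in> ?K" using n by auto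
      then show "a \<in> radical R ?K" using n(1) unfolding radical_def by blast
    qed
    have "x \<inter> y \<union> x \<inter> z \<subseteq> rad (y \<union> z)" using subset_radical_Idl[of "y \<union> z"] c by blast
    then show "radical R ?K \<subseteq> x \<inter> rad (y \<union> z)"
      using radical_Idl_subset_iff[OF cK x] radical_Idl_subset_iff[OF cK yz] by blast
  qed
  then show ?thesis by (simp only: RadId_ops[OF y z] RadId_ops[OF x yz] RadId_ops[OF x y] RadId_ops[OF x z] RadId_ops[OF m])
qed

text \<open>The elements that lie in the ideal of some finite subset already form an ideal
  containing \<open>X\<close>.\<close>

lemma Idl_finite:
  assumes X: "X \<subseteq> carrier R" and a: "a \<in> Idl X"
  obtains F where "finite F" "F \<subseteq> X" "a \<in> Idl F"
proof -
  let ?A = "{a. \<exists>F\<subseteq>X. finite F \<and> a \<in> Idl F}"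
  have F: "ideal (Idl F) R" if "F \<subseteq> X" for F using genideal_ideal X that by blast
  have "ideal ?A R"
  proof (rule idealI_comm)
    show "?A \<subseteq> carrier R" using ideal_mem(1)[OF F] by blast
    have "\<zero> \<in> Idl {}" using ideal_mem(2)[OF F[of "{}"]] by simp
    then show "\<zero> \<in> ?A" by blast
    fix x assume "x \<in> ?A"
    then obtain F where F1: "F \<subseteq> X" "finite F" "x \<in> Idl F" by blast
    then show "r \<otimes> x \<in> ?A" if "r \<in> carrier R" for r using ideal_mem(4)[OF F[OF F1(1)] F1(3) that] by blast
    fix y assume "y \<in> ?A"
    then obtain G where G: "G \<subseteq> X" "finite G" "y \<in> Idl G" by blast
    have "F \<union> G \<subseteq> carrier R" using F1 G X by blast
    then have "Idl F \<subseteq> Idl (F \<union> G)" "Idl G \<subseteq> Idl (F \<union> G)" by (intro subset_Idl_subset; blast)+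
    then have "x \<in> Idl (F \<union> G)" "y \<in> Idl (F \<union> G)" using F1(3) G(3) by (simp_all add: subsetD)
    then have "x \<oplus> y \<in> Idl (F \<union> G)" by (intro ideal_mem(3)[OF F[of "F \<union> G"]]) (use F1(1) G(1) in simp_all)
    then show "x \<oplus> y \<in> ?A" using F1(1,2) G(1,2) by (intro CollectI exI[of _ "F \<union> G"]) simp
  qed
  moreover have "X \<subseteq> ?A"
  proof
    fix x assume "x \<in> X"
    then show "x \<in> ?A" using genideal_self'[of x] X by (intro CollectI exI[of _ "{x}"]) auto
  qed
  ultimately have "Idl X \<subseteq> ?A" by (rule genideal_minimal)
  then show ?thesis using a that by blast
qed

text \<open>A radical ideal is the join of the radicals of its finitely generated subideals;
  conversely, membership of a generator in a radical involves only finitely many elements.\<close>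

lemma finite_elements_RadId: "finite_elements (RadId R) = {rad K | K. finite K \<and> K \<subseteq> carrier R}"
proof
  show "finite_elements (RadId R) \<subseteq> {rad K | K. finite K \<and> K \<subseteq> carrier R}"
  proof
    fix I assume I: "I \<in> finite_elements (RadId R)"
    then have IC: "I \<in> rads" by (simp add: finite_elements_def)
    \<comment> \<open>A family with join above \<open>I\<close> for which any finite subfamily is
      again bounded by one finite set of generators inside \<open>I\<close>.\<close>
    let ?S = "{rad K | K. finite K \<and> K \<subseteq> I}"
    have Ic: "I \<subseteq> carrier R" by (rule RadId_sub[OF IC])
    then have SC: "?S \<subseteq> rads" using radical_Idl_RadId by blast
    then have Sc: "\<Union>?S \<subseteq> carrier R" using RadId_sub by blast
    have "I \<subseteq> \<Union>?S"
    proof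
      fix x assume x: "x \<in> I"
      then have "x \<in> radical R (Idl {x})" using subset_radical_Idl[of "{x}"] Ic by blast
      then show "x \<in> \<Union>?S" using x by blast
    qed
    then have "I \<sqsubseteq>\<^bsub>RadId R\<^esub> \<Squnion>\<^bsub>RadId R\<^esub>?S" using subset_radical_Idl[OF Sc] RadId_sup[OF SC] by auto
    then obtain T where T: "T \<subseteq> ?S" "finite T" "I \<sqsubseteq>\<^bsub>RadId R\<^esub> \<Squnion>\<^bsub>RadId R\<^esub>T"
      using finite_elementsD[OF I SC] by blast
    have "\<forall>t\<in>T. \<exists>K. finite K \<and> K \<subseteq> I \<and> t = rad K" using T(1) by blast
    then obtain k where k: "\<And>t. t \<in> T \<Longrightarrow> finite (k t) \<and> k t \<subseteq> I \<and> t = rad (k t)" by metis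
    let ?K = "\<Union>(k ` T)"
    have K: "finite ?K" "?K \<subseteq> I" using k T(2) by auto
    have Kc: "?K \<subseteq> carrier R" using K Ic by blast
    have "\<Union>T \<subseteq> rad ?K"
    proof
      fix x assume "x \<in> \<Union>T"
      then obtain t where t: "t \<in> T" "x \<in> rad (k t)" using k by blast
      have "Idl (k t) \<subseteq> Idl ?K" by (rule subset_Idl_subset[OF Kc]) (use t in blast)
      then show "x \<in> rad ?K" using t(2) radical_mono by blast
    qed
    moreover have TC: "T \<subseteq> rads" using T(1) SC by blast
    moreover have "\<Union>T \<subseteq> carrier R" using TC RadId_sub by blast
    ultimately have "rad (\<Union>T) \<subseteq> rad ?K"
      using radical_Idl_subset_iff radical_Idl_RadId[OF Kc] by blast
    then have "I \<subseteq> rad ?K" using T(3) RadId_sup[OF TC] by simp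
    moreover have "rad ?K \<subseteq> I" using radical_Idl_subset_iff[OF Kc IC] K(2) by blast
    ultimately have "I = rad ?K" by blast
    then show "I \<in> {rad K | K. finite K \<and> K \<subseteq> carrier R}" using K(1) Kc by blast
  qed
  show "{rad K | K. finite K \<and> K \<subseteq> carrier R} \<subseteq> finite_elements (RadId R)"
  proof
    fix I assume "I \<in> {rad K | K. finite K \<and> K \<subseteq> carrier R}"
    then obtain K where K: "finite K" "K \<subseteq> carrier R" "I = rad K" by blast
    have IC: "I \<in> rads" using radical_Idl_RadId[OF K(2)] K(3) by simp
    show "I \<in> finite_elements (RadId R)"
    proof (rule finite_elementsI[OF IC])
      fix S assume S: "S \<subseteq> rads" "I \<sqsubseteq>\<^bsub>RadId R\<^esub> \<Squnion>\<^bsub>RadId R\<^esub>S"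
      have Sc: "\<Union>S \<subseteq> carrier R" using S(1) RadId_sub by blast
      have KS: "K \<subseteq> rad (\<Union>S)" using S(2) K(3) RadId_sup[OF S(1)] subset_radical_Idl[OF K(2)] by auto
      \<comment> \<open>Each generator needs finitely many elements of the union, and these are
        contained in finitely many members of the family.\<close>
      have "\<forall>g\<in>K. \<exists>F. finite F \<and> F \<subseteq> \<Union>S \<and> g \<in> rad F"
      proof
        fix g assume "g \<in> K"
        then obtain n :: nat where n: "g \<in> carrier R" "g [^] n \<in> Idl (\<Union>S)" using KS by (auto simp: radical_def)
        obtain F where "finite F" "F \<subseteq> \<Union>S" "g [^] n \<in> Idl F" using Idl_finite[OF Sc n(2)] .
        then show "\<exists>F. finite F \<and> F \<subseteq> \<Union>S \<and> g \<in> rad F" using n(1) by (auto simp: radical_def)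
      qed
      then obtain F where F: "\<And>g. g \<in> K \<Longrightarrow> finite (F g) \<and> F g \<subseteq> \<Union>S \<and> g \<in> rad (F g)" by metis
      have "finite (\<Union>(F ` K))" "\<Union>(F ` K) \<subseteq> \<Union>S" using F K(1) by auto
      then obtain T where T: "finite T" "T \<subseteq> S" "\<Union>(F ` K) \<subseteq> \<Union>T" using finite_subset_Union by metis
      have TC: "T \<subseteq> rads" and Tc: "\<Union>T \<subseteq> carrier R" using T(2) S(1) Sc by blast+
      have "K \<subseteq> rad (\<Union>T)"
      proof
        fix g assume g: "g \<in> K"
        have "Idl (F g) \<subseteq> Idl (\<Union>T)" by (rule subset_Idl_subset[OF Tc]) (use g T(3) in blast)
        then show "g \<in> rad (\<Union>T)" using F[OF g] radical_mono by blast
      qed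
      then have "I \<sqsubseteq>\<^bsub>RadId R\<^esub> \<Squnion>\<^bsub>RadId R\<^esub>T"
        using radical_Idl_subset_iff[OF K(2) radical_Idl_RadId[OF Tc]] K(3) RadId_sup[OF TC] by simp
      then show "\<exists>T\<subseteq>S. finite T \<and> I \<sqsubseteq>\<^bsub>RadId R\<^esub> \<Squnion>\<^bsub>RadId R\<^esub>T" using T by blast
    qed
  qed
qed

text \<open>The radical of a product ideal is the intersection of the radicals. In this form a meet
  of radicals with finitely many generators visibly has finitely many generators again.\<close>

lemma radical_Idl_inter:
  assumes K: "K \<subseteq> carrier R" and L: "L \<subseteq> carrier R"
  shows "rad K \<inter> rad L = rad ((\<lambda>(a, b). a \<otimes> b) ` (K \<times> L))"
    (is "_ = rad ?P")
proof
  have P: "?P \<subseteq> carrier R" using K L by auto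
  note I = genideal_ideal[OF P]
  show "rad K \<inter> rad L \<subseteq> rad ?P"
  proof
    fix x assume "x \<in> rad K \<inter> rad L"
    then obtain m n :: nat where x: "x \<in> carrier R" "x [^] m \<in> Idl K" "x [^] n \<in> Idl L" by (auto simp: radical_def)
    have 1: "p \<otimes> b \<in> Idl ?P" if p: "p \<in> Idl K" and b: "b \<in> L" for p b
    proof -
      have bR: "b \<in> carrier R" using b L by blast
      have "K \<subseteq> {p \<in> carrier R. p \<otimes> b \<in> Idl ?P}" using K b genideal_self[OF P] by auto
      then show ?thesis using genideal_minimal[OF ideal_colon[OF I bR]] p by blast
    qed
    have "L \<subseteq> {q \<in> carrier R. q \<otimes> x [^] m \<in> Idl ?P}"
    proof
      fix b assume b: "b \<in> L"
      then show "b \<in> {q \<in> carrier R. q \<otimes> x [^] m \<in> Idl ?P}" using 1[OF x(2) b] L x(1) m_comm[of "x [^] m" b] by auto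
    qed
    then have "Idl L \<subseteq> {q \<in> carrier R. q \<otimes> x [^] m \<in> Idl ?P}"
      by (intro genideal_minimal ideal_colon[OF I]) (use x(1) in simp)
    \<comment> \<open>The product of a power of \<open>x\<close> in the ideal of \<open>L\<close>
      and one in the ideal of \<open>K\<close>; bilinearity was obtained by two passages to
      generated ideals.\<close>
    then have "x [^] (n + m) \<in> Idl ?P" using x(1,3) by (auto simp: nat_pow_mult)
    then show "x \<in> rad ?P" using x(1) unfolding radical_def by blast
  qed
  have "a \<otimes> b \<in> Idl K" "a \<otimes> b \<in> Idl L" if "a \<in> K" "b \<in> L" for a b
    using ideal_mem(5)[OF genideal_ideal[OF K], of a b] ideal_mem(4)[OF genideal_ideal[OF L], of b a]
      subsetD[OF genideal_self[OF K] that(1)] subsetD[OF genideal_self[OF L] that(2)] that K L by auto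
  then have "?P \<subseteq> Idl K" "?P \<subseteq> Idl L" by auto
  then have "Idl ?P \<subseteq> Idl K" "Idl ?P \<subseteq> Idl L" using genideal_minimal genideal_ideal K L by auto
  then show "rad ?P \<subseteq> rad K \<inter> rad L" using radical_mono by blast
qed

lemma radical_Idl_join:
  assumes K: "K \<subseteq> carrier R" and L: "L \<subseteq> carrier R"
  shows "rad (rad K \<union> rad L) = rad (K \<union> L)" (is "rad ?U = _")
proof
  have KL: "K \<union> L \<subseteq> carrier R" using K L by blast
  have U: "?U \<subseteq> carrier R" by (auto simp: radical_def)
  have "Idl K \<subseteq> Idl (K \<union> L)" "Idl L \<subseteq> Idl (K \<union> L)" by (intro subset_Idl_subset[OF KL]; blast)+
  then have "?U \<subseteq> rad (K \<union> L)" using radical_mono by blast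
  then show "rad ?U \<subseteq> rad (K \<union> L)"
    using radical_Idl_subset_iff[OF U radical_Idl_RadId[OF KL]] by blast
  have "K \<union> L \<subseteq> ?U" using subset_radical_Idl K L by blast
  then show "rad (K \<union> L) \<subseteq> rad ?U"
    using radical_mono[OF subset_Idl_subset[OF U]] by blast
qed

lemma sublattice_RadId: "sublattice (RadId R) (finite_elements (RadId R))"
proof -
  let ?F = "finite_elements (RadId R)"
  have mem: "rad K \<in> ?F" if "finite K" "K \<subseteq> carrier R" for K
    using that unfolding finite_elements_RadId by blast
  have "\<bottom>\<^bsub>RadId R\<^esub> \<in> ?F" using mem[of "{}"] by (simp add: RadId_bounds)
  moreover have "\<top>\<^bsub>RadId R\<^esub> \<in> ?F" using mem[of "{\<one>}"] by (simp add: RadId_bounds genideal_one radical_carrier)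
  moreover have "x \<squnion>\<^bsub>RadId R\<^esub> y \<in> ?F \<and> x \<sqinter>\<^bsub>RadId R\<^esub> y \<in> ?F" if xy: "x \<in> ?F" "y \<in> ?F" for x y
  proof -
    obtain K L where K: "finite K" "K \<subseteq> carrier R" "x = rad K"
      and L: "finite L" "L \<subseteq> carrier R" "y = rad L"
      using xy unfolding finite_elements_RadId by blast
    have xyC: "x \<in> rads" "y \<in> rads" using K L radical_Idl_RadId by blast+
    have "x \<squnion>\<^bsub>RadId R\<^esub> y = rad (K \<union> L)"
      using RadId_ops(1)[OF xyC] radical_Idl_join[OF K(2) L(2)] K(3) L(3) by simp
    moreover have "x \<sqinter>\<^bsub>RadId R\<^esub> y = rad ((\<lambda>(a, b). a \<otimes> b) ` (K \<times> L))"
      using RadId_ops(2)[OF xyC] radical_Idl_inter[OF K(2) L(2)] K(3) L(3) by simp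
    moreover have "(\<lambda>(a, b). a \<otimes> b) ` (K \<times> L) \<subseteq> carrier R" using K(2) L(2) by auto
    ultimately show ?thesis using mem[of "K \<union> L"] mem[of "(\<lambda>(a, b). a \<otimes> b) ` (K \<times> L)"] K(1,2) L(1,2) by simp
  qed
  ultimately show ?thesis unfolding sublattice_def using finite_elements_subset[of "RadId R"] by (simp del: RadId_simps)
qed

lemma fgRadId_finite_part: "fgRadId R = finite_part (RadId R)"
  by (simp add: fgRadId_def finite_part_def finite_elements_RadId) (simp add: RadId_def)

end

section \<open>The classification\<close>

lemma RfGLoc_simps [simp]:
  "carrier (RfGLoc R) = {LocR R J | J. J \<subseteq> carrier R}"
  "x \<sqsubseteq>\<^bsub>RfGLoc R\<^esub> y \<longleftrightarrow> x \<subseteq> y" "x .=\<^bsub>RfGLoc R\<^esub> y \<longleftrightarrow> x = y"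
  by (simp_all add: RfGLoc_def)

lemma RfGLoc_partial_order: "partial_order (RfGLoc R)"
  by standard (auto simp: RfGLoc_def)

context derived_category
begin

text \<open>The isomorphism of the theorem, given by membership instead of by a generating set; so
  it is well defined at once and visibly monotone.\<close>

definition loc_support :: "('r, 'u) cochain_complex set \<Rightarrow> 'r set" where
  "loc_support L = {f \<in> carrier R. \<forall>X. is_loc_complex R f X \<longrightarrow> X \<in> L}"

text \<open>One inclusion is the closure of localizing subcategories under passing to the radical
  ideal; the other uses a separating localizing subcategory for each element outside the
  radical.\<close>

lemma loc_support_LocR:
  assumes J: "J \<subseteq> carrier R"
  shows "loc_support (LocR R J) = rad J"
proof
  show "rad J \<subseteq> loc_support (LocR R J)"
  proof
    fix f assume f: "f \<in> rad J"
    then have fR: "f \<in> carrier R" by (simp add: radical_def)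
    have "X \<in> L" if "is_loc_complex R f X" "localizing_subcat R L" "{X. \<exists>f\<in>J. is_loc_complex R f X} \<subseteq> L"
      for X :: "('r, 'u) cochain_complex" and L
      by (rule localizing_copies_radical[OF that(2) J _ f is_loc_complex_copy[OF that(1) fR]]) (use that(3) in blast)
    then show "f \<in> loc_support (LocR R J)" using fR by (simp add: loc_support_def LocR_def Loc_def)
  qed
  show "loc_support (LocR R J) \<subseteq> rad J"
  proof
    fix f assume f: "f \<in> loc_support (LocR R J)"
    then have fR: "f \<in> carrier R" by (simp add: loc_support_def)
    show "f \<in> rad J"
    proof (rule ccontr)
      assume "f \<notin> rad J"
      then obtain L where L: "localizing_subcat R L" "\<And>g X. \<lbrakk>g \<in> J; loc_copy g X\<rbrakk> \<Longrightarrow> X \<in> L"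
        "\<And>X. loc_copy f X \<Longrightarrow> X \<notin> L"
        using localizing_separates[OF J fR] by metis
      obtain X :: "('r, 'u) cochain_complex" where X: "is_loc_complex R f X" using is_loc_complex_exists[OF fR] .
      have "{X. \<exists>f\<in>J. is_loc_complex R f X} \<subseteq> L" using L(2) is_loc_complex_copy J by blast
      then have "LocR R J \<subseteq> L" unfolding LocR_def Loc_def using L(1) by blast
      then show False using f X L(3)[OF is_loc_complex_copy[OF X fR]] by (auto simp: loc_support_def)
    qed
  qed
qed

text \<open>Order reflection and injectivity at once. The direction from radicals to subcategories
  needs only that the generators for \<open>J\<close> lie in every localizing subcategory containing
  those for \<open>J'\<close>.\<close>

lemma LocR_subset_iff:
  assumes J: "J \<subseteq> carrier R" and J': "J' \<subseteq> carrier R"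
  shows "(LocR R J :: ('r, 'u) cochain_complex set) \<subseteq> LocR R J' \<longleftrightarrow> rad J \<subseteq> rad J'"
proof
  assume "(LocR R J :: ('r, 'u) cochain_complex set) \<subseteq> LocR R J'"
  then have "loc_support (LocR R J) \<subseteq> loc_support (LocR R J')" by (auto simp: loc_support_def)
  then show "rad J \<subseteq> rad J'" by (simp only: loc_support_LocR[OF J] loc_support_LocR[OF J'])
next
  assume "rad J \<subseteq> rad J'"
  then have JJ: "J \<subseteq> rad J'" using subset_radical_Idl[OF J] by blast
  have "X \<in> L" if "is_loc_complex R f X" "f \<in> J" "localizing_subcat R L" "{X. \<exists>f\<in>J'. is_loc_complex R f X} \<subseteq> L"
    for X f and L :: "('r, 'u) cochain_complex set"
    by (rule localizing_copies_radical[OF that(3) J' _ _ is_loc_complex_copy[OF that(1)]])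
      (use that(2,4) J JJ in blast)+
  then have "{X. \<exists>f\<in>J. is_loc_complex R f X} \<subseteq> L"
    if "localizing_subcat R L" "{X. \<exists>f\<in>J'. is_loc_complex R f X} \<subseteq> L" for L :: "('r, 'u) cochain_complex set"
    using that by blast
  then show "(LocR R J :: ('r, 'u) cochain_complex set) \<subseteq> LocR R J'" unfolding LocR_def Loc_def by blast
qed

lemma poset_iso_loc_support: "poset_iso (RfGLoc R) (RadId R) loc_support"
  unfolding poset_iso_def
proof (intro conjI RfGLoc_partial_order RadId_partial_order)
  show "bij_betw loc_support (carrier (RfGLoc R)) (rads)"
    unfolding bij_betw_def
  proof
    show "inj_on loc_support (carrier (RfGLoc R))"
    proof (rule inj_onI)
      fix x y :: "('r, 'u) cochain_complex set"
      assume "x \<in> carrier (RfGLoc R)" "y \<in> carrier (RfGLoc R)" and e: "loc_support x = loc_support y"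
      then obtain J J' where J: "J \<subseteq> carrier R" "x = LocR R J" and J': "J' \<subseteq> carrier R" "y = LocR R J'" by auto
      have "rad J = rad J'" using e loc_support_LocR J J' by simp
      then show "x = y" using LocR_subset_iff[OF J(1) J'(1)] LocR_subset_iff[OF J'(1) J(1)] J(2) J'(2) by simp
    qed
    show "loc_support ` carrier (RfGLoc R) = rads"
    proof
      show "loc_support ` carrier (RfGLoc R) \<subseteq> rads"
      proof
        fix I assume "I \<in> loc_support ` carrier (RfGLoc R)"
        then obtain J where "J \<subseteq> carrier R" "I = loc_support (LocR R J)" by auto
        then show "I \<in> rads" using radical_Idl_RadId loc_support_LocR by simp
      qed
      show "rads \<subseteq> loc_support ` carrier (RfGLoc R)"
      proof
        fix I assume I: "I \<in> rads"
        have "I = loc_support (LocR R I)" using loc_support_LocR[OF RadId_sub[OF I]] radical_Idl_self[OF I] by simp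
        then show "I \<in> loc_support ` carrier (RfGLoc R)" using RadId_sub[OF I] by auto
      qed
    qed
  qed
  have "loc_support x \<subseteq> loc_support y \<longleftrightarrow> x \<subseteq> y"
    if xy: "x \<in> carrier (RfGLoc R)" "y \<in> carrier (RfGLoc R)" for x y
  proof -
    obtain J J' where J: "J \<subseteq> carrier R" "x = LocR R J" and J': "J' \<subseteq> carrier R" "y = LocR R J'" using xy by auto
    then show ?thesis using LocR_subset_iff[OF J(1) J'(1)] loc_support_LocR by simp
  qed
  then show "order_emb (RfGLoc R) (RadId R) loc_support"
    unfolding order_emb_def using partial_order.axioms(1)[OF RfGLoc_partial_order] partial_order.axioms(1)[OF RadId_partial_order]
    by (simp del: RfGLoc_simps(1) RadId_simps(1))
qed

lemma inv_into_loc_support: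
  assumes I: "I \<in> rads"
  shows "inv_into (carrier (RfGLoc R)) loc_support I = LocR R I"
proof (rule inv_into_f_eq)
  show "inj_on loc_support (carrier (RfGLoc R))" using poset_iso_loc_support by (simp add: poset_iso_def bij_betw_def)
  show "LocR R I \<in> carrier (RfGLoc R)" using RadId_sub[OF I] by auto
  show "loc_support (LocR R I) = I" using loc_support_LocR[OF RadId_sub[OF I]] radical_Idl_self[OF I] by simp
qed

text \<open>Finite elements are transferred through \<open>loc_support\<close>; a finite element has
  the same support as the subcategory generated by finitely many localizations, hence equals
  it.\<close>

lemma finite_elements_RfGLoc:
  "finite_elements (RfGLoc R :: ('r, 'u) cochain_complex set gorder) = {LocR R K | K. finite K \<and> K \<subseteq> carrier R}"
proof -
  note fin = iso_finite_elements[OF poset_iso_loc_support RadId_complete_lattice]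
  show ?thesis
  proof
    show "finite_elements (RfGLoc R :: ('r, 'u) cochain_complex set gorder) \<subseteq> {LocR R K | K. finite K \<and> K \<subseteq> carrier R}"
    proof
      fix L :: "('r, 'u) cochain_complex set" assume L: "L \<in> finite_elements (RfGLoc R)"
      have LC: "L \<in> carrier (RfGLoc R)" by (rule finite_elements_carrier[OF L])
      then have "loc_support L \<in> finite_elements (RadId R)" using fin L by blast
      then obtain K where K: "finite K" "K \<subseteq> carrier R" "loc_support L = rad K"
        unfolding finite_elements_RadId by blast
      have "LocR R K \<in> carrier (RfGLoc R)" using K(2) by auto
      then have "L = LocR R K"
        by (intro iso_inj[OF poset_iso_loc_support _ LC]) (simp_all only: K(3) loc_support_LocR[OF K(2)])
      then show "L \<in> {LocR R K | K. finite K \<and> K \<subseteq> carrier R}" using K by blast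
    qed
    show "{LocR R K | K. finite K \<and> K \<subseteq> carrier R} \<subseteq> finite_elements (RfGLoc R :: ('r, 'u) cochain_complex set gorder)"
    proof
      fix L :: "('r, 'u) cochain_complex set" assume "L \<in> {LocR R K | K. finite K \<and> K \<subseteq> carrier R}"
      then obtain K where K: "finite K" "K \<subseteq> carrier R" "L = LocR R K" by blast
      then have "loc_support L \<in> finite_elements (RadId R)" unfolding finite_elements_RadId using loc_support_LocR by blast
      moreover have "L \<in> carrier (RfGLoc R)" using K by auto
      ultimately show "L \<in> finite_elements (RfGLoc R)" using fin by blast
    qed
  qed
qed

end

theorem theorem2p2p16:
  fixes R :: "('r, 'k) ring_scheme"
  assumes "cring R"
    and "universe_for R TYPE('u)"
  shows "complete_lattice (RfGLoc R :: ('r, 'u) cochain_complex set gorder) \<and>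
    complete_lattice (RadId R) \<and>
    (\<exists>\<Phi> :: ('r, 'u) cochain_complex set \<Rightarrow> 'r set.
      poset_iso (RfGLoc R) (RadId R) \<Phi> \<and>
      (\<forall>J \<subseteq> carrier R. \<Phi> (LocR R J) = radical R (Idl\<^bsub>R\<^esub> J)) \<and>
      (\<forall>I \<in> carrier (RadId R). inv_into (carrier (RfGLoc R)) \<Phi> I = LocR R I) \<and>
      carrier (fgRfGLoc R :: ('r, 'u) cochain_complex set gorder) =
        {LocR R K | K. finite K \<and> K \<subseteq> carrier R} \<and>
      carrier (fgRadId R) = finite_elements (RadId R) \<and>
      sublattice (RfGLoc R :: ('r, 'u) cochain_complex set gorder) (carrier (fgRfGLoc R)) \<and>
      sublattice (RadId R) (carrier (fgRadId R)) \<and>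
      distributive_lattice (fgRfGLoc R :: ('r, 'u) cochain_complex set gorder) \<and>
      distributive_lattice (fgRadId R) \<and>
      lattice_iso (fgRfGLoc R) (fgRadId R) \<Phi>)"
proof -
  interpret derived_category R "TYPE('u)"
    using assms by (simp add: derived_category_def derived_category_axioms_def)
  note iso = poset_iso_loc_support and cl = RadId_complete_lattice
  have car: "carrier (fgRfGLoc R :: ('r, 'u) cochain_complex set gorder) = finite_elements (RfGLoc R)"
    "carrier (fgRadId R) = finite_elements (RadId R)"
    by (simp_all add: fgRfGLoc_def fgRadId_finite_part finite_part_def)
  show ?thesis
  proof (intro conjI exI[of _ loc_support] allI ballI impI)
    show "complete_lattice (RfGLoc R :: ('r, 'u) cochain_complex set gorder)" by (rule iso_complete_lattice[OF iso cl])
    show "complete_lattice (RadId R)" by (rule cl)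
    show "poset_iso (RfGLoc R) (RadId R) loc_support" by (rule iso)
    show "loc_support (LocR R J) = radical R (Idl\<^bsub>R\<^esub> J)" if "J \<subseteq> carrier R" for J by (rule loc_support_LocR[OF that])
    show "inv_into (carrier (RfGLoc R)) loc_support I = LocR R I" if "I \<in> carrier (RadId R)" for I
      by (rule inv_into_loc_support[OF that])
    show "carrier (fgRfGLoc R :: ('r, 'u) cochain_complex set gorder) = {LocR R K | K. finite K \<and> K \<subseteq> carrier R}"
      unfolding car by (rule finite_elements_RfGLoc)
    show "carrier (fgRadId R) = finite_elements (RadId R)" by (rule car)
    show "sublattice (RfGLoc R :: ('r, 'u) cochain_complex set gorder) (carrier (fgRfGLoc R))"
      unfolding car by (rule iso_sublattice[OF iso cl sublattice_RadId])
    show "sublattice (RadId R) (carrier (fgRadId R))" unfolding car by (rule sublattice_RadId)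
    show "distributive_lattice (fgRfGLoc R :: ('r, 'u) cochain_complex set gorder)"
      unfolding fgRfGLoc_def by (rule iso_distributive[OF iso cl sublattice_RadId RadId_distrib])
    show "distributive_lattice (fgRadId R)"
      unfolding fgRadId_finite_part finite_part_def
      by (rule sublattice_distributive[OF cl sublattice_RadId RadId_distrib]) (simp_all only: finite_elements_carrier)
    show "lattice_iso (fgRfGLoc R) (fgRadId R) loc_support"
      unfolding fgRfGLoc_def fgRadId_finite_part by (rule iso_lattice_iso[OF iso cl sublattice_RadId])
  qed
qed

end
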